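(* The idempotent monads $\mathbf C:\mathsf{Adj}\to\mathsf{Adj}$ and $\mathbf M:\mathsf{Adj}\to\mathsf{Adj}$ commute, and their composites agree with the nucleus $\mathbf N$: for every adjunction $F$ there are equivalences of adjunctions $$\mathbf C(\mathbf M(F))\;\simeq\;\mathbf N(F)\;\simeq\;\mathbf M(\mathbf C(F)),$$ natural in $F$. Moreover, modulo these equivalences, the units of the monads $\mathbf M$ and $\mathbf C$ form a commutative square in $\mathsf{Adj}$ $$\overline F\xrightarrow{(\mathrm{Id},\kappa_1)}\mathbf M(F)\xrightarrow{(\kappa^0,\mathrm{Id})}\mathbf N(F)\quad=\quad \overline F\xrightarrow{(\kappa^0,\mathrm{Id})}\mathbf C(F)\xrightarrow{(\mathrm{Id},\kappa_1)}\mathbf N(F),$$ whose diagonal $(\kappa^0,\kappa_1):\overline F\to\mathbf N(F)$ presents the unit of the monad $\mathbf N$.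
   Context: **Adjunctions.** An adjunction $F=(F^*\dashv F_*:\mathcal B\to\mathcal A)$ has left adjoint $F^*:\mathcal A\to\mathcal B$, right adjoint $F_*:\mathcal B\to\mathcal A$, unit $\eta$ and counit $\varepsilon$. The category $\mathsf{Adj}$ has adjunctions as objects. A morphism from $F$ to $G=(G^*\dashv G_*:\mathcal D\to\mathcal C)$ is $(H,K,\upsilon^*,\upsilon_* )$ with functors $H:\mathcal A\to\mathcal C$, $K:\mathcal B\to\mathcal D$ and natural isomorphisms $\upsilon^*:KF^*\cong G^*H$, $\upsilon_*:HF_*\cong G_*K$ such that $G_*\upsilon^*\circ\upsilon_*F^*\circ H\eta^F=\eta^GH$ and $\varepsilon^GK\circ G^*\upsilon_*\circ\upsilon^*F_*=K\varepsilon^F$. Composition is by pasting. When only $(H,K)$ is written, $\upsilon^*,\upsilon_*$ are identities. An equivalence of adjunctions is a morphism of $\mathsf{Adj}$ with $H$ and $K$ equivalences of categories. Two parallel morphisms $(H,K,\upsilon^*,\upsilon_* )$ and $(H',K',\upsilon'^*,\upsilon'_* )$ are isomorphic if there are natural isomorphisms $\theta:H\cong H'$, $\varphi:K\cong K'$ with $\upsilon'^*\circ\varphi F^*=G^*\theta\circ\upsilon^*$ and $\upsilon'_*\circ\theta F_*=G_*\varphi\circ\upsilon_*$. "Natural in $F$" means that the naturality squares for morphisms of $\mathsf{Adj}$ commute up to such isomorphism; "idempotent monad" is likewise understood up to equivalence. **Absolute completion.** For a category $\mathcal C$, $\overline{\mathcal C}$ is its idempotent (Karoubi/Cauchy) completion: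 objects are idempotents of $\mathcal C$, morphisms $\varphi\to\psi$ are arrows $f$ with $\psi f\varphi=f$. Functors, natural transformations, and hence adjunctions and their morphisms lift along $\mathcal C\mapsto\overline{\mathcal C}$; the lift of $F$ is $\overline F=(F^*\dashv F_*:\overline{\mathcal B}\to\overline{\mathcal A})$ (same notation for the lifted functors). **Resolutions.** $\overline{\mathrm{Alg}}(F)$ is the Eilenberg–Moore category of algebras for the monad $F_*F^*$ on $\overline{\mathcal A}$, with forgetful $U_F$ and free functor $U^F\dashv U_F$. $\overline{\mathrm{Coalg}}(F)$ is the category of coalgebras for the comonad $F^*F_*$ on $\overline{\mathcal B}$, with forgetful $V^F$ and cofree functor $V_F$, $V^F\dashv V_F$. Comparison functors: $\kappa^0:\overline{\mathcal A}\to\overline{\mathrm{Coalg}}(F)$, $a\mapsto(F^*\eta_a:F^*a\to F^*F_*F^*a)$; $\kappa_1:\overline{\mathcal B}\to\overline{\mathrm{Alg}}(F)$, $b\mapsto(F_*\varepsilon_b:F_*F^*F_*b\to F_*b)$. For a morphism $\Upsilon=(H,K,\upsilon^*,\upsilon_* ):F\to G$ put $H^\upsilon(\alpha)=\big(G_*G^*Ha\cong G_*KF^*a\cong HF_*F^*a\xrightarrow{H\alpha}Ha\big)$ for an algebra $\alpha:F_*F^*a\to a$, and $K^\upsilon(\beta)=\big(Kb\xrightarrow{K\beta}KF^*F_*b\cong G^*HF_*b\cong G^*G_*Kb\big)$ for a coalgebra $\beta:b\to F^*F_*b$, the isomorphisms being induced by $\upsilon^*,\upsilon_*$. **The three endofunctors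 of $\mathsf{Adj}$** (morphisms are first lifted to the completions). - $\mathbf M(F)=(U^F\dashv U_F:\overline{\mathrm{Alg}}(F)\to\overline{\mathcal A})$; on morphisms $\Upsilon\mapsto(H,H^\upsilon)$ with 2-cells $G_*\upsilon^*\circ\upsilon_*F^*$ (its inverse underlies $H^\upsilon U^F\cong U^GH$ where direction requires) and the identity. Its unit is $(\mathrm{Id},\kappa_1):\overline F\to\mathbf M(F)$, precomposed with the embedding $F\to\overline F$. - $\mathbf C(F)=(V^F\dashv V_F:\overline{\mathcal B}\to\overline{\mathrm{Coalg}}(F))$; on morphisms $\Upsilon\mapsto(K^\upsilon,K)$ with 2-cells the identity and $G^*\upsilon_*\circ\upsilon^*F_*$. Its unit is $(\kappa^0,\mathrm{Id}):\overline F\to\mathbf C(F)$, precomposed with the embedding $F\to\overline F$. - $\mathbf N(F)=(F^\sharp\dashv F_\sharp:\overline{\mathrm{Alg}}(F)\to\overline{\mathrm{Coalg}}(F))$ with $F_\sharp=\kappa^0U_F$ and $F^\sharp=\kappa_1V^F$; the hom-bijection sends an algebra homomorphism $f:F^\sharp\beta\to\alpha$ to $F^*f\circ\beta:\beta\to F_\sharp\alpha$. On morphisms $\Upsilon\mapsto(K^\upsilon,H^\upsilon)$ with 2-cells $H^\upsilon F^\sharp\cong G^\sharp K^\upsilon$ given at $\beta:y\to F^*F_*y$ by $\upsilon_{*,y}$, and $K^\upsilon F_\sharp\cong G_\sharp H^\upsilon$ given at $\alpha:F_*F^*x\to x$ by $\upsilon^*_x$. *)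

theory Defs
  imports Main
begin

section \<open>Categories, functors, natural transformations\<close>

text \<open>A category carries its own sets of objects and arrows, both inside one type \<open>'u\<close>; outside
  these sets the structure maps are unconstrained.  \<open>Comp C g f\<close> is ``\<open>g\<close> after \<open>f\<close>''.\<close>

record 'u cat =
  Obj :: "'u set"
  Arr :: "'u set"
  Dom :: "'u \<Rightarrow> 'u"
  Cod :: "'u \<Rightarrow> 'u"
  One :: "'u \<Rightarrow> 'u"
  Comp :: "'u \<Rightarrow> 'u \<Rightarrow> 'u"

definition hom :: "'u cat \<Rightarrow> 'u \<Rightarrow> 'u \<Rightarrow> 'u set" where
  "hom C a b = {f \<in> Arr C. Dom C f = a \<and> Cod C f = b}"

locale category =
  fixes C :: "'u cat"
  assumes Dom_Obj: "f \<in> Arr C \<Longrightarrow> Dom C f \<in> Obj C"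
    and Cod_Obj: "f \<in> Arr C \<Longrightarrow> Cod C f \<in> Obj C"
    and One_hom: "a \<in> Obj C \<Longrightarrow> One C a \<in> hom C a a"
    and Comp_hom: "f \<in> hom C a b \<Longrightarrow> g \<in> hom C b c \<Longrightarrow> Comp C g f \<in> hom C a c"
    and Comp_assoc: "f \<in> hom C a b \<Longrightarrow> g \<in> hom C b c \<Longrightarrow> h \<in> hom C c d \<Longrightarrow>
      Comp C h (Comp C g f) = Comp C (Comp C h g) f"
    and Comp_One_right: "f \<in> hom C a b \<Longrightarrow> Comp C f (One C a) = f"
    and Comp_One_left: "f \<in> hom C a b \<Longrightarrow> Comp C (One C b) f = f"

definition inverse_arrows :: "'u cat \<Rightarrow> 'u \<Rightarrow> 'u \<Rightarrow> bool" where
  "inverse_arrows C f g \<longleftrightarrow> (\<exists>a b. f \<in> hom C a b \<and> g \<in> hom C b a \<and>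
     Comp C g f = One C a \<and> Comp C f g = One C b)"

definition iso_arrow :: "'u cat \<Rightarrow> 'u \<Rightarrow> bool" where
  "iso_arrow C f \<longleftrightarrow> (\<exists>g. inverse_arrows C f g)"

definition inverse_arrow :: "'u cat \<Rightarrow> 'u \<Rightarrow> 'u" where
  "inverse_arrow C f = (THE g. inverse_arrows C f g)"

record 'u ftor =
  FObj :: "'u \<Rightarrow> 'u"
  FArr :: "'u \<Rightarrow> 'u"

definition is_functor :: "'u cat \<Rightarrow> 'u cat \<Rightarrow> 'u ftor \<Rightarrow> bool" where
  "is_functor A B F \<longleftrightarrow> category A \<and> category B \<and>
     (\<forall>a \<in> Obj A. FObj F a \<in> Obj B) \<and>
     (\<forall>a b. \<forall>f \<in> hom A a b. FArr F f \<in> hom B (FObj F a) (FObj F b)) \<and>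
     (\<forall>a \<in> Obj A. FArr F (One A a) = One B (FObj F a)) \<and>
     (\<forall>a b c. \<forall>f \<in> hom A a b. \<forall>g \<in> hom A b c.
        FArr F (Comp A g f) = Comp B (FArr F g) (FArr F f))"

definition id_ftor :: "'u ftor" where
  "id_ftor = \<lparr>FObj = (\<lambda>a. a), FArr = (\<lambda>f. f)\<rparr>"

definition comp_ftor :: "'u ftor \<Rightarrow> 'u ftor \<Rightarrow> 'u ftor" where
  "comp_ftor G F = \<lparr>FObj = FObj G \<circ> FObj F, FArr = FArr G \<circ> FArr F\<rparr>"

definition nat_trans :: "'u cat \<Rightarrow> 'u cat \<Rightarrow> 'u ftor \<Rightarrow> 'u ftor \<Rightarrow> ('u \<Rightarrow> 'u) \<Rightarrow> bool" where
  "nat_trans A B F G \<tau> \<longleftrightarrow> is_functor A B F \<and> is_functor A B G \<and>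
     (\<forall>a \<in> Obj A. \<tau> a \<in> hom B (FObj F a) (FObj G a)) \<and>
     (\<forall>a b. \<forall>f \<in> hom A a b. Comp B (\<tau> b) (FArr F f) = Comp B (FArr G f) (\<tau> a))"

definition nat_iso :: "'u cat \<Rightarrow> 'u cat \<Rightarrow> 'u ftor \<Rightarrow> 'u ftor \<Rightarrow> ('u \<Rightarrow> 'u) \<Rightarrow> bool" where
  "nat_iso A B F G \<tau> \<longleftrightarrow> nat_trans A B F G \<tau> \<and> (\<forall>a \<in> Obj A. iso_arrow B (\<tau> a))"

definition equivalence_functor :: "'u cat \<Rightarrow> 'u cat \<Rightarrow> 'u ftor \<Rightarrow> bool" where
  "equivalence_functor A B F \<longleftrightarrow> is_functor A B F \<and>
     (\<exists>G \<sigma> \<tau>. is_functor B A G \<and> nat_iso A A id_ftor (comp_ftor G F) \<sigma> \<and>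
        nat_iso B B (comp_ftor F G) id_ftor \<tau>)"

section \<open>The category of adjunctions\<close>

text \<open>\<open>ladj F = F\<^sup>* : catA F \<rightarrow> catB F\<close> and \<open>radj F = F\<^sub>* : catB F \<rightarrow> catA F\<close>.\<close>

record 'u adj =
  catA :: "'u cat"
  catB :: "'u cat"
  ladj :: "'u ftor"
  radj :: "'u ftor"
  eta :: "'u \<Rightarrow> 'u"
  eps :: "'u \<Rightarrow> 'u"

definition adjunction :: "'u adj \<Rightarrow> bool" where
  "adjunction F \<longleftrightarrow>
     is_functor (catA F) (catB F) (ladj F) \<and> is_functor (catB F) (catA F) (radj F) \<and>
     nat_trans (catA F) (catA F) id_ftor (comp_ftor (radj F) (ladj F)) (eta F) \<and>
     nat_trans (catB F) (catB F) (comp_ftor (ladj F) (radj F)) id_ftor (eps F) \<and>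
     (\<forall>a \<in> Obj (catA F).
        Comp (catB F) (eps F (FObj (ladj F) a)) (FArr (ladj F) (eta F a)) =
        One (catB F) (FObj (ladj F) a)) \<and>
     (\<forall>b \<in> Obj (catB F).
        Comp (catA F) (FArr (radj F) (eps F b)) (eta F (FObj (radj F) b)) =
        One (catA F) (FObj (radj F) b))"

text \<open>\<open>ups\<close> is \<open>\<upsilon>\<^sup>* : K F\<^sup>* \<cong> G\<^sup>* H\<close> and \<open>dns\<close> is \<open>\<upsilon>\<^sub>* : H F\<^sub>* \<cong> G\<^sub>* K\<close>.\<close>

record 'u adj_mor =
  src_adj :: "'u adj"
  tgt_adj :: "'u adj"
  mH :: "'u ftor"
  mK :: "'u ftor"
  ups :: "'u \<Rightarrow> 'u"
  dns :: "'u \<Rightarrow> 'u"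

definition adj_morphism :: "'u adj_mor \<Rightarrow> bool" where
  "adj_morphism \<Upsilon> \<longleftrightarrow>
     (let F = src_adj \<Upsilon>; G = tgt_adj \<Upsilon>; H = mH \<Upsilon>; K = mK \<Upsilon> in
      adjunction F \<and> adjunction G \<and>
      is_functor (catA F) (catA G) H \<and> is_functor (catB F) (catB G) K \<and>
      nat_iso (catA F) (catB G) (comp_ftor K (ladj F)) (comp_ftor (ladj G) H) (ups \<Upsilon>) \<and>
      nat_iso (catB F) (catA G) (comp_ftor H (radj F)) (comp_ftor (radj G) K) (dns \<Upsilon>) \<and>
      (\<forall>a \<in> Obj (catA F).
         Comp (catA G) (FArr (radj G) (ups \<Upsilon> a))
           (Comp (catA G) (dns \<Upsilon> (FObj (ladj F) a)) (FArr H (eta F a))) =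
         eta G (FObj H a)) \<and>
      (\<forall>b \<in> Obj (catB F).
         Comp (catB G) (eps G (FObj K b))
           (Comp (catB G) (FArr (ladj G) (dns \<Upsilon> b)) (ups \<Upsilon> (FObj (radj F) b))) =
         FArr K (eps F b)))"

definition adj_hom :: "'u adj \<Rightarrow> 'u adj \<Rightarrow> 'u adj_mor set" where
  "adj_hom F G = {\<Upsilon>. adj_morphism \<Upsilon> \<and> src_adj \<Upsilon> = F \<and> tgt_adj \<Upsilon> = G}"

text \<open>A morphism \<open>(H, K)\<close> whose two 2-cells are identities.\<close>

definition strict_mor :: "'u adj \<Rightarrow> 'u adj \<Rightarrow> 'u ftor \<Rightarrow> 'u ftor \<Rightarrow> 'u adj_mor" where
  "strict_mor F G H K = \<lparr>src_adj = F, tgt_adj = G, mH = H, mK = K,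
     ups = (\<lambda>a. One (catB G) (FObj K (FObj (ladj F) a))),
     dns = (\<lambda>b. One (catA G) (FObj H (FObj (radj F) b)))\<rparr>"

definition id_adj :: "'u adj \<Rightarrow> 'u adj_mor" where
  "id_adj F = strict_mor F F id_ftor id_ftor"

text \<open>Composition by pasting; \<open>\<Psi> \<odot> \<Upsilon>\<close> is ``\<open>\<Psi>\<close> after \<open>\<Upsilon>\<close>''.\<close>

definition comp_adj :: "'u adj_mor \<Rightarrow> 'u adj_mor \<Rightarrow> 'u adj_mor" (infixr "\<odot>" 70) where
  "\<Psi> \<odot> \<Upsilon> =
     (let F = src_adj \<Upsilon>; L = tgt_adj \<Psi> in
      \<lparr>src_adj = F, tgt_adj = L,
       mH = comp_ftor (mH \<Psi>) (mH \<Upsilon>), mK = comp_ftor (mK \<Psi>) (mK \<Upsilon>),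
       ups = (\<lambda>a. Comp (catB L) (ups \<Psi> (FObj (mH \<Upsilon>) a)) (FArr (mK \<Psi>) (ups \<Upsilon> a))),
       dns = (\<lambda>b. Comp (catA L) (dns \<Psi> (FObj (mK \<Upsilon>) b)) (FArr (mH \<Psi>) (dns \<Upsilon> b)))\<rparr>)"

definition adj_equivalence :: "'u adj_mor \<Rightarrow> bool" where
  "adj_equivalence \<Upsilon> \<longleftrightarrow> adj_morphism \<Upsilon> \<and>
     equivalence_functor (catA (src_adj \<Upsilon>)) (catA (tgt_adj \<Upsilon>)) (mH \<Upsilon>) \<and>
     equivalence_functor (catB (src_adj \<Upsilon>)) (catB (tgt_adj \<Upsilon>)) (mK \<Upsilon>)"

definition adj_iso :: "'u adj_mor \<Rightarrow> 'u adj_mor \<Rightarrow> bool" (infix "\<cong>" 50) where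
  "\<Upsilon> \<cong> \<Upsilon>' \<longleftrightarrow>
     (let F = src_adj \<Upsilon>; G = tgt_adj \<Upsilon> in
      \<Upsilon> \<in> adj_hom F G \<and> \<Upsilon>' \<in> adj_hom F G \<and>
      (\<exists>\<theta> \<phi>. nat_iso (catA F) (catA G) (mH \<Upsilon>) (mH \<Upsilon>') \<theta> \<and>
             nat_iso (catB F) (catB G) (mK \<Upsilon>) (mK \<Upsilon>') \<phi> \<and>
             (\<forall>a \<in> Obj (catA F).
                Comp (catB G) (ups \<Upsilon>' a) (\<phi> (FObj (ladj F) a)) =
                Comp (catB G) (FArr (ladj G) (\<theta> a)) (ups \<Upsilon> a)) \<and>
             (\<forall>b \<in> Obj (catB F).
                Comp (catA G) (dns \<Upsilon>' b) (\<theta> (FObj (radj F) b)) =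
                Comp (catA G) (FArr (radj G) (\<phi> b)) (dns \<Upsilon> b))))"

text \<open>Equality of morphisms of adjunctions.  It disregards the irrelevant values of the functors
  and of the 2-cells outside of the categories on which they are defined.\<close>

definition adj_eq :: "'u adj_mor \<Rightarrow> 'u adj_mor \<Rightarrow> bool" (infix "\<doteq>" 50) where
  "\<Upsilon> \<doteq> \<Upsilon>' \<longleftrightarrow>
     (let F = src_adj \<Upsilon>; G = tgt_adj \<Upsilon> in
      \<Upsilon> \<in> adj_hom F G \<and> \<Upsilon>' \<in> adj_hom F G \<and>
      (\<forall>a \<in> Obj (catA F). FObj (mH \<Upsilon>) a = FObj (mH \<Upsilon>') a \<and> ups \<Upsilon> a = ups \<Upsilon>' a) \<and>
      (\<forall>f \<in> Arr (catA F). FArr (mH \<Upsilon>) f = FArr (mH \<Upsilon>') f) \<and>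
      (\<forall>b \<in> Obj (catB F). FObj (mK \<Upsilon>) b = FObj (mK \<Upsilon>') b \<and> dns \<Upsilon> b = dns \<Upsilon>' b) \<and>
      (\<forall>g \<in> Arr (catB F). FArr (mK \<Upsilon>) g = FArr (mK \<Upsilon>') g))"

section \<open>Endofunctors and monads on the category of adjunctions\<close>

text \<open>The hom-sets of the category of adjunctions are taken up to isomorphism: endofunctors,
  natural transformations and monad laws are required up to \<open>\<cong>\<close>, invertibility up to
  equivalence.\<close>

record 'u adj_endo =
  on_adj :: "'u adj \<Rightarrow> 'u adj"
  on_mor :: "'u adj_mor \<Rightarrow> 'u adj_mor"

definition id_endo :: "'u adj_endo" where
  "id_endo = \<lparr>on_adj = (\<lambda>F. F), on_mor = (\<lambda>\<Upsilon>. \<Upsilon>)\<rparr>"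

definition comp_endo :: "'u adj_endo \<Rightarrow> 'u adj_endo \<Rightarrow> 'u adj_endo" where
  "comp_endo S T = \<lparr>on_adj = on_adj S \<circ> on_adj T, on_mor = on_mor S \<circ> on_mor T\<rparr>"

definition endofunctor :: "'u adj_endo \<Rightarrow> bool" where
  "endofunctor T \<longleftrightarrow>
     (\<forall>F. adjunction F \<longrightarrow> adjunction (on_adj T F)) \<and>
     (\<forall>F G \<Upsilon>. \<Upsilon> \<in> adj_hom F G \<longrightarrow> on_mor T \<Upsilon> \<in> adj_hom (on_adj T F) (on_adj T G)) \<and>
     (\<forall>\<Upsilon> \<Upsilon>'. \<Upsilon> \<cong> \<Upsilon>' \<longrightarrow> on_mor T \<Upsilon> \<cong> on_mor T \<Upsilon>') \<and>
     (\<forall>F. adjunction F \<longrightarrow> on_mor T (id_adj F) \<cong> id_adj (on_adj T F)) \<and>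
     (\<forall>F G L \<Upsilon> \<Psi>. \<Upsilon> \<in> adj_hom F G \<longrightarrow> \<Psi> \<in> adj_hom G L \<longrightarrow>
        on_mor T (\<Psi> \<odot> \<Upsilon>) \<cong> on_mor T \<Psi> \<odot> on_mor T \<Upsilon>)"

definition adj_natural :: "'u adj_endo \<Rightarrow> 'u adj_endo \<Rightarrow> ('u adj \<Rightarrow> 'u adj_mor) \<Rightarrow> bool" where
  "adj_natural S T E \<longleftrightarrow>
     (\<forall>F. adjunction F \<longrightarrow> E F \<in> adj_hom (on_adj S F) (on_adj T F)) \<and>
     (\<forall>F G \<Upsilon>. \<Upsilon> \<in> adj_hom F G \<longrightarrow> E G \<odot> on_mor S \<Upsilon> \<cong> on_mor T \<Upsilon> \<odot> E F)"

definition natural_equivalence ::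
  "'u adj_endo \<Rightarrow> 'u adj_endo \<Rightarrow> ('u adj \<Rightarrow> 'u adj_mor) \<Rightarrow> bool" where
  "natural_equivalence S T E \<longleftrightarrow> adj_natural S T E \<and>
     (\<forall>F. adjunction F \<longrightarrow> adj_equivalence (E F))"

definition adj_monad ::
  "'u adj_endo \<Rightarrow> ('u adj \<Rightarrow> 'u adj_mor) \<Rightarrow> ('u adj \<Rightarrow> 'u adj_mor) \<Rightarrow> bool" where
  "adj_monad T \<eta> \<mu> \<longleftrightarrow> endofunctor T \<and>
     adj_natural id_endo T \<eta> \<and> adj_natural (comp_endo T T) T \<mu> \<and>
     (\<forall>F. adjunction F \<longrightarrow>
        \<mu> F \<odot> \<eta> (on_adj T F) \<cong> id_adj (on_adj T F) \<and>
        \<mu> F \<odot> on_mor T (\<eta> F) \<cong> id_adj (on_adj T F) \<and>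
        \<mu> F \<odot> on_mor T (\<mu> F) \<cong> \<mu> F \<odot> \<mu> (on_adj T F))"

definition idempotent_monad :: "'u adj_endo \<Rightarrow> ('u adj \<Rightarrow> 'u adj_mor) \<Rightarrow> bool" where
  "idempotent_monad T \<eta> \<longleftrightarrow>
     (\<exists>\<mu>. adj_monad T \<eta> \<mu> \<and> (\<forall>F. adjunction F \<longrightarrow> adj_equivalence (\<mu> F)))"

section \<open>A universe closed under the constructions\<close>

text \<open>To have genuine endofunctors, all categories live in the type \<open>'a univ\<close>, the closure of an
  arbitrary type \<open>'a\<close> under pairs \<open>Struct a \<alpha>\<close> (an object with a structure map, i.e. an algebra or a
  coalgebra) and triples \<open>Arrow x f y\<close> (an arrow \<open>f\<close> of an old category, seen as an arrow from \<open>x\<close> to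
  \<open>y\<close> in a new one).  A category with objects in \<open>'o\<close> and arrows in \<open>'m\<close> is isomorphic, via
  \<open>Atom\<close>, to one in \<open>('o + 'm) univ\<close>; nothing requires objects and arrows to be disjoint.\<close>

datatype 'a univ =
    Atom 'a
  | Struct (carrier: "'a univ") (action: "'a univ")
  | Arrow (src: "'a univ") (und: "'a univ") (tgt: "'a univ")

section \<open>Idempotent completion\<close>

definition idem :: "'u cat \<Rightarrow> 'u set" where
  "idem C = {e. \<exists>a. e \<in> hom C a a \<and> Comp C e e = e}"

definition karoubi :: "'a univ cat \<Rightarrow> 'a univ cat" where
  "karoubi C = \<lparr>Obj = idem C,
     Arr = {Arrow e f e' | e f e'. e \<in> idem C \<and> e' \<in> idem C \<and>
              f \<in> hom C (Dom C e) (Dom C e') \<and> Comp C e' (Comp C f e) = f},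
     Dom = src, Cod = tgt, One = (\<lambda>e. Arrow e e e),
     Comp = (\<lambda>g f. Arrow (src f) (Comp C (und g) (und f)) (tgt g))\<rparr>"

definition lift_ftor :: "'a univ ftor \<Rightarrow> 'a univ ftor" where
  "lift_ftor F = \<lparr>FObj = FArr F,
     FArr = (\<lambda>f. Arrow (FArr F (src f)) (FArr F (und f)) (FArr F (tgt f)))\<rparr>"

text \<open>The lift of \<open>\<tau> : F \<rightarrow> G\<close> has at an idempotent \<open>e : a \<rightarrow> a\<close> the component
  \<open>G e \<circ> \<tau>\<^sub>a = \<tau>\<^sub>a \<circ> F e : F e \<rightarrow> G e\<close>.\<close>

definition lift_nat ::
  "'a univ cat \<Rightarrow> 'a univ cat \<Rightarrow> 'a univ ftor \<Rightarrow> 'a univ ftor \<Rightarrow>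
   ('a univ \<Rightarrow> 'a univ) \<Rightarrow> 'a univ \<Rightarrow> 'a univ" where
  "lift_nat A B F G \<tau> e = Arrow (FArr F e) (Comp B (FArr G e) (\<tau> (Dom A e))) (FArr G e)"

definition lift_adj :: "'a univ adj \<Rightarrow> 'a univ adj" where
  "lift_adj F = \<lparr>catA = karoubi (catA F), catB = karoubi (catB F),
     ladj = lift_ftor (ladj F), radj = lift_ftor (radj F),
     eta = lift_nat (catA F) (catA F) id_ftor (comp_ftor (radj F) (ladj F)) (eta F),
     eps = lift_nat (catB F) (catB F) (comp_ftor (ladj F) (radj F)) id_ftor (eps F)\<rparr>"

definition lift_mor :: "'a univ adj_mor \<Rightarrow> 'a univ adj_mor" where
  "lift_mor \<Upsilon> =
     (let F = src_adj \<Upsilon>; G = tgt_adj \<Upsilon>; H = mH \<Upsilon>; K = mK \<Upsilon> in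
      \<lparr>src_adj = lift_adj F, tgt_adj = lift_adj G, mH = lift_ftor H, mK = lift_ftor K,
       ups = lift_nat (catA F) (catB G) (comp_ftor K (ladj F)) (comp_ftor (ladj G) H) (ups \<Upsilon>),
       dns = lift_nat (catB F) (catA G) (comp_ftor H (radj F)) (comp_ftor (radj G) K) (dns \<Upsilon>)\<rparr>)"

definition embed_ftor :: "'a univ cat \<Rightarrow> 'a univ ftor" where
  "embed_ftor C = \<lparr>FObj = One C,
     FArr = (\<lambda>f. Arrow (One C (Dom C f)) f (One C (Cod C f)))\<rparr>"

definition embed_adj :: "'a univ adj \<Rightarrow> 'a univ adj_mor" where
  "embed_adj F = strict_mor F (lift_adj F) (embed_ftor (catA F)) (embed_ftor (catB F))"

section \<open>Algebras and coalgebras\<close>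

text \<open>Eilenberg--Moore categories of a monad \<open>(T, \<eta>, \<mu>)\<close> on \<open>A\<close> and of a comonad
  \<open>(D, \<epsilon>, \<delta>)\<close> on \<open>B\<close>; an arrow is a triple \<open>Arrow x f y\<close>, with underlying arrow \<open>f\<close>.\<close>

definition algebras ::
  "'a univ cat \<Rightarrow> 'a univ ftor \<Rightarrow> ('a univ \<Rightarrow> 'a univ) \<Rightarrow> ('a univ \<Rightarrow> 'a univ) \<Rightarrow> 'a univ set"
  where
  "algebras A T \<eta> \<mu> = {Struct a \<alpha> | a \<alpha>. a \<in> Obj A \<and> \<alpha> \<in> hom A (FObj T a) a \<and>
     Comp A \<alpha> (\<eta> a) = One A a \<and> Comp A \<alpha> (\<mu> a) = Comp A \<alpha> (FArr T \<alpha>)}"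

definition EM_cat ::
  "'a univ cat \<Rightarrow> 'a univ ftor \<Rightarrow> ('a univ \<Rightarrow> 'a univ) \<Rightarrow> ('a univ \<Rightarrow> 'a univ) \<Rightarrow> 'a univ cat"
  where
  "EM_cat A T \<eta> \<mu> = \<lparr>Obj = algebras A T \<eta> \<mu>,
     Arr = {Arrow x f y | x f y. x \<in> algebras A T \<eta> \<mu> \<and> y \<in> algebras A T \<eta> \<mu> \<and>
              f \<in> hom A (carrier x) (carrier y) \<and>
              Comp A f (action x) = Comp A (action y) (FArr T f)},
     Dom = src, Cod = tgt, One = (\<lambda>x. Arrow x (One A (carrier x)) x),
     Comp = (\<lambda>g f. Arrow (src f) (Comp A (und g) (und f)) (tgt g))\<rparr>"

definition coalgebras ::
  "'a univ cat \<Rightarrow> 'a univ ftor \<Rightarrow> ('a univ \<Rightarrow> 'a univ) \<Rightarrow> ('a univ \<Rightarrow> 'a univ) \<Rightarrow> 'a univ set"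
  where
  "coalgebras B D \<epsilon> \<delta> = {Struct b \<beta> | b \<beta>. b \<in> Obj B \<and> \<beta> \<in> hom B b (FObj D b) \<and>
     Comp B (\<epsilon> b) \<beta> = One B b \<and> Comp B (\<delta> b) \<beta> = Comp B (FArr D \<beta>) \<beta>}"

definition coEM_cat ::
  "'a univ cat \<Rightarrow> 'a univ ftor \<Rightarrow> ('a univ \<Rightarrow> 'a univ) \<Rightarrow> ('a univ \<Rightarrow> 'a univ) \<Rightarrow> 'a univ cat"
  where
  "coEM_cat B D \<epsilon> \<delta> = \<lparr>Obj = coalgebras B D \<epsilon> \<delta>,
     Arr = {Arrow x f y | x f y. x \<in> coalgebras B D \<epsilon> \<delta> \<and> y \<in> coalgebras B D \<epsilon> \<delta> \<and>
              f \<in> hom B (carrier x) (carrier y) \<and>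
              Comp B (action y) f = Comp B (FArr D f) (action x)},
     Dom = src, Cod = tgt, One = (\<lambda>x. Arrow x (One B (carrier x)) x),
     Comp = (\<lambda>g f. Arrow (src f) (Comp B (und g) (und f)) (tgt g))\<rparr>"

definition Alg :: "'a univ adj \<Rightarrow> 'a univ cat" where
  "Alg F = EM_cat (catA F) (comp_ftor (radj F) (ladj F)) (eta F)
     (\<lambda>a. FArr (radj F) (eps F (FObj (ladj F) a)))"

definition Coalg :: "'a univ adj \<Rightarrow> 'a univ cat" where
  "Coalg F = coEM_cat (catB F) (comp_ftor (ladj F) (radj F)) (eps F)
     (\<lambda>b. FArr (ladj F) (eta F (FObj (radj F) b)))"

definition forget :: "'a univ ftor" where
  "forget = \<lparr>FObj = carrier, FArr = und\<rparr>"

text \<open>The functor from \<open>C\<close> to (co)algebras with object part \<open>X\<close> and underlying arrow part \<open>u\<close>.\<close>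

definition structured :: "'a univ cat \<Rightarrow> ('a univ \<Rightarrow> 'a univ) \<Rightarrow> ('a univ \<Rightarrow> 'a univ) \<Rightarrow> 'a univ ftor"
  where
  "structured C X u = \<lparr>FObj = X, FArr = (\<lambda>f. Arrow (X (Dom C f)) (u f) (X (Cod C f)))\<rparr>"

definition free_alg :: "'a univ adj \<Rightarrow> 'a univ ftor" where
  "free_alg F = structured (catA F)
     (\<lambda>a. Struct (FObj (radj F) (FObj (ladj F) a)) (FArr (radj F) (eps F (FObj (ladj F) a))))
     (\<lambda>f. FArr (radj F) (FArr (ladj F) f))"

definition cofree_coalg :: "'a univ adj \<Rightarrow> 'a univ ftor" where
  "cofree_coalg F = structured (catB F)
     (\<lambda>b. Struct (FObj (ladj F) (FObj (radj F) b)) (FArr (ladj F) (eta F (FObj (radj F) b))))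
     (\<lambda>g. FArr (ladj F) (FArr (radj F) g))"

definition kappa0 :: "'a univ adj \<Rightarrow> 'a univ ftor" where
  "kappa0 F = structured (catA F)
     (\<lambda>a. Struct (FObj (ladj F) a) (FArr (ladj F) (eta F a))) (FArr (ladj F))"

definition kappa1 :: "'a univ adj \<Rightarrow> 'a univ ftor" where
  "kappa1 F = structured (catB F)
     (\<lambda>b. Struct (FObj (radj F) b) (FArr (radj F) (eps F b))) (FArr (radj F))"

text \<open>The functors \<open>H\<^sup>\<upsilon>\<close> and \<open>K\<^sup>\<upsilon>\<close> induced on algebras and on coalgebras.\<close>

definition alg_ftor :: "'a univ adj_mor \<Rightarrow> 'a univ ftor" where
  "alg_ftor \<Upsilon> =
     (let F = src_adj \<Upsilon>; G = tgt_adj \<Upsilon>; H = mH \<Upsilon> in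
      structured (Alg F)
        (\<lambda>x. let a = carrier x in
           Struct (FObj H a)
             (Comp (catA G) (FArr H (action x))
               (Comp (catA G) (inverse_arrow (catA G) (dns \<Upsilon> (FObj (ladj F) a)))
                 (FArr (radj G) (inverse_arrow (catB G) (ups \<Upsilon> a))))))
        (\<lambda>h. FArr H (und h)))"

definition coalg_ftor :: "'a univ adj_mor \<Rightarrow> 'a univ ftor" where
  "coalg_ftor \<Upsilon> =
     (let F = src_adj \<Upsilon>; G = tgt_adj \<Upsilon>; K = mK \<Upsilon> in
      structured (Coalg F)
        (\<lambda>y. let b = carrier y in
           Struct (FObj K b)
             (Comp (catB G) (FArr (ladj G) (dns \<Upsilon> b))
               (Comp (catB G) (ups \<Upsilon> (FObj (radj F) b)) (FArr K (action y)))))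
        (\<lambda>h. FArr K (und h)))"

section \<open>The resolutions of an adjunction, before completion\<close>

definition EM_adj :: "'a univ adj \<Rightarrow> 'a univ adj" where
  "EM_adj F = \<lparr>catA = catA F, catB = Alg F, ladj = free_alg F, radj = forget,
     eta = eta F,
     eps = (\<lambda>x. Arrow (FObj (free_alg F) (carrier x)) (action x) x)\<rparr>"

definition coEM_adj :: "'a univ adj \<Rightarrow> 'a univ adj" where
  "coEM_adj F = \<lparr>catA = Coalg F, catB = catB F, ladj = forget, radj = cofree_coalg F,
     eta = (\<lambda>y. Arrow y (action y) (FObj (cofree_coalg F) (carrier y))),
     eps = eps F\<rparr>"

text \<open>Unit and counit of the nucleus adjunction are read off from the hom-bijection
  \<open>f \<mapsto> F\<^sup>* f \<circ> \<beta>\<close>: the transpose of the identity on \<open>F\<^sup>\<sharp> \<beta>\<close> is \<open>\<beta>\<close>, and the homomorphism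
  \<open>F\<^sup>\<sharp> F\<^sub>\<sharp> \<alpha> \<rightarrow> \<alpha>\<close> with transpose the identity is \<open>\<alpha>\<close>, since \<open>F\<^sup>* \<alpha> \<circ> F\<^sup>* \<eta>\<close> is an identity.\<close>

definition nucleus_adj :: "'a univ adj \<Rightarrow> 'a univ adj" where
  "nucleus_adj F =
     (let Fl = comp_ftor (kappa1 F) forget; Fr = comp_ftor (kappa0 F) forget in
      \<lparr>catA = Coalg F, catB = Alg F, ladj = Fl, radj = Fr,
       eta = (\<lambda>y. Arrow y (action y) (FObj Fr (FObj Fl y))),
       eps = (\<lambda>x. Arrow (FObj Fl (FObj Fr x)) (action x) x)\<rparr>)"

definition EM_mor :: "'a univ adj_mor \<Rightarrow> 'a univ adj_mor" where
  "EM_mor \<Upsilon> =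
     (let F = src_adj \<Upsilon>; G = tgt_adj \<Upsilon>; H = mH \<Upsilon>; K = alg_ftor \<Upsilon> in
      \<lparr>src_adj = EM_adj F, tgt_adj = EM_adj G, mH = H, mK = K,
       ups = (\<lambda>a. Arrow (FObj K (FObj (free_alg F) a))
                (Comp (catA G) (FArr (radj G) (ups \<Upsilon> a)) (dns \<Upsilon> (FObj (ladj F) a)))
                (FObj (free_alg G) (FObj H a))),
       dns = (\<lambda>x. One (catA G) (FObj H (carrier x)))\<rparr>)"

definition coEM_mor :: "'a univ adj_mor \<Rightarrow> 'a univ adj_mor" where
  "coEM_mor \<Upsilon> =
     (let F = src_adj \<Upsilon>; G = tgt_adj \<Upsilon>; H = coalg_ftor \<Upsilon>; K = mK \<Upsilon> in
      \<lparr>src_adj = coEM_adj F, tgt_adj = coEM_adj G, mH = H, mK = K,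
       ups = (\<lambda>y. One (catB G) (FObj K (carrier y))),
       dns = (\<lambda>b. Arrow (FObj H (FObj (cofree_coalg F) b))
                (Comp (catB G) (FArr (ladj G) (dns \<Upsilon> b)) (ups \<Upsilon> (FObj (radj F) b)))
                (FObj (cofree_coalg G) (FObj K b)))\<rparr>)"

definition nucleus_mor :: "'a univ adj_mor \<Rightarrow> 'a univ adj_mor" where
  "nucleus_mor \<Upsilon> =
     (let NF = nucleus_adj (src_adj \<Upsilon>); NG = nucleus_adj (tgt_adj \<Upsilon>);
          H = coalg_ftor \<Upsilon>; K = alg_ftor \<Upsilon> in
      \<lparr>src_adj = NF, tgt_adj = NG, mH = H, mK = K,
       ups = (\<lambda>y. Arrow (FObj K (FObj (ladj NF) y)) (dns \<Upsilon> (carrier y)) (FObj (ladj NG) (FObj H y))),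
       dns = (\<lambda>x. Arrow (FObj H (FObj (radj NF) x)) (ups \<Upsilon> (carrier x)) (FObj (radj NG) (FObj K x)))\<rparr>)"

section \<open>The three endofunctors and their units\<close>

definition M_endo :: "'a univ adj_endo" where
  "M_endo = \<lparr>on_adj = (\<lambda>F. EM_adj (lift_adj F)), on_mor = (\<lambda>\<Upsilon>. EM_mor (lift_mor \<Upsilon>))\<rparr>"

definition C_endo :: "'a univ adj_endo" where
  "C_endo = \<lparr>on_adj = (\<lambda>F. coEM_adj (lift_adj F)), on_mor = (\<lambda>\<Upsilon>. coEM_mor (lift_mor \<Upsilon>))\<rparr>"

definition N_endo :: "'a univ adj_endo" where
  "N_endo = \<lparr>on_adj = (\<lambda>F. nucleus_adj (lift_adj F)), on_mor = (\<lambda>\<Upsilon>. nucleus_mor (lift_mor \<Upsilon>))\<rparr>"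

text \<open>The morphisms \<open>(Id, \<kappa>\<^sub>1)\<close>, \<open>(\<kappa>\<^sup>0, Id)\<close> and \<open>(\<kappa>\<^sup>0, \<kappa>\<^sub>1)\<close> of the commutative square, between the
  completion of \<open>F\<close> and its three resolutions.\<close>

definition bar_to_M :: "'a univ adj \<Rightarrow> 'a univ adj_mor" where
  "bar_to_M F = strict_mor (lift_adj F) (on_adj M_endo F) id_ftor (kappa1 (lift_adj F))"

definition bar_to_C :: "'a univ adj \<Rightarrow> 'a univ adj_mor" where
  "bar_to_C F = strict_mor (lift_adj F) (on_adj C_endo F) (kappa0 (lift_adj F)) id_ftor"

definition M_to_N :: "'a univ adj \<Rightarrow> 'a univ adj_mor" where
  "M_to_N F = strict_mor (on_adj M_endo F) (on_adj N_endo F) (kappa0 (lift_adj F)) id_ftor"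

definition C_to_N :: "'a univ adj \<Rightarrow> 'a univ adj_mor" where
  "C_to_N F = strict_mor (on_adj C_endo F) (on_adj N_endo F) id_ftor (kappa1 (lift_adj F))"

definition bar_to_N :: "'a univ adj \<Rightarrow> 'a univ adj_mor" where
  "bar_to_N F =
     strict_mor (lift_adj F) (on_adj N_endo F) (kappa0 (lift_adj F)) (kappa1 (lift_adj F))"

definition M_unit :: "'a univ adj \<Rightarrow> 'a univ adj_mor" where
  "M_unit F = bar_to_M F \<odot> embed_adj F"

definition C_unit :: "'a univ adj \<Rightarrow> 'a univ adj_mor" where
  "C_unit F = bar_to_C F \<odot> embed_adj F"

definition N_unit :: "'a univ adj \<Rightarrow> 'a univ adj_mor" where
  "N_unit F = bar_to_N F \<odot> embed_adj F"

end

theory Submission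
  imports Defs
begin

text \<open>
  Idempotent monads on adjunctions, up to isomorphism of morphisms, are endofunctors \<open>T\<close> with a
  natural point \<open>t\<close> such that \<open>t\<close> at \<open>T F\<close> and \<open>T\<close> applied to \<open>t\<close> at \<open>F\<close> are invertible; then
  \<open>T F\<close> is the reflection of \<open>F\<close> into the objects with invertible \<open>t\<close>.
  The nucleus receives comparison maps from \<open>M F\<close> and from \<open>C F\<close>. The first is inverted by \<open>C\<close>, the
  second by \<open>M\<close>, and the nucleus is local for both; uniqueness of reflections then yields
  \<open>C (M F) \<simeq> N F \<simeq> M (C F)\<close> together with naturality and the square of units.
  Locality rests on idempotent completeness: from an algebra and a compatible coalgebra structure
  the object underneath is recovered by splitting an idempotent built from the unit.
  Both 2-cells of a morphism of adjunctions are mates, which makes half of the conditions redundant,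
  and coalgebras are algebras of the opposite adjunction.
\<close>

section \<open>Categories and functors\<close>

text \<open>Naturality and monad laws hold only up to isomorphism of morphisms, so the reflection
  argument runs in a quotient category \<open>hAdj\<close>: its arrows are isomorphism classes,
  \<open>\<cong>\<close> becomes equality, equivalences become isomorphisms, and ordinary
  1-categorical lemmas suffice. The functor laws of \<open>N\<close> are not computed. A map from
  one nucleus to another is determined by its restriction along
  \<open>M F \<rightarrow> N F\<close>, so the laws are inherited from \<open>M\<close>. The
  comparison \<open>C F \<rightarrow> N F\<close> is inverted by \<open>M\<close> because both
  adjunctions induce the same monad on coalgebras; their algebra categories coincide on the nose.
  For locality, write \<open>L \<stileturn> R\<close> for the adjunction and let
  \<open>\<beta>\<close> be a coalgebra on \<open>b\<close> with an algebra structure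
  \<open>g\<close>. Then \<open>R g \<circ> \<eta>\<close> is an idempotent on \<open>R b\<close>
  which \<open>L\<close> sends to \<open>\<beta> \<circ> g\<close>; as
  \<open>g \<circ> \<beta>\<close> is an identity, the splitting \<open>a\<close> satisfies
  \<open>L a \<cong> b\<close>. Completion has a second role: it is an idempotent pointed
  endofunctor itself, and \<open>M\<close> and \<open>C\<close> are its composites with the plain
  (co)algebra constructions.\<close>

notation FArr (infixr "\<cdot>" 90)
notation FObj (infixr "\<bullet>" 90)

abbreviation comp_in :: "'u \<Rightarrow> 'u cat \<Rightarrow> 'u \<Rightarrow> 'u" ("_ \<circ>\<^bsub>_\<^esub> _" [66,0,65] 65)
  where "g \<circ>\<^bsub>C\<^esub> f \<equiv> Comp C g f"

lemma hom_iff: "f \<in> hom C a b \<longleftrightarrow> f \<in> Arr C \<and> Dom C f = a \<and> Cod C f = b"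
  by (auto simp: hom_def)

text \<open>The locale axioms speak of membership in \<open>hom C a b\<close>, whose endpoints the
  simplifier would have to guess. Stated with \<open>Arr\<close>, \<open>Dom\<close> and
  \<open>Cod\<close> they are conditional rewrite rules that also discharge typing conditions;
  associativity is oriented so that composites are bracketed to the right.\<close>

lemma category_simps [simp]:
  assumes "category C"
  shows "f \<in> Arr C \<Longrightarrow> Dom C f \<in> Obj C" "f \<in> Arr C \<Longrightarrow> Cod C f \<in> Obj C"
    "a \<in> Obj C \<Longrightarrow> One C a \<in> Arr C"
    "a \<in> Obj C \<Longrightarrow> Dom C (One C a) = a" "a \<in> Obj C \<Longrightarrow> Cod C (One C a) = a"
    "\<lbrakk>f \<in> Arr C; g \<in> Arr C; Dom C g = Cod C f\<rbrakk> \<Longrightarrow> g \<circ>\<^bsub>C\<^esub> f \<in> Arr C"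
    "\<lbrakk>f \<in> Arr C; g \<in> Arr C; Dom C g = Cod C f\<rbrakk> \<Longrightarrow> Dom C (g \<circ>\<^bsub>C\<^esub> f) = Dom C f"
    "\<lbrakk>f \<in> Arr C; g \<in> Arr C; Dom C g = Cod C f\<rbrakk> \<Longrightarrow> Cod C (g \<circ>\<^bsub>C\<^esub> f) = Cod C g"
    "\<lbrakk>f \<in> Arr C; g \<in> Arr C; h \<in> Arr C; Dom C g = Cod C f; Dom C h = Cod C g\<rbrakk>
      \<Longrightarrow> (h \<circ>\<^bsub>C\<^esub> g) \<circ>\<^bsub>C\<^esub> f = h \<circ>\<^bsub>C\<^esub> (g \<circ>\<^bsub>C\<^esub> f)"
    "\<lbrakk>f \<in> Arr C; Dom C f = a\<rbrakk> \<Longrightarrow> f \<circ>\<^bsub>C\<^esub> One C a = f"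
    "\<lbrakk>f \<in> Arr C; Cod C f = b\<rbrakk> \<Longrightarrow> One C b \<circ>\<^bsub>C\<^esub> f = f"
  using category.Dom_Obj[OF assms, of f] category.Cod_Obj[OF assms, of f]
    category.One_hom[OF assms, of a] category.Comp_hom[OF assms, of f _ _ g]
    category.Comp_assoc[OF assms, of f _ _ g _ h] category.Comp_One_right[OF assms, of f]
    category.Comp_One_left[OF assms, of f]
  by (auto simp: hom_iff)

lemma categoryI:
  assumes "\<And>f. f \<in> Arr C \<Longrightarrow> Dom C f \<in> Obj C \<and> Cod C f \<in> Obj C"
    and "\<And>a. a \<in> Obj C \<Longrightarrow> One C a \<in> Arr C \<and> Dom C (One C a) = a \<and> Cod C (One C a) = a"
    and "\<And>f g. \<lbrakk>f \<in> Arr C; g \<in> Arr C; Dom C g = Cod C f\<rbrakk> \<Longrightarrow>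
      g \<circ>\<^bsub>C\<^esub> f \<in> Arr C \<and> Dom C (g \<circ>\<^bsub>C\<^esub> f) = Dom C f \<and> Cod C (g \<circ>\<^bsub>C\<^esub> f) = Cod C g"
    and "\<And>f g h. \<lbrakk>f \<in> Arr C; g \<in> Arr C; h \<in> Arr C; Dom C g = Cod C f; Dom C h = Cod C g\<rbrakk> \<Longrightarrow>
      (h \<circ>\<^bsub>C\<^esub> g) \<circ>\<^bsub>C\<^esub> f = h \<circ>\<^bsub>C\<^esub> (g \<circ>\<^bsub>C\<^esub> f)"
    and "\<And>f. f \<in> Arr C \<Longrightarrow> f \<circ>\<^bsub>C\<^esub> One C (Dom C f) = f \<and> One C (Cod C f) \<circ>\<^bsub>C\<^esub> f = f"
  shows "category C"
  by unfold_locales (use assms in \<open>force simp: hom_iff\<close>)+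

section \<open>Isomorphisms and their inverses\<close>

lemma inverse_arrows_iff:
  "inverse_arrows C f g \<longleftrightarrow> f \<in> Arr C \<and> g \<in> Arr C \<and> Dom C g = Cod C f \<and> Cod C g = Dom C f \<and>
     g \<circ>\<^bsub>C\<^esub> f = One C (Dom C f) \<and> f \<circ>\<^bsub>C\<^esub> g = One C (Cod C f)"
  by (auto simp: inverse_arrows_def hom_iff)

lemma inverse_arrow_eqI:
  assumes C: "category C" and fg: "inverse_arrows C f g"
  shows "inverse_arrow C f = g"
  unfolding inverse_arrow_def
proof (rule the_equality)
  fix h assume "inverse_arrows C f h"
  then have "h = (g \<circ>\<^bsub>C\<^esub> f) \<circ>\<^bsub>C\<^esub> h"
    using C fg by (auto simp: inverse_arrows_iff simp del: category_simps(9))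
  also have "\<dots> = g \<circ>\<^bsub>C\<^esub> (f \<circ>\<^bsub>C\<^esub> h)"
    using fg \<open>inverse_arrows C f h\<close>
    by (intro category_simps(9)[OF C]) (auto simp: inverse_arrows_iff)
  finally show "h = g"
    using C fg \<open>inverse_arrows C f h\<close> by (auto simp: inverse_arrows_iff)
qed fact

lemma iso_arrow_Arr: "iso_arrow C f \<Longrightarrow> f \<in> Arr C"
  by (auto simp: iso_arrow_def inverse_arrows_iff)

lemma inverse_arrow_simps [simp]:
  assumes C: "category C" and iso: "iso_arrow C f"
  shows "inverse_arrow C f \<in> Arr C" "Dom C (inverse_arrow C f) = Cod C f"
    "Cod C (inverse_arrow C f) = Dom C f"
    "inverse_arrow C f \<circ>\<^bsub>C\<^esub> f = One C (Dom C f)"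
    "f \<circ>\<^bsub>C\<^esub> inverse_arrow C f = One C (Cod C f)"
    "\<lbrakk>x \<in> Arr C; Cod C x = Dom C f\<rbrakk> \<Longrightarrow> inverse_arrow C f \<circ>\<^bsub>C\<^esub> (f \<circ>\<^bsub>C\<^esub> x) = x"
    "\<lbrakk>x \<in> Arr C; Cod C x = Cod C f\<rbrakk> \<Longrightarrow> f \<circ>\<^bsub>C\<^esub> (inverse_arrow C f \<circ>\<^bsub>C\<^esub> x) = x"
    "iso_arrow C (inverse_arrow C f)" "inverse_arrow C (inverse_arrow C f) = f"
proof -
  obtain g where g: "inverse_arrows C f g"
    using iso by (auto simp: iso_arrow_def)
  note inv = inverse_arrow_eqI[OF C g]
  from g show *: "inverse_arrow C f \<in> Arr C" "Dom C (inverse_arrow C f) = Cod C f"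
    "Cod C (inverse_arrow C f) = Dom C f"
    "inverse_arrow C f \<circ>\<^bsub>C\<^esub> f = One C (Dom C f)"
    "f \<circ>\<^bsub>C\<^esub> inverse_arrow C f = One C (Cod C f)"
    by (auto simp: inverse_arrows_iff inv)
  have f: "f \<in> Arr C"
    using iso by (rule iso_arrow_Arr)
  show "inverse_arrow C f \<circ>\<^bsub>C\<^esub> (f \<circ>\<^bsub>C\<^esub> x) = x" if "x \<in> Arr C" "Cod C x = Dom C f"
    using category_simps(9)[OF C that(1) f *(1)] that C f * by auto
  show "f \<circ>\<^bsub>C\<^esub> (inverse_arrow C f \<circ>\<^bsub>C\<^esub> x) = x" if "x \<in> Arr C" "Cod C x = Cod C f"
    using category_simps(9)[OF C that(1) *(1) f] that C f * by auto
  have "inverse_arrows C g f"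
    using g by (auto simp: inverse_arrows_iff)
  then show "iso_arrow C (inverse_arrow C f)" "inverse_arrow C (inverse_arrow C f) = f"
    by (auto simp: inv iso_arrow_def intro: inverse_arrow_eqI[OF C])
qed

lemma iso_arrowI:
  assumes "f \<in> Arr C" "g \<in> Arr C" "Dom C g = Cod C f" "Cod C g = Dom C f"
    "g \<circ>\<^bsub>C\<^esub> f = One C (Dom C f)" "f \<circ>\<^bsub>C\<^esub> g = One C (Cod C f)"
  shows "iso_arrow C f"
  using assms by (auto simp: iso_arrow_def inverse_arrows_iff)

lemma inverse_arrowI:
  assumes "category C" "f \<in> Arr C" "g \<in> Arr C" "Dom C g = Cod C f" "Cod C g = Dom C f"
    "g \<circ>\<^bsub>C\<^esub> f = One C (Dom C f)" "f \<circ>\<^bsub>C\<^esub> g = One C (Cod C f)"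
  shows "inverse_arrow C f = g"
  using assms by (auto intro!: inverse_arrow_eqI simp: inverse_arrows_iff)

lemma iso_One [simp]:
  assumes "category C" "a \<in> Obj C"
  shows "iso_arrow C (One C a)" "inverse_arrow C (One C a) = One C a"
  using assms by (auto intro!: iso_arrowI[of _ _ "One C a"] inverse_arrowI)

lemma iso_Comp:
  assumes "category C" "iso_arrow C f" "iso_arrow C g" "Dom C g = Cod C f"
  shows "iso_arrow C (g \<circ>\<^bsub>C\<^esub> f)"
    "inverse_arrow C (g \<circ>\<^bsub>C\<^esub> f) = inverse_arrow C f \<circ>\<^bsub>C\<^esub> inverse_arrow C g"
  using assms iso_arrow_Arr[OF assms(2)] iso_arrow_Arr[OF assms(3)]
  by (auto intro!: iso_arrowI[of _ _ "inverse_arrow C f \<circ>\<^bsub>C\<^esub> inverse_arrow C g"] inverse_arrowI)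

lemma iso_cancel:
  assumes C: "category C" and f: "iso_arrow C f"
    and gh: "g \<in> Arr C" "h \<in> Arr C"
  shows "\<lbrakk>f \<circ>\<^bsub>C\<^esub> g = f \<circ>\<^bsub>C\<^esub> h; Cod C g = Dom C f; Cod C h = Dom C f\<rbrakk> \<Longrightarrow> g = h"
    and "\<lbrakk>g \<circ>\<^bsub>C\<^esub> f = h \<circ>\<^bsub>C\<^esub> f; Dom C g = Cod C f; Dom C h = Cod C f\<rbrakk> \<Longrightarrow> g = h"
proof -
  note [simp] = C f gh iso_arrow_Arr[OF f]
  show "g = h" if "f \<circ>\<^bsub>C\<^esub> g = f \<circ>\<^bsub>C\<^esub> h" "Cod C g = Dom C f" "Cod C h = Dom C f"
    using arg_cong[OF that(1), of "\<lambda>x. inverse_arrow C f \<circ>\<^bsub>C\<^esub> x"] that(2,3) by simp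
  show "g = h" if "g \<circ>\<^bsub>C\<^esub> f = h \<circ>\<^bsub>C\<^esub> f" "Dom C g = Cod C f" "Dom C h = Cod C f"
    using arg_cong[OF that(1), of "\<lambda>x. x \<circ>\<^bsub>C\<^esub> inverse_arrow C f"] that(2,3) by simp
qed

text \<open>Composition is normalised to the right; this moves an equation under such a composite.\<close>

lemma precomp:
  assumes "g \<circ>\<^bsub>C\<^esub> f = k" "category C" "f \<in> Arr C" "g \<in> Arr C" "x \<in> Arr C"
    "Dom C g = Cod C f" "Dom C f = Cod C x"
  shows "g \<circ>\<^bsub>C\<^esub> (f \<circ>\<^bsub>C\<^esub> x) = k \<circ>\<^bsub>C\<^esub> x"
  using assms by (metis category_simps(9))

section \<open>Functors and natural isomorphisms\<close>

lemma is_functor_iff: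
  "is_functor A B F \<longleftrightarrow> category A \<and> category B \<and>
     (\<forall>a \<in> Obj A. F \<bullet> a \<in> Obj B) \<and>
     (\<forall>f \<in> Arr A. F \<cdot> f \<in> Arr B \<and> Dom B (F \<cdot> f) = F \<bullet> Dom A f \<and> Cod B (F \<cdot> f) = F \<bullet> Cod A f) \<and>
     (\<forall>a \<in> Obj A. F \<cdot> One A a = One B (F \<bullet> a)) \<and>
     (\<forall>f \<in> Arr A. \<forall>g \<in> Arr A. Dom A g = Cod A f \<longrightarrow> F \<cdot> (g \<circ>\<^bsub>A\<^esub> f) = F \<cdot> g \<circ>\<^bsub>B\<^esub> F \<cdot> f)"
  unfolding is_functor_def hom_def by (auto; metis)

lemma nat_trans_iff:
  "nat_trans A B F G \<tau> \<longleftrightarrow> is_functor A B F \<and> is_functor A B G \<and>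
     (\<forall>a \<in> Obj A. \<tau> a \<in> Arr B \<and> Dom B (\<tau> a) = F \<bullet> a \<and> Cod B (\<tau> a) = G \<bullet> a) \<and>
     (\<forall>f \<in> Arr A. \<tau> (Cod A f) \<circ>\<^bsub>B\<^esub> F \<cdot> f = G \<cdot> f \<circ>\<^bsub>B\<^esub> \<tau> (Dom A f))"
  unfolding nat_trans_def hom_def by (auto; metis)

lemma comp_ftor_simps [simp]:
  "comp_ftor G F \<bullet> a = G \<bullet> F \<bullet> a" "comp_ftor G F \<cdot> f = G \<cdot> F \<cdot> f"
  by (auto simp: comp_ftor_def)

lemma id_ftor_simps [simp]: "id_ftor \<bullet> a = a" "id_ftor \<cdot> f = f"
  by (auto simp: id_ftor_def)

lemma comp_ftor_id [simp]: "comp_ftor F id_ftor = F" "comp_ftor id_ftor F = F"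
  by (cases F; simp add: comp_ftor_def id_ftor_def comp_def)+

lemma comp_ftor_assoc [simp]: "comp_ftor (comp_ftor F G) H = comp_ftor F (comp_ftor G H)"
  by (simp add: comp_ftor_def comp_assoc)

lemma is_functor_comp: "\<lbrakk>is_functor A B F; is_functor B C G\<rbrakk> \<Longrightarrow> is_functor A C (comp_ftor G F)"
  by (auto simp: is_functor_iff)

lemma is_functor_id: "category A \<Longrightarrow> is_functor A A id_ftor"
  by (auto simp: is_functor_iff)

lemma is_functor_cong:
  assumes "is_functor A B F" "\<And>a. a \<in> Obj A \<Longrightarrow> F' \<bullet> a = F \<bullet> a" "\<And>f. f \<in> Arr A \<Longrightarrow> F' \<cdot> f = F \<cdot> f"
  shows "is_functor A B F'"
  using assms by (auto simp: is_functor_iff)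

locale ftor =
  fixes A B :: "'u cat" and F :: "'u ftor"
  assumes is_ftor: "is_functor A B F"
begin

lemma ftor_simps [simp]:
  "category A" "category B" "a \<in> Obj A \<Longrightarrow> F \<bullet> a \<in> Obj B"
  "f \<in> Arr A \<Longrightarrow> F \<cdot> f \<in> Arr B" "f \<in> Arr A \<Longrightarrow> Dom B (F \<cdot> f) = F \<bullet> Dom A f"
  "f \<in> Arr A \<Longrightarrow> Cod B (F \<cdot> f) = F \<bullet> Cod A f"
  "a \<in> Obj A \<Longrightarrow> F \<cdot> One A a = One B (F \<bullet> a)"
  "\<lbrakk>f \<in> Arr A; g \<in> Arr A; Dom A g = Cod A f\<rbrakk> \<Longrightarrow> F \<cdot> (g \<circ>\<^bsub>A\<^esub> f) = F \<cdot> g \<circ>\<^bsub>B\<^esub> F \<cdot> f"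
  using is_ftor unfolding is_functor_iff by auto

lemma iso_ftor [simp]:
  assumes "iso_arrow A f"
  shows "iso_arrow B (F \<cdot> f)" "F \<cdot> inverse_arrow A f = inverse_arrow B (F \<cdot> f)"
proof -
  have f: "f \<in> Arr A"
    using assms by (rule iso_arrow_Arr)
  have *: "F \<cdot> inverse_arrow A f \<circ>\<^bsub>B\<^esub> F \<cdot> f = One B (F \<bullet> Dom A f)"
    "F \<cdot> f \<circ>\<^bsub>B\<^esub> F \<cdot> inverse_arrow A f = One B (F \<bullet> Cod A f)"
    using f assms by (simp_all flip: ftor_simps(8))
  show "iso_arrow B (F \<cdot> f)"
    using f assms * by (intro iso_arrowI[of _ _ "F \<cdot> inverse_arrow A f"]) auto
  show "F \<cdot> inverse_arrow A f = inverse_arrow B (F \<cdot> f)"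
    using f assms * by (intro inverse_arrowI[symmetric]) auto
qed

end

lemma nat_isoD:
  assumes "nat_iso A B F G \<tau>"
  shows "is_functor A B F" "is_functor A B G"
    "a \<in> Obj A \<Longrightarrow> \<tau> a \<in> Arr B" "a \<in> Obj A \<Longrightarrow> Dom B (\<tau> a) = F \<bullet> a"
    "a \<in> Obj A \<Longrightarrow> Cod B (\<tau> a) = G \<bullet> a" "a \<in> Obj A \<Longrightarrow> iso_arrow B (\<tau> a)"
    "f \<in> Arr A \<Longrightarrow> \<tau> (Cod A f) \<circ>\<^bsub>B\<^esub> F \<cdot> f = G \<cdot> f \<circ>\<^bsub>B\<^esub> \<tau> (Dom A f)"
  using assms unfolding nat_iso_def nat_trans_iff by auto

lemma nat_isoI:
  assumes "is_functor A B F" "is_functor A B G"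
    and "\<And>a. a \<in> Obj A \<Longrightarrow> iso_arrow B (\<tau> a) \<and> Dom B (\<tau> a) = F \<bullet> a \<and> Cod B (\<tau> a) = G \<bullet> a"
    and "\<And>f. f \<in> Arr A \<Longrightarrow> \<tau> (Cod A f) \<circ>\<^bsub>B\<^esub> F \<cdot> f = G \<cdot> f \<circ>\<^bsub>B\<^esub> \<tau> (Dom A f)"
  shows "nat_iso A B F G \<tau>"
  using assms iso_arrow_Arr unfolding nat_iso_def nat_trans_iff by fast

lemma nat_iso_inverse:
  assumes "nat_iso A B F G \<tau>"
  shows "nat_iso A B G F (\<lambda>a. inverse_arrow B (\<tau> a))"
proof (rule nat_isoI)
  note \<tau> = nat_isoD[OF assms]
  interpret F: ftor A B F
    by unfold_locales (fact \<tau>)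
  interpret G: ftor A B G
    by unfold_locales (fact \<tau>)
  note [simp] = \<tau>(3-6)
  show "inverse_arrow B (\<tau> (Cod A f)) \<circ>\<^bsub>B\<^esub> G \<cdot> f = F \<cdot> f \<circ>\<^bsub>B\<^esub> inverse_arrow B (\<tau> (Dom A f))"
    if f [simp]: "f \<in> Arr A" for f
  proof -
    have "inverse_arrow B (\<tau> (Cod A f)) \<circ>\<^bsub>B\<^esub> G \<cdot> f =
        inverse_arrow B (\<tau> (Cod A f)) \<circ>\<^bsub>B\<^esub> ((G \<cdot> f \<circ>\<^bsub>B\<^esub> \<tau> (Dom A f)) \<circ>\<^bsub>B\<^esub> inverse_arrow B (\<tau> (Dom A f)))"
      by simp
    also have "\<dots> = F \<cdot> f \<circ>\<^bsub>B\<^esub> inverse_arrow B (\<tau> (Dom A f))"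
      unfolding \<tau>(7)[OF f, symmetric] by simp
    finally show ?thesis .
  qed
  show "iso_arrow B (inverse_arrow B (\<tau> a)) \<and> Dom B (inverse_arrow B (\<tau> a)) = G \<bullet> a \<and>
      Cod B (inverse_arrow B (\<tau> a)) = F \<bullet> a" if "a \<in> Obj A" for a
    using that by simp
qed (use nat_isoD[OF assms] in auto)

lemma nat_iso_comp:
  assumes "nat_iso A B F G \<tau>" "nat_iso A B G H \<sigma>"
  shows "nat_iso A B F H (\<lambda>a. \<sigma> a \<circ>\<^bsub>B\<^esub> \<tau> a)"
proof (rule nat_isoI)
  note \<tau> = nat_isoD[OF assms(1)] and \<sigma> = nat_isoD[OF assms(2)]
  interpret F: ftor A B F by unfold_locales (fact \<tau>)
  interpret G: ftor A B G by unfold_locales (fact \<tau>)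
  interpret H: ftor A B H by unfold_locales (fact \<sigma>)
  note [simp] = \<tau>(3-6) \<sigma>(3-6)
  show "(\<sigma> (Cod A f) \<circ>\<^bsub>B\<^esub> \<tau> (Cod A f)) \<circ>\<^bsub>B\<^esub> F \<cdot> f = H \<cdot> f \<circ>\<^bsub>B\<^esub> (\<sigma> (Dom A f) \<circ>\<^bsub>B\<^esub> \<tau> (Dom A f))"
    if f [simp]: "f \<in> Arr A" for f
    using \<tau>(7)[OF f] precomp[OF \<sigma>(7)[OF f], of "\<tau> (Dom A f)"] by simp
  show "iso_arrow B (\<sigma> a \<circ>\<^bsub>B\<^esub> \<tau> a) \<and> Dom B (\<sigma> a \<circ>\<^bsub>B\<^esub> \<tau> a) = F \<bullet> a \<and> Cod B (\<sigma> a \<circ>\<^bsub>B\<^esub> \<tau> a) = H \<bullet> a"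
    if "a \<in> Obj A" for a
    using that by (simp add: iso_Comp)
qed (use nat_isoD[OF assms(1)] nat_isoD[OF assms(2)] in auto)

lemma nat_iso_id:
  assumes "is_functor A B F"
  shows "nat_iso A B F F (\<lambda>a. One B (F \<bullet> a))"
proof -
  interpret ftor A B F by unfold_locales fact
  show ?thesis by (rule nat_isoI) (use assms in auto)
qed

lemma nat_iso_whisker_left:
  assumes "nat_iso A B F G \<tau>" "is_functor B C H"
  shows "nat_iso A C (comp_ftor H F) (comp_ftor H G) (\<lambda>a. H \<cdot> \<tau> a)"
proof -
  interpret H: ftor B C H by unfold_locales fact
  note \<tau> = nat_isoD[OF assms(1)]
  interpret F: ftor A B F by unfold_locales (fact \<tau>)
  interpret G: ftor A B G by unfold_locales (fact \<tau>)
  note [simp] = \<tau>(3-6)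
  have "H \<cdot> \<tau> (Cod A f) \<circ>\<^bsub>C\<^esub> H \<cdot> F \<cdot> f = H \<cdot> G \<cdot> f \<circ>\<^bsub>C\<^esub> H \<cdot> \<tau> (Dom A f)" if [simp]: "f \<in> Arr A" for f
    using arg_cong[OF \<tau>(7)[of f], of "FArr H"] by simp
  then show ?thesis
    by (intro nat_isoI is_functor_comp[OF _ assms(2)] \<tau>) auto
qed

lemma nat_iso_whisker_right:
  assumes "nat_iso B C F G \<tau>" "is_functor A B H"
  shows "nat_iso A C (comp_ftor F H) (comp_ftor G H) (\<lambda>a. \<tau> (H \<bullet> a))"
proof -
  interpret H: ftor A B H by unfold_locales fact
  note \<tau> = nat_isoD[OF assms(1)]
  have "\<tau> (H \<bullet> Cod A f) \<circ>\<^bsub>C\<^esub> F \<cdot> H \<cdot> f = G \<cdot> H \<cdot> f \<circ>\<^bsub>C\<^esub> \<tau> (H \<bullet> Dom A f)" if "f \<in> Arr A" for f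
    using \<tau>(7)[of "H \<cdot> f"] that by simp
  then show ?thesis
    using \<tau>(3-6) by (intro nat_isoI is_functor_comp[OF assms(2)] \<tau>(1,2)) auto
qed

subsection \<open>Equivalences of categories\<close>

text \<open>Fully faithful and essentially surjective functors: the working criterion for
  equivalences. The quasi-inverse is built below by choosing preimages.\<close>

locale ff_eso = ftor +
  assumes faithful: "\<lbrakk>f \<in> Arr A; g \<in> Arr A; Dom A f = Dom A g; Cod A f = Cod A g; F \<cdot> f = F \<cdot> g\<rbrakk> \<Longrightarrow> f = g"
    and full: "\<lbrakk>a \<in> Obj A; a' \<in> Obj A; g \<in> Arr B; Dom B g = F \<bullet> a; Cod B g = F \<bullet> a'\<rbrakk> \<Longrightarrow>
      \<exists>f. f \<in> hom A a a' \<and> F \<cdot> f = g"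
    and eso: "b \<in> Obj B \<Longrightarrow> \<exists>a \<in> Obj A. \<exists>i. iso_arrow B i \<and> Dom B i = F \<bullet> a \<and> Cod B i = b"
begin

definition lift_arr :: "'a \<Rightarrow> 'a \<Rightarrow> 'a \<Rightarrow> 'a" where
  "lift_arr a a' g = (SOME f. f \<in> hom A a a' \<and> F \<cdot> f = g)"

lemma lift_arr [simp]:
  assumes "a \<in> Obj A" "a' \<in> Obj A" "g \<in> Arr B" "Dom B g = F \<bullet> a" "Cod B g = F \<bullet> a'"
  shows "lift_arr a a' g \<in> Arr A" "Dom A (lift_arr a a' g) = a" "Cod A (lift_arr a a' g) = a'"
    "F \<cdot> lift_arr a a' g = g"
  using someI_ex[OF full[OF assms]] unfolding lift_arr_def hom_iff by auto

lemma lift_arr_iso: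
  assumes "a \<in> Obj A" "a' \<in> Obj A" "iso_arrow B g" "Dom B g = F \<bullet> a" "Cod B g = F \<bullet> a'"
  shows "iso_arrow A (lift_arr a a' g)"
  using assms iso_arrow_Arr[OF assms(3)]
  by (intro iso_arrowI[of _ _ "lift_arr a' a (inverse_arrow B g)"])
    (auto intro: faithful[of "_ \<circ>\<^bsub>A\<^esub> _"])

definition iobj :: "'a \<Rightarrow> 'a" where
  "iobj b = (SOME a. a \<in> Obj A \<and> (\<exists>i. iso_arrow B i \<and> Dom B i = F \<bullet> a \<and> Cod B i = b))"

definition cnt :: "'a \<Rightarrow> 'a" where
  "cnt b = (SOME i. iso_arrow B i \<and> Dom B i = F \<bullet> iobj b \<and> Cod B i = b)"

lemma iobj [simp]:
  assumes "b \<in> Obj B"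
  shows "iobj b \<in> Obj A" "iso_arrow B (cnt b)" "Dom B (cnt b) = F \<bullet> iobj b" "Cod B (cnt b) = b"
    "cnt b \<in> Arr B"
proof -
  have 1: "iobj b \<in> Obj A \<and> (\<exists>i. iso_arrow B i \<and> Dom B i = F \<bullet> iobj b \<and> Cod B i = b)"
    using someI_ex[of "\<lambda>a. a \<in> Obj A \<and> (\<exists>i. iso_arrow B i \<and> Dom B i = F \<bullet> a \<and> Cod B i = b)"]
      eso[OF assms] unfolding iobj_def by blast
  then have "iso_arrow B (cnt b) \<and> Dom B (cnt b) = F \<bullet> iobj b \<and> Cod B (cnt b) = b"
    unfolding cnt_def by (intro someI_ex[of "\<lambda>i. iso_arrow B i \<and> Dom B i = F \<bullet> iobj b \<and> Cod B i = b"]) auto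
  with 1 show "iobj b \<in> Obj A" "iso_arrow B (cnt b)" "Dom B (cnt b) = F \<bullet> iobj b"
    "Cod B (cnt b) = b" "cnt b \<in> Arr B"
    by (auto intro: iso_arrow_Arr)
qed

text \<open>An arrow \<open>g\<close> is conjugated by the chosen isomorphisms \<open>cnt\<close>,
  which puts it between objects in the image of \<open>F\<close>, and then lifted along fullness.
  All functor laws follow by faithfulness.\<close>

definition inv_ftor :: "'a ftor" where
  "inv_ftor = \<lparr>FObj = iobj, FArr = (\<lambda>g. lift_arr (iobj (Dom B g)) (iobj (Cod B g))
     (inverse_arrow B (cnt (Cod B g)) \<circ>\<^bsub>B\<^esub> (g \<circ>\<^bsub>B\<^esub> cnt (Dom B g))))\<rparr>"

lemma inv_ftor_simps [simp]:
  "inv_ftor \<bullet> b = iobj b"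
  "g \<in> Arr B \<Longrightarrow> F \<cdot> inv_ftor \<cdot> g = inverse_arrow B (cnt (Cod B g)) \<circ>\<^bsub>B\<^esub> (g \<circ>\<^bsub>B\<^esub> cnt (Dom B g))"
  "g \<in> Arr B \<Longrightarrow> inv_ftor \<cdot> g \<in> Arr A" "g \<in> Arr B \<Longrightarrow> Dom A (inv_ftor \<cdot> g) = iobj (Dom B g)"
  "g \<in> Arr B \<Longrightarrow> Cod A (inv_ftor \<cdot> g) = iobj (Cod B g)"
  by (auto simp: inv_ftor_def)

lemma inv_ftor: "is_functor B A inv_ftor"
  unfolding is_functor_iff
  by (auto intro: faithful[of "_ \<cdot> One B _"] faithful[of "_ \<cdot> (_ \<circ>\<^bsub>B\<^esub> _)"])

lemma cnt_nat_iso: "nat_iso B B (comp_ftor F inv_ftor) id_ftor cnt"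
  by (rule nat_isoI) (auto intro: is_functor_comp[OF inv_ftor is_ftor] is_functor_id)

text \<open>The second triangle is forced: \<open>F\<close> must send this component to
  \<open>cnt\<close>, so it is the lift of \<open>cnt\<close> and inherits invertibility and
  naturality from it.\<close>

definition unt :: "'a \<Rightarrow> 'a" where
  "unt a = lift_arr (iobj (F \<bullet> a)) a (cnt (F \<bullet> a))"

lemma unt_simps [simp]:
  assumes "a \<in> Obj A"
  shows "unt a \<in> Arr A" "Dom A (unt a) = iobj (F \<bullet> a)" "Cod A (unt a) = a"
    "F \<cdot> unt a = cnt (F \<bullet> a)" "iso_arrow A (unt a)"
  using assms by (auto simp: unt_def intro: lift_arr_iso)

lemma unt_nat_iso: "nat_iso A A (comp_ftor inv_ftor F) id_ftor unt"
  by (rule nat_isoI) (auto intro: is_functor_comp[OF is_ftor inv_ftor] is_functor_id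
    faithful[of "_ \<circ>\<^bsub>A\<^esub> _"])

lemma equivalence: "equivalence_functor A B F"
  unfolding equivalence_functor_def
  using is_ftor inv_ftor cnt_nat_iso nat_iso_inverse[OF unt_nat_iso] by blast

end

text \<open>Only one of the two natural isomorphisms is assumed, so that the statement can be
  applied to either functor of an equivalence.\<close>

lemma equivalence_faithful:
  assumes \<sigma>: "nat_iso A A id_ftor (comp_ftor G F) \<sigma>"
    and fg: "f \<in> Arr A" "g \<in> Arr A" "Dom A f = Dom A g" "Cod A f = Cod A g" "F \<cdot> f = F \<cdot> g"
  shows "f = g"
proof -
  have A: "category A"
    using nat_isoD(1)[OF \<sigma>] by (simp add: is_functor_iff)
  note s = nat_isoD(3-)[OF \<sigma>]
  have eq: "\<sigma> (Cod A f) \<circ>\<^bsub>A\<^esub> f = \<sigma> (Cod A f) \<circ>\<^bsub>A\<^esub> g"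
    using s(5)[OF fg(1)] s(5)[OF fg(2)] fg by simp
  show ?thesis
    by (rule iso_cancel(1)[OF A _ _ _ eq]) (use A fg s(1-4) in auto)
qed

lemma equivalence_functor_iff: "equivalence_functor A B F \<longleftrightarrow> ff_eso A B F"
proof
  assume "equivalence_functor A B F"
  then obtain G \<sigma> \<tau> where F: "is_functor A B F" and G: "is_functor B A G"
    and \<sigma>: "nat_iso A A id_ftor (comp_ftor G F) \<sigma>" and \<tau>: "nat_iso B B (comp_ftor F G) id_ftor \<tau>"
    unfolding equivalence_functor_def by blast
  interpret F: ftor A B F by unfold_locales fact
  interpret G: ftor B A G by unfold_locales fact
  note s = nat_isoD(3-)[OF \<sigma>, simplified] and t = nat_isoD(3-)[OF \<tau>, simplified]
  note [simp] = s(1-4) t(1-4)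
  show "ff_eso A B F"
  proof
    show "f = g" if "f \<in> Arr A" "g \<in> Arr A" "Dom A f = Dom A g" "Cod A f = Cod A g" "F \<cdot> f = F \<cdot> g" for f g
      using equivalence_faithful[OF \<sigma> that] .
    show "\<exists>f. f \<in> hom A a a' \<and> F \<cdot> f = g"
      if [simp]: "a \<in> Obj A" "a' \<in> Obj A" "g \<in> Arr B" "Dom B g = F \<bullet> a" "Cod B g = F \<bullet> a'" for a a' g
    proof -
      \<comment> \<open>The candidate preimage is \<open>G \<cdot> g\<close> conjugated by
        \<open>\<sigma>\<close>. Naturality of \<open>\<sigma>\<close> gives
        \<open>G \<cdot> F \<cdot> f = G \<cdot> g\<close>, and \<open>G\<close> is faithful because
        of \<open>\<tau>\<close>.\<close>
      define f where "f = inverse_arrow A (\<sigma> a') \<circ>\<^bsub>A\<^esub> (G \<cdot> g \<circ>\<^bsub>A\<^esub> \<sigma> a)"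
      have f [simp]: "f \<in> Arr A" "Dom A f = a" "Cod A f = a'"
        by (simp_all add: f_def)
      have "\<sigma> a' \<circ>\<^bsub>A\<^esub> f = G \<cdot> g \<circ>\<^bsub>A\<^esub> \<sigma> a"
        by (simp add: f_def)
      then have eq: "G \<cdot> F \<cdot> f \<circ>\<^bsub>A\<^esub> \<sigma> a = G \<cdot> g \<circ>\<^bsub>A\<^esub> \<sigma> a"
        using s(5)[of f] by simp
      have "G \<cdot> F \<cdot> f = G \<cdot> g"
        by (rule iso_cancel(2)[OF _ _ _ _ eq]) auto
      then have "F \<cdot> f = g"
        using equivalence_faithful[OF nat_iso_inverse[OF \<tau>], of "F \<cdot> f" g] by simp
      then show ?thesis
        by (intro exI[of _ f]) (auto simp: hom_iff)
    qed
    show "\<exists>a\<in>Obj A. \<exists>i. iso_arrow B i \<and> Dom B i = F \<bullet> a \<and> Cod B i = b" if "b \<in> Obj B" for b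
      using that by (intro bexI[of _ "G \<bullet> b"] exI[of _ "\<tau> b"]) auto
  qed
qed (rule ff_eso.equivalence)

text \<open>Functors are total records, so a functor that acts as the identity on a category need
  not equal \<open>id_ftor\<close>; hence the pointwise hypotheses.\<close>

lemma equivalence_functor_id:
  assumes "category A" "\<And>a. a \<in> Obj A \<Longrightarrow> F \<bullet> a = a" "\<And>f. f \<in> Arr A \<Longrightarrow> F \<cdot> f = f"
  shows "equivalence_functor A A F"
proof -
  have "is_functor A A F"
    using assms by (auto simp: is_functor_iff)
  moreover have "\<exists>a\<in>Obj A. \<exists>i. iso_arrow A i \<and> Dom A i = F \<bullet> a \<and> Cod A i = b" if "b \<in> Obj A" for b
    using assms that by (intro bexI[of _ b] exI[of _ "One A b"]) auto
  ultimately show ?thesis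
    unfolding equivalence_functor_iff using assms
    by unfold_locales (auto simp: hom_iff)
qed

section \<open>Adjunctions and their morphisms\<close>

lemma adjunction_ftors:
  assumes "adjunction F"
  shows "ftor (catA F) (catB F) (ladj F)" "ftor (catB F) (catA F) (radj F)"
  using assms by (auto simp: adjunction_def ftor_def)

lemmas adjunction_simps [simp] =
  ftor.ftor_simps[OF adjunction_ftors(1)] ftor.ftor_simps(3-)[OF adjunction_ftors(2)]
  ftor.iso_ftor[OF adjunction_ftors(1)] ftor.iso_ftor[OF adjunction_ftors(2)]

lemma adjunction_unit_counit:
  assumes "adjunction F"
  shows "a \<in> Obj (catA F) \<Longrightarrow> eta F a \<in> Arr (catA F)"
    "a \<in> Obj (catA F) \<Longrightarrow> Dom (catA F) (eta F a) = a"
    "a \<in> Obj (catA F) \<Longrightarrow> Cod (catA F) (eta F a) = radj F \<bullet> ladj F \<bullet> a"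
    "b \<in> Obj (catB F) \<Longrightarrow> eps F b \<in> Arr (catB F)"
    "b \<in> Obj (catB F) \<Longrightarrow> Dom (catB F) (eps F b) = ladj F \<bullet> radj F \<bullet> b"
    "b \<in> Obj (catB F) \<Longrightarrow> Cod (catB F) (eps F b) = b"
    "f \<in> Arr (catA F) \<Longrightarrow> eta F (Cod (catA F) f) \<circ>\<^bsub>catA F\<^esub> f =
       radj F \<cdot> ladj F \<cdot> f \<circ>\<^bsub>catA F\<^esub> eta F (Dom (catA F) f)"
    "g \<in> Arr (catB F) \<Longrightarrow> eps F (Cod (catB F) g) \<circ>\<^bsub>catB F\<^esub> ladj F \<cdot> radj F \<cdot> g =
       g \<circ>\<^bsub>catB F\<^esub> eps F (Dom (catB F) g)"
    "a \<in> Obj (catA F) \<Longrightarrow>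
       eps F (ladj F \<bullet> a) \<circ>\<^bsub>catB F\<^esub> ladj F \<cdot> eta F a = One (catB F) (ladj F \<bullet> a)"
    "b \<in> Obj (catB F) \<Longrightarrow>
       radj F \<cdot> eps F b \<circ>\<^bsub>catA F\<^esub> eta F (radj F \<bullet> b) = One (catA F) (radj F \<bullet> b)"
  using assms unfolding adjunction_def nat_trans_iff by auto

lemmas eta_nat = adjunction_unit_counit(7)
lemmas eps_nat = adjunction_unit_counit(8)
declare adjunction_unit_counit(1-6,9,10) [simp]

lemma triangle_precomp [simp]:
  assumes "adjunction F"
  shows "\<lbrakk>a \<in> Obj (catA F); x \<in> Arr (catB F); Cod (catB F) x = ladj F \<bullet> a\<rbrakk> \<Longrightarrow>
      eps F (ladj F \<bullet> a) \<circ>\<^bsub>catB F\<^esub> (ladj F \<cdot> eta F a \<circ>\<^bsub>catB F\<^esub> x) = x"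
    "\<lbrakk>b \<in> Obj (catB F); y \<in> Arr (catA F); Cod (catA F) y = radj F \<bullet> b\<rbrakk> \<Longrightarrow>
      radj F \<cdot> eps F b \<circ>\<^bsub>catA F\<^esub> (eta F (radj F \<bullet> b) \<circ>\<^bsub>catA F\<^esub> y) = y"
  using assms by (simp_all add: precomp[OF adjunction_unit_counit(9)] precomp[OF adjunction_unit_counit(10)])

lemma adjunctionI:
  assumes "is_functor (catA F) (catB F) (ladj F)" "is_functor (catB F) (catA F) (radj F)"
    and "\<And>a. a \<in> Obj (catA F) \<Longrightarrow> eta F a \<in> Arr (catA F) \<and> Dom (catA F) (eta F a) = a \<and>
       Cod (catA F) (eta F a) = radj F \<bullet> ladj F \<bullet> a"
    and "\<And>b. b \<in> Obj (catB F) \<Longrightarrow> eps F b \<in> Arr (catB F) \<and>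
       Dom (catB F) (eps F b) = ladj F \<bullet> radj F \<bullet> b \<and> Cod (catB F) (eps F b) = b"
    and "\<And>f. f \<in> Arr (catA F) \<Longrightarrow> eta F (Cod (catA F) f) \<circ>\<^bsub>catA F\<^esub> f =
       radj F \<cdot> ladj F \<cdot> f \<circ>\<^bsub>catA F\<^esub> eta F (Dom (catA F) f)"
    and "\<And>g. g \<in> Arr (catB F) \<Longrightarrow> eps F (Cod (catB F) g) \<circ>\<^bsub>catB F\<^esub> ladj F \<cdot> radj F \<cdot> g =
       g \<circ>\<^bsub>catB F\<^esub> eps F (Dom (catB F) g)"
    and "\<And>a. a \<in> Obj (catA F) \<Longrightarrow>
       eps F (ladj F \<bullet> a) \<circ>\<^bsub>catB F\<^esub> ladj F \<cdot> eta F a = One (catB F) (ladj F \<bullet> a)"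
    and "\<And>b. b \<in> Obj (catB F) \<Longrightarrow>
       radj F \<cdot> eps F b \<circ>\<^bsub>catA F\<^esub> eta F (radj F \<bullet> b) = One (catA F) (radj F \<bullet> b)"
  shows "adjunction F"
proof -
  have "category (catA F)" "category (catB F)"
    using assms(1) by (auto simp: is_functor_iff)
  then show ?thesis
    unfolding adjunction_def nat_trans_iff
    by (simp add: assms is_functor_id is_functor_comp[OF assms(1,2)] is_functor_comp[OF assms(2,1)])
qed

text \<open>The compatibility with the counits is not assumed: the two 2-cells are mates, so it follows
  from the compatibility with the units.\<close>

locale adj_morph =
  fixes F G :: "'u adj" and H K :: "'u ftor" and u d :: "'u \<Rightarrow> 'u"
  assumes F [simp]: "adjunction F" and G [simp]: "adjunction G"
    and H: "is_functor (catA F) (catA G) H" and K: "is_functor (catB F) (catB G) K"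
    and u: "nat_iso (catA F) (catB G) (comp_ftor K (ladj F)) (comp_ftor (ladj G) H) u"
    and d: "nat_iso (catB F) (catA G) (comp_ftor H (radj F)) (comp_ftor (radj G) K) d"
    and unit: "a \<in> Obj (catA F) \<Longrightarrow> radj G \<cdot> u a \<circ>\<^bsub>catA G\<^esub> (d (ladj F \<bullet> a) \<circ>\<^bsub>catA G\<^esub> H \<cdot> eta F a) =
      eta G (H \<bullet> a)"
begin

sublocale H: ftor "catA F" "catA G" H by unfold_locales (rule H)
sublocale K: ftor "catB F" "catB G" K by unfold_locales (rule K)

lemmas u_simps [simp] = nat_isoD(3-6)[OF u, simplified]
lemmas d_simps [simp] = nat_isoD(3-6)[OF d, simplified]
lemmas u_nat = nat_isoD(7)[OF u, simplified]
lemmas d_nat = nat_isoD(7)[OF d, simplified]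

text \<open>\<open>d\<close> is the mate of the inverse of \<open>u\<close>. Substituting the unit
  law for \<open>eta G\<close>, naturality of \<open>d\<close> at the counit moves \<open>d\<close>
  to the front, and a triangle identity of \<open>F\<close> removes the rest.\<close>

lemma d_mate:
  assumes [simp]: "b \<in> Obj (catB F)"
  shows "radj G \<cdot> (K \<cdot> eps F b \<circ>\<^bsub>catB G\<^esub> inverse_arrow (catB G) (u (radj F \<bullet> b))) \<circ>\<^bsub>catA G\<^esub>
    eta G (H \<bullet> radj F \<bullet> b) = d b"
proof -
  let ?d = "d (ladj F \<bullet> radj F \<bullet> b)"
  have "radj G \<cdot> (K \<cdot> eps F b \<circ>\<^bsub>catB G\<^esub> inverse_arrow (catB G) (u (radj F \<bullet> b))) \<circ>\<^bsub>catA G\<^esub>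
      eta G (H \<bullet> radj F \<bullet> b) =
    radj G \<cdot> K \<cdot> eps F b \<circ>\<^bsub>catA G\<^esub> (?d \<circ>\<^bsub>catA G\<^esub> H \<cdot> eta F (radj F \<bullet> b))"
    by (simp flip: unit)
  also have "\<dots> = d b \<circ>\<^bsub>catA G\<^esub> (H \<cdot> radj F \<cdot> eps F b \<circ>\<^bsub>catA G\<^esub> H \<cdot> eta F (radj F \<bullet> b))"
    by (simp add: precomp[OF d_nat[of "eps F b", simplified, symmetric]])
  also have "\<dots> = d b"
    by (simp flip: H.ftor_simps(8))
  finally show ?thesis .
qed

text \<open>With \<open>d\<close> replaced by its mate, \<open>eps G\<close> slides past the mate by
  naturality and meets \<open>eta G\<close> in a triangle identity of \<open>G\<close>; what remains
  is \<open>K \<cdot> eps F b\<close> after the inverse of \<open>u\<close>.\<close>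

lemma counit:
  assumes [simp]: "b \<in> Obj (catB F)"
  shows "eps G (K \<bullet> b) \<circ>\<^bsub>catB G\<^esub> (ladj G \<cdot> d b \<circ>\<^bsub>catB G\<^esub> u (radj F \<bullet> b)) = K \<cdot> eps F b"
proof -
  let ?k = "K \<cdot> eps F b \<circ>\<^bsub>catB G\<^esub> inverse_arrow (catB G) (u (radj F \<bullet> b))"
  have "eps G (K \<bullet> b) \<circ>\<^bsub>catB G\<^esub> ladj G \<cdot> d b =
      (eps G (K \<bullet> b) \<circ>\<^bsub>catB G\<^esub> ladj G \<cdot> radj G \<cdot> ?k) \<circ>\<^bsub>catB G\<^esub> ladj G \<cdot> eta G (H \<bullet> radj F \<bullet> b)"
    by (simp flip: d_mate)
  also have "eps G (K \<bullet> b) \<circ>\<^bsub>catB G\<^esub> ladj G \<cdot> radj G \<cdot> ?k = ?k \<circ>\<^bsub>catB G\<^esub> eps G (ladj G \<bullet> H \<bullet> radj F \<bullet> b)"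
    using eps_nat[of G ?k] by simp
  finally have eq: "eps G (K \<bullet> b) \<circ>\<^bsub>catB G\<^esub> ladj G \<cdot> d b = ?k"
    by simp
  show ?thesis
    by (simp add: precomp[OF eq])
qed

text \<open>The opposite passage between mates: \<open>d\<close> determines the inverse of
  \<open>u\<close>. Composing the right-hand side with \<open>u a\<close> reduces it to the unit law
  and a triangle of \<open>G\<close>.\<close>

lemma u_mate:
  assumes [simp]: "a \<in> Obj (catA F)"
  shows "inverse_arrow (catB G) (u a) =
    eps G (K \<bullet> ladj F \<bullet> a) \<circ>\<^bsub>catB G\<^esub> ladj G \<cdot> (d (ladj F \<bullet> a) \<circ>\<^bsub>catA G\<^esub> H \<cdot> eta F a)" (is "_ = ?k")
proof -
  have "u a \<circ>\<^bsub>catB G\<^esub> ?k = eps G (ladj G \<bullet> H \<bullet> a) \<circ>\<^bsub>catB G\<^esub>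
      (ladj G \<cdot> radj G \<cdot> u a \<circ>\<^bsub>catB G\<^esub> ladj G \<cdot> (d (ladj F \<bullet> a) \<circ>\<^bsub>catA G\<^esub> H \<cdot> eta F a))"
    by (simp add: precomp[OF eps_nat[of G "u a", simplified, symmetric]])
  also have "\<dots> = eps G (ladj G \<bullet> H \<bullet> a) \<circ>\<^bsub>catB G\<^esub> ladj G \<cdot> eta G (H \<bullet> a)"
    by (simp flip: unit)
  finally have eq: "u a \<circ>\<^bsub>catB G\<^esub> inverse_arrow (catB G) (u a) = u a \<circ>\<^bsub>catB G\<^esub> ?k"
    by simp
  show ?thesis
    by (rule iso_cancel(1)[OF _ _ _ _ eq]) auto
qed

end

section \<open>Isomorphism and pointwise agreement of morphisms of adjunctions\<close>

lemma adj_hom_iff: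
  "\<Upsilon> \<in> adj_hom F G \<longleftrightarrow>
    src_adj \<Upsilon> = F \<and> tgt_adj \<Upsilon> = G \<and> adj_morph F G (mH \<Upsilon>) (mK \<Upsilon>) (ups \<Upsilon>) (dns \<Upsilon>)"
  using adj_morph.counit[of F G "mH \<Upsilon>" "mK \<Upsilon>" "ups \<Upsilon>" "dns \<Upsilon>"]
  unfolding adj_hom_def adj_morphism_def adj_morph_def Let_def by auto

lemma adj_morphism_iff: "adj_morphism \<Upsilon> \<longleftrightarrow> \<Upsilon> \<in> adj_hom (src_adj \<Upsilon>) (tgt_adj \<Upsilon>)"
  by (simp add: adj_hom_def)

lemma adj_homD:
  assumes "\<Upsilon> \<in> adj_hom F G"
  shows "src_adj \<Upsilon> = F" "tgt_adj \<Upsilon> = G" "adjunction F" "adjunction G"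
    "adj_morph F G (mH \<Upsilon>) (mK \<Upsilon>) (ups \<Upsilon>) (dns \<Upsilon>)"
  using assms by (auto simp: adj_hom_iff adj_morph_def)

text \<open>As the 2-cells are mates, one of the two compatibility conditions implies the other.\<close>

lemma adj_isoI:
  assumes \<Upsilon>: "\<Upsilon> \<in> adj_hom F G" and \<Upsilon>': "\<Upsilon>' \<in> adj_hom F G"
    and \<theta>: "nat_iso (catA F) (catA G) (mH \<Upsilon>) (mH \<Upsilon>') \<theta>"
    and \<phi>: "nat_iso (catB F) (catB G) (mK \<Upsilon>) (mK \<Upsilon>') \<phi>"
    and "(\<forall>a \<in> Obj (catA F). ups \<Upsilon>' a \<circ>\<^bsub>catB G\<^esub> \<phi> (ladj F \<bullet> a) = ladj G \<cdot> \<theta> a \<circ>\<^bsub>catB G\<^esub> ups \<Upsilon> a) \<or>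
      (\<forall>b \<in> Obj (catB F). dns \<Upsilon>' b \<circ>\<^bsub>catA G\<^esub> \<theta> (radj F \<bullet> b) = radj G \<cdot> \<phi> b \<circ>\<^bsub>catA G\<^esub> dns \<Upsilon> b)"
      (is "(\<forall>a \<in> _. ?U a) \<or> (\<forall>b \<in> _. ?D b)")
  shows "\<Upsilon> \<cong> \<Upsilon>'"
proof -
  interpret Y: adj_morph F G "mH \<Upsilon>" "mK \<Upsilon>" "ups \<Upsilon>" "dns \<Upsilon>"
    by (rule adj_homD(5)[OF \<Upsilon>])
  interpret Y': adj_morph F G "mH \<Upsilon>'" "mK \<Upsilon>'" "ups \<Upsilon>'" "dns \<Upsilon>'"
    by (rule adj_homD(5)[OF \<Upsilon>'])
  let ?i = "inverse_arrow (catB G)"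
  note [simp] = nat_isoD(3-6)[OF \<theta>] nat_isoD(3-6)[OF \<phi>]
  have D: "?D b" if U: "\<forall>a \<in> Obj (catA F). ?U a" and b [simp]: "b \<in> Obj (catB F)" for b
  proof -
    let ?a = "radj F \<bullet> b"
    \<comment> \<open>The condition on \<open>ups\<close> is rewritten for the inverses, as these
      are what occurs in \<open>d_mate\<close>.\<close>
    have 1: "?i (ups \<Upsilon>' ?a) \<circ>\<^bsub>catB G\<^esub> ladj G \<cdot> \<theta> ?a = \<phi> (ladj F \<bullet> ?a) \<circ>\<^bsub>catB G\<^esub> ?i (ups \<Upsilon> ?a)"
    proof -
      have "?i (ups \<Upsilon>' ?a) \<circ>\<^bsub>catB G\<^esub> ladj G \<cdot> \<theta> ?a =
          ?i (ups \<Upsilon>' ?a) \<circ>\<^bsub>catB G\<^esub> ((ladj G \<cdot> \<theta> ?a \<circ>\<^bsub>catB G\<^esub> ups \<Upsilon> ?a) \<circ>\<^bsub>catB G\<^esub> ?i (ups \<Upsilon> ?a))"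
        by simp
      also have "\<dots> = \<phi> (ladj F \<bullet> ?a) \<circ>\<^bsub>catB G\<^esub> ?i (ups \<Upsilon> ?a)"
        by (subst U[rule_format, symmetric]) auto
      finally show ?thesis .
    qed
    have "mK \<Upsilon>' \<cdot> eps F b \<circ>\<^bsub>catB G\<^esub> (?i (ups \<Upsilon>' ?a) \<circ>\<^bsub>catB G\<^esub> ladj G \<cdot> \<theta> ?a) =
        \<phi> b \<circ>\<^bsub>catB G\<^esub> (mK \<Upsilon> \<cdot> eps F b \<circ>\<^bsub>catB G\<^esub> ?i (ups \<Upsilon> ?a))"
      unfolding 1 by (simp add: precomp[OF nat_isoD(7)[OF \<phi>, of "eps F b", simplified, symmetric]])
    note 2 = arg_cong[OF this, of "FArr (radj G)"]
    \<comment> \<open>After \<open>dns\<close> is expanded as a mate, \<open>\<theta>\<close>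
      crosses \<open>eta G\<close> by naturality; equation \<open>2\<close> then turns the mate for
      \<open>\<Upsilon>'\<close> into the mate for \<open>\<Upsilon>\<close>, with
      \<open>\<phi>\<close> in front.\<close>
    have "dns \<Upsilon>' b \<circ>\<^bsub>catA G\<^esub> \<theta> ?a = radj G \<cdot> (mK \<Upsilon>' \<cdot> eps F b \<circ>\<^bsub>catB G\<^esub> ?i (ups \<Upsilon>' ?a)) \<circ>\<^bsub>catA G\<^esub>
        (eta G (mH \<Upsilon>' \<bullet> ?a) \<circ>\<^bsub>catA G\<^esub> \<theta> ?a)"
      by (subst Y'.d_mate[symmetric]) auto
    also have "\<dots> = radj G \<cdot> (mK \<Upsilon>' \<cdot> eps F b \<circ>\<^bsub>catB G\<^esub> (?i (ups \<Upsilon>' ?a) \<circ>\<^bsub>catB G\<^esub> ladj G \<cdot> \<theta> ?a)) \<circ>\<^bsub>catA G\<^esub>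
        eta G (mH \<Upsilon> \<bullet> ?a)"
      using eta_nat[of G "\<theta> ?a"] by simp
    also have "\<dots> = radj G \<cdot> \<phi> b \<circ>\<^bsub>catA G\<^esub> (radj G \<cdot> (mK \<Upsilon> \<cdot> eps F b \<circ>\<^bsub>catB G\<^esub> ?i (ups \<Upsilon> ?a)) \<circ>\<^bsub>catA G\<^esub>
        eta G (mH \<Upsilon> \<bullet> ?a))"
      unfolding 2 by simp
    finally show ?thesis
      by (simp only: Y.d_mate[OF b])
  qed
  have U: "?U a" if D: "\<forall>b \<in> Obj (catB F). ?D b" and [simp]: "a \<in> Obj (catA F)" for a
  proof -
    let ?b = "ladj F \<bullet> a"
    have nat: "mH \<Upsilon>' \<cdot> eta F a \<circ>\<^bsub>catA G\<^esub> \<theta> a = \<theta> (radj F \<bullet> ?b) \<circ>\<^bsub>catA G\<^esub> mH \<Upsilon> \<cdot> eta F a"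
      using nat_isoD(7)[OF \<theta>, of "eta F a"] by simp
    have "radj G \<cdot> \<phi> ?b \<circ>\<^bsub>catA G\<^esub> (dns \<Upsilon> ?b \<circ>\<^bsub>catA G\<^esub> mH \<Upsilon> \<cdot> eta F a) =
        (dns \<Upsilon>' ?b \<circ>\<^bsub>catA G\<^esub> mH \<Upsilon>' \<cdot> eta F a) \<circ>\<^bsub>catA G\<^esub> \<theta> a"
      by (simp add: nat precomp[OF D[rule_format, of ?b, simplified]])
    note 2 = arg_cong[OF this, of "FArr (ladj G)"]
    \<comment> \<open>Same argument through \<open>u_mate\<close>: \<open>\<phi>\<close> crosses
      \<open>eps G\<close>. The outcome concerns inverses of \<open>ups\<close> and is inverted at
      the end.\<close>
    have "\<phi> ?b \<circ>\<^bsub>catB G\<^esub> ?i (ups \<Upsilon> a) = (\<phi> ?b \<circ>\<^bsub>catB G\<^esub> eps G (mK \<Upsilon> \<bullet> ?b)) \<circ>\<^bsub>catB G\<^esub>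
        ladj G \<cdot> (dns \<Upsilon> ?b \<circ>\<^bsub>catA G\<^esub> mH \<Upsilon> \<cdot> eta F a)"
      by (simp add: Y.u_mate)
    also have "\<phi> ?b \<circ>\<^bsub>catB G\<^esub> eps G (mK \<Upsilon> \<bullet> ?b) = eps G (mK \<Upsilon>' \<bullet> ?b) \<circ>\<^bsub>catB G\<^esub> ladj G \<cdot> radj G \<cdot> \<phi> ?b"
      using eps_nat[of G "\<phi> ?b"] by simp
    also have "(eps G (mK \<Upsilon>' \<bullet> ?b) \<circ>\<^bsub>catB G\<^esub> ladj G \<cdot> radj G \<cdot> \<phi> ?b) \<circ>\<^bsub>catB G\<^esub>
        ladj G \<cdot> (dns \<Upsilon> ?b \<circ>\<^bsub>catA G\<^esub> mH \<Upsilon> \<cdot> eta F a) =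
        (eps G (mK \<Upsilon>' \<bullet> ?b) \<circ>\<^bsub>catB G\<^esub> ladj G \<cdot> (dns \<Upsilon>' ?b \<circ>\<^bsub>catA G\<^esub> mH \<Upsilon>' \<cdot> eta F a)) \<circ>\<^bsub>catB G\<^esub> ladj G \<cdot> \<theta> a"
      using 2 by simp
    also have "\<dots> = ?i (ups \<Upsilon>' a) \<circ>\<^bsub>catB G\<^esub> ladj G \<cdot> \<theta> a"
      by (simp add: Y'.u_mate)
    finally have 3: "\<phi> ?b \<circ>\<^bsub>catB G\<^esub> ?i (ups \<Upsilon> a) = ?i (ups \<Upsilon>' a) \<circ>\<^bsub>catB G\<^esub> ladj G \<cdot> \<theta> a" .
    have "ups \<Upsilon>' a \<circ>\<^bsub>catB G\<^esub> \<phi> ?b = ups \<Upsilon>' a \<circ>\<^bsub>catB G\<^esub> ((\<phi> ?b \<circ>\<^bsub>catB G\<^esub> ?i (ups \<Upsilon> a)) \<circ>\<^bsub>catB G\<^esub> ups \<Upsilon> a)"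
      by simp
    then show ?thesis
      unfolding 3 by simp
  qed
  have "(\<forall>a \<in> Obj (catA F). ?U a) \<and> (\<forall>b \<in> Obj (catB F). ?D b)"
    using assms(5) U D by blast
  then show ?thesis
    unfolding adj_iso_def Let_def using assms(1-4) adj_homD(1,2)[OF \<Upsilon>] by auto
qed

lemma adj_isoE:
  assumes "\<Upsilon> \<cong> \<Upsilon>'"
  obtains F G \<theta> \<phi> where "\<Upsilon> \<in> adj_hom F G" "\<Upsilon>' \<in> adj_hom F G"
    "nat_iso (catA F) (catA G) (mH \<Upsilon>) (mH \<Upsilon>') \<theta>" "nat_iso (catB F) (catB G) (mK \<Upsilon>) (mK \<Upsilon>') \<phi>"
    "\<And>a. a \<in> Obj (catA F) \<Longrightarrow>
      ups \<Upsilon>' a \<circ>\<^bsub>catB G\<^esub> \<phi> (ladj F \<bullet> a) = ladj G \<cdot> \<theta> a \<circ>\<^bsub>catB G\<^esub> ups \<Upsilon> a"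
    "\<And>b. b \<in> Obj (catB F) \<Longrightarrow>
      dns \<Upsilon>' b \<circ>\<^bsub>catA G\<^esub> \<theta> (radj F \<bullet> b) = radj G \<cdot> \<phi> b \<circ>\<^bsub>catA G\<^esub> dns \<Upsilon> b"
  using assms unfolding adj_iso_def Let_def by blast


text \<open>\<open>\<doteq>\<close> without its typing conditions. In this form the well-typedness
  of the second morphism can be deduced from that of the first.\<close>

definition agree :: "'u adj_mor \<Rightarrow> 'u adj_mor \<Rightarrow> bool" where
  "agree \<Upsilon> \<Upsilon>' \<longleftrightarrow> src_adj \<Upsilon>' = src_adj \<Upsilon> \<and> tgt_adj \<Upsilon>' = tgt_adj \<Upsilon> \<and>
    (\<forall>a \<in> Obj (catA (src_adj \<Upsilon>)). mH \<Upsilon> \<bullet> a = mH \<Upsilon>' \<bullet> a \<and> ups \<Upsilon> a = ups \<Upsilon>' a) \<and>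
    (\<forall>f \<in> Arr (catA (src_adj \<Upsilon>)). mH \<Upsilon> \<cdot> f = mH \<Upsilon>' \<cdot> f) \<and>
    (\<forall>b \<in> Obj (catB (src_adj \<Upsilon>)). mK \<Upsilon> \<bullet> b = mK \<Upsilon>' \<bullet> b \<and> dns \<Upsilon> b = dns \<Upsilon>' b) \<and>
    (\<forall>g \<in> Arr (catB (src_adj \<Upsilon>)). mK \<Upsilon> \<cdot> g = mK \<Upsilon>' \<cdot> g)"

lemma nat_iso_cong:
  assumes "nat_iso A B F G \<tau>" "is_functor A B F'" "is_functor A B G'"
    and "\<And>a. a \<in> Obj A \<Longrightarrow> F \<bullet> a = F' \<bullet> a \<and> G \<bullet> a = G' \<bullet> a \<and> \<tau> a = \<tau>' a"
    and "\<And>f. f \<in> Arr A \<Longrightarrow> F \<cdot> f = F' \<cdot> f \<and> G \<cdot> f = G' \<cdot> f"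
  shows "nat_iso A B F' G' \<tau>'"
proof -
  have A: "category A"
    using assms(2) by (auto simp: is_functor_iff)
  show ?thesis
  proof (rule nat_isoI[OF assms(2,3)])
    show "iso_arrow B (\<tau>' a) \<and> Dom B (\<tau>' a) = F' \<bullet> a \<and> Cod B (\<tau>' a) = G' \<bullet> a" if "a \<in> Obj A" for a
      using assms(4)[OF that] nat_isoD(4-6)[OF assms(1) that] by simp
    show "\<tau>' (Cod A f) \<circ>\<^bsub>B\<^esub> F' \<cdot> f = G' \<cdot> f \<circ>\<^bsub>B\<^esub> \<tau>' (Dom A f)" if "f \<in> Arr A" for f
      using assms(4)[of "Dom A f"] assms(4)[of "Cod A f"] assms(5)[OF that]
        nat_isoD(7)[OF assms(1) that] that A by simp
  qed
qed

text \<open>Every condition on a morphism is evaluated only on objects and arrows of the source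
  categories, so it passes from \<open>\<Upsilon>\<close> to \<open>\<Upsilon>'\<close>; identities
  then serve as the components of the isomorphism. This is the standard way below to relate
  morphisms whose data coincide but whose total functions may differ elsewhere.\<close>

lemma agree_adj_hom:
  assumes \<Upsilon>: "\<Upsilon> \<in> adj_hom F G" and ag: "agree \<Upsilon> \<Upsilon>'"
  shows "\<Upsilon>' \<in> adj_hom F G" "\<Upsilon> \<cong> \<Upsilon>'"
proof -
  interpret Y: adj_morph F G "mH \<Upsilon>" "mK \<Upsilon>" "ups \<Upsilon>" "dns \<Upsilon>"
    by (rule adj_homD(5)[OF \<Upsilon>])
  note 1 = ag[unfolded agree_def adj_homD(1,2)[OF \<Upsilon>]]
  have H: "is_functor (catA F) (catA G) (mH \<Upsilon>')" and K: "is_functor (catB F) (catB G) (mK \<Upsilon>')"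
    using 1 is_functor_cong[OF Y.H, of "mH \<Upsilon>'"] is_functor_cong[OF Y.K, of "mK \<Upsilon>'"] by auto
  have ftors: "is_functor (catA F) (catB F) (ladj F)" "is_functor (catB F) (catA F) (radj F)"
     "is_functor (catA G) (catB G) (ladj G)" "is_functor (catB G) (catA G) (radj G)"
    using adjunction_ftors[OF Y.F] adjunction_ftors[OF Y.G] by (auto simp: ftor_def)
  have "adj_morph F G (mH \<Upsilon>') (mK \<Upsilon>') (ups \<Upsilon>') (dns \<Upsilon>')"
  proof
    show "nat_iso (catA F) (catB G) (comp_ftor (mK \<Upsilon>') (ladj F)) (comp_ftor (ladj G) (mH \<Upsilon>')) (ups \<Upsilon>')"
      by (rule nat_iso_cong[OF Y.u]) (use 1 in \<open>auto intro!: is_functor_comp[OF _ K] is_functor_comp[OF H] ftors\<close>)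
    show "nat_iso (catB F) (catA G) (comp_ftor (mH \<Upsilon>') (radj F)) (comp_ftor (radj G) (mK \<Upsilon>')) (dns \<Upsilon>')"
      by (rule nat_iso_cong[OF Y.d]) (use 1 in \<open>auto intro!: is_functor_comp[OF _ H] is_functor_comp[OF K] ftors\<close>)
    show "radj G \<cdot> ups \<Upsilon>' a \<circ>\<^bsub>catA G\<^esub> (dns \<Upsilon>' (ladj F \<bullet> a) \<circ>\<^bsub>catA G\<^esub> mH \<Upsilon>' \<cdot> eta F a) = eta G (mH \<Upsilon>' \<bullet> a)"
      if "a \<in> Obj (catA F)" for a
      using Y.unit[OF that] 1 that by auto
  qed (use H K in auto)
  with 1 show Y': "\<Upsilon>' \<in> adj_hom F G"
    by (simp add: adj_hom_iff)
  show "\<Upsilon> \<cong> \<Upsilon>'"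
  proof (rule adj_isoI[OF \<Upsilon> Y'])
    show "nat_iso (catA F) (catA G) (mH \<Upsilon>) (mH \<Upsilon>') (\<lambda>a. One (catA G) (mH \<Upsilon> \<bullet> a))"
      by (rule nat_iso_cong[OF nat_iso_id[OF Y.H]]) (use 1 H Y.H in auto)
    show "nat_iso (catB F) (catB G) (mK \<Upsilon>) (mK \<Upsilon>') (\<lambda>b. One (catB G) (mK \<Upsilon> \<bullet> b))"
      by (rule nat_iso_cong[OF nat_iso_id[OF Y.K]]) (use 1 K Y.K in auto)
    have "ups \<Upsilon>' a \<circ>\<^bsub>catB G\<^esub> One (catB G) (mK \<Upsilon> \<bullet> ladj F \<bullet> a) =
          ladj G \<cdot> One (catA G) (mH \<Upsilon> \<bullet> a) \<circ>\<^bsub>catB G\<^esub> ups \<Upsilon> a" if "a \<in> Obj (catA F)" for a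
    proof -
      have "ups \<Upsilon>' a = ups \<Upsilon> a"
        using 1 that by auto
      then show ?thesis
        using that by simp
    qed
    then show "(\<forall>a \<in> Obj (catA F). ups \<Upsilon>' a \<circ>\<^bsub>catB G\<^esub> One (catB G) (mK \<Upsilon> \<bullet> ladj F \<bullet> a) =
          ladj G \<cdot> One (catA G) (mH \<Upsilon> \<bullet> a) \<circ>\<^bsub>catB G\<^esub> ups \<Upsilon> a) \<or>
       (\<forall>b \<in> Obj (catB F). dns \<Upsilon>' b \<circ>\<^bsub>catA G\<^esub> One (catA G) (mH \<Upsilon> \<bullet> radj F \<bullet> b) =
          radj G \<cdot> One (catB G) (mK \<Upsilon> \<bullet> b) \<circ>\<^bsub>catA G\<^esub> dns \<Upsilon> b)"
      by blast
  qed
qed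

lemma adj_eq_iff:
  "\<Upsilon> \<doteq> \<Upsilon>' \<longleftrightarrow> \<Upsilon> \<in> adj_hom (src_adj \<Upsilon>) (tgt_adj \<Upsilon>) \<and> agree \<Upsilon> \<Upsilon>'"
  using agree_adj_hom(1)[of \<Upsilon> "src_adj \<Upsilon>" "tgt_adj \<Upsilon>" \<Upsilon>'] adj_homD(1,2)[of \<Upsilon>']
  unfolding adj_eq_def agree_def Let_def by blast

lemma adj_eqI: "\<lbrakk>\<Upsilon> \<in> adj_hom F G; agree \<Upsilon> \<Upsilon>'\<rbrakk> \<Longrightarrow> \<Upsilon> \<doteq> \<Upsilon>'"
  unfolding adj_eq_iff using adj_homD(1,2)[of \<Upsilon> F G] by blast

lemma adj_eq_iso: "\<Upsilon> \<doteq> \<Upsilon>' \<Longrightarrow> \<Upsilon> \<cong> \<Upsilon>'"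
  unfolding adj_eq_iff by (blast intro: agree_adj_hom(2))

lemma adj_iso_hom: "\<Upsilon> \<cong> \<Upsilon>' \<Longrightarrow> \<Upsilon> \<in> adj_hom F G \<longleftrightarrow> \<Upsilon>' \<in> adj_hom F G"
  unfolding adj_iso_def Let_def by (metis adj_homD(1,2))

lemma adj_iso_homD: "\<Upsilon> \<cong> \<Upsilon>' \<Longrightarrow> \<exists>F G. \<Upsilon> \<in> adj_hom F G"
  unfolding adj_iso_def Let_def by blast

lemma adj_iso_refl: "\<Upsilon> \<in> adj_hom F G \<Longrightarrow> \<Upsilon> \<cong> \<Upsilon>"
  by (rule agree_adj_hom(2)) (auto simp: agree_def)

lemma adj_iso_sym:
  assumes "\<Upsilon> \<cong> \<Upsilon>'"
  shows "\<Upsilon>' \<cong> \<Upsilon>"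
  using assms
proof (rule adj_isoE)
  fix F G \<theta> \<phi>
  assume \<Upsilon>: "\<Upsilon> \<in> adj_hom F G" and \<Upsilon>': "\<Upsilon>' \<in> adj_hom F G"
    and \<theta>: "nat_iso (catA F) (catA G) (mH \<Upsilon>) (mH \<Upsilon>') \<theta>"
    and \<phi>: "nat_iso (catB F) (catB G) (mK \<Upsilon>) (mK \<Upsilon>') \<phi>"
    and u: "\<And>a. a \<in> Obj (catA F) \<Longrightarrow>
      ups \<Upsilon>' a \<circ>\<^bsub>catB G\<^esub> \<phi> (ladj F \<bullet> a) = ladj G \<cdot> \<theta> a \<circ>\<^bsub>catB G\<^esub> ups \<Upsilon> a"
  interpret Y: adj_morph F G "mH \<Upsilon>" "mK \<Upsilon>" "ups \<Upsilon>" "dns \<Upsilon>"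
    by (rule adj_homD(5)[OF \<Upsilon>])
  interpret Y': adj_morph F G "mH \<Upsilon>'" "mK \<Upsilon>'" "ups \<Upsilon>'" "dns \<Upsilon>'"
    by (rule adj_homD(5)[OF \<Upsilon>'])
  note [simp] = nat_isoD(3-6)[OF \<theta>] nat_isoD(3-6)[OF \<phi>]
  have "ups \<Upsilon> a \<circ>\<^bsub>catB G\<^esub> inverse_arrow (catB G) (\<phi> (ladj F \<bullet> a)) =
      ladj G \<cdot> inverse_arrow (catA G) (\<theta> a) \<circ>\<^bsub>catB G\<^esub> ups \<Upsilon>' a" if [simp]: "a \<in> Obj (catA F)" for a
  proof -
    have "ladj G \<cdot> inverse_arrow (catA G) (\<theta> a) \<circ>\<^bsub>catB G\<^esub> ups \<Upsilon>' a =
       ladj G \<cdot> inverse_arrow (catA G) (\<theta> a) \<circ>\<^bsub>catB G\<^esub> ((ups \<Upsilon>' a \<circ>\<^bsub>catB G\<^esub> \<phi> (ladj F \<bullet> a)) \<circ>\<^bsub>catB G\<^esub>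
         inverse_arrow (catB G) (\<phi> (ladj F \<bullet> a)))"
      by simp
    then show ?thesis
      unfolding u[OF that] by simp
  qed
  then show ?thesis
    by (intro adj_isoI[OF \<Upsilon>' \<Upsilon> nat_iso_inverse[OF \<theta>] nat_iso_inverse[OF \<phi>]]) blast
qed

lemma adj_iso_trans [trans]:
  assumes "\<Upsilon> \<cong> \<Upsilon>'" "\<Upsilon>' \<cong> \<Upsilon>''"
  shows "\<Upsilon> \<cong> \<Upsilon>''"
proof -
  obtain F G \<theta> \<phi> where \<Upsilon>: "\<Upsilon> \<in> adj_hom F G" and \<Upsilon>': "\<Upsilon>' \<in> adj_hom F G"
    and \<theta>: "nat_iso (catA F) (catA G) (mH \<Upsilon>) (mH \<Upsilon>') \<theta>"
    and \<phi>: "nat_iso (catB F) (catB G) (mK \<Upsilon>) (mK \<Upsilon>') \<phi>"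
    and u: "\<And>a. a \<in> Obj (catA F) \<Longrightarrow>
      ups \<Upsilon>' a \<circ>\<^bsub>catB G\<^esub> \<phi> (ladj F \<bullet> a) = ladj G \<cdot> \<theta> a \<circ>\<^bsub>catB G\<^esub> ups \<Upsilon> a"
    using assms(1) by (rule adj_isoE) blast
  obtain F' G' \<theta>' \<phi>' where *: "\<Upsilon>' \<in> adj_hom F' G'" and \<Upsilon>'': "\<Upsilon>'' \<in> adj_hom F' G'"
    and \<theta>': "nat_iso (catA F') (catA G') (mH \<Upsilon>') (mH \<Upsilon>'') \<theta>'"
    and \<phi>': "nat_iso (catB F') (catB G') (mK \<Upsilon>') (mK \<Upsilon>'') \<phi>'"
    and u': "\<And>a. a \<in> Obj (catA F') \<Longrightarrow>
      ups \<Upsilon>'' a \<circ>\<^bsub>catB G'\<^esub> \<phi>' (ladj F' \<bullet> a) = ladj G' \<cdot> \<theta>' a \<circ>\<^bsub>catB G'\<^esub> ups \<Upsilon>' a"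
    using assms(2) by (rule adj_isoE) blast
  have FG: "F' = F" "G' = G"
    using adj_homD(1,2)[OF *] adj_homD(1,2)[OF \<Upsilon>'] by auto
  note \<Upsilon>'' = \<Upsilon>''[unfolded FG] and \<theta>' = \<theta>'[unfolded FG] and \<phi>' = \<phi>'[unfolded FG] and u' = u'[unfolded FG]
  interpret Y: adj_morph F G "mH \<Upsilon>" "mK \<Upsilon>" "ups \<Upsilon>" "dns \<Upsilon>"
    by (rule adj_homD(5)[OF \<Upsilon>])
  interpret Y'': adj_morph F G "mH \<Upsilon>''" "mK \<Upsilon>''" "ups \<Upsilon>''" "dns \<Upsilon>''"
    by (rule adj_homD(5)[OF \<Upsilon>''])
  interpret Y': adj_morph F G "mH \<Upsilon>'" "mK \<Upsilon>'" "ups \<Upsilon>'" "dns \<Upsilon>'"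
    by (rule adj_homD(5)[OF \<Upsilon>'])
  note [simp] = nat_isoD(3-6)[OF \<theta>] nat_isoD(3-6)[OF \<phi>] nat_isoD(3-6)[OF \<theta>'] nat_isoD(3-6)[OF \<phi>']
  have "ups \<Upsilon>'' a \<circ>\<^bsub>catB G\<^esub> (\<phi>' (ladj F \<bullet> a) \<circ>\<^bsub>catB G\<^esub> \<phi> (ladj F \<bullet> a)) =
      ladj G \<cdot> (\<theta>' a \<circ>\<^bsub>catA G\<^esub> \<theta> a) \<circ>\<^bsub>catB G\<^esub> ups \<Upsilon> a" if a: "a \<in> Obj (catA F)" for a
    using a by (simp add: u[OF a] precomp[OF u'[OF a]])
  then show ?thesis
    by (intro adj_isoI[OF \<Upsilon> \<Upsilon>'' nat_iso_comp[OF \<theta> \<theta>'] nat_iso_comp[OF \<phi> \<phi>']]) blast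
qed

section \<open>Pasting, strict morphisms and identities\<close>

lemma comp_adj_simps [simp]:
  "src_adj (\<Psi> \<odot> \<Upsilon>) = src_adj \<Upsilon>" "tgt_adj (\<Psi> \<odot> \<Upsilon>) = tgt_adj \<Psi>"
  "mH (\<Psi> \<odot> \<Upsilon>) = comp_ftor (mH \<Psi>) (mH \<Upsilon>)" "mK (\<Psi> \<odot> \<Upsilon>) = comp_ftor (mK \<Psi>) (mK \<Upsilon>)"
  "ups (\<Psi> \<odot> \<Upsilon>) = (\<lambda>a. ups \<Psi> (mH \<Upsilon> \<bullet> a) \<circ>\<^bsub>catB (tgt_adj \<Psi>)\<^esub> mK \<Psi> \<cdot> ups \<Upsilon> a)"
  "dns (\<Psi> \<odot> \<Upsilon>) = (\<lambda>b. dns \<Psi> (mK \<Upsilon> \<bullet> b) \<circ>\<^bsub>catA (tgt_adj \<Psi>)\<^esub> mH \<Psi> \<cdot> dns \<Upsilon> b)"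
  by (simp_all add: comp_adj_def Let_def)

lemma comp_adj_hom:
  assumes \<Upsilon>: "\<Upsilon> \<in> adj_hom F G" and \<Psi>: "\<Psi> \<in> adj_hom G L"
  shows "\<Psi> \<odot> \<Upsilon> \<in> adj_hom F L"
proof -
  interpret Y: adj_morph F G "mH \<Upsilon>" "mK \<Upsilon>" "ups \<Upsilon>" "dns \<Upsilon>"
    by (rule adj_homD(5)[OF \<Upsilon>])
  interpret P: adj_morph G L "mH \<Psi>" "mK \<Psi>" "ups \<Psi>" "dns \<Psi>"
    by (rule adj_homD(5)[OF \<Psi>])
  note [simp] = adj_homD(1,2)[OF \<Upsilon>] adj_homD(1,2)[OF \<Psi>]
  have "adj_morph F L (mH (\<Psi> \<odot> \<Upsilon>)) (mK (\<Psi> \<odot> \<Upsilon>)) (ups (\<Psi> \<odot> \<Upsilon>)) (dns (\<Psi> \<odot> \<Upsilon>))"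
  proof
    show "is_functor (catA F) (catA L) (mH (\<Psi> \<odot> \<Upsilon>))" "is_functor (catB F) (catB L) (mK (\<Psi> \<odot> \<Upsilon>))"
      by (auto intro: is_functor_comp[OF Y.H P.H] is_functor_comp[OF Y.K P.K])
    show "nat_iso (catA F) (catB L) (comp_ftor (mK (\<Psi> \<odot> \<Upsilon>)) (ladj F))
        (comp_ftor (ladj L) (mH (\<Psi> \<odot> \<Upsilon>))) (ups (\<Psi> \<odot> \<Upsilon>))"
      using nat_iso_comp[OF nat_iso_whisker_left[OF Y.u P.K, simplified] nat_iso_whisker_right[OF P.u Y.H, simplified]]
      by simp
    show "nat_iso (catB F) (catA L) (comp_ftor (mH (\<Psi> \<odot> \<Upsilon>)) (radj F))
        (comp_ftor (radj L) (mK (\<Psi> \<odot> \<Upsilon>))) (dns (\<Psi> \<odot> \<Upsilon>))"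
      using nat_iso_comp[OF nat_iso_whisker_left[OF Y.d P.H, simplified] nat_iso_whisker_right[OF P.d Y.K, simplified]]
      by simp
    fix a assume a [simp]: "a \<in> Obj (catA F)"
    let ?b = "ladj F \<bullet> a"
    have "radj L \<cdot> ups (\<Psi> \<odot> \<Upsilon>) a \<circ>\<^bsub>catA L\<^esub> (dns (\<Psi> \<odot> \<Upsilon>) ?b \<circ>\<^bsub>catA L\<^esub> mH (\<Psi> \<odot> \<Upsilon>) \<cdot> eta F a) =
      radj L \<cdot> ups \<Psi> (mH \<Upsilon> \<bullet> a) \<circ>\<^bsub>catA L\<^esub> ((radj L \<cdot> mK \<Psi> \<cdot> ups \<Upsilon> a \<circ>\<^bsub>catA L\<^esub> dns \<Psi> (mK \<Upsilon> \<bullet> ?b)) \<circ>\<^bsub>catA L\<^esub>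
        mH \<Psi> \<cdot> (dns \<Upsilon> ?b \<circ>\<^bsub>catA G\<^esub> mH \<Upsilon> \<cdot> eta F a))"
      by simp
    \<comment> \<open>The interchange at the heart of pasting: naturality of
      \<open>dns \<Psi>\<close> at the arrow \<open>ups \<Upsilon> a\<close> separates the two
      morphisms, after which the unit laws of \<open>\<Upsilon>\<close> and of \<open>\<Psi>\<close>
      apply one after the other.\<close>
    also have "radj L \<cdot> mK \<Psi> \<cdot> ups \<Upsilon> a \<circ>\<^bsub>catA L\<^esub> dns \<Psi> (mK \<Upsilon> \<bullet> ?b) =
        dns \<Psi> (ladj G \<bullet> mH \<Upsilon> \<bullet> a) \<circ>\<^bsub>catA L\<^esub> mH \<Psi> \<cdot> radj G \<cdot> ups \<Upsilon> a"
      using P.d_nat[of "ups \<Upsilon> a"] by simp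
    also have "(dns \<Psi> (ladj G \<bullet> mH \<Upsilon> \<bullet> a) \<circ>\<^bsub>catA L\<^esub> mH \<Psi> \<cdot> radj G \<cdot> ups \<Upsilon> a) \<circ>\<^bsub>catA L\<^esub>
        mH \<Psi> \<cdot> (dns \<Upsilon> ?b \<circ>\<^bsub>catA G\<^esub> mH \<Upsilon> \<cdot> eta F a) =
        dns \<Psi> (ladj G \<bullet> mH \<Upsilon> \<bullet> a) \<circ>\<^bsub>catA L\<^esub> mH \<Psi> \<cdot> eta G (mH \<Upsilon> \<bullet> a)"
      by (simp flip: Y.unit)
    finally show "radj L \<cdot> ups (\<Psi> \<odot> \<Upsilon>) a \<circ>\<^bsub>catA L\<^esub>
       (dns (\<Psi> \<odot> \<Upsilon>) (ladj F \<bullet> a) \<circ>\<^bsub>catA L\<^esub> mH (\<Psi> \<odot> \<Upsilon>) \<cdot> eta F a) = eta L (mH (\<Psi> \<odot> \<Upsilon>) \<bullet> a)"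
      by (simp add: P.unit)
  qed auto
  then show ?thesis
    by (simp add: adj_hom_iff)
qed

text \<open>Whiskering: the isomorphism is the image of \<open>\<theta>\<close> and
  \<open>\<phi>\<close> under \<open>\<Psi>\<close>, and the compatibility is naturality of
  \<open>ups \<Psi>\<close> at \<open>\<theta> a\<close>.\<close>

lemma comp_adj_cong_right:
  assumes \<Psi>: "\<Psi> \<in> adj_hom G L" and iso: "\<Upsilon> \<cong> \<Upsilon>'" and \<Upsilon>1: "\<Upsilon> \<in> adj_hom F G"
  shows "\<Psi> \<odot> \<Upsilon> \<cong> \<Psi> \<odot> \<Upsilon>'"
  using iso
proof (rule adj_isoE)
  fix F' G' \<theta> \<phi>
  assume \<Upsilon>: "\<Upsilon> \<in> adj_hom F' G'" and \<Upsilon>': "\<Upsilon>' \<in> adj_hom F' G'"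
    and \<theta>: "nat_iso (catA F') (catA G') (mH \<Upsilon>) (mH \<Upsilon>') \<theta>"
    and \<phi>: "nat_iso (catB F') (catB G') (mK \<Upsilon>) (mK \<Upsilon>') \<phi>"
    and u: "\<And>a. a \<in> Obj (catA F') \<Longrightarrow>
      ups \<Upsilon>' a \<circ>\<^bsub>catB G'\<^esub> \<phi> (ladj F' \<bullet> a) = ladj G' \<cdot> \<theta> a \<circ>\<^bsub>catB G'\<^esub> ups \<Upsilon> a"
  have [simp]: "F' = F" "G' = G"
    using adj_homD(1,2)[OF \<Upsilon>] adj_homD(1,2)[OF \<Upsilon>1] by auto
  note \<theta> = \<theta>[simplified] and \<phi> = \<phi>[simplified] and u = u[simplified]
  interpret Y: adj_morph F G "mH \<Upsilon>" "mK \<Upsilon>" "ups \<Upsilon>" "dns \<Upsilon>"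
    using adj_homD(5)[OF \<Upsilon>] by simp
  interpret Y': adj_morph F G "mH \<Upsilon>'" "mK \<Upsilon>'" "ups \<Upsilon>'" "dns \<Upsilon>'"
    using adj_homD(5)[OF \<Upsilon>'] by simp
  interpret P: adj_morph G L "mH \<Psi>" "mK \<Psi>" "ups \<Psi>" "dns \<Psi>"
    by (rule adj_homD(5)[OF \<Psi>])
  note [simp] = adj_homD(1,2)[OF \<Upsilon>] adj_homD(1,2)[OF \<Upsilon>'] adj_homD(1,2)[OF \<Psi>]
  note [simp] = nat_isoD(3-6)[OF \<theta>] nat_isoD(3-6)[OF \<phi>]
  have "ups (\<Psi> \<odot> \<Upsilon>') a \<circ>\<^bsub>catB L\<^esub> mK \<Psi> \<cdot> \<phi> (ladj F \<bullet> a) =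
      ladj L \<cdot> mH \<Psi> \<cdot> \<theta> a \<circ>\<^bsub>catB L\<^esub> ups (\<Psi> \<odot> \<Upsilon>) a" if a [simp]: "a \<in> Obj (catA F)" for a
  proof -
    have "ups (\<Psi> \<odot> \<Upsilon>') a \<circ>\<^bsub>catB L\<^esub> mK \<Psi> \<cdot> \<phi> (ladj F \<bullet> a) =
        ups \<Psi> (mH \<Upsilon>' \<bullet> a) \<circ>\<^bsub>catB L\<^esub> mK \<Psi> \<cdot> (ups \<Upsilon>' a \<circ>\<^bsub>catB G\<^esub> \<phi> (ladj F \<bullet> a))"
      by simp
    also have "\<dots> = (ups \<Psi> (mH \<Upsilon>' \<bullet> a) \<circ>\<^bsub>catB L\<^esub> mK \<Psi> \<cdot> ladj G \<cdot> \<theta> a) \<circ>\<^bsub>catB L\<^esub> mK \<Psi> \<cdot> ups \<Upsilon> a"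
      unfolding u[OF a] by simp
    also have "ups \<Psi> (mH \<Upsilon>' \<bullet> a) \<circ>\<^bsub>catB L\<^esub> mK \<Psi> \<cdot> ladj G \<cdot> \<theta> a =
        ladj L \<cdot> mH \<Psi> \<cdot> \<theta> a \<circ>\<^bsub>catB L\<^esub> ups \<Psi> (mH \<Upsilon> \<bullet> a)"
      using P.u_nat[of "\<theta> a"] by simp
    finally show ?thesis
      by simp
  qed
  then show ?thesis
    using comp_adj_hom[OF _ \<Psi>, of \<Upsilon> F] comp_adj_hom[OF _ \<Psi>, of \<Upsilon>' F] \<Upsilon> \<Upsilon>'
      nat_iso_whisker_left[OF \<theta> P.H] nat_iso_whisker_left[OF \<phi> P.K]
    by (intro adj_isoI[of _ F L _ "\<lambda>a. mH \<Psi> \<cdot> \<theta> a" "\<lambda>b. mK \<Psi> \<cdot> \<phi> b"]) auto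
qed

text \<open>Here \<open>\<theta>\<close> and \<open>\<phi>\<close> are restricted along
  \<open>\<Upsilon>\<close>, and the compatibility is naturality of \<open>\<phi>\<close> at
  \<open>ups \<Upsilon> a\<close>.\<close>

lemma comp_adj_cong_left:
  assumes \<Upsilon>: "\<Upsilon> \<in> adj_hom F G" and iso: "\<Psi> \<cong> \<Psi>'" and \<Psi>1: "\<Psi> \<in> adj_hom G L"
  shows "\<Psi> \<odot> \<Upsilon> \<cong> \<Psi>' \<odot> \<Upsilon>"
  using iso
proof (rule adj_isoE)
  fix G' L' \<theta> \<phi>
  assume \<Psi>: "\<Psi> \<in> adj_hom G' L'" and \<Psi>': "\<Psi>' \<in> adj_hom G' L'"
    and \<theta>: "nat_iso (catA G') (catA L') (mH \<Psi>) (mH \<Psi>') \<theta>"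
    and \<phi>: "nat_iso (catB G') (catB L') (mK \<Psi>) (mK \<Psi>') \<phi>"
    and u: "\<And>a. a \<in> Obj (catA G') \<Longrightarrow>
      ups \<Psi>' a \<circ>\<^bsub>catB L'\<^esub> \<phi> (ladj G' \<bullet> a) = ladj L' \<cdot> \<theta> a \<circ>\<^bsub>catB L'\<^esub> ups \<Psi> a"
  have [simp]: "G' = G" "L' = L"
    using adj_homD(1,2)[OF \<Psi>] adj_homD(1,2)[OF \<Psi>1] by auto
  note \<theta> = \<theta>[simplified] and \<phi> = \<phi>[simplified] and u = u[simplified]
  interpret Y: adj_morph F G "mH \<Upsilon>" "mK \<Upsilon>" "ups \<Upsilon>" "dns \<Upsilon>"
    by (rule adj_homD(5)[OF \<Upsilon>])
  interpret P: adj_morph G L "mH \<Psi>" "mK \<Psi>" "ups \<Psi>" "dns \<Psi>"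
    using adj_homD(5)[OF \<Psi>] by simp
  interpret P': adj_morph G L "mH \<Psi>'" "mK \<Psi>'" "ups \<Psi>'" "dns \<Psi>'"
    using adj_homD(5)[OF \<Psi>'] by simp
  note [simp] = adj_homD(1,2)[OF \<Upsilon>] adj_homD(1,2)[OF \<Psi>'] adj_homD(1,2)[OF \<Psi>]
  note [simp] = nat_isoD(3-6)[OF \<theta>] nat_isoD(3-6)[OF \<phi>]
  have "ups (\<Psi>' \<odot> \<Upsilon>) a \<circ>\<^bsub>catB L\<^esub> \<phi> (mK \<Upsilon> \<bullet> ladj F \<bullet> a) =
      ladj L \<cdot> \<theta> (mH \<Upsilon> \<bullet> a) \<circ>\<^bsub>catB L\<^esub> ups (\<Psi> \<odot> \<Upsilon>) a" if a [simp]: "a \<in> Obj (catA F)" for a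
  proof -
    have "mK \<Psi>' \<cdot> ups \<Upsilon> a \<circ>\<^bsub>catB L\<^esub> \<phi> (mK \<Upsilon> \<bullet> ladj F \<bullet> a) =
        \<phi> (ladj G \<bullet> mH \<Upsilon> \<bullet> a) \<circ>\<^bsub>catB L\<^esub> mK \<Psi> \<cdot> ups \<Upsilon> a"
      using nat_isoD(7)[OF \<phi>, of "ups \<Upsilon> a"] by simp
    then show ?thesis
      by (simp add: precomp[OF u])
  qed
  then show ?thesis
    using comp_adj_hom[OF \<Upsilon>, of \<Psi> L] comp_adj_hom[OF \<Upsilon>, of \<Psi>' L] \<Psi> \<Psi>'
      nat_iso_whisker_right[OF \<theta> Y.H] nat_iso_whisker_right[OF \<phi> Y.K]
    by (intro adj_isoI[of _ F L _ "\<lambda>a. \<theta> (mH \<Upsilon> \<bullet> a)" "\<lambda>b. \<phi> (mK \<Upsilon> \<bullet> b)"]) auto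
qed

lemma strict_mor_simps [simp]:
  "src_adj (strict_mor F G H K) = F" "tgt_adj (strict_mor F G H K) = G"
  "mH (strict_mor F G H K) = H" "mK (strict_mor F G H K) = K"
  "ups (strict_mor F G H K) = (\<lambda>a. One (catB G) (K \<bullet> ladj F \<bullet> a))"
  "dns (strict_mor F G H K) = (\<lambda>b. One (catA G) (H \<bullet> radj F \<bullet> b))"
  by (simp_all add: strict_mor_def)

lemma strict_mor_hom:
  assumes F: "adjunction F" and G: "adjunction G"
    and H: "is_functor (catA F) (catA G) H" and K: "is_functor (catB F) (catB G) K"
    and "\<And>a. a \<in> Obj (catA F) \<Longrightarrow> K \<bullet> ladj F \<bullet> a = ladj G \<bullet> H \<bullet> a"
    and "\<And>f. f \<in> Arr (catA F) \<Longrightarrow> K \<cdot> ladj F \<cdot> f = ladj G \<cdot> H \<cdot> f"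
    and "\<And>b. b \<in> Obj (catB F) \<Longrightarrow> H \<bullet> radj F \<bullet> b = radj G \<bullet> K \<bullet> b"
    and "\<And>g. g \<in> Arr (catB F) \<Longrightarrow> H \<cdot> radj F \<cdot> g = radj G \<cdot> K \<cdot> g"
    and "\<And>a. a \<in> Obj (catA F) \<Longrightarrow> H \<cdot> eta F a = eta G (H \<bullet> a)"
  shows "strict_mor F G H K \<in> adj_hom F G"
proof -
  interpret H: ftor "catA F" "catA G" H by unfold_locales (rule H)
  interpret K: ftor "catB F" "catB G" K by unfold_locales (rule K)
  note [simp] = F G assms(5-8)
  have ftors: "is_functor (catA F) (catB F) (ladj F)" "is_functor (catB F) (catA F) (radj F)"
     "is_functor (catA G) (catB G) (ladj G)" "is_functor (catB G) (catA G) (radj G)"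
    using adjunction_ftors[OF F] adjunction_ftors[OF G] by (auto simp: ftor_def)
  have "nat_iso (catA F) (catB G) (comp_ftor K (ladj F)) (comp_ftor (ladj G) H) (ups (strict_mor F G H K))"
    by (rule nat_isoI[OF is_functor_comp[OF ftors(1) K] is_functor_comp[OF H ftors(3)]]) auto
  moreover have "nat_iso (catB F) (catA G) (comp_ftor H (radj F)) (comp_ftor (radj G) K) (dns (strict_mor F G H K))"
    by (rule nat_isoI[OF is_functor_comp[OF ftors(2) H] is_functor_comp[OF K ftors(4)]]) auto
  ultimately have "adj_morph F G H K (ups (strict_mor F G H K)) (dns (strict_mor F G H K))"
    using H K assms(9) by unfold_locales auto
  then show ?thesis
    by (simp add: adj_hom_iff)
qed

lemma id_adj_hom: "adjunction F \<Longrightarrow> id_adj F \<in> adj_hom F F"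
  unfolding id_adj_def by (rule strict_mor_hom) (auto intro: is_functor_id)

lemma id_adj_simps [simp]:
  "src_adj (id_adj F) = F" "tgt_adj (id_adj F) = F" "mH (id_adj F) = id_ftor" "mK (id_adj F) = id_ftor"
  "ups (id_adj F) = (\<lambda>a. One (catB F) (ladj F \<bullet> a))" "dns (id_adj F) = (\<lambda>b. One (catA F) (radj F \<bullet> b))"
  by (simp_all add: id_adj_def)

lemma comp_adj_id:
  assumes \<Upsilon>: "\<Upsilon> \<in> adj_hom F G"
  shows "\<Upsilon> \<odot> id_adj F \<cong> \<Upsilon>" "id_adj G \<odot> \<Upsilon> \<cong> \<Upsilon>"
proof -
  interpret Y: adj_morph F G "mH \<Upsilon>" "mK \<Upsilon>" "ups \<Upsilon>" "dns \<Upsilon>"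
    by (rule adj_homD(5)[OF \<Upsilon>])
  note [simp] = adj_homD(1,2)[OF \<Upsilon>]
  show "\<Upsilon> \<odot> id_adj F \<cong> \<Upsilon>"
    by (rule agree_adj_hom(2)[OF comp_adj_hom[OF id_adj_hom \<Upsilon>]]) (auto simp: agree_def)
  show "id_adj G \<odot> \<Upsilon> \<cong> \<Upsilon>"
    by (rule agree_adj_hom(2)[OF comp_adj_hom[OF \<Upsilon> id_adj_hom]]) (auto simp: agree_def)
qed

lemma comp_adj_assoc:
  assumes \<Upsilon>: "\<Upsilon> \<in> adj_hom F G" and \<Psi>: "\<Psi> \<in> adj_hom G L" and \<Xi>: "\<Xi> \<in> adj_hom L M"
  shows "(\<Xi> \<odot> \<Psi>) \<odot> \<Upsilon> \<cong> \<Xi> \<odot> \<Psi> \<odot> \<Upsilon>"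
proof -
  interpret Y: adj_morph F G "mH \<Upsilon>" "mK \<Upsilon>" "ups \<Upsilon>" "dns \<Upsilon>"
    by (rule adj_homD(5)[OF \<Upsilon>])
  interpret P: adj_morph G L "mH \<Psi>" "mK \<Psi>" "ups \<Psi>" "dns \<Psi>"
    by (rule adj_homD(5)[OF \<Psi>])
  interpret X: adj_morph L M "mH \<Xi>" "mK \<Xi>" "ups \<Xi>" "dns \<Xi>"
    by (rule adj_homD(5)[OF \<Xi>])
  note [simp] = adj_homD(1,2)[OF \<Upsilon>] adj_homD(1,2)[OF \<Psi>] adj_homD(1,2)[OF \<Xi>]
  show ?thesis
    by (rule agree_adj_hom(2)[OF comp_adj_hom[OF \<Upsilon> comp_adj_hom[OF \<Psi> \<Xi>]]]) (auto simp: agree_def)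
qed

subsection \<open>Equivalences of adjunctions are invertible up to isomorphism\<close>

context adj_morph
begin

lemma u_inv_nat:
  "f \<in> Arr (catA F) \<Longrightarrow> K \<cdot> ladj F \<cdot> f \<circ>\<^bsub>catB G\<^esub> inverse_arrow (catB G) (u (Dom (catA F) f)) =
    inverse_arrow (catB G) (u (Cod (catA F) f)) \<circ>\<^bsub>catB G\<^esub> ladj G \<cdot> H \<cdot> f"
  using nat_isoD(7)[OF nat_iso_inverse[OF u]] by simp

lemma d_inv_nat:
  "g \<in> Arr (catB F) \<Longrightarrow> H \<cdot> radj F \<cdot> g \<circ>\<^bsub>catA G\<^esub> inverse_arrow (catA G) (d (Dom (catB F) g)) =
    inverse_arrow (catA G) (d (Cod (catB F) g)) \<circ>\<^bsub>catA G\<^esub> radj G \<cdot> K \<cdot> g"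
  using nat_isoD(7)[OF nat_iso_inverse[OF d]] by simp

end

locale adj_equiv = adj_morph F G H K u d + eH: ff_eso "catA F" "catA G" H + eK: ff_eso "catB F" "catB G" K
  for F G :: "'u adj" and H K u d
begin

text \<open>Prescribed by its image under the fully faithful \<open>K\<close>, namely the only
  evident route from \<open>K \<bullet> eK.iobj (ladj G \<bullet> c)\<close> to
  \<open>K \<bullet> ladj F \<bullet> eH.iobj c\<close>: through \<open>ladj G \<bullet> c\<close>
  and \<open>ladj G \<bullet> H \<bullet> eH.iobj c\<close>. \<open>inv_d\<close> follows the same
  pattern for \<open>H\<close>.\<close>

definition inv_u :: "'u \<Rightarrow> 'u" where
  "inv_u c = eK.lift_arr (eK.iobj (ladj G \<bullet> c)) (ladj F \<bullet> eH.iobj c)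
     (inverse_arrow (catB G) (u (eH.iobj c)) \<circ>\<^bsub>catB G\<^esub>
       (inverse_arrow (catB G) (ladj G \<cdot> eH.cnt c) \<circ>\<^bsub>catB G\<^esub> eK.cnt (ladj G \<bullet> c)))"

definition inv_d :: "'u \<Rightarrow> 'u" where
  "inv_d b = eH.lift_arr (eH.iobj (radj G \<bullet> b)) (radj F \<bullet> eK.iobj b)
     (inverse_arrow (catA G) (d (eK.iobj b)) \<circ>\<^bsub>catA G\<^esub>
       (inverse_arrow (catA G) (radj G \<cdot> eK.cnt b) \<circ>\<^bsub>catA G\<^esub> eH.cnt (radj G \<bullet> b)))"

lemma inv_u_simps [simp]:
  assumes "c \<in> Obj (catA G)"
  shows "inv_u c \<in> Arr (catB F)" "Dom (catB F) (inv_u c) = eK.iobj (ladj G \<bullet> c)"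
    "Cod (catB F) (inv_u c) = ladj F \<bullet> eH.iobj c" "iso_arrow (catB F) (inv_u c)"
    "K \<cdot> inv_u c = inverse_arrow (catB G) (u (eH.iobj c)) \<circ>\<^bsub>catB G\<^esub>
       (inverse_arrow (catB G) (ladj G \<cdot> eH.cnt c) \<circ>\<^bsub>catB G\<^esub> eK.cnt (ladj G \<bullet> c))"
  using assms unfolding inv_u_def by (auto intro!: eK.lift_arr_iso iso_Comp(1))

lemma inv_d_simps [simp]:
  assumes "b \<in> Obj (catB G)"
  shows "inv_d b \<in> Arr (catA F)" "Dom (catA F) (inv_d b) = eH.iobj (radj G \<bullet> b)"
    "Cod (catA F) (inv_d b) = radj F \<bullet> eK.iobj b" "iso_arrow (catA F) (inv_d b)"
    "H \<cdot> inv_d b = inverse_arrow (catA G) (d (eK.iobj b)) \<circ>\<^bsub>catA G\<^esub>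
       (inverse_arrow (catA G) (radj G \<cdot> eK.cnt b) \<circ>\<^bsub>catA G\<^esub> eH.cnt (radj G \<bullet> b))"
  using assms unfolding inv_d_def by (auto intro!: eH.lift_arr_iso iso_Comp(1))

lemma inv_morph: "adj_morph G F eH.inv_ftor eK.inv_ftor inv_u inv_d"
proof
  have ftors: "is_functor (catA F) (catB F) (ladj F)" "is_functor (catB F) (catA F) (radj F)"
     "is_functor (catA G) (catB G) (ladj G)" "is_functor (catB G) (catA G) (radj G)"
    using adjunction_ftors[OF F] adjunction_ftors[OF G] by (auto simp: ftor_def)
  show "nat_iso (catA G) (catB F) (comp_ftor eK.inv_ftor (ladj G)) (comp_ftor (ladj F) eH.inv_ftor) inv_u"
  proof (rule nat_isoI[OF is_functor_comp[OF ftors(3) eK.inv_ftor] is_functor_comp[OF eH.inv_ftor ftors(1)]])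
    fix f assume [simp]: "f \<in> Arr (catA G)"
    have "K \<cdot> (inv_u (Cod (catA G) f) \<circ>\<^bsub>catB F\<^esub> eK.inv_ftor \<cdot> ladj G \<cdot> f) =
        K \<cdot> (ladj F \<cdot> eH.inv_ftor \<cdot> f \<circ>\<^bsub>catB F\<^esub> inv_u (Dom (catA G) f))"
      by (simp add: precomp[OF u_inv_nat[of "eH.inv_ftor \<cdot> f", simplified]])
    then show "inv_u (Cod (catA G) f) \<circ>\<^bsub>catB F\<^esub> comp_ftor eK.inv_ftor (ladj G) \<cdot> f =
        comp_ftor (ladj F) eH.inv_ftor \<cdot> f \<circ>\<^bsub>catB F\<^esub> inv_u (Dom (catA G) f)"
      using eK.faithful[of "inv_u (Cod (catA G) f) \<circ>\<^bsub>catB F\<^esub> eK.inv_ftor \<cdot> ladj G \<cdot> f"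
        "ladj F \<cdot> eH.inv_ftor \<cdot> f \<circ>\<^bsub>catB F\<^esub> inv_u (Dom (catA G) f)"] by simp
  qed auto
  show "nat_iso (catB G) (catA F) (comp_ftor eH.inv_ftor (radj G)) (comp_ftor (radj F) eK.inv_ftor) inv_d"
  proof (rule nat_isoI[OF is_functor_comp[OF ftors(4) eH.inv_ftor] is_functor_comp[OF eK.inv_ftor ftors(2)]])
    fix g assume [simp]: "g \<in> Arr (catB G)"
    have "H \<cdot> (inv_d (Cod (catB G) g) \<circ>\<^bsub>catA F\<^esub> eH.inv_ftor \<cdot> radj G \<cdot> g) =
        H \<cdot> (radj F \<cdot> eK.inv_ftor \<cdot> g \<circ>\<^bsub>catA F\<^esub> inv_d (Dom (catB G) g))"
      by (simp add: precomp[OF d_inv_nat[of "eK.inv_ftor \<cdot> g", simplified]])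
    then show "inv_d (Cod (catB G) g) \<circ>\<^bsub>catA F\<^esub> comp_ftor eH.inv_ftor (radj G) \<cdot> g =
        comp_ftor (radj F) eK.inv_ftor \<cdot> g \<circ>\<^bsub>catA F\<^esub> inv_d (Dom (catB G) g)"
      using eH.faithful[of "inv_d (Cod (catB G) g) \<circ>\<^bsub>catA F\<^esub> eH.inv_ftor \<cdot> radj G \<cdot> g"
        "radj F \<cdot> eK.inv_ftor \<cdot> g \<circ>\<^bsub>catA F\<^esub> inv_d (Dom (catB G) g)"] by simp
  qed auto
  fix c assume c [simp]: "c \<in> Obj (catA G)"
  let ?a = "eH.iobj c"
  let ?l = "radj F \<cdot> inv_u c \<circ>\<^bsub>catA F\<^esub> (inv_d (ladj G \<bullet> c) \<circ>\<^bsub>catA F\<^esub> eH.inv_ftor \<cdot> eta G c)"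
  \<comment> \<open>The unit law of the inverse is checked after applying the faithful
    \<open>H\<close> and composing with the invertible \<open>d\<close>; in that form it reduces to
    the unit law of the given morphism and naturality of \<open>eta G\<close> at
    \<open>eH.cnt c\<close>.\<close>
  have "d (ladj F \<bullet> ?a) \<circ>\<^bsub>catA G\<^esub> H \<cdot> ?l = (d (ladj F \<bullet> ?a) \<circ>\<^bsub>catA G\<^esub> H \<cdot> radj F \<cdot> inv_u c) \<circ>\<^bsub>catA G\<^esub>
      (H \<cdot> inv_d (ladj G \<bullet> c) \<circ>\<^bsub>catA G\<^esub> H \<cdot> eH.inv_ftor \<cdot> eta G c)"
    by simp
  also have "d (ladj F \<bullet> ?a) \<circ>\<^bsub>catA G\<^esub> H \<cdot> radj F \<cdot> inv_u c =
      radj G \<cdot> K \<cdot> inv_u c \<circ>\<^bsub>catA G\<^esub> d (eK.iobj (ladj G \<bullet> c))"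
    using d_nat[of "inv_u c"] by simp
  also have "(radj G \<cdot> K \<cdot> inv_u c \<circ>\<^bsub>catA G\<^esub> d (eK.iobj (ladj G \<bullet> c))) \<circ>\<^bsub>catA G\<^esub>
      (H \<cdot> inv_d (ladj G \<bullet> c) \<circ>\<^bsub>catA G\<^esub> H \<cdot> eH.inv_ftor \<cdot> eta G c) =
      inverse_arrow (catA G) (radj G \<cdot> u ?a) \<circ>\<^bsub>catA G\<^esub> (inverse_arrow (catA G) (radj G \<cdot> ladj G \<cdot> eH.cnt c) \<circ>\<^bsub>catA G\<^esub>
       (eta G c \<circ>\<^bsub>catA G\<^esub> eH.cnt c))"
    by simp
  also have "eta G c \<circ>\<^bsub>catA G\<^esub> eH.cnt c = radj G \<cdot> ladj G \<cdot> eH.cnt c \<circ>\<^bsub>catA G\<^esub> eta G (H \<bullet> ?a)"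
    using eta_nat[of G "eH.cnt c"] by simp
  also have "inverse_arrow (catA G) (radj G \<cdot> u ?a) \<circ>\<^bsub>catA G\<^esub> (inverse_arrow (catA G) (radj G \<cdot> ladj G \<cdot> eH.cnt c) \<circ>\<^bsub>catA G\<^esub>
       (radj G \<cdot> ladj G \<cdot> eH.cnt c \<circ>\<^bsub>catA G\<^esub> eta G (H \<bullet> ?a))) = d (ladj F \<bullet> ?a) \<circ>\<^bsub>catA G\<^esub> H \<cdot> eta F ?a"
    by (simp flip: unit)
  finally have eq: "d (ladj F \<bullet> ?a) \<circ>\<^bsub>catA G\<^esub> H \<cdot> ?l = d (ladj F \<bullet> ?a) \<circ>\<^bsub>catA G\<^esub> H \<cdot> eta F ?a" .
  have "H \<cdot> ?l = H \<cdot> eta F ?a"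
    by (rule iso_cancel(1)[OF _ _ _ _ eq]) auto
  then show "?l = eta F (eH.inv_ftor \<bullet> c)"
    using eH.faithful[of ?l "eta F ?a"] by simp
qed (use eH.inv_ftor eK.inv_ftor in auto)

end

text \<open>Equivalences, defined by the two functors alone, turn out to be invertible up to
  \<open>\<cong>\<close> including their 2-cells; so they become isomorphisms once isomorphic
  morphisms are identified.\<close>

lemma adj_equivalence_iff:
  assumes \<Upsilon>: "\<Upsilon> \<in> adj_hom F G"
  shows "adj_equivalence \<Upsilon> \<longleftrightarrow> (\<exists>\<Psi> \<in> adj_hom G F. \<Psi> \<odot> \<Upsilon> \<cong> id_adj F \<and> \<Upsilon> \<odot> \<Psi> \<cong> id_adj G)"
proof
  note [simp] = adj_homD(1,2)[OF \<Upsilon>]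
  assume "adj_equivalence \<Upsilon>"
  then have "adj_equiv F G (mH \<Upsilon>) (mK \<Upsilon>) (ups \<Upsilon>) (dns \<Upsilon>)"
    using adj_homD(5)[OF \<Upsilon>] by (auto simp: adj_equivalence_def equivalence_functor_iff adj_equiv_def)
  then interpret Y: adj_equiv F G "mH \<Upsilon>" "mK \<Upsilon>" "ups \<Upsilon>" "dns \<Upsilon>" .
  define \<Psi> where "\<Psi> = \<lparr>src_adj = G, tgt_adj = F, mH = Y.eH.inv_ftor, mK = Y.eK.inv_ftor,
    ups = Y.inv_u, dns = Y.inv_d\<rparr>"
  have \<Psi>: "\<Psi> \<in> adj_hom G F"
    by (simp add: adj_hom_iff \<Psi>_def Y.inv_morph)
  have [simp]: "mH \<Psi> = Y.eH.inv_ftor" "mK \<Psi> = Y.eK.inv_ftor" "ups \<Psi> = Y.inv_u" "dns \<Psi> = Y.inv_d"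
    "src_adj \<Psi> = G" "tgt_adj \<Psi> = F"
    by (simp_all add: \<Psi>_def)
  have "ups (id_adj F) a \<circ>\<^bsub>catB F\<^esub> Y.eK.unt (ladj F \<bullet> a) = ladj F \<cdot> Y.eH.unt a \<circ>\<^bsub>catB F\<^esub> ups (\<Psi> \<odot> \<Upsilon>) a"
    if [simp]: "a \<in> Obj (catA F)" for a
  proof -
    \<comment> \<open>The equation is verified after applying the faithful
      \<open>mK \<Upsilon>\<close>, where \<open>unt\<close> becomes \<open>cnt\<close>.\<close>
    have "mK \<Upsilon> \<cdot> (ladj F \<cdot> Y.eH.unt a \<circ>\<^bsub>catB F\<^esub> ups (\<Psi> \<odot> \<Upsilon>) a) = mK \<Upsilon> \<cdot> Y.eK.unt (ladj F \<bullet> a)"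
      by (simp add: precomp[OF Y.u_inv_nat[of "Y.eH.unt a", simplified]])
    then have "ladj F \<cdot> Y.eH.unt a \<circ>\<^bsub>catB F\<^esub> ups (\<Psi> \<odot> \<Upsilon>) a = Y.eK.unt (ladj F \<bullet> a)"
      using Y.eK.faithful[of "ladj F \<cdot> Y.eH.unt a \<circ>\<^bsub>catB F\<^esub> ups (\<Psi> \<odot> \<Upsilon>) a" "Y.eK.unt (ladj F \<bullet> a)"] by simp
    then show ?thesis
      by simp
  qed
  then have "\<Psi> \<odot> \<Upsilon> \<cong> id_adj F"
    using comp_adj_hom[OF \<Upsilon> \<Psi>] Y.eH.unt_nat_iso Y.eK.unt_nat_iso
    by (intro adj_isoI[of _ F F _ Y.eH.unt Y.eK.unt]) (auto intro: id_adj_hom)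
  \<comment> \<open>For this composite the compatibility with \<open>cnt\<close> is the defining
    formula of \<open>inv_u\<close>.\<close>
  moreover have "\<Upsilon> \<odot> \<Psi> \<cong> id_adj G"
    using comp_adj_hom[OF \<Psi> \<Upsilon>] Y.eH.cnt_nat_iso Y.eK.cnt_nat_iso
    by (intro adj_isoI[of _ G G _ Y.eH.cnt Y.eK.cnt]) (auto intro: id_adj_hom)
  ultimately show "\<exists>\<Psi> \<in> adj_hom G F. \<Psi> \<odot> \<Upsilon> \<cong> id_adj F \<and> \<Upsilon> \<odot> \<Psi> \<cong> id_adj G"
    using \<Psi> by blast
next
  assume "\<exists>\<Psi> \<in> adj_hom G F. \<Psi> \<odot> \<Upsilon> \<cong> id_adj F \<and> \<Upsilon> \<odot> \<Psi> \<cong> id_adj G"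
  then obtain \<Psi> where \<Psi>: "\<Psi> \<in> adj_hom G F" and 1: "\<Psi> \<odot> \<Upsilon> \<cong> id_adj F" and 2: "\<Upsilon> \<odot> \<Psi> \<cong> id_adj G"
    by blast
  note ad = adj_homD(1-4)[OF \<Upsilon>] adj_homD(1,2)[OF \<Psi>]
  obtain \<theta> \<phi> where "nat_iso (catA F) (catA F) (comp_ftor (mH \<Psi>) (mH \<Upsilon>)) id_ftor \<theta>"
      "nat_iso (catB F) (catB F) (comp_ftor (mK \<Psi>) (mK \<Upsilon>)) id_ftor \<phi>"
    using 1 unfolding adj_iso_def by (auto simp: ad)
  moreover obtain \<theta>' \<phi>' where "nat_iso (catA G) (catA G) (comp_ftor (mH \<Upsilon>) (mH \<Psi>)) id_ftor \<theta>'"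
      "nat_iso (catB G) (catB G) (comp_ftor (mK \<Upsilon>) (mK \<Psi>)) id_ftor \<phi>'"
    using 2 unfolding adj_iso_def by (auto simp: ad)
  moreover have "adj_morphism \<Upsilon>"
    using \<Upsilon> by (simp add: adj_morphism_iff ad)
  moreover have "is_functor (catA F) (catA G) (mH \<Upsilon>)" "is_functor (catB F) (catB G) (mK \<Upsilon>)"
    "is_functor (catA G) (catA F) (mH \<Psi>)" "is_functor (catB G) (catB F) (mK \<Psi>)"
    using adj_homD(5)[OF \<Upsilon>] adj_homD(5)[OF \<Psi>] by (auto simp: adj_morph_def)
  ultimately show "adj_equivalence \<Upsilon>"
    unfolding adj_equivalence_def equivalence_functor_def ad by (blast intro: nat_iso_inverse)
qed

section \<open>Idempotent pointed endofunctors\<close>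

locale pointed = ftor X X T for X :: "'u cat" and T +
  fixes t :: "'u \<Rightarrow> 'u"
  assumes point [simp]: "a \<in> Obj X \<Longrightarrow> t a \<in> Arr X" "a \<in> Obj X \<Longrightarrow> Dom X (t a) = a"
      "a \<in> Obj X \<Longrightarrow> Cod X (t a) = T \<bullet> a"
    and point_nat: "f \<in> Arr X \<Longrightarrow> t (Cod X f) \<circ>\<^bsub>X\<^esub> f = T \<cdot> f \<circ>\<^bsub>X\<^esub> t (Dom X f)"
begin

text \<open>Objects with invertible \<open>t\<close> are local for the arrows inverted by \<open>T\<close>.\<close>

lemma local_cancel:
  assumes [simp]: "h \<in> Arr X" "f \<in> Arr X" "g \<in> Arr X" "Dom X f = Cod X h" "Dom X g = Cod X h" "Cod X g = Cod X f"
    and iso: "iso_arrow X (T \<cdot> h)" "iso_arrow X (t (Cod X f))"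
    and eq: "f \<circ>\<^bsub>X\<^esub> h = g \<circ>\<^bsub>X\<^esub> h"
  shows "f = g"
proof -
  have 1: "T \<cdot> f \<circ>\<^bsub>X\<^esub> T \<cdot> h = T \<cdot> g \<circ>\<^bsub>X\<^esub> T \<cdot> h"
    by (simp add: eq flip: ftor_simps(8))
  have "T \<cdot> f = T \<cdot> g"
    by (rule iso_cancel(2)[OF _ iso(1) _ _ 1]) auto
  then have 2: "t (Cod X f) \<circ>\<^bsub>X\<^esub> f = t (Cod X f) \<circ>\<^bsub>X\<^esub> g"
    using point_nat[of f] point_nat[of g] by simp
  show "f = g"
    by (rule iso_cancel(1)[OF _ iso(2) _ _ 2]) auto
qed

text \<open>Between two local objects, naturality of \<open>t\<close> exhibits \<open>f\<close> as a
  conjugate of \<open>T \<cdot> f\<close>.\<close>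

lemma local_iso:
  assumes "f \<in> Arr X" "iso_arrow X (T \<cdot> f)" "iso_arrow X (t (Dom X f))" "iso_arrow X (t (Cod X f))"
  shows "iso_arrow X f"
proof -
  have "f = inverse_arrow X (t (Cod X f)) \<circ>\<^bsub>X\<^esub> (t (Cod X f) \<circ>\<^bsub>X\<^esub> f)"
    using assms by simp
  also have "\<dots> = inverse_arrow X (t (Cod X f)) \<circ>\<^bsub>X\<^esub> (T \<cdot> f \<circ>\<^bsub>X\<^esub> t (Dom X f))"
    using assms point_nat by simp
  finally show ?thesis
    using assms by (metis category_simps(1,2) ftor_simps(1,4,5,6) inverse_arrow_simps(2,8) iso_Comp(1) point(2,3)
       category_simps(8) iso_arrow_Arr)
qed

text \<open>Locality is invariant under isomorphism: naturality of \<open>t\<close> at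
  \<open>f\<close> conjugates one component into the other.\<close>

lemma iso_T_of_local_equiv:
  assumes "f \<in> Arr X" "iso_arrow X f" "iso_arrow X (t (Dom X f))"
  shows "iso_arrow X (t (Cod X f))"
proof -
  have "t (Cod X f) = (t (Cod X f) \<circ>\<^bsub>X\<^esub> f) \<circ>\<^bsub>X\<^esub> inverse_arrow X f"
    using assms by simp
  also have "\<dots> = (T \<cdot> f \<circ>\<^bsub>X\<^esub> t (Dom X f)) \<circ>\<^bsub>X\<^esub> inverse_arrow X f"
    using assms point_nat by simp
  finally show ?thesis
    using assms by (auto intro!: iso_Comp(1))
qed

end

locale idem_pointed = pointed +
  assumes iso_point_T: "a \<in> Obj X \<Longrightarrow> iso_arrow X (t (T \<bullet> a))"
    and iso_T_point: "a \<in> Obj X \<Longrightarrow> iso_arrow X (T \<cdot> t a)"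
begin

text \<open>Well-pointedness is a consequence, not an axiom: both sides agree after precomposition
  with \<open>t a\<close>, by naturality, and \<open>T\<close> inverts \<open>t a\<close> while the
  target is local.\<close>

lemma point_T: "a \<in> Obj X \<Longrightarrow> t (T \<bullet> a) = T \<cdot> t a"
  by (rule local_cancel[of "t a"]) (use point_nat[of "t a"] in \<open>auto intro: iso_T_point iso_point_T\<close>)

text \<open>The left unit law leaves no other choice. The remaining monad laws are then proved by
  cancelling a component of \<open>t\<close>.\<close>

definition mult :: "'a \<Rightarrow> 'a" where
  "mult a = inverse_arrow X (t (T \<bullet> a))"

lemma mult_simps [simp]:
  assumes "a \<in> Obj X"
  shows "mult a \<in> Arr X" "Dom X (mult a) = T \<bullet> T \<bullet> a" "Cod X (mult a) = T \<bullet> a" "iso_arrow X (mult a)"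
    "mult a \<circ>\<^bsub>X\<^esub> t (T \<bullet> a) = One X (T \<bullet> a)" "mult a \<circ>\<^bsub>X\<^esub> T \<cdot> t a = One X (T \<bullet> a)"
  using assms iso_point_T[OF assms] point_T[OF assms, symmetric] by (simp_all add: mult_def)

lemma mult_assoc:
  assumes [simp]: "a \<in> Obj X"
  shows "mult a \<circ>\<^bsub>X\<^esub> T \<cdot> mult a = mult a \<circ>\<^bsub>X\<^esub> mult (T \<bullet> a)"
proof (rule local_cancel[of "t (T \<bullet> T \<bullet> a)"])
  have "T \<cdot> mult a \<circ>\<^bsub>X\<^esub> t (T \<bullet> T \<bullet> a) = t (T \<bullet> a) \<circ>\<^bsub>X\<^esub> mult a"
    using point_nat[of "mult a"] by simp
  then show "(mult a \<circ>\<^bsub>X\<^esub> T \<cdot> mult a) \<circ>\<^bsub>X\<^esub> t (T \<bullet> T \<bullet> a) = (mult a \<circ>\<^bsub>X\<^esub> mult (T \<bullet> a)) \<circ>\<^bsub>X\<^esub> t (T \<bullet> T \<bullet> a)"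
    using iso_point_T[of a] iso_point_T[of "T \<bullet> a"] by (simp add: mult_def)
qed (auto intro: iso_T_point iso_point_T)

lemma mult_nat:
  assumes [simp]: "f \<in> Arr X"
  shows "mult (Cod X f) \<circ>\<^bsub>X\<^esub> T \<cdot> T \<cdot> f = T \<cdot> f \<circ>\<^bsub>X\<^esub> mult (Dom X f)"
proof (rule local_cancel[of "t (T \<bullet> Dom X f)"])
  have 1: "T \<cdot> T \<cdot> f \<circ>\<^bsub>X\<^esub> t (T \<bullet> Dom X f) = t (T \<bullet> Cod X f) \<circ>\<^bsub>X\<^esub> T \<cdot> f"
    using point_nat[of "T \<cdot> f"] by simp
  show "(mult (Cod X f) \<circ>\<^bsub>X\<^esub> T \<cdot> T \<cdot> f) \<circ>\<^bsub>X\<^esub> t (T \<bullet> Dom X f) =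
      (T \<cdot> f \<circ>\<^bsub>X\<^esub> mult (Dom X f)) \<circ>\<^bsub>X\<^esub> t (T \<bullet> Dom X f)"
    using iso_point_T[of "Cod X f"] by (simp add: 1 mult_def[of "Cod X f"])
qed (auto intro: iso_T_point iso_point_T)

end

text \<open>\<open>closed\<close> says that \<open>T\<close> keeps objects of the form
  \<open>S \<bullet> a\<close> local for \<open>S\<close>; this replaces a distributive law. It is
  used with \<open>S\<close> the idempotent completion and \<open>T\<close> the passage to algebras
  or coalgebras.\<close>

lemma idem_pointed_comp:
  assumes "idem_pointed X S s" and "idem_pointed X T t"
    and closed: "\<And>a. a \<in> Obj X \<Longrightarrow> iso_arrow X (s (T \<bullet> S \<bullet> a))"
  shows "idem_pointed X (comp_ftor T S) (\<lambda>a. t (S \<bullet> a) \<circ>\<^bsub>X\<^esub> s a)"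
proof -
  interpret S: idem_pointed X S s by fact
  interpret T: idem_pointed X T t by fact
  show ?thesis
  proof
    show "is_functor X X (comp_ftor T S)"
      by (rule is_functor_comp[OF S.is_ftor T.is_ftor])
    fix f assume [simp]: "f \<in> Arr X"
    have "(t (S \<bullet> Cod X f) \<circ>\<^bsub>X\<^esub> s (Cod X f)) \<circ>\<^bsub>X\<^esub> f = (t (S \<bullet> Cod X f) \<circ>\<^bsub>X\<^esub> S \<cdot> f) \<circ>\<^bsub>X\<^esub> s (Dom X f)"
      using S.point_nat[of f] by simp
    also have "t (S \<bullet> Cod X f) \<circ>\<^bsub>X\<^esub> S \<cdot> f = T \<cdot> S \<cdot> f \<circ>\<^bsub>X\<^esub> t (S \<bullet> Dom X f)"
      using T.point_nat[of "S \<cdot> f"] by simp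
    finally show "(t (S \<bullet> Cod X f) \<circ>\<^bsub>X\<^esub> s (Cod X f)) \<circ>\<^bsub>X\<^esub> f =
        comp_ftor T S \<cdot> f \<circ>\<^bsub>X\<^esub> (t (S \<bullet> Dom X f) \<circ>\<^bsub>X\<^esub> s (Dom X f))"
      by simp
  next
    fix a assume a [simp]: "a \<in> Obj X"
    \<comment> \<open>\<open>s\<close> at \<open>T \<bullet> S \<bullet> a\<close> is an isomorphism
      out of a \<open>T\<close>-local object, so its target is \<open>T\<close>-local as
      well.\<close>
    have 1: "iso_arrow X (t (S \<bullet> T \<bullet> S \<bullet> a))"
      using T.iso_T_of_local_equiv[of "s (T \<bullet> S \<bullet> a)"] closed[OF a] T.iso_point_T[of "S \<bullet> a"] by simp
    then show "iso_arrow X (t (S \<bullet> (comp_ftor T S \<bullet> a)) \<circ>\<^bsub>X\<^esub> s (comp_ftor T S \<bullet> a))"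
      using closed[OF a] by (simp add: iso_Comp)
    \<comment> \<open>The naturality square of \<open>s\<close> at \<open>t (S \<bullet> a)\<close>,
      mapped by \<open>T\<close>. Three of its sides are invertible, hence so is the fourth.\<close>
    have 2: "T \<cdot> S \<cdot> t (S \<bullet> a) \<circ>\<^bsub>X\<^esub> T \<cdot> s (S \<bullet> a) = T \<cdot> s (T \<bullet> S \<bullet> a) \<circ>\<^bsub>X\<^esub> T \<cdot> t (S \<bullet> a)"
      using S.point_nat[of "t (S \<bullet> a)"] by (simp flip: T.ftor_simps(8))
    have 3: "iso_arrow X (T \<cdot> s (S \<bullet> a))" "iso_arrow X (T \<cdot> s (T \<bullet> S \<bullet> a))" "iso_arrow X (T \<cdot> t (S \<bullet> a))"
      using S.iso_point_T[OF a] closed[OF a] T.iso_T_point[of "S \<bullet> a"] by auto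
    have "T \<cdot> S \<cdot> t (S \<bullet> a) = (T \<cdot> S \<cdot> t (S \<bullet> a) \<circ>\<^bsub>X\<^esub> T \<cdot> s (S \<bullet> a)) \<circ>\<^bsub>X\<^esub> inverse_arrow X (T \<cdot> s (S \<bullet> a))"
      using 3 by simp
    then have "iso_arrow X (T \<cdot> S \<cdot> t (S \<bullet> a))"
      unfolding 2 using 3 by (simp add: iso_Comp)
    then show "iso_arrow X (comp_ftor T S \<cdot> (t (S \<bullet> a) \<circ>\<^bsub>X\<^esub> s a))"
      using T.iso_ftor(1)[OF S.iso_T_point[OF a]] by (simp add: iso_Comp)
  qed auto
qed

text \<open>The setting for uniqueness of reflections: \<open>p\<close> leads from
  \<open>M \<bullet> a\<close> to a \<open>T\<close>-local object and is inverted by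
  \<open>T\<close>, so \<open>N \<bullet> a\<close> is a \<open>T\<close>-reflection of
  \<open>M \<bullet> a\<close>.\<close>

locale local_cover = idem_pointed X T t for X :: "'u cat" and T t +
  fixes M N :: "'u ftor" and p :: "'u \<Rightarrow> 'u"
  assumes M: "is_functor X X M" and N: "is_functor X X N"
    and p [simp]: "a \<in> Obj X \<Longrightarrow> p a \<in> Arr X" "a \<in> Obj X \<Longrightarrow> Dom X (p a) = M \<bullet> a"
      "a \<in> Obj X \<Longrightarrow> Cod X (p a) = N \<bullet> a"
    and p_nat: "f \<in> Arr X \<Longrightarrow> p (Cod X f) \<circ>\<^bsub>X\<^esub> M \<cdot> f = N \<cdot> f \<circ>\<^bsub>X\<^esub> p (Dom X f)"
    and N_local [simp]: "a \<in> Obj X \<Longrightarrow> iso_arrow X (t (N \<bullet> a))"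
    and T_p [simp]: "a \<in> Obj X \<Longrightarrow> iso_arrow X (T \<cdot> p a)"
begin

sublocale M: ftor X X M by unfold_locales (rule M)
sublocale N: ftor X X N by unfold_locales (rule N)

text \<open>The factorisation of \<open>p a\<close> through \<open>t (M \<bullet> a)\<close> that
  locality of the target provides. It is invertible because \<open>T\<close> inverts
  \<open>p a\<close>.\<close>

definition cmp :: "'u \<Rightarrow> 'u" where
  "cmp a = inverse_arrow X (t (N \<bullet> a)) \<circ>\<^bsub>X\<^esub> T \<cdot> p a"

lemma cmp_simps [simp]:
  assumes "a \<in> Obj X"
  shows "cmp a \<in> Arr X" "Dom X (cmp a) = T \<bullet> M \<bullet> a" "Cod X (cmp a) = N \<bullet> a" "iso_arrow X (cmp a)"
  using assms by (simp_all add: cmp_def iso_Comp)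

lemma cmp_point: "a \<in> Obj X \<Longrightarrow> cmp a \<circ>\<^bsub>X\<^esub> t (M \<bullet> a) = p a"
  using point_nat[of "p a", symmetric] by (simp add: cmp_def)

lemma cmp_nat:
  assumes [simp]: "f \<in> Arr X"
  shows "cmp (Cod X f) \<circ>\<^bsub>X\<^esub> T \<cdot> M \<cdot> f = N \<cdot> f \<circ>\<^bsub>X\<^esub> cmp (Dom X f)"
proof -
  have 1: "t (N \<bullet> Cod X f) \<circ>\<^bsub>X\<^esub> N \<cdot> f = T \<cdot> N \<cdot> f \<circ>\<^bsub>X\<^esub> t (N \<bullet> Dom X f)"
    using point_nat[of "N \<cdot> f"] by simp
  have "cmp (Cod X f) \<circ>\<^bsub>X\<^esub> T \<cdot> M \<cdot> f = inverse_arrow X (t (N \<bullet> Cod X f)) \<circ>\<^bsub>X\<^esub> T \<cdot> (p (Cod X f) \<circ>\<^bsub>X\<^esub> M \<cdot> f)"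
    by (simp add: cmp_def)
  also have "\<dots> = inverse_arrow X (t (N \<bullet> Cod X f)) \<circ>\<^bsub>X\<^esub>
      ((T \<cdot> N \<cdot> f \<circ>\<^bsub>X\<^esub> t (N \<bullet> Dom X f)) \<circ>\<^bsub>X\<^esub> (inverse_arrow X (t (N \<bullet> Dom X f)) \<circ>\<^bsub>X\<^esub> T \<cdot> p (Dom X f)))"
    unfolding p_nat[OF assms] by simp
  also have "\<dots> = N \<cdot> f \<circ>\<^bsub>X\<^esub> cmp (Dom X f)"
    unfolding 1[symmetric] by (simp add: cmp_def)
  finally show ?thesis .
qed

end

text \<open>Abstract form of the square of units: \<open>N\<close> is at once the
  \<open>C\<close>-reflection of \<open>M\<close> and the \<open>M\<close>-reflection of
  \<open>C\<close>, with the two paths to it having the same diagonal \<open>n\<close>.\<close>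

locale nucleus_square = M: idem_pointed X M m + C: idem_pointed X C c
  for X :: "'u cat" and M m C c +
  fixes N :: "'u ftor" and p q n :: "'u \<Rightarrow> 'u"
  assumes p_cover: "local_cover X C c M N p" and q_cover: "local_cover X M m C N q"
    and n: "a \<in> Obj X \<Longrightarrow> n a = p a \<circ>\<^bsub>X\<^esub> m a" "a \<in> Obj X \<Longrightarrow> n a = q a \<circ>\<^bsub>X\<^esub> c a"
begin

sublocale P: local_cover X C c M N p by (rule p_cover)
sublocale Q: local_cover X M m C N q by (rule q_cover)

text \<open>The natural isomorphism \<open>P.cmp\<close> makes \<open>N \<cdot> f\<close> a
  conjugate of \<open>C \<cdot> M \<cdot> f\<close>.\<close>

lemma iso_N:
  assumes f: "f \<in> Arr X" and iso: "iso_arrow X (C \<cdot> M \<cdot> f)"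
  shows "iso_arrow X (N \<cdot> f)"
proof -
  have "N \<cdot> f = (N \<cdot> f \<circ>\<^bsub>X\<^esub> P.cmp (Dom X f)) \<circ>\<^bsub>X\<^esub> inverse_arrow X (P.cmp (Dom X f))"
    using f by simp
  also have "\<dots> = (P.cmp (Cod X f) \<circ>\<^bsub>X\<^esub> C \<cdot> M \<cdot> f) \<circ>\<^bsub>X\<^esub> inverse_arrow X (P.cmp (Dom X f))"
    using f by (simp only: P.cmp_nat)
  finally show ?thesis
    using f iso by (simp add: iso_Comp)
qed

lemma idem_pointed_N: "idem_pointed X N n"
proof
  fix a assume a [simp]: "a \<in> Obj X"
  show "iso_arrow X (n (N \<bullet> a))"
  proof -
    \<comment> \<open>\<open>N \<bullet> a\<close> is local for both reflections, so it is
      isomorphic to \<open>M \<bullet> N \<bullet> a\<close>, which is therefore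
      \<open>C\<close>-local. Thus \<open>p (N \<bullet> a)\<close> is a
      \<open>C\<close>-equivalence between \<open>C\<close>-local objects.\<close>
    have "iso_arrow X (c (M \<bullet> N \<bullet> a))"
      using C.iso_T_of_local_equiv[of "m (N \<bullet> a)"] by simp
    then have "iso_arrow X (p (N \<bullet> a))"
      using C.local_iso[of "p (N \<bullet> a)"] by simp
    then show ?thesis
      by (simp add: n(1) iso_Comp)
  qed
  show "iso_arrow X (N \<cdot> n a)"
  proof -
    have "iso_arrow X (N \<cdot> m a)"
      by (intro iso_N C.iso_ftor M.iso_T_point) auto
    moreover have "iso_arrow X (N \<cdot> p a)"
    proof (rule iso_N)
      \<comment> \<open>That \<open>C \<cdot> M\<close> inverts \<open>p a\<close> is read off the
        naturality square of \<open>m\<close> at \<open>p a\<close>, mapped by \<open>C\<close>: the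
        two components of \<open>m\<close> are at \<open>M\<close>-local objects, and
        \<open>C\<close> inverts \<open>p a\<close>.\<close>
      have 1: "iso_arrow X (C \<cdot> m (N \<bullet> a))" "iso_arrow X (C \<cdot> m (M \<bullet> a))"
        using M.iso_point_T[of a] by auto
      have "C \<cdot> M \<cdot> p a \<circ>\<^bsub>X\<^esub> C \<cdot> m (M \<bullet> a) = C \<cdot> m (N \<bullet> a) \<circ>\<^bsub>X\<^esub> C \<cdot> p a"
        using M.point_nat[of "p a"] by (simp flip: C.ftor_simps(8))
      then have "(C \<cdot> M \<cdot> p a \<circ>\<^bsub>X\<^esub> C \<cdot> m (M \<bullet> a)) \<circ>\<^bsub>X\<^esub> inverse_arrow X (C \<cdot> m (M \<bullet> a)) =
          (C \<cdot> m (N \<bullet> a) \<circ>\<^bsub>X\<^esub> C \<cdot> p a) \<circ>\<^bsub>X\<^esub> inverse_arrow X (C \<cdot> m (M \<bullet> a))"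
        by simp
      also have "(C \<cdot> M \<cdot> p a \<circ>\<^bsub>X\<^esub> C \<cdot> m (M \<bullet> a)) \<circ>\<^bsub>X\<^esub> inverse_arrow X (C \<cdot> m (M \<bullet> a)) = C \<cdot> M \<cdot> p a"
        using 1 by simp
      finally show "iso_arrow X (C \<cdot> M \<cdot> p a)"
        using 1 by (simp add: iso_Comp)
    qed simp
    ultimately show ?thesis
      by (simp add: n(1) iso_Comp)
  qed
next
  fix f assume [simp]: "f \<in> Arr X"
  have "n (Cod X f) \<circ>\<^bsub>X\<^esub> f = p (Cod X f) \<circ>\<^bsub>X\<^esub> (M \<cdot> f \<circ>\<^bsub>X\<^esub> m (Dom X f))"
    using M.point_nat[of f] by (simp add: n(1))
  also have "\<dots> = N \<cdot> f \<circ>\<^bsub>X\<^esub> n (Dom X f)"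
    by (simp add: n(1) precomp[OF P.p_nat])
  finally show "n (Cod X f) \<circ>\<^bsub>X\<^esub> f = N \<cdot> f \<circ>\<^bsub>X\<^esub> n (Dom X f)" .
qed (auto simp: n(1) P.N)

end

section \<open>The homotopy category of adjunctions\<close>

definition adj_class :: "'u adj_mor \<Rightarrow> 'u adj + 'u adj_mor set" where
  "adj_class \<Upsilon> = Inr {\<Upsilon>'. \<Upsilon> \<cong> \<Upsilon>'}"

definition adj_rep :: "'u adj + 'u adj_mor set \<Rightarrow> 'u adj_mor" where
  "adj_rep x = (SOME \<Upsilon>. \<Upsilon> \<in> projr x)"

text \<open>A \<open>cat\<close> keeps objects and arrows in one type, hence the sum: adjunctions on
  the left, isomorphism classes of morphisms on the right. Domain, codomain and composite are
  computed on chosen representatives, and the congruence lemmas for pasting make the choice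
  irrelevant.\<close>

definition hAdj :: "('u adj + 'u adj_mor set) cat" where
  "hAdj = \<lparr>Obj = Inl ` {F. adjunction F}, Arr = adj_class ` {\<Upsilon>. adj_morphism \<Upsilon>},
     Dom = (\<lambda>x. Inl (src_adj (adj_rep x))), Cod = (\<lambda>x. Inl (tgt_adj (adj_rep x))),
     One = (\<lambda>F. adj_class (id_adj (projl F))),
     Comp = (\<lambda>y x. adj_class (adj_rep y \<odot> adj_rep x))\<rparr>"

lemma adj_class_eq:
  assumes "\<Upsilon> \<in> adj_hom F G"
  shows "adj_class \<Upsilon> = adj_class \<Upsilon>' \<longleftrightarrow> \<Upsilon> \<cong> \<Upsilon>'"
  using adj_iso_refl[OF assms] adj_iso_sym adj_iso_trans unfolding adj_class_def by blast

lemma adj_class_cong: "\<Upsilon> \<cong> \<Upsilon>' \<Longrightarrow> adj_class \<Upsilon> = adj_class \<Upsilon>'"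
  using adj_iso_sym adj_iso_trans unfolding adj_class_def by blast

lemma adj_class_isoI: "\<lbrakk>adj_class \<Upsilon> = adj_class \<Upsilon>'; \<Upsilon> \<in> adj_hom F G\<rbrakk> \<Longrightarrow> \<Upsilon> \<cong> \<Upsilon>'"
  using adj_class_eq by blast

lemma adj_rep_class:
  assumes "\<Upsilon> \<in> adj_hom F G"
  shows "\<Upsilon> \<cong> adj_rep (adj_class \<Upsilon>)" "adj_rep (adj_class \<Upsilon>) \<in> adj_hom F G"
    "adj_class (adj_rep (adj_class \<Upsilon>)) = adj_class \<Upsilon>"
proof -
  show 1: "\<Upsilon> \<cong> adj_rep (adj_class \<Upsilon>)"
    using someI[of "\<lambda>\<Upsilon>'. \<Upsilon> \<cong> \<Upsilon>'", OF adj_iso_refl[OF assms]] by (simp add: adj_class_def adj_rep_def)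
  show "adj_rep (adj_class \<Upsilon>) \<in> adj_hom F G"
    using adj_iso_hom[OF 1] assms by blast
  show "adj_class (adj_rep (adj_class \<Upsilon>)) = adj_class \<Upsilon>"
    by (rule adj_class_cong[OF 1, symmetric])
qed

lemma hAdj_Obj: "x \<in> Obj hAdj \<longleftrightarrow> (\<exists>F. x = Inl F \<and> adjunction F)"
  by (auto simp: hAdj_def)

lemma Inl_hAdj [simp]: "Inl F \<in> Obj hAdj \<longleftrightarrow> adjunction F"
  by (auto simp: hAdj_Obj)

lemma hAdj_Arr: "x \<in> Arr hAdj \<longleftrightarrow> (\<exists>\<Upsilon> F G. x = adj_class \<Upsilon> \<and> \<Upsilon> \<in> adj_hom F G)"
  by (auto simp: hAdj_def adj_hom_def)

lemma adj_class_hAdj: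
  assumes "\<Upsilon> \<in> adj_hom F G"
  shows "adj_class \<Upsilon> \<in> Arr hAdj" "Dom hAdj (adj_class \<Upsilon>) = Inl F" "Cod hAdj (adj_class \<Upsilon>) = Inl G"
proof -
  show "adj_class \<Upsilon> \<in> Arr hAdj"
    unfolding hAdj_Arr using assms by blast
  show "Dom hAdj (adj_class \<Upsilon>) = Inl F" "Cod hAdj (adj_class \<Upsilon>) = Inl G"
    using adj_homD(1,2)[OF adj_rep_class(2)[OF assms]] by (simp_all add: hAdj_def)
qed

lemma adj_rep_hAdj:
  assumes "x \<in> Arr hAdj" "Dom hAdj x = Inl F" "Cod hAdj x = Inl G"
  shows "adj_rep x \<in> adj_hom F G" "adj_class (adj_rep x) = x"
proof -
  obtain \<Upsilon> F' G' where 1: "x = adj_class \<Upsilon>" "\<Upsilon> \<in> adj_hom F' G'"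
    using assms by (auto simp: hAdj_Arr)
  with assms(2,3) have "F' = F" "G' = G"
    using adj_class_hAdj[OF 1(2)] by auto
  with 1 show "adj_rep x \<in> adj_hom F G" "adj_class (adj_rep x) = x"
    using adj_rep_class[OF 1(2)] by auto
qed

text \<open>Independence of representatives: replace first the left, then the right factor by the
  chosen representative of its class.\<close>

lemma adj_class_comp:
  assumes \<Upsilon>: "\<Upsilon> \<in> adj_hom F G" and \<Psi>: "\<Psi> \<in> adj_hom G L"
  shows "adj_class \<Psi> \<circ>\<^bsub>hAdj\<^esub> adj_class \<Upsilon> = adj_class (\<Psi> \<odot> \<Upsilon>)"
proof -
  note r = adj_rep_class[OF \<Upsilon>] adj_rep_class[OF \<Psi>]
  have "\<Psi> \<odot> \<Upsilon> \<cong> adj_rep (adj_class \<Psi>) \<odot> \<Upsilon>"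
    by (rule comp_adj_cong_left[OF \<Upsilon> r(4) \<Psi>])
  also have "\<dots> \<cong> adj_rep (adj_class \<Psi>) \<odot> adj_rep (adj_class \<Upsilon>)"
    by (rule comp_adj_cong_right[OF r(5) r(1) \<Upsilon>])
  finally have "adj_class (\<Psi> \<odot> \<Upsilon>) = adj_class (adj_rep (adj_class \<Psi>) \<odot> adj_rep (adj_class \<Upsilon>))"
    by (rule adj_class_cong)
  then show ?thesis
    by (simp add: hAdj_def)
qed

lemma adj_class_id: "One hAdj (Inl F) = adj_class (id_adj F)"
  by (simp add: hAdj_def)

lemma hAdj_category [simp]: "category hAdj"
proof (rule categoryI; (elim exE conjE)?)
  fix f assume "f \<in> Arr hAdj"
  then obtain \<Upsilon> F G where [simp]: "f = adj_class \<Upsilon>" and \<Upsilon>: "\<Upsilon> \<in> adj_hom F G"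
    by (auto simp: hAdj_Arr)
  note 1 = adj_homD(3,4)[OF \<Upsilon>]
  show "Dom hAdj f \<in> Obj hAdj \<and> Cod hAdj f \<in> Obj hAdj"
    using adj_class_hAdj[OF \<Upsilon>] 1 by simp
  show "f \<circ>\<^bsub>hAdj\<^esub> One hAdj (Dom hAdj f) = f \<and> One hAdj (Cod hAdj f) \<circ>\<^bsub>hAdj\<^esub> f = f"
    using adj_class_comp[OF id_adj_hom \<Upsilon>] adj_class_comp[OF \<Upsilon> id_adj_hom] 1
    by (simp add: adj_class_hAdj[OF \<Upsilon>] adj_class_id adj_class_cong[OF comp_adj_id(1)[OF \<Upsilon>]]
      adj_class_cong[OF comp_adj_id(2)[OF \<Upsilon>]])
next
  fix a :: "'a adj + 'a adj_mor set" assume "a \<in> Obj hAdj"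
  then show "One hAdj a \<in> Arr hAdj \<and> Dom hAdj (One hAdj a) = a \<and> Cod hAdj (One hAdj a) = a"
    using adj_class_hAdj[OF id_adj_hom] by (auto simp: hAdj_Obj adj_class_id)
next
  fix f g assume "f \<in> Arr hAdj" "g \<in> Arr hAdj" and gf: "Dom hAdj g = Cod hAdj f"
  then obtain \<Upsilon> F G \<Psi> G' L where [simp]: "f = adj_class \<Upsilon>" "g = adj_class \<Psi>"
    and \<Upsilon>: "\<Upsilon> \<in> adj_hom F G" and \<Psi>': "\<Psi> \<in> adj_hom G' L"
    by (auto simp: hAdj_Arr)
  have \<Psi>: "\<Psi> \<in> adj_hom G L"
    using gf \<Psi>' by (simp add: adj_class_hAdj[OF \<Upsilon>] adj_class_hAdj[OF \<Psi>'])
  show "g \<circ>\<^bsub>hAdj\<^esub> f \<in> Arr hAdj \<and> Dom hAdj (g \<circ>\<^bsub>hAdj\<^esub> f) = Dom hAdj f \<and> Cod hAdj (g \<circ>\<^bsub>hAdj\<^esub> f) = Cod hAdj g"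
    by (simp add: adj_class_comp[OF \<Upsilon> \<Psi>] adj_class_hAdj[OF \<Upsilon>] adj_class_hAdj[OF \<Psi>]
      adj_class_hAdj[OF comp_adj_hom[OF \<Upsilon> \<Psi>]])
  fix h assume "h \<in> Arr hAdj" and hg: "Dom hAdj h = Cod hAdj g"
  then obtain \<Xi> M L' where [simp]: "h = adj_class \<Xi>" and \<Xi>': "\<Xi> \<in> adj_hom L' M"
    by (auto simp: hAdj_Arr)
  have \<Xi>: "\<Xi> \<in> adj_hom L M"
    using hg \<Xi>' by (simp add: adj_class_hAdj[OF \<Psi>] adj_class_hAdj[OF \<Xi>'])
  show "(h \<circ>\<^bsub>hAdj\<^esub> g) \<circ>\<^bsub>hAdj\<^esub> f = h \<circ>\<^bsub>hAdj\<^esub> (g \<circ>\<^bsub>hAdj\<^esub> f)"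
    using adj_class_cong[OF comp_adj_assoc[OF \<Upsilon> \<Psi> \<Xi>]]
    by (simp add: adj_class_comp[OF \<Upsilon> \<Psi>] adj_class_comp[OF \<Psi> \<Xi>] adj_class_comp[OF comp_adj_hom[OF \<Upsilon> \<Psi>] \<Xi>]
      adj_class_comp[OF \<Upsilon> comp_adj_hom[OF \<Psi> \<Xi>]])
qed

text \<open>The dictionary used throughout: both directions go through invertibility up to
  \<open>\<cong>\<close>, which is what \<open>adj_equivalence_iff\<close> supplies.\<close>

lemma adj_class_iso:
  assumes \<Upsilon>: "\<Upsilon> \<in> adj_hom F G"
  shows "iso_arrow hAdj (adj_class \<Upsilon>) \<longleftrightarrow> adj_equivalence \<Upsilon>"
proof
  assume iso: "iso_arrow hAdj (adj_class \<Upsilon>)"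
  note \<Psi> = adj_rep_hAdj[of "inverse_arrow hAdj (adj_class \<Upsilon>)" G F]
  let ?\<Psi> = "adj_rep (inverse_arrow hAdj (adj_class \<Upsilon>))"
  have 1: "?\<Psi> \<in> adj_hom G F" "adj_class ?\<Psi> = inverse_arrow hAdj (adj_class \<Upsilon>)"
    using \<Psi> iso adj_class_hAdj[OF \<Upsilon>] by auto
  have "adj_class (?\<Psi> \<odot> \<Upsilon>) = adj_class (id_adj F)"
    unfolding adj_class_comp[OF \<Upsilon> 1(1), symmetric] 1(2) using iso adj_class_hAdj[OF \<Upsilon>]
    by (simp add: adj_class_id)
  moreover have "adj_class (\<Upsilon> \<odot> ?\<Psi>) = adj_class (id_adj G)"
    unfolding adj_class_comp[OF 1(1) \<Upsilon>, symmetric] 1(2) using iso adj_class_hAdj[OF \<Upsilon>]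
    by (simp add: adj_class_id)
  ultimately show "adj_equivalence \<Upsilon>"
    unfolding adj_equivalence_iff[OF \<Upsilon>]
    using adj_class_isoI comp_adj_hom[OF \<Upsilon> 1(1)] comp_adj_hom[OF 1(1) \<Upsilon>] 1(1) by blast
next
  assume "adj_equivalence \<Upsilon>"
  then obtain \<Psi> where \<Psi>: "\<Psi> \<in> adj_hom G F" "\<Psi> \<odot> \<Upsilon> \<cong> id_adj F" "\<Upsilon> \<odot> \<Psi> \<cong> id_adj G"
    unfolding adj_equivalence_iff[OF \<Upsilon>] by blast
  show "iso_arrow hAdj (adj_class \<Upsilon>)"
    by (rule iso_arrowI[of _ _ "adj_class \<Psi>"])
      (use adj_class_cong[OF \<Psi>(2)] adj_class_cong[OF \<Psi>(3)] in
       \<open>auto simp: adj_class_hAdj[OF \<Upsilon>] adj_class_hAdj[OF \<Psi>(1)] adj_class_comp[OF \<Upsilon> \<Psi>(1)]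
          adj_class_comp[OF \<Psi>(1) \<Upsilon>] adj_class_id\<close>)
qed

section \<open>Endofunctors on adjunctions as functors on the homotopy category\<close>

definition endo_ftor :: "'u adj_endo \<Rightarrow> ('u adj + 'u adj_mor set) ftor" where
  "endo_ftor T = \<lparr>FObj = (\<lambda>x. Inl (on_adj T (projl x))), FArr = (\<lambda>x. adj_class (on_mor T (adj_rep x)))\<rparr>"

lemma endo_ftor_Inl [simp]: "endo_ftor T \<bullet> Inl F = Inl (on_adj T F)"
  by (simp add: endo_ftor_def)

lemma endofunctorD:
  assumes "endofunctor T"
  shows "adjunction F \<Longrightarrow> adjunction (on_adj T F)"
    "\<Upsilon> \<in> adj_hom F G \<Longrightarrow> on_mor T \<Upsilon> \<in> adj_hom (on_adj T F) (on_adj T G)"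
    "\<Upsilon> \<cong> \<Upsilon>' \<Longrightarrow> on_mor T \<Upsilon> \<cong> on_mor T \<Upsilon>'"
    "adjunction F \<Longrightarrow> on_mor T (id_adj F) \<cong> id_adj (on_adj T F)"
    "\<lbrakk>\<Upsilon> \<in> adj_hom F G; \<Psi> \<in> adj_hom G L\<rbrakk> \<Longrightarrow> on_mor T (\<Psi> \<odot> \<Upsilon>) \<cong> on_mor T \<Psi> \<odot> on_mor T \<Upsilon>"
  using assms unfolding endofunctor_def by blast+

lemma endo_ftor_class:
  assumes T: "endofunctor T" and \<Upsilon>: "\<Upsilon> \<in> adj_hom F G"
  shows "endo_ftor T \<cdot> adj_class \<Upsilon> = adj_class (on_mor T \<Upsilon>)"
  using adj_class_cong[OF endofunctorD(3)[OF T adj_rep_class(1)[OF \<Upsilon>]]] by (simp add: endo_ftor_def)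

lemma endo_ftor:
  assumes T: "endofunctor T"
  shows "is_functor hAdj hAdj (endo_ftor T)"
  unfolding is_functor_iff
proof (intro conjI ballI impI)
  fix a :: "'a adj + 'a adj_mor set" assume "a \<in> Obj hAdj"
  then obtain F where [simp]: "a = Inl F" and F: "adjunction F"
    by (auto simp: hAdj_Obj)
  show "endo_ftor T \<bullet> a \<in> Obj hAdj"
    using endofunctorD(1)[OF T F] by simp
  show "endo_ftor T \<cdot> One hAdj a = One hAdj (endo_ftor T \<bullet> a)"
    using adj_class_cong[OF endofunctorD(4)[OF T F]]
    by (simp add: adj_class_id endo_ftor_class[OF T id_adj_hom[OF F]])
next
  fix f :: "'a adj + 'a adj_mor set" assume "f \<in> Arr hAdj"
  then obtain \<Upsilon> F G where [simp]: "f = adj_class \<Upsilon>" and \<Upsilon>: "\<Upsilon> \<in> adj_hom F G"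
    by (auto simp: hAdj_Arr)
  note 1 = adj_class_hAdj[OF \<Upsilon>] adj_class_hAdj[OF endofunctorD(2)[OF T \<Upsilon>]] endo_ftor_class[OF T \<Upsilon>]
  show "endo_ftor T \<cdot> f \<in> Arr hAdj" "Dom hAdj (endo_ftor T \<cdot> f) = endo_ftor T \<bullet> Dom hAdj f"
    "Cod hAdj (endo_ftor T \<cdot> f) = endo_ftor T \<bullet> Cod hAdj f"
    by (simp_all add: 1)
  fix g :: "'a adj + 'a adj_mor set" assume "g \<in> Arr hAdj" and gf: "Dom hAdj g = Cod hAdj f"
  then obtain \<Psi> G' L where [simp]: "g = adj_class \<Psi>" and \<Psi>': "\<Psi> \<in> adj_hom G' L"
    by (auto simp: hAdj_Arr)
  have \<Psi>: "\<Psi> \<in> adj_hom G L"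
    using gf \<Psi>' by (simp add: adj_class_hAdj[OF \<Upsilon>] adj_class_hAdj[OF \<Psi>'])
  note TT = endofunctorD(2)[OF T \<Upsilon>] endofunctorD(2)[OF T \<Psi>]
  show "endo_ftor T \<cdot> (g \<circ>\<^bsub>hAdj\<^esub> f) = endo_ftor T \<cdot> g \<circ>\<^bsub>hAdj\<^esub> endo_ftor T \<cdot> f"
    using adj_class_cong[OF endofunctorD(5)[OF T \<Upsilon> \<Psi>]]
    by (simp add: adj_class_comp[OF \<Upsilon> \<Psi>] endo_ftor_class[OF T \<Upsilon>] endo_ftor_class[OF T \<Psi>]
       endo_ftor_class[OF T comp_adj_hom[OF \<Upsilon> \<Psi>]] adj_class_comp[OF TT])
qed simp_all

text \<open>An idempotent monad without its multiplication, which is recovered as an inverse of the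
  point.\<close>

definition idem_pointed_endo :: "'u adj_endo \<Rightarrow> ('u adj \<Rightarrow> 'u adj_mor) \<Rightarrow> bool" where
  "idem_pointed_endo T t \<longleftrightarrow> endofunctor T \<and> adj_natural id_endo T t \<and>
     (\<forall>F. adjunction F \<longrightarrow> adj_equivalence (t (on_adj T F)) \<and> adj_equivalence (on_mor T (t F)))"

lemma endo_simps [simp]:
  "on_adj id_endo F = F" "on_mor id_endo \<Upsilon> = \<Upsilon>"
  "on_adj (comp_endo S T) F = on_adj S (on_adj T F)" "on_mor (comp_endo S T) \<Upsilon> = on_mor S (on_mor T \<Upsilon>)"
  by (simp_all add: id_endo_def comp_endo_def)

lemma adj_naturalD:
  assumes "adj_natural S T E"
  shows "adjunction F \<Longrightarrow> E F \<in> adj_hom (on_adj S F) (on_adj T F)"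
    "\<Upsilon> \<in> adj_hom F G \<Longrightarrow> E G \<odot> on_mor S \<Upsilon> \<cong> on_mor T \<Upsilon> \<odot> E F"
  using assms unfolding adj_natural_def by blast+

lemma adj_natural_class:
  assumes E: "adj_natural S T E" and \<Upsilon>: "\<Upsilon> \<in> adj_hom F G"
    and S\<Upsilon>: "on_mor S \<Upsilon> \<in> adj_hom (on_adj S F) (on_adj S G)"
    and T\<Upsilon>: "on_mor T \<Upsilon> \<in> adj_hom (on_adj T F) (on_adj T G)"
  shows "adj_class (E G) \<circ>\<^bsub>hAdj\<^esub> adj_class (on_mor S \<Upsilon>) = adj_class (on_mor T \<Upsilon>) \<circ>\<^bsub>hAdj\<^esub> adj_class (E F)"
proof -
  note EFG = adj_naturalD(1)[OF E adj_homD(3)[OF \<Upsilon>]] adj_naturalD(1)[OF E adj_homD(4)[OF \<Upsilon>]]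
  show ?thesis
    using adj_class_cong[OF adj_naturalD(2)[OF E \<Upsilon>]]
    by (simp add: adj_class_comp[OF S\<Upsilon> EFG(2)] adj_class_comp[OF EFG(1) T\<Upsilon>])
qed

lemma idem_pointed_hAdj:
  assumes "idem_pointed_endo T t"
  shows "idem_pointed hAdj (endo_ftor T) (\<lambda>x. adj_class (t (projl x)))"
proof
  have T: "endofunctor T" and t: "adj_natural id_endo T t"
    and iso: "adjunction F \<Longrightarrow> adj_equivalence (t (on_adj T F))"
      "adjunction F \<Longrightarrow> adj_equivalence (on_mor T (t F))" for F
    using assms unfolding idem_pointed_endo_def by blast+
  note tF = adj_naturalD(1)[OF t, simplified]
  show "is_functor hAdj hAdj (endo_ftor T)"
    by (rule endo_ftor[OF T])
  fix a :: "'a adj + 'a adj_mor set" assume "a \<in> Obj hAdj"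
  then obtain F where [simp]: "a = Inl F" and F: "adjunction F"
    by (auto simp: hAdj_Obj)
  show "adj_class (t (projl a)) \<in> Arr hAdj" "Dom hAdj (adj_class (t (projl a))) = a"
    "Cod hAdj (adj_class (t (projl a))) = endo_ftor T \<bullet> a"
    using adj_class_hAdj[OF tF[OF F]] by simp_all
  show "iso_arrow hAdj (adj_class (t (projl (endo_ftor T \<bullet> a))))"
    using adj_class_iso[OF tF[OF endofunctorD(1)[OF T F]]] iso(1)[OF F] by simp
  show "iso_arrow hAdj (endo_ftor T \<cdot> adj_class (t (projl a)))"
    using adj_class_iso[OF endofunctorD(2)[OF T tF[OF F]]] iso(2)[OF F]
    by (simp add: endo_ftor_class[OF T tF[OF F]])
next
  have T: "endofunctor T" and t: "adj_natural id_endo T t"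
    using assms unfolding idem_pointed_endo_def by blast+
  fix f :: "'a adj + 'a adj_mor set" assume "f \<in> Arr hAdj"
  then obtain \<Upsilon> F G where [simp]: "f = adj_class \<Upsilon>" and \<Upsilon>: "\<Upsilon> \<in> adj_hom F G"
    by (auto simp: hAdj_Arr)
  show "adj_class (t (projl (Cod hAdj f))) \<circ>\<^bsub>hAdj\<^esub> f = endo_ftor T \<cdot> f \<circ>\<^bsub>hAdj\<^esub> adj_class (t (projl (Dom hAdj f)))"
    using adj_natural_class[OF t \<Upsilon>] \<Upsilon> endofunctorD(2)[OF T \<Upsilon>]
    by (simp add: adj_class_hAdj[OF \<Upsilon>] endo_ftor_class[OF T \<Upsilon>])
qed

text \<open>The way back from \<open>hAdj\<close>: equal classes give \<open>\<cong>\<close>,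
  invertible classes give equivalences. Only the typing of the point has to be supplied
  separately.\<close>

lemma idem_pointed_endoI:
  assumes T: "endofunctor T" and t: "\<And>F. adjunction F \<Longrightarrow> t F \<in> adj_hom F (on_adj T F)"
    and ip: "idem_pointed hAdj (endo_ftor T) (\<lambda>x. adj_class (t (projl x)))"
  shows "idem_pointed_endo T t"
proof -
  interpret idem_pointed hAdj "endo_ftor T" "\<lambda>x. adj_class (t (projl x))"
    by (rule ip)
  have "adj_natural id_endo T t"
    unfolding adj_natural_def
  proof (intro conjI allI impI)
    fix F G and \<Upsilon> :: "'a adj_mor" assume \<Upsilon>: "\<Upsilon> \<in> adj_hom F G"
    note FG = adj_homD(3,4)[OF \<Upsilon>]
    have "adj_class (t G) \<circ>\<^bsub>hAdj\<^esub> adj_class \<Upsilon> = adj_class (on_mor T \<Upsilon>) \<circ>\<^bsub>hAdj\<^esub> adj_class (t F)"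
      using point_nat[of "adj_class \<Upsilon>"] by (simp add: adj_class_hAdj[OF \<Upsilon>] endo_ftor_class[OF T \<Upsilon>])
    then show "t G \<odot> on_mor id_endo \<Upsilon> \<cong> on_mor T \<Upsilon> \<odot> t F"
      using adj_class_isoI[OF _ comp_adj_hom[OF \<Upsilon> t[OF FG(2)]]]
      by (simp add: adj_class_comp[OF \<Upsilon> t[OF FG(2)]] adj_class_comp[OF t[OF FG(1)] endofunctorD(2)[OF T \<Upsilon>]])
  qed (simp add: t)
  moreover have "adj_equivalence (t (on_adj T F))" "adj_equivalence (on_mor T (t F))" if F: "adjunction F" for F
    using iso_point_T[of "Inl F"] iso_T_point[of "Inl F"] F adj_class_iso[OF t[OF endofunctorD(1)[OF T F]]]
      adj_class_iso[OF endofunctorD(2)[OF T t[OF F]]] by (auto simp: endo_ftor_class[OF T t[OF F]])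
  ultimately show ?thesis
    unfolding idem_pointed_endo_def using T by blast
qed

lemma endofunctor_comp:
  assumes S: "endofunctor S" and T: "endofunctor T"
  shows "endofunctor (comp_endo S T)"
  unfolding endofunctor_def
proof (intro conjI allI impI)
  fix F :: "'a adj" assume F: "adjunction F"
  show "on_mor (comp_endo S T) (id_adj F) \<cong> id_adj (on_adj (comp_endo S T) F)"
    using adj_iso_trans[OF endofunctorD(3)[OF S endofunctorD(4)[OF T F]] endofunctorD(4)[OF S endofunctorD(1)[OF T F]]]
    by simp
next
  fix F G L and \<Upsilon> \<Psi> :: "'a adj_mor" assume *: "\<Upsilon> \<in> adj_hom F G" "\<Psi> \<in> adj_hom G L"
  show "on_mor (comp_endo S T) (\<Psi> \<odot> \<Upsilon>) \<cong> on_mor (comp_endo S T) \<Psi> \<odot> on_mor (comp_endo S T) \<Upsilon>"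
    using adj_iso_trans[OF endofunctorD(3)[OF S endofunctorD(5)[OF T *]]
        endofunctorD(5)[OF S endofunctorD(2)[OF T *(1)] endofunctorD(2)[OF T *(2)]]]
    by simp
qed (auto intro: endofunctorD[OF S] endofunctorD[OF T])

lemma idem_pointed_endo_comp:
  assumes S: "idem_pointed_endo S s" and T: "idem_pointed_endo T t"
    and closed: "\<And>F. adjunction F \<Longrightarrow> adj_equivalence (s (on_adj T (on_adj S F)))"
  shows "idem_pointed_endo (comp_endo T S) (\<lambda>F. t (on_adj S F) \<odot> s F)"
proof (rule idem_pointed_endoI)
  have eS: "endofunctor S" and eT: "endofunctor T"
    and s: "adj_natural id_endo S s" and t: "adj_natural id_endo T t"
    using S T unfolding idem_pointed_endo_def by blast+
  note sF = adj_naturalD(1)[OF s, simplified] and tF = adj_naturalD(1)[OF t, simplified]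
  note adS = endofunctorD(1)[OF eS] and adT = endofunctorD(1)[OF eT]
  show "endofunctor (comp_endo T S)"
    by (rule endofunctor_comp[OF eT eS])
  show "t (on_adj S F) \<odot> s F \<in> adj_hom F (on_adj (comp_endo T S) F)" if F: "adjunction F" for F
    using comp_adj_hom[OF sF[OF F] tF[OF adS[OF F]]] by simp
  have "idem_pointed hAdj (comp_ftor (endo_ftor T) (endo_ftor S))
     (\<lambda>x. adj_class (t (projl (endo_ftor S \<bullet> x))) \<circ>\<^bsub>hAdj\<^esub> adj_class (s (projl x)))"
  proof (rule idem_pointed_comp[OF idem_pointed_hAdj[OF S] idem_pointed_hAdj[OF T]])
    fix a :: "'a adj + 'a adj_mor set" assume "a \<in> Obj hAdj"
    then show "iso_arrow hAdj (adj_class (s (projl (endo_ftor T \<bullet> endo_ftor S \<bullet> a))))"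
      using closed adj_class_iso[OF sF[OF adT[OF adS]]] by (auto simp: hAdj_Obj)
  qed
  then interpret i: idem_pointed hAdj "comp_ftor (endo_ftor T) (endo_ftor S)"
     "\<lambda>x. adj_class (t (projl (endo_ftor S \<bullet> x))) \<circ>\<^bsub>hAdj\<^esub> adj_class (s (projl x))" .
  \<comment> \<open>The functor of a composite endofunctor and the composite of the functors agree
    only on objects and arrows of \<open>hAdj\<close>, not as records, so the abstract result is
    transported along these pointwise equations.\<close>
  have eq1: "endo_ftor (comp_endo T S) \<bullet> a = comp_ftor (endo_ftor T) (endo_ftor S) \<bullet> a" if "a \<in> Obj hAdj" for a
    using that by (auto simp: hAdj_Obj)
  have eq2: "endo_ftor (comp_endo T S) \<cdot> f = comp_ftor (endo_ftor T) (endo_ftor S) \<cdot> f" if "f \<in> Arr hAdj" for f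
  proof -
    obtain \<Upsilon> F G where f: "f = adj_class \<Upsilon>" and \<Upsilon>: "\<Upsilon> \<in> adj_hom F G"
      using \<open>f \<in> Arr hAdj\<close> by (auto simp: hAdj_Arr)
    show ?thesis
      by (simp add: f endo_ftor_class[OF eS \<Upsilon>] endo_ftor_class[OF eT endofunctorD(2)[OF eS \<Upsilon>]]
          endo_ftor_class[OF endofunctor_comp[OF eT eS] \<Upsilon>])
  qed
  have eq3: "adj_class (t (on_adj S (projl a)) \<odot> s (projl a)) =
      adj_class (t (projl (endo_ftor S \<bullet> a))) \<circ>\<^bsub>hAdj\<^esub> adj_class (s (projl a))" if "a \<in> Obj hAdj" for a
    using that by (auto simp: hAdj_Obj adj_class_comp[OF sF tF[OF adS]])
  show "idem_pointed hAdj (endo_ftor (comp_endo T S)) (\<lambda>x. adj_class (t (on_adj S (projl x)) \<odot> s (projl x)))"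
  proof
    fix a :: "'a adj + 'a adj_mor set" assume a: "a \<in> Obj hAdj"
    have Ta: "comp_ftor (endo_ftor T) (endo_ftor S) \<bullet> a \<in> Obj hAdj"
      by (rule i.ftor_simps(3)[OF a])
    show "adj_class (t (on_adj S (projl a)) \<odot> s (projl a)) \<in> Arr hAdj"
      "Dom hAdj (adj_class (t (on_adj S (projl a)) \<odot> s (projl a))) = a"
      "Cod hAdj (adj_class (t (on_adj S (projl a)) \<odot> s (projl a))) = endo_ftor (comp_endo T S) \<bullet> a"
      unfolding eq1[OF a] eq3[OF a] by (rule i.point[OF a])+
    show "iso_arrow hAdj (adj_class (t (on_adj S (projl (endo_ftor (comp_endo T S) \<bullet> a)))
        \<odot> s (projl (endo_ftor (comp_endo T S) \<bullet> a))))"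
      unfolding eq1[OF a] eq3[OF Ta] by (rule i.iso_point_T[OF a])
    show "iso_arrow hAdj (endo_ftor (comp_endo T S) \<cdot> adj_class (t (on_adj S (projl a)) \<odot> s (projl a)))"
      unfolding eq3[OF a] eq2[OF i.point(1)[OF a]] by (rule i.iso_T_point[OF a])
  next
    fix f :: "'a adj + 'a adj_mor set" assume f: "f \<in> Arr hAdj"
    show "adj_class (t (on_adj S (projl (Cod hAdj f))) \<odot> s (projl (Cod hAdj f))) \<circ>\<^bsub>hAdj\<^esub> f =
        endo_ftor (comp_endo T S) \<cdot> f \<circ>\<^bsub>hAdj\<^esub> adj_class (t (on_adj S (projl (Dom hAdj f))) \<odot> s (projl (Dom hAdj f)))"
      using i.point_nat[OF f] f by (simp only: eq2 eq3 category_simps(1,2)[OF hAdj_category])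
  qed (rule endo_ftor[OF endofunctor_comp[OF eT eS]])
qed

lemma idempotent_monadI:
  assumes it: "idem_pointed_endo T t"
  shows "idempotent_monad T t"
proof -
  interpret i: idem_pointed hAdj "endo_ftor T" "\<lambda>x. adj_class (t (projl x))"
    by (rule idem_pointed_hAdj[OF it])
  have T: "endofunctor T" and t: "adj_natural id_endo T t"
    using it unfolding idem_pointed_endo_def by blast+
  note tF = adj_naturalD(1)[OF t, simplified]
  note TF = endofunctorD(1)[OF T] and T\<Upsilon> = endofunctorD(2)[OF T]
  \<comment> \<open>A representative of the abstract multiplication; each monad law up to
    \<open>\<cong>\<close> is then the corresponding equation between classes.\<close>
  define \<mu> where "\<mu> F = adj_rep (i.mult (Inl F))" for F
  have \<mu>: "\<mu> F \<in> adj_hom (on_adj T (on_adj T F)) (on_adj T F)" "adj_class (\<mu> F) = i.mult (Inl F)"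
    if "adjunction F" for F
    using adj_rep_hAdj[of "i.mult (Inl F)" "on_adj T (on_adj T F)" "on_adj T F"] that
    by (simp_all add: \<mu>_def)
  have \<mu>_nat: "adj_natural (comp_endo T T) T \<mu>"
    unfolding adj_natural_def
  proof (intro conjI allI impI)
    fix F G and \<Upsilon> :: "'a adj_mor" assume \<Upsilon>: "\<Upsilon> \<in> adj_hom F G"
    note FG = adj_homD(3,4)[OF \<Upsilon>]
    note TT = T\<Upsilon>[OF T\<Upsilon>[OF \<Upsilon>]]
    have "adj_class (\<mu> G \<odot> on_mor T (on_mor T \<Upsilon>)) = adj_class (on_mor T \<Upsilon> \<odot> \<mu> F)"
      using i.mult_nat[of "adj_class \<Upsilon>"]
      by (simp add: adj_class_hAdj[OF \<Upsilon>] endo_ftor_class[OF T \<Upsilon>] endo_ftor_class[OF T T\<Upsilon>[OF \<Upsilon>]] \<mu>(2) FG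
          flip: adj_class_comp[OF TT \<mu>(1)[OF FG(2)]] adj_class_comp[OF \<mu>(1)[OF FG(1)] T\<Upsilon>[OF \<Upsilon>]])
    then show "\<mu> G \<odot> on_mor (comp_endo T T) \<Upsilon> \<cong> on_mor T \<Upsilon> \<odot> \<mu> F"
      using adj_class_isoI[OF _ comp_adj_hom[OF TT \<mu>(1)[OF FG(2)]]] by simp
  qed (simp add: \<mu>(1))
  have "\<mu> F \<odot> t (on_adj T F) \<cong> id_adj (on_adj T F) \<and> \<mu> F \<odot> on_mor T (t F) \<cong> id_adj (on_adj T F) \<and>
      \<mu> F \<odot> on_mor T (\<mu> F) \<cong> \<mu> F \<odot> \<mu> (on_adj T F)" if F: "adjunction F" for F
  proof (intro conjI)
    note h = tF[OF TF[OF F]] T\<Upsilon>[OF tF[OF F]] T\<Upsilon>[OF \<mu>(1)[OF F]] \<mu>(1)[OF TF[OF F]] \<mu>(1)[OF F]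
    note c = adj_class_isoI[OF _ comp_adj_hom[OF _ h(5)]]
    show "\<mu> F \<odot> t (on_adj T F) \<cong> id_adj (on_adj T F)"
      using i.mult_simps(5)[of "Inl F"] F
      by (intro c[OF _ h(1)]) (simp add: adj_class_id \<mu>(2) flip: adj_class_comp[OF h(1) h(5)])
    show "\<mu> F \<odot> on_mor T (t F) \<cong> id_adj (on_adj T F)"
      using i.mult_simps(6)[of "Inl F"] F
      by (intro c[OF _ h(2)])
        (simp add: adj_class_id \<mu>(2) endo_ftor_class[OF T tF[OF F]] flip: adj_class_comp[OF h(2) h(5)])
    show "\<mu> F \<odot> on_mor T (\<mu> F) \<cong> \<mu> F \<odot> \<mu> (on_adj T F)"
      using i.mult_assoc[of "Inl F"] F TF
      by (intro c[OF _ h(3)])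
        (simp add: \<mu>(2) flip: endo_ftor_class[OF T \<mu>(1)[OF F]] adj_class_comp[OF h(3) h(5)] adj_class_comp[OF h(4) h(5)])
  qed
  then have "adj_monad T t \<mu>"
    unfolding adj_monad_def using T t \<mu>_nat by blast
  moreover have "adj_equivalence (\<mu> F)" if "adjunction F" for F
    using adj_class_iso[OF \<mu>(1)[OF that]] that by (simp add: \<mu>(2))
  ultimately show ?thesis
    unfolding idempotent_monad_def by blast
qed

text \<open>What has to be verified about the concrete constructions. For \<open>N\<close> only the
  typing of its action and the naturality of \<open>p\<close> and \<open>q\<close> are required;
  that it respects \<open>\<cong>\<close>, identities and composition is derived.\<close>

locale formal_nucleus =
  fixes M C N :: "'u adj_endo" and m c p q n :: "'u adj \<Rightarrow> 'u adj_mor"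
  assumes M: "idem_pointed_endo M m" and C: "idem_pointed_endo C c"
    and N_adj: "adjunction F \<Longrightarrow> adjunction (on_adj N F)"
    and N_mor: "\<Upsilon> \<in> adj_hom F G \<Longrightarrow> on_mor N \<Upsilon> \<in> adj_hom (on_adj N F) (on_adj N G)"
    and p: "adj_natural M N p" and q: "adj_natural C N q"
    and m_N: "adjunction F \<Longrightarrow> adj_equivalence (m (on_adj N F))"
    and c_N: "adjunction F \<Longrightarrow> adj_equivalence (c (on_adj N F))"
    and C_p: "adjunction F \<Longrightarrow> adj_equivalence (on_mor C (p F))"
    and M_q: "adjunction F \<Longrightarrow> adj_equivalence (on_mor M (q F))"
    and n: "adjunction F \<Longrightarrow> n F \<cong> p F \<odot> m F" "adjunction F \<Longrightarrow> n F \<cong> q F \<odot> c F"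
begin

sublocale M: idem_pointed hAdj "endo_ftor M" "\<lambda>x. adj_class (m (projl x))"
  by (rule idem_pointed_hAdj[OF M])

sublocale C: idem_pointed hAdj "endo_ftor C" "\<lambda>x. adj_class (c (projl x))"
  by (rule idem_pointed_hAdj[OF C])

lemma endofunctors: "endofunctor M" "endofunctor C"
  using M C by (auto simp: idem_pointed_endo_def)

lemma naturals: "adj_natural id_endo M m" "adj_natural id_endo C c"
  using M C by (auto simp: idem_pointed_endo_def)

lemmas M_adj = endofunctorD(1)[OF endofunctors(1)] and C_adj = endofunctorD(1)[OF endofunctors(2)]
lemmas M_mor = endofunctorD(2)[OF endofunctors(1)] and C_mor = endofunctorD(2)[OF endofunctors(2)]
lemmas m_hom = adj_naturalD(1)[OF naturals(1), simplified] and c_hom = adj_naturalD(1)[OF naturals(2), simplified]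
lemmas p_hom = adj_naturalD(1)[OF p] and q_hom = adj_naturalD(1)[OF q]

text \<open>\<open>p F\<close> is inverted by \<open>C\<close> and \<open>on_adj N G\<close> is
  \<open>C\<close>-local, so a morphism between nuclei is determined up to \<open>\<cong>\<close> by
  its restriction along \<open>p F\<close>.\<close>

lemma N_unique:
  assumes F: "adjunction F" and f: "f \<in> adj_hom (on_adj N F) (on_adj N G)" "g \<in> adj_hom (on_adj N F) (on_adj N G)"
    and G: "adjunction G"
    and eq: "adj_class f \<circ>\<^bsub>hAdj\<^esub> adj_class (p F) = adj_class g \<circ>\<^bsub>hAdj\<^esub> adj_class (p F)"
  shows "f \<cong> g"
proof -
  have "adj_class f = adj_class g"
    by (rule C.local_cancel[of "adj_class (p F)"])
      (use F G eq C_p[OF F] c_N[OF G] adj_class_iso[OF C_mor[OF p_hom[OF F]]] adj_class_iso[OF c_hom[OF N_adj[OF G]]] in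
        \<open>auto simp: adj_class_hAdj[OF f(1)] adj_class_hAdj[OF f(2)] adj_class_hAdj[OF p_hom[OF F]]
          endo_ftor_class[OF endofunctors(2) p_hom[OF F]]\<close>)
  then show ?thesis
    using adj_class_isoI f(1) by blast
qed

lemma p_class:
  assumes \<Upsilon>: "\<Upsilon> \<in> adj_hom F G"
  shows "adj_class (on_mor N \<Upsilon>) \<circ>\<^bsub>hAdj\<^esub> adj_class (p F) = adj_class (p G) \<circ>\<^bsub>hAdj\<^esub> adj_class (on_mor M \<Upsilon>)"
  using adj_natural_class[OF p \<Upsilon> M_mor[OF \<Upsilon>] N_mor[OF \<Upsilon>]] by simp

text \<open>Each law is restricted along \<open>p F\<close>, where naturality of \<open>p\<close>
  turns it into the same law for \<open>M\<close>; \<open>N_unique\<close> lifts it back.\<close>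

lemma endofunctor_N: "endofunctor N"
  unfolding endofunctor_def
proof (intro conjI allI impI)
  fix F :: "'u adj" assume F: "adjunction F"
  show "adjunction (on_adj N F)"
    by (rule N_adj[OF F])
  have "adj_class (on_mor N (id_adj F)) \<circ>\<^bsub>hAdj\<^esub> adj_class (p F) =
      adj_class (p F) \<circ>\<^bsub>hAdj\<^esub> adj_class (id_adj (on_adj M F))"
    using p_class[OF id_adj_hom[OF F]] adj_class_cong[OF endofunctorD(4)[OF endofunctors(1) F]] by simp
  also have "\<dots> = adj_class (id_adj (on_adj N F)) \<circ>\<^bsub>hAdj\<^esub> adj_class (p F)"
    using F N_adj[OF F] M_adj[OF F] by (simp add: adj_class_hAdj[OF p_hom[OF F]] flip: adj_class_id)
  finally show "on_mor N (id_adj F) \<cong> id_adj (on_adj N F)"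
    by (rule N_unique[OF F N_mor[OF id_adj_hom[OF F]] id_adj_hom[OF N_adj[OF F]] F])
next
  fix F G and \<Upsilon> :: "'u adj_mor" assume \<Upsilon>: "\<Upsilon> \<in> adj_hom F G"
  show "on_mor N \<Upsilon> \<in> adj_hom (on_adj N F) (on_adj N G)"
    by (rule N_mor[OF \<Upsilon>])
next
  fix \<Upsilon> \<Upsilon>' :: "'u adj_mor" assume iso: "\<Upsilon> \<cong> \<Upsilon>'"
  then obtain F G where \<Upsilon>: "\<Upsilon> \<in> adj_hom F G"
    using adj_iso_homD by blast
  then have \<Upsilon>': "\<Upsilon>' \<in> adj_hom F G"
    using adj_iso_hom[OF iso] by blast
  show "on_mor N \<Upsilon> \<cong> on_mor N \<Upsilon>'"
    by (rule N_unique[OF adj_homD(3)[OF \<Upsilon>] N_mor[OF \<Upsilon>] N_mor[OF \<Upsilon>'] adj_homD(4)[OF \<Upsilon>]])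
      (simp add: p_class[OF \<Upsilon>] p_class[OF \<Upsilon>'] adj_class_cong[OF endofunctorD(3)[OF endofunctors(1) iso]])
next
  fix F G L and \<Upsilon> \<Psi> :: "'u adj_mor" assume \<Upsilon>: "\<Upsilon> \<in> adj_hom F G" and \<Psi>: "\<Psi> \<in> adj_hom G L"
  note FG = adj_homD(3)[OF \<Upsilon>] adj_homD(3,4)[OF \<Psi>]
  note ty = adj_class_hAdj[OF p_hom[OF FG(1)]] adj_class_hAdj[OF p_hom[OF FG(2)]] adj_class_hAdj[OF p_hom[OF FG(3)]]
    adj_class_hAdj[OF N_mor[OF \<Upsilon>]] adj_class_hAdj[OF N_mor[OF \<Psi>]] adj_class_hAdj[OF M_mor[OF \<Upsilon>]] adj_class_hAdj[OF M_mor[OF \<Psi>]]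
  have "adj_class (on_mor N (\<Psi> \<odot> \<Upsilon>)) \<circ>\<^bsub>hAdj\<^esub> adj_class (p F) =
      adj_class (p L) \<circ>\<^bsub>hAdj\<^esub> (adj_class (on_mor M \<Psi>) \<circ>\<^bsub>hAdj\<^esub> adj_class (on_mor M \<Upsilon>))"
    using p_class[OF comp_adj_hom[OF \<Upsilon> \<Psi>]] adj_class_cong[OF endofunctorD(5)[OF endofunctors(1) \<Upsilon> \<Psi>]]
    by (simp add: adj_class_comp[OF M_mor[OF \<Upsilon>] M_mor[OF \<Psi>]])
  also have "\<dots> = (adj_class (on_mor N \<Psi>) \<circ>\<^bsub>hAdj\<^esub> adj_class (on_mor N \<Upsilon>)) \<circ>\<^bsub>hAdj\<^esub> adj_class (p F)"
    using p_class[OF \<Upsilon>] precomp[OF p_class[OF \<Psi>], of "adj_class (on_mor M \<Upsilon>)"] by (simp add: ty)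
  finally show "on_mor N (\<Psi> \<odot> \<Upsilon>) \<cong> on_mor N \<Psi> \<odot> on_mor N \<Upsilon>"
    by (intro N_unique[OF FG(1) N_mor[OF comp_adj_hom[OF \<Upsilon> \<Psi>]] comp_adj_hom[OF N_mor[OF \<Upsilon>] N_mor[OF \<Psi>]] FG(3)])
      (simp add: adj_class_comp[OF N_mor[OF \<Upsilon>] N_mor[OF \<Psi>]])
qed

text \<open>Stated for a general pair of endofunctors so that it serves both sides of the
  square.\<close>

lemma cover_aux:
  assumes T: "idem_pointed_endo T t" and P: "endofunctor P" and r: "adj_natural P N r"
    and t_N: "\<And>F. adjunction F \<Longrightarrow> adj_equivalence (t (on_adj N F))"
    and T_r: "\<And>F. adjunction F \<Longrightarrow> adj_equivalence (on_mor T (r F))"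
  shows "local_cover hAdj (endo_ftor T) (\<lambda>x. adj_class (t (projl x))) (endo_ftor P) (endo_ftor N)
    (\<lambda>x. adj_class (r (projl x)))"
proof -
  have eT: "endofunctor T" and t: "adj_natural id_endo T t"
    using T by (auto simp: idem_pointed_endo_def)
  note rF = adj_naturalD(1)[OF r] and tF = adj_naturalD(1)[OF t, simplified]
  interpret T: idem_pointed hAdj "endo_ftor T" "\<lambda>x. adj_class (t (projl x))"
    by (rule idem_pointed_hAdj[OF T])
  show ?thesis
  proof
    show "is_functor hAdj hAdj (endo_ftor P)" "is_functor hAdj hAdj (endo_ftor N)"
      by (rule endo_ftor[OF P] endo_ftor[OF endofunctor_N])+
    fix a :: "'u adj + 'u adj_mor set" assume "a \<in> Obj hAdj"
    then obtain F where [simp]: "a = Inl F" and F: "adjunction F"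
      by (auto simp: hAdj_Obj)
    show "adj_class (r (projl a)) \<in> Arr hAdj" "Dom hAdj (adj_class (r (projl a))) = endo_ftor P \<bullet> a"
      "Cod hAdj (adj_class (r (projl a))) = endo_ftor N \<bullet> a"
      using adj_class_hAdj[OF rF[OF F]] by simp_all
    show "iso_arrow hAdj (adj_class (t (projl (endo_ftor N \<bullet> a))))"
      using adj_class_iso[OF tF[OF N_adj[OF F]]] t_N[OF F] by simp
    show "iso_arrow hAdj (endo_ftor T \<cdot> adj_class (r (projl a)))"
      using adj_class_iso[OF endofunctorD(2)[OF eT rF[OF F]]] T_r[OF F] by (simp add: endo_ftor_class[OF eT rF[OF F]])
  next
    fix f :: "'u adj + 'u adj_mor set" assume "f \<in> Arr hAdj"
    then obtain \<Upsilon> F G where [simp]: "f = adj_class \<Upsilon>" and \<Upsilon>: "\<Upsilon> \<in> adj_hom F G"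
      by (auto simp: hAdj_Arr)
    show "adj_class (r (projl (Cod hAdj f))) \<circ>\<^bsub>hAdj\<^esub> endo_ftor P \<cdot> f =
        endo_ftor N \<cdot> f \<circ>\<^bsub>hAdj\<^esub> adj_class (r (projl (Dom hAdj f)))"
      using adj_natural_class[OF r \<Upsilon> endofunctorD(2)[OF P \<Upsilon>] N_mor[OF \<Upsilon>]]
      by (simp add: adj_class_hAdj[OF \<Upsilon>] endo_ftor_class[OF P \<Upsilon>] endo_ftor_class[OF endofunctor_N \<Upsilon>])
  qed
qed

lemma n_class:
  assumes F: "adjunction F"
  shows "adj_class (n F) = adj_class (p F) \<circ>\<^bsub>hAdj\<^esub> adj_class (m F)"
    "adj_class (n F) = adj_class (q F) \<circ>\<^bsub>hAdj\<^esub> adj_class (c F)"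
  using adj_class_cong[OF n(1)[OF F]] adj_class_cong[OF n(2)[OF F]]
  by (simp_all add: adj_class_comp[OF m_hom[OF F] p_hom[OF F]] adj_class_comp[OF c_hom[OF F] q_hom[OF F]])

sublocale P: local_cover hAdj "endo_ftor C" "\<lambda>x. adj_class (c (projl x))" "endo_ftor M" "endo_ftor N"
    "\<lambda>x. adj_class (p (projl x))"
  by (rule cover_aux[OF C endofunctors(1) p c_N C_p])

sublocale Q: local_cover hAdj "endo_ftor M" "\<lambda>x. adj_class (m (projl x))" "endo_ftor C" "endo_ftor N"
    "\<lambda>x. adj_class (q (projl x))"
  by (rule cover_aux[OF M endofunctors(2) q m_N M_q])

lemma nucleus_square_hAdj:
  "nucleus_square hAdj (endo_ftor M) (\<lambda>x. adj_class (m (projl x))) (endo_ftor C) (\<lambda>x. adj_class (c (projl x)))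
    (endo_ftor N) (\<lambda>x. adj_class (p (projl x))) (\<lambda>x. adj_class (q (projl x))) (\<lambda>x. adj_class (n (projl x)))"
proof
  fix a :: "'u adj + 'u adj_mor set" assume "a \<in> Obj hAdj"
  then obtain F where a: "a = Inl F" and F: "adjunction F"
    by (auto simp: hAdj_Obj)
  show "adj_class (n (projl a)) = adj_class (p (projl a)) \<circ>\<^bsub>hAdj\<^esub> adj_class (m (projl a))"
    using n_class(1)[OF F] by (simp add: a)
  show "adj_class (n (projl a)) = adj_class (q (projl a)) \<circ>\<^bsub>hAdj\<^esub> adj_class (c (projl a))"
    using n_class(2)[OF F] by (simp add: a)
qed

lemma idem_pointed_N: "idem_pointed_endo N n"
proof (rule idem_pointed_endoI[OF endofunctor_N])
  show "n F \<in> adj_hom F (on_adj N F)" if "adjunction F" for F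
    using adj_iso_hom[OF n(1)[OF that]] comp_adj_hom[OF m_hom p_hom] that by blast
qed (rule nucleus_square.idem_pointed_N[OF nucleus_square_hAdj])

text \<open>Turns natural isomorphisms between functors on \<open>hAdj\<close>, given by arrows
  \<open>e F\<close>, into natural equivalences by choosing representatives.\<close>

lemma natural_equivalenceI:
  assumes S: "endofunctor S" and T: "endofunctor T"
    and e: "\<And>F. adjunction F \<Longrightarrow> e F \<in> Arr hAdj \<and> Dom hAdj (e F) = Inl (on_adj S F) \<and>
        Cod hAdj (e F) = Inl (on_adj T F) \<and> iso_arrow hAdj (e F)"
    and nat: "\<And>\<Upsilon> F G. \<Upsilon> \<in> adj_hom F G \<Longrightarrow>
        e G \<circ>\<^bsub>hAdj\<^esub> adj_class (on_mor S \<Upsilon>) = adj_class (on_mor T \<Upsilon>) \<circ>\<^bsub>hAdj\<^esub> e F"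
  shows "natural_equivalence S T (\<lambda>F. adj_rep (e F))"
    "adjunction F \<Longrightarrow> adj_class (adj_rep (e F)) = e F"
    "adjunction F \<Longrightarrow> adj_rep (e F) \<in> adj_hom (on_adj S F) (on_adj T F)"
proof -
  have E: "adj_rep (e F) \<in> adj_hom (on_adj S F) (on_adj T F)" "adj_class (adj_rep (e F)) = e F"
    if "adjunction F" for F
    using adj_rep_hAdj[of "e F"] e[OF that] by auto
  then show "adjunction F \<Longrightarrow> adj_class (adj_rep (e F)) = e F"
    "adjunction F \<Longrightarrow> adj_rep (e F) \<in> adj_hom (on_adj S F) (on_adj T F)" by auto
  have "adj_rep (e G) \<odot> on_mor S \<Upsilon> \<cong> on_mor T \<Upsilon> \<odot> adj_rep (e F)" if \<Upsilon>: "\<Upsilon> \<in> adj_hom F G" for F G \<Upsilon>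
  proof -
    note FG = adj_homD(3,4)[OF \<Upsilon>] and ST = endofunctorD(2)[OF S \<Upsilon>] endofunctorD(2)[OF T \<Upsilon>]
    show ?thesis
      using nat[OF \<Upsilon>] adj_class_isoI[OF _ comp_adj_hom[OF ST(1) E(1)[OF FG(2)]]]
      by (simp add: E(2) FG flip: adj_class_comp[OF ST(1) E(1)[OF FG(2)]] adj_class_comp[OF E(1)[OF FG(1)] ST(2)])
  qed
  moreover have "adj_equivalence (adj_rep (e F))" if "adjunction F" for F
    using adj_class_iso[OF E(1)[OF that]] E(2)[OF that] e[OF that] by simp
  ultimately show "natural_equivalence S T (\<lambda>F. adj_rep (e F))"
    unfolding natural_equivalence_def adj_natural_def using E(1) by blast
qed

lemma natural_equivalence_comp:
  assumes S: "endofunctor S" and T: "endofunctor T" and R: "endofunctor R"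
    and E: "natural_equivalence S T E" and D: "natural_equivalence T R D"
  shows "natural_equivalence S R (\<lambda>F. D F \<odot> E F)"
proof -
  have En: "adj_natural S T E" and Dn: "adj_natural T R D"
    and w: "adjunction F \<Longrightarrow> adj_equivalence (E F)" "adjunction F \<Longrightarrow> adj_equivalence (D F)" for F
    using E D by (auto simp: natural_equivalence_def)
  note EF = adj_naturalD(1)[OF En] and DF = adj_naturalD(1)[OF Dn]
  have nat: "(D G \<odot> E G) \<odot> on_mor S \<Upsilon> \<cong> on_mor R \<Upsilon> \<odot> (D F \<odot> E F)" if \<Upsilon>: "\<Upsilon> \<in> adj_hom F G" for F G \<Upsilon>
  proof -
    note FG = adj_homD(3,4)[OF \<Upsilon>]
    note h = endofunctorD(2)[OF S \<Upsilon>] endofunctorD(2)[OF T \<Upsilon>] endofunctorD(2)[OF R \<Upsilon>]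
      EF[OF FG(1)] EF[OF FG(2)] DF[OF FG(1)] DF[OF FG(2)]
    note ty = adj_class_hAdj[OF h(1)] adj_class_hAdj[OF h(2)] adj_class_hAdj[OF h(3)] adj_class_hAdj[OF h(4)]
      adj_class_hAdj[OF h(5)] adj_class_hAdj[OF h(6)] adj_class_hAdj[OF h(7)]
    have "adj_class (D G) \<circ>\<^bsub>hAdj\<^esub> (adj_class (E G) \<circ>\<^bsub>hAdj\<^esub> adj_class (on_mor S \<Upsilon>)) =
        (adj_class (D G) \<circ>\<^bsub>hAdj\<^esub> adj_class (on_mor T \<Upsilon>)) \<circ>\<^bsub>hAdj\<^esub> adj_class (E F)"
      by (simp add: adj_natural_class[OF En \<Upsilon> h(1,2)] ty)
    also have "\<dots> = adj_class (on_mor R \<Upsilon>) \<circ>\<^bsub>hAdj\<^esub> (adj_class (D F) \<circ>\<^bsub>hAdj\<^esub> adj_class (E F))"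
      by (simp add: adj_natural_class[OF Dn \<Upsilon> h(2,3)] ty)
    finally have "adj_class ((D G \<odot> E G) \<odot> on_mor S \<Upsilon>) = adj_class (on_mor R \<Upsilon> \<odot> (D F \<odot> E F))"
      by (simp add: ty flip: adj_class_comp[OF h(1) comp_adj_hom[OF h(5,7)]] adj_class_comp[OF h(5,7)]
         adj_class_comp[OF comp_adj_hom[OF h(4,6)] h(3)] adj_class_comp[OF h(4,6)])
    then show ?thesis
      by (rule adj_class_isoI[OF _ comp_adj_hom[OF h(1) comp_adj_hom[OF h(5,7)]]])
  qed
  have "adj_equivalence (D F \<odot> E F)" if F: "adjunction F" for F
    using w[OF F] adj_class_iso[OF EF[OF F]] adj_class_iso[OF DF[OF F]]
      adj_class_iso[OF comp_adj_hom[OF EF[OF F] DF[OF F]]]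
    by (simp add: iso_Comp(1) adj_class_hAdj[OF EF[OF F]] adj_class_hAdj[OF DF[OF F]]
       flip: adj_class_comp[OF EF[OF F] DF[OF F]])
  then show ?thesis
    unfolding natural_equivalence_def adj_natural_def using nat comp_adj_hom[OF EF DF] by blast
qed

theorem nucleus_equivalences:
  "\<exists>E1 E2. natural_equivalence (comp_endo C M) N E1 \<and> natural_equivalence N (comp_endo M C) E2 \<and>
    natural_equivalence (comp_endo C M) (comp_endo M C) (\<lambda>F. E2 F \<odot> E1 F) \<and>
    (\<forall>F. adjunction F \<longrightarrow> E1 F \<odot> c (on_adj M F) \<cong> p F \<and> E2 F \<odot> q F \<cong> m (on_adj C F))"
proof -
  note eM = endofunctors(1) and eC = endofunctors(2)
  note eCM = endofunctor_comp[OF eC eM] and eMC = endofunctor_comp[OF eM eC]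
  \<comment> \<open>The two comparisons between reflections: from \<open>C\<close> of
    \<open>M F\<close> to the nucleus as it stands, and from \<open>M\<close> of \<open>C F\<close>
    to the nucleus, inverted to obtain the direction asked for.\<close>
  let ?e1 = "\<lambda>F. P.cmp (Inl F)" and ?e2 = "\<lambda>F. inverse_arrow hAdj (Q.cmp (Inl F))"
  have e1: "?e1 F \<in> Arr hAdj \<and> Dom hAdj (?e1 F) = Inl (on_adj (comp_endo C M) F) \<and>
      Cod hAdj (?e1 F) = Inl (on_adj N F) \<and> iso_arrow hAdj (?e1 F)" if "adjunction F" for F
    using that by simp
  have e1n: "?e1 G \<circ>\<^bsub>hAdj\<^esub> adj_class (on_mor (comp_endo C M) \<Upsilon>) = adj_class (on_mor N \<Upsilon>) \<circ>\<^bsub>hAdj\<^esub> ?e1 F"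
    if \<Upsilon>: "\<Upsilon> \<in> adj_hom F G" for F G \<Upsilon>
    using P.cmp_nat[of "adj_class \<Upsilon>"]
    by (simp add: adj_class_hAdj[OF \<Upsilon>] endo_ftor_class[OF eM \<Upsilon>] endo_ftor_class[OF eC M_mor[OF \<Upsilon>]]
       endo_ftor_class[OF endofunctor_N \<Upsilon>])
  have e2: "?e2 F \<in> Arr hAdj \<and> Dom hAdj (?e2 F) = Inl (on_adj N F) \<and>
      Cod hAdj (?e2 F) = Inl (on_adj (comp_endo M C) F) \<and> iso_arrow hAdj (?e2 F)" if "adjunction F" for F
    using that by simp
  have e2n: "?e2 G \<circ>\<^bsub>hAdj\<^esub> adj_class (on_mor N \<Upsilon>) = adj_class (on_mor (comp_endo M C) \<Upsilon>) \<circ>\<^bsub>hAdj\<^esub> ?e2 F"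
    if \<Upsilon>: "\<Upsilon> \<in> adj_hom F G" for F G \<Upsilon>
  proof -
    note FG = adj_homD(3,4)[OF \<Upsilon>]
    note ty = adj_class_hAdj[OF N_mor[OF \<Upsilon>]] adj_class_hAdj[OF M_mor[OF C_mor[OF \<Upsilon>]]]
    have nat: "Q.cmp (Inl G) \<circ>\<^bsub>hAdj\<^esub> adj_class (on_mor M (on_mor C \<Upsilon>)) = adj_class (on_mor N \<Upsilon>) \<circ>\<^bsub>hAdj\<^esub> Q.cmp (Inl F)"
      using Q.cmp_nat[of "adj_class \<Upsilon>"]
      by (simp add: adj_class_hAdj[OF \<Upsilon>] endo_ftor_class[OF eC \<Upsilon>] endo_ftor_class[OF eM C_mor[OF \<Upsilon>]]
         endo_ftor_class[OF endofunctor_N \<Upsilon>])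
    have "?e2 G \<circ>\<^bsub>hAdj\<^esub> adj_class (on_mor N \<Upsilon>) =
        ?e2 G \<circ>\<^bsub>hAdj\<^esub> ((adj_class (on_mor N \<Upsilon>) \<circ>\<^bsub>hAdj\<^esub> Q.cmp (Inl F)) \<circ>\<^bsub>hAdj\<^esub> ?e2 F)"
      using FG by (simp add: ty)
    also have "\<dots> = adj_class (on_mor M (on_mor C \<Upsilon>)) \<circ>\<^bsub>hAdj\<^esub> ?e2 F"
      unfolding nat[symmetric] using FG by (simp add: ty)
    finally show ?thesis
      by simp
  qed
  have E1: "natural_equivalence (comp_endo C M) N (\<lambda>F. adj_rep (?e1 F))"
    "\<And>F. adjunction F \<Longrightarrow> adj_class (adj_rep (?e1 F)) = ?e1 F"
    "\<And>F. adjunction F \<Longrightarrow> adj_rep (?e1 F) \<in> adj_hom (on_adj (comp_endo C M) F) (on_adj N F)"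
    by (rule natural_equivalenceI[OF eCM endofunctor_N e1 e1n]; assumption)+
  have E2: "natural_equivalence N (comp_endo M C) (\<lambda>F. adj_rep (?e2 F))"
    "\<And>F. adjunction F \<Longrightarrow> adj_class (adj_rep (?e2 F)) = ?e2 F"
    "\<And>F. adjunction F \<Longrightarrow> adj_rep (?e2 F) \<in> adj_hom (on_adj N F) (on_adj (comp_endo M C) F)"
    by (rule natural_equivalenceI[OF endofunctor_N eMC e2 e2n]; assumption)+
  have "adj_rep (?e1 F) \<odot> c (on_adj M F) \<cong> p F \<and> adj_rep (?e2 F) \<odot> q F \<cong> m (on_adj C F)" if F: "adjunction F" for F
  proof
    note h = c_hom[OF M_adj[OF F]] E1(3)[OF F, simplified] q_hom[OF F] E2(3)[OF F, simplified] m_hom[OF C_adj[OF F]]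
    show "adj_rep (?e1 F) \<odot> c (on_adj M F) \<cong> p F"
      by (rule adj_class_isoI[OF _ comp_adj_hom[OF h(1,2)]])
        (use P.cmp_point[of "Inl F"] F E1(2)[OF F] in \<open>simp flip: adj_class_comp[OF h(1,2)]\<close>)
    have "?e2 F \<circ>\<^bsub>hAdj\<^esub> adj_class (q F) = ?e2 F \<circ>\<^bsub>hAdj\<^esub> (Q.cmp (Inl F) \<circ>\<^bsub>hAdj\<^esub> adj_class (m (on_adj C F)))"
      using Q.cmp_point[of "Inl F"] F by simp
    also have "\<dots> = adj_class (m (on_adj C F))"
      using F by (simp add: adj_class_hAdj[OF h(5)])
    finally show "adj_rep (?e2 F) \<odot> q F \<cong> m (on_adj C F)"
      by (intro adj_class_isoI[OF _ comp_adj_hom[OF h(3,4)]])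
        (use E2(2)[OF F] in \<open>simp flip: adj_class_comp[OF h(3,4)]\<close>)
  qed
  then show ?thesis
    using E1(1) E2(1) natural_equivalence_comp[OF eCM endofunctor_N eMC E1(1) E2(1)] by blast
qed

end

section \<open>Idempotent completion\<close>

lemma idem_iff: "e \<in> idem C \<longleftrightarrow> e \<in> Arr C \<and> Cod C e = Dom C e \<and> e \<circ>\<^bsub>C\<^esub> e = e"
  by (auto simp: idem_def hom_iff)

lemma idemI: "\<lbrakk>e \<in> Arr C; Cod C e = Dom C e; e \<circ>\<^bsub>C\<^esub> e = e\<rbrakk> \<Longrightarrow> e \<in> idem C"
  by (simp add: idem_iff)

lemma idem_simps [simp]:
  assumes "e \<in> idem C"
  shows "e \<in> Arr C" "Cod C e = Dom C e" "e \<circ>\<^bsub>C\<^esub> e = e"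
    "\<lbrakk>category C; x \<in> Arr C; Cod C x = Dom C e\<rbrakk> \<Longrightarrow> e \<circ>\<^bsub>C\<^esub> (e \<circ>\<^bsub>C\<^esub> x) = e \<circ>\<^bsub>C\<^esub> x"
  using assms by (auto simp: idem_iff intro: precomp)

lemma One_idem [simp]: "category C \<Longrightarrow> a \<in> Obj C \<Longrightarrow> One C a \<in> idem C"
  unfolding idem_iff by simp

lemma (in ftor) ftor_idem [simp]: "e \<in> idem A \<Longrightarrow> F \<cdot> e \<in> idem B"
  unfolding idem_iff by (auto simp flip: ftor_simps(8))

lemmas adjunction_idem [simp] =
  ftor.ftor_idem[OF adjunction_ftors(1)] ftor.ftor_idem[OF adjunction_ftors(2)]

lemma karoubi_simps [simp]:
  "Obj (karoubi C) = idem C" "Dom (karoubi C) = src" "Cod (karoubi C) = tgt"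
  "One (karoubi C) e = Arrow e e e" "g \<circ>\<^bsub>karoubi C\<^esub> f = Arrow (src f) (und g \<circ>\<^bsub>C\<^esub> und f) (tgt g)"
  by (simp_all add: karoubi_def)

text \<open>The single condition \<open>e' f e = f\<close> is split into absorption on either side,
  by multiplying with \<open>e\<close> and \<open>e'\<close>. The one-sided equations can be used
  for rewriting separately.\<close>

lemma Arrow_karoubi [simp]:
  assumes "category C"
  shows "Arrow e f e' \<in> Arr (karoubi C) \<longleftrightarrow> e \<in> idem C \<and> e' \<in> idem C \<and> f \<in> Arr C \<and>
    Dom C f = Dom C e \<and> Cod C f = Dom C e' \<and> f \<circ>\<^bsub>C\<^esub> e = f \<and> e' \<circ>\<^bsub>C\<^esub> f = f" (is "_ \<longleftrightarrow> ?R")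
proof -
  note [simp] = assms
  have "Arrow e f e' \<in> Arr (karoubi C) \<longleftrightarrow> e \<in> idem C \<and> e' \<in> idem C \<and> f \<in> Arr C \<and>
    Dom C f = Dom C e \<and> Cod C f = Dom C e' \<and> e' \<circ>\<^bsub>C\<^esub> (f \<circ>\<^bsub>C\<^esub> e) = f"
    by (simp add: karoubi_def hom_iff)
  also have "\<dots> \<longleftrightarrow> ?R"
  proof (intro conj_cong refl iffI conjI)
    assume *: "e \<in> idem C" "e' \<in> idem C" "f \<in> Arr C" "Dom C f = Dom C e" "Cod C f = Dom C e'"
      "e' \<circ>\<^bsub>C\<^esub> (f \<circ>\<^bsub>C\<^esub> e) = f"
    have "(e' \<circ>\<^bsub>C\<^esub> (f \<circ>\<^bsub>C\<^esub> e)) \<circ>\<^bsub>C\<^esub> e = e' \<circ>\<^bsub>C\<^esub> (f \<circ>\<^bsub>C\<^esub> e)"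
      "e' \<circ>\<^bsub>C\<^esub> (e' \<circ>\<^bsub>C\<^esub> (f \<circ>\<^bsub>C\<^esub> e)) = e' \<circ>\<^bsub>C\<^esub> (f \<circ>\<^bsub>C\<^esub> e)"
      using *(1-5) by simp_all
    then show "f \<circ>\<^bsub>C\<^esub> e = f" "e' \<circ>\<^bsub>C\<^esub> f = f"
      unfolding *(6) by simp_all
  qed auto
  finally show ?thesis .
qed

lemma karoubi_cases:
  assumes "category C" "x \<in> Arr (karoubi C)"
  obtains e f e' where "x = Arrow e f e'" "e \<in> idem C" "e' \<in> idem C" "f \<in> Arr C"
    "Dom C f = Dom C e" "Cod C f = Dom C e'" "f \<circ>\<^bsub>C\<^esub> e = f" "e' \<circ>\<^bsub>C\<^esub> f = f"
proof -
  obtain e f e' where x: "x = Arrow e f e'"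
    using assms(2) by (auto simp: karoubi_def)
  show thesis
    by (rule that[OF x]) (use assms(2) in \<open>auto simp: x assms(1)\<close>)
qed

lemma category_karoubi [simp]:
  assumes C: "category C"
  shows "category (karoubi C)"
proof (rule categoryI)
  note [simp] = C
  fix f assume f: "f \<in> Arr (karoubi C)"
  then show "Dom (karoubi C) f \<in> Obj (karoubi C) \<and> Cod (karoubi C) f \<in> Obj (karoubi C)"
    "f \<circ>\<^bsub>karoubi C\<^esub> One (karoubi C) (Dom (karoubi C) f) = f \<and>
     One (karoubi C) (Cod (karoubi C) f) \<circ>\<^bsub>karoubi C\<^esub> f = f"
    by (auto elim!: karoubi_cases[OF C])
  fix g assume g: "g \<in> Arr (karoubi C)" "Dom (karoubi C) g = Cod (karoubi C) f"
  show "g \<circ>\<^bsub>karoubi C\<^esub> f \<in> Arr (karoubi C) \<and> Dom (karoubi C) (g \<circ>\<^bsub>karoubi C\<^esub> f) = Dom (karoubi C) f \<and>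
     Cod (karoubi C) (g \<circ>\<^bsub>karoubi C\<^esub> f) = Cod (karoubi C) g"
    using f g by (elim karoubi_cases[OF C]) (simp add: precomp)
  fix h assume "h \<in> Arr (karoubi C)" "Dom (karoubi C) h = Cod (karoubi C) g"
  then show "(h \<circ>\<^bsub>karoubi C\<^esub> g) \<circ>\<^bsub>karoubi C\<^esub> f = h \<circ>\<^bsub>karoubi C\<^esub> (g \<circ>\<^bsub>karoubi C\<^esub> f)"
    using f g by (elim karoubi_cases[OF C]) simp
qed (use C in auto)

lemma karoubi_isoI:
  assumes "category C" "Arrow e f e' \<in> Arr (karoubi C)" "Arrow e' g e \<in> Arr (karoubi C)"
    "g \<circ>\<^bsub>C\<^esub> f = e" "f \<circ>\<^bsub>C\<^esub> g = e'"
  shows "iso_arrow (karoubi C) (Arrow e f e')"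
  using assms by (intro iso_arrowI[of _ _ "Arrow e' g e"]) auto

section \<open>Lifting functors, adjunctions and morphisms to the completion\<close>

lemma lift_ftor_simps [simp]:
  "lift_ftor F \<bullet> e = F \<cdot> e" "lift_ftor F \<cdot> Arrow e f e' = Arrow (F \<cdot> e) (F \<cdot> f) (F \<cdot> e')"
  by (simp_all add: lift_ftor_def)

lemma lift_ftor_comp: "comp_ftor (lift_ftor G) (lift_ftor F) = lift_ftor (comp_ftor G F)"
  by (simp add: lift_ftor_def comp_ftor_def comp_def)

lemma lift_ftor:
  assumes "is_functor A B F"
  shows "is_functor (karoubi A) (karoubi B) (lift_ftor F)"
proof -
  interpret ftor A B F by unfold_locales fact
  have "F \<cdot> f \<circ>\<^bsub>B\<^esub> F \<cdot> e = F \<cdot> f" if "f \<circ>\<^bsub>A\<^esub> e = f" "f \<in> Arr A" "e \<in> Arr A" "Dom A f = Cod A e" for e f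
    using that by (simp flip: ftor_simps(8))
  moreover have "F \<cdot> e \<circ>\<^bsub>B\<^esub> F \<cdot> f = F \<cdot> f" if "e \<circ>\<^bsub>A\<^esub> f = f" "f \<in> Arr A" "e \<in> Arr A" "Dom A e = Cod A f" for e f
    using that by (simp flip: ftor_simps(8))
  ultimately show ?thesis
    unfolding is_functor_iff by (auto elim!: karoubi_cases[OF ftor_simps(1)])
qed

lemma lift_ftor_id: "category A \<Longrightarrow> f \<in> Arr (karoubi A) \<Longrightarrow> lift_ftor id_ftor \<cdot> f = f"
  by (auto elim: karoubi_cases)

lemma lift_nat_iso:
  assumes "nat_iso A B F G \<tau>"
  shows "nat_iso (karoubi A) (karoubi B) (lift_ftor F) (lift_ftor G) (lift_nat A B F G \<tau>)"
proof (rule nat_isoI)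
  note \<tau> = nat_isoD[OF assms]
  note \<tau>' = nat_isoD[OF nat_iso_inverse[OF assms]]
  interpret F: ftor A B F by unfold_locales (rule \<tau>)
  interpret G: ftor A B G by unfold_locales (rule \<tau>)
  note [simp] = \<tau>(3-6)
  show "is_functor (karoubi A) (karoubi B) (lift_ftor F)" "is_functor (karoubi A) (karoubi B) (lift_ftor G)"
    by (rule lift_ftor[OF \<tau>(1)] lift_ftor[OF \<tau>(2)])+
  fix e assume "e \<in> Obj (karoubi A)"
  then have e [simp]: "e \<in> idem A"
    by simp
  have n: "\<tau> (Dom A e) \<circ>\<^bsub>B\<^esub> F \<cdot> e = G \<cdot> e \<circ>\<^bsub>B\<^esub> \<tau> (Dom A e)"
    using \<tau>(7)[of e] by simp
  have n': "inverse_arrow B (\<tau> (Dom A e)) \<circ>\<^bsub>B\<^esub> G \<cdot> e = F \<cdot> e \<circ>\<^bsub>B\<^esub> inverse_arrow B (\<tau> (Dom A e))"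
    using \<tau>'(7)[of e] by simp
  \<comment> \<open>The lifted component is not invertible in \<open>B\<close> itself; its inverse
    in the completion is the lift of the inverse component, again composed with the
    idempotent.\<close>
  have "iso_arrow (karoubi B) (Arrow (F \<cdot> e) (G \<cdot> e \<circ>\<^bsub>B\<^esub> \<tau> (Dom A e)) (G \<cdot> e))"
    by (rule karoubi_isoI[of _ _ _ _ "F \<cdot> e \<circ>\<^bsub>B\<^esub> inverse_arrow B (\<tau> (Dom A e))"])
      (simp_all add: n n' precomp[OF n] precomp[OF n'])
  then show "iso_arrow (karoubi B) (lift_nat A B F G \<tau> e) \<and>
      Dom (karoubi B) (lift_nat A B F G \<tau> e) = lift_ftor F \<bullet> e \<and>
      Cod (karoubi B) (lift_nat A B F G \<tau> e) = lift_ftor G \<bullet> e"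
    by (simp add: lift_nat_def)
next
  note \<tau> = nat_isoD[OF assms]
  interpret F: ftor A B F by unfold_locales (rule \<tau>)
  interpret G: ftor A B G by unfold_locales (rule \<tau>)
  note [simp] = \<tau>(3-6)
  fix x assume "x \<in> Arr (karoubi A)"
  then obtain e f e' where x: "x = Arrow e f e'" and [simp]: "e \<in> idem A" "e' \<in> idem A" "f \<in> Arr A"
    "Dom A f = Dom A e" "Cod A f = Dom A e'" and fe: "f \<circ>\<^bsub>A\<^esub> e = f" "e' \<circ>\<^bsub>A\<^esub> f = f"
    by (rule karoubi_cases[rotated]) auto
  have fe': "G \<cdot> f \<circ>\<^bsub>B\<^esub> G \<cdot> e = G \<cdot> f" "G \<cdot> e' \<circ>\<^bsub>B\<^esub> G \<cdot> f = G \<cdot> f"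
    using fe by (simp_all flip: G.ftor_simps(8))
  have "\<tau> (Dom A e') \<circ>\<^bsub>B\<^esub> F \<cdot> f = G \<cdot> f \<circ>\<^bsub>B\<^esub> \<tau> (Dom A e)"
    using \<tau>(7)[of f] by simp
  then show "lift_nat A B F G \<tau> (Cod (karoubi A) x) \<circ>\<^bsub>karoubi B\<^esub> lift_ftor F \<cdot> x =
      lift_ftor G \<cdot> x \<circ>\<^bsub>karoubi B\<^esub> lift_nat A B F G \<tau> (Dom (karoubi A) x)"
    by (simp add: x lift_nat_def precomp[OF fe'(1)] precomp[OF fe'(2)])
qed

lemma lift_adj_simps [simp]:
  "catA (lift_adj F) = karoubi (catA F)" "catB (lift_adj F) = karoubi (catB F)"
  "ladj (lift_adj F) = lift_ftor (ladj F)" "radj (lift_adj F) = lift_ftor (radj F)"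
  "eta (lift_adj F) e = Arrow e (radj F \<cdot> ladj F \<cdot> e \<circ>\<^bsub>catA F\<^esub> eta F (Dom (catA F) e)) (radj F \<cdot> ladj F \<cdot> e)"
  "eps (lift_adj F) e' = Arrow (ladj F \<cdot> radj F \<cdot> e') (e' \<circ>\<^bsub>catB F\<^esub> eps F (Dom (catB F) e')) e'"
  by (simp_all add: lift_adj_def lift_nat_def)

lemma lift_adj:
  assumes F [simp]: "adjunction F"
  shows "adjunction (lift_adj F)"
proof (rule adjunctionI)
  note ftors = adjunction_ftors[OF F, unfolded ftor_def]
  show "is_functor (catA (lift_adj F)) (catB (lift_adj F)) (ladj (lift_adj F))"
    "is_functor (catB (lift_adj F)) (catA (lift_adj F)) (radj (lift_adj F))"
    using lift_ftor[OF ftors(1)] lift_ftor[OF ftors(2)] by simp_all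
next
  fix e assume "e \<in> Obj (catA (lift_adj F))"
  then have [simp]: "e \<in> idem (catA F)"
    by simp
  have n: "eta F (Dom (catA F) e) \<circ>\<^bsub>catA F\<^esub> e = radj F \<cdot> ladj F \<cdot> e \<circ>\<^bsub>catA F\<^esub> eta F (Dom (catA F) e)"
    using eta_nat[OF F, of e] by simp
  show "eta (lift_adj F) e \<in> Arr (catA (lift_adj F)) \<and> Dom (catA (lift_adj F)) (eta (lift_adj F) e) = e \<and>
     Cod (catA (lift_adj F)) (eta (lift_adj F) e) = radj (lift_adj F) \<bullet> ladj (lift_adj F) \<bullet> e"
    by (simp add: n)
  have n': "eps F (ladj F \<bullet> Dom (catA F) e) \<circ>\<^bsub>catB F\<^esub> ladj F \<cdot> radj F \<cdot> ladj F \<cdot> e =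
      ladj F \<cdot> e \<circ>\<^bsub>catB F\<^esub> eps F (ladj F \<bullet> Dom (catA F) e)"
    using eps_nat[OF F, of "ladj F \<cdot> e"] by simp
  show "eps (lift_adj F) (ladj (lift_adj F) \<bullet> e) \<circ>\<^bsub>catB (lift_adj F)\<^esub> ladj (lift_adj F) \<cdot> eta (lift_adj F) e =
      One (catB (lift_adj F)) (ladj (lift_adj F) \<bullet> e)"
    by (simp add: precomp[OF n'])
next
  fix e assume "e \<in> Obj (catB (lift_adj F))"
  then have [simp]: "e \<in> idem (catB F)"
    by simp
  have n: "eps F (Dom (catB F) e) \<circ>\<^bsub>catB F\<^esub> ladj F \<cdot> radj F \<cdot> e = e \<circ>\<^bsub>catB F\<^esub> eps F (Dom (catB F) e)"
    using eps_nat[OF F, of e] by simp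
  show "eps (lift_adj F) e \<in> Arr (catB (lift_adj F)) \<and>
      Dom (catB (lift_adj F)) (eps (lift_adj F) e) = ladj (lift_adj F) \<bullet> radj (lift_adj F) \<bullet> e \<and>
      Cod (catB (lift_adj F)) (eps (lift_adj F) e) = e"
    by (simp add: n)
  have n': "eta F (radj F \<bullet> Dom (catB F) e) \<circ>\<^bsub>catA F\<^esub> radj F \<cdot> e =
      radj F \<cdot> ladj F \<cdot> radj F \<cdot> e \<circ>\<^bsub>catA F\<^esub> eta F (radj F \<bullet> Dom (catB F) e)"
    using eta_nat[OF F, of "radj F \<cdot> e"] by simp
  have "radj F \<cdot> eps F (Dom (catB F) e) \<circ>\<^bsub>catA F\<^esub>
      (radj F \<cdot> ladj F \<cdot> radj F \<cdot> e \<circ>\<^bsub>catA F\<^esub> eta F (radj F \<bullet> Dom (catB F) e)) = radj F \<cdot> e"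
    by (simp flip: n')
  then show "radj (lift_adj F) \<cdot> eps (lift_adj F) e \<circ>\<^bsub>catA (lift_adj F)\<^esub> eta (lift_adj F) (radj (lift_adj F) \<bullet> e) =
      One (catA (lift_adj F)) (radj (lift_adj F) \<bullet> e)"
    by simp
next
  fix x assume "x \<in> Arr (catA (lift_adj F))"
  then have "x \<in> Arr (karoubi (catA F))"
    by simp
  then obtain e f e' where x: "x = Arrow e f e'" and [simp]: "e \<in> idem (catA F)" "e' \<in> idem (catA F)"
    "f \<in> Arr (catA F)" "Dom (catA F) f = Dom (catA F) e" "Cod (catA F) f = Dom (catA F) e'"
    and fe: "f \<circ>\<^bsub>catA F\<^esub> e = f" "e' \<circ>\<^bsub>catA F\<^esub> f = f"
    by (rule karoubi_cases[rotated]) auto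
  note fe' = arg_cong[OF fe(1), of "\<lambda>f. radj F \<cdot> ladj F \<cdot> f", simplified]
    arg_cong[OF fe(2), of "\<lambda>f. radj F \<cdot> ladj F \<cdot> f", simplified]
  have "eta F (Dom (catA F) e') \<circ>\<^bsub>catA F\<^esub> f = radj F \<cdot> ladj F \<cdot> f \<circ>\<^bsub>catA F\<^esub> eta F (Dom (catA F) e)"
    using eta_nat[OF F, of f] by simp
  then show "eta (lift_adj F) (Cod (catA (lift_adj F)) x) \<circ>\<^bsub>catA (lift_adj F)\<^esub> x =
      radj (lift_adj F) \<cdot> ladj (lift_adj F) \<cdot> x \<circ>\<^bsub>catA (lift_adj F)\<^esub> eta (lift_adj F) (Dom (catA (lift_adj F)) x)"
    by (simp add: x precomp[OF fe'(1)] precomp[OF fe'(2)])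
next
  fix x assume "x \<in> Arr (catB (lift_adj F))"
  then have "x \<in> Arr (karoubi (catB F))"
    by simp
  then obtain e f e' where x: "x = Arrow e f e'" and [simp]: "e \<in> idem (catB F)" "e' \<in> idem (catB F)"
    "f \<in> Arr (catB F)" "Dom (catB F) f = Dom (catB F) e" "Cod (catB F) f = Dom (catB F) e'"
    and fe: "f \<circ>\<^bsub>catB F\<^esub> e = f" "e' \<circ>\<^bsub>catB F\<^esub> f = f"
    by (rule karoubi_cases[rotated]) auto
  have "eps F (Dom (catB F) e') \<circ>\<^bsub>catB F\<^esub> ladj F \<cdot> radj F \<cdot> f = f \<circ>\<^bsub>catB F\<^esub> eps F (Dom (catB F) e)"
    using eps_nat[OF F, of f] by simp
  then show "eps (lift_adj F) (Cod (catB (lift_adj F)) x) \<circ>\<^bsub>catB (lift_adj F)\<^esub> ladj (lift_adj F) \<cdot> radj (lift_adj F) \<cdot> x =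
      x \<circ>\<^bsub>catB (lift_adj F)\<^esub> eps (lift_adj F) (Dom (catB (lift_adj F)) x)"
    by (simp add: x precomp[OF fe(1)] precomp[OF fe(2)])
qed

lemma lift_mor_simps [simp]:
  "src_adj (lift_mor \<Upsilon>) = lift_adj (src_adj \<Upsilon>)" "tgt_adj (lift_mor \<Upsilon>) = lift_adj (tgt_adj \<Upsilon>)"
  "mH (lift_mor \<Upsilon>) = lift_ftor (mH \<Upsilon>)" "mK (lift_mor \<Upsilon>) = lift_ftor (mK \<Upsilon>)"
  "ups (lift_mor \<Upsilon>) = lift_nat (catA (src_adj \<Upsilon>)) (catB (tgt_adj \<Upsilon>))
     (comp_ftor (mK \<Upsilon>) (ladj (src_adj \<Upsilon>))) (comp_ftor (ladj (tgt_adj \<Upsilon>)) (mH \<Upsilon>)) (ups \<Upsilon>)"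
  "dns (lift_mor \<Upsilon>) = lift_nat (catB (src_adj \<Upsilon>)) (catA (tgt_adj \<Upsilon>))
     (comp_ftor (mH \<Upsilon>) (radj (src_adj \<Upsilon>))) (comp_ftor (radj (tgt_adj \<Upsilon>)) (mK \<Upsilon>)) (dns \<Upsilon>)"
  by (simp_all add: lift_mor_def Let_def)

lemma lift_mor_hom:
  assumes \<Upsilon>: "\<Upsilon> \<in> adj_hom F G"
  shows "lift_mor \<Upsilon> \<in> adj_hom (lift_adj F) (lift_adj G)"
proof -
  interpret Y: adj_morph F G "mH \<Upsilon>" "mK \<Upsilon>" "ups \<Upsilon>" "dns \<Upsilon>"
    by (rule adj_homD(5)[OF \<Upsilon>])
  note [simp] = adj_homD(1,2)[OF \<Upsilon>]
  have "adj_morph (lift_adj F) (lift_adj G) (mH (lift_mor \<Upsilon>)) (mK (lift_mor \<Upsilon>)) (ups (lift_mor \<Upsilon>)) (dns (lift_mor \<Upsilon>))"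
  proof
    show "nat_iso (catA (lift_adj F)) (catB (lift_adj G)) (comp_ftor (mK (lift_mor \<Upsilon>)) (ladj (lift_adj F)))
        (comp_ftor (ladj (lift_adj G)) (mH (lift_mor \<Upsilon>))) (ups (lift_mor \<Upsilon>))"
      using lift_nat_iso[OF Y.u] by (simp add: lift_ftor_comp)
    show "nat_iso (catB (lift_adj F)) (catA (lift_adj G)) (comp_ftor (mH (lift_mor \<Upsilon>)) (radj (lift_adj F)))
        (comp_ftor (radj (lift_adj G)) (mK (lift_mor \<Upsilon>))) (dns (lift_mor \<Upsilon>))"
      using lift_nat_iso[OF Y.d] by (simp add: lift_ftor_comp)
    fix e assume "e \<in> Obj (catA (lift_adj F))"
    then have e [simp]: "e \<in> idem (catA F)"
      by simp
    let ?a = "Dom (catA F) e" and ?H = "mH \<Upsilon>" and ?K = "mK \<Upsilon>"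
    \<comment> \<open>Both naturality squares are oriented so that every copy of the idempotent
      moves to the left end, where the copies merge and the unit law of \<open>\<Upsilon>\<close>
      remains.\<close>
    have 1: "dns \<Upsilon> (ladj F \<bullet> ?a) \<circ>\<^bsub>catA G\<^esub> ?H \<cdot> radj F \<cdot> ladj F \<cdot> e = radj G \<cdot> ?K \<cdot> ladj F \<cdot> e \<circ>\<^bsub>catA G\<^esub> dns \<Upsilon> (ladj F \<bullet> ?a)"
      using Y.d_nat[of "ladj F \<cdot> e"] by simp
    have 2: "radj G \<cdot> ups \<Upsilon> ?a \<circ>\<^bsub>catA G\<^esub> radj G \<cdot> ?K \<cdot> ladj F \<cdot> e =
        radj G \<cdot> ladj G \<cdot> ?H \<cdot> e \<circ>\<^bsub>catA G\<^esub> radj G \<cdot> ups \<Upsilon> ?a"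
      using arg_cong[OF Y.u_nat[of e], of "FArr (radj G)"] by simp
    show "radj (lift_adj G) \<cdot> ups (lift_mor \<Upsilon>) e \<circ>\<^bsub>catA (lift_adj G)\<^esub>
       (dns (lift_mor \<Upsilon>) (ladj (lift_adj F) \<bullet> e) \<circ>\<^bsub>catA (lift_adj G)\<^esub> mH (lift_mor \<Upsilon>) \<cdot> eta (lift_adj F) e) =
       eta (lift_adj G) (mH (lift_mor \<Upsilon>) \<bullet> e)"
      by (simp add: lift_nat_def precomp[OF 1] precomp[OF 2] Y.unit)
  qed (auto intro: lift_adj lift_ftor Y.H Y.K)
  then show ?thesis
    by (simp add: adj_hom_iff)
qed

text \<open>Completion as an endofunctor of its own, so that idempotency of \<open>M\<close> and
  \<open>C\<close> can be deduced from that of two simpler constructions.\<close>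

definition L_endo :: "'a univ adj_endo" where
  "L_endo = \<lparr>on_adj = lift_adj, on_mor = lift_mor\<rparr>"

lemma L_endo_simps [simp]: "on_adj L_endo = lift_adj" "on_mor L_endo = lift_mor"
  by (simp_all add: L_endo_def)

lemma lift_mor_cong:
  assumes "\<Upsilon> \<cong> \<Upsilon>'"
  shows "lift_mor \<Upsilon> \<cong> lift_mor \<Upsilon>'"
  using assms
proof (rule adj_isoE)
  fix F G \<theta> \<phi>
  assume \<Upsilon>: "\<Upsilon> \<in> adj_hom F G" and \<Upsilon>': "\<Upsilon>' \<in> adj_hom F G"
    and \<theta>: "nat_iso (catA F) (catA G) (mH \<Upsilon>) (mH \<Upsilon>') \<theta>"
    and \<phi>: "nat_iso (catB F) (catB G) (mK \<Upsilon>) (mK \<Upsilon>') \<phi>"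
    and u: "\<And>a. a \<in> Obj (catA F) \<Longrightarrow>
      ups \<Upsilon>' a \<circ>\<^bsub>catB G\<^esub> \<phi> (ladj F \<bullet> a) = ladj G \<cdot> \<theta> a \<circ>\<^bsub>catB G\<^esub> ups \<Upsilon> a"
  interpret Y: adj_morph F G "mH \<Upsilon>" "mK \<Upsilon>" "ups \<Upsilon>" "dns \<Upsilon>"
    by (rule adj_homD(5)[OF \<Upsilon>])
  interpret Y': adj_morph F G "mH \<Upsilon>'" "mK \<Upsilon>'" "ups \<Upsilon>'" "dns \<Upsilon>'"
    by (rule adj_homD(5)[OF \<Upsilon>'])
  note [simp] = nat_isoD(3-6)[OF \<theta>] nat_isoD(3-6)[OF \<phi>] adj_homD(1,2)[OF \<Upsilon>] adj_homD(1,2)[OF \<Upsilon>']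
  have "ups (lift_mor \<Upsilon>') e \<circ>\<^bsub>karoubi (catB G)\<^esub> lift_nat (catB F) (catB G) (mK \<Upsilon>) (mK \<Upsilon>') \<phi> (ladj F \<cdot> e) =
      lift_ftor (ladj G) \<cdot> lift_nat (catA F) (catA G) (mH \<Upsilon>) (mH \<Upsilon>') \<theta> e \<circ>\<^bsub>karoubi (catB G)\<^esub> ups (lift_mor \<Upsilon>) e"
    if e [simp]: "e \<in> idem (catA F)" for e
  proof -
    let ?a = "Dom (catA F) e"
    have 1: "ups \<Upsilon>' ?a \<circ>\<^bsub>catB G\<^esub> mK \<Upsilon>' \<cdot> ladj F \<cdot> e = ladj G \<cdot> mH \<Upsilon>' \<cdot> e \<circ>\<^bsub>catB G\<^esub> ups \<Upsilon>' ?a"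
      using Y'.u_nat[of e] by simp
    have 2: "ladj G \<cdot> \<theta> ?a \<circ>\<^bsub>catB G\<^esub> ladj G \<cdot> mH \<Upsilon> \<cdot> e = ladj G \<cdot> mH \<Upsilon>' \<cdot> e \<circ>\<^bsub>catB G\<^esub> ladj G \<cdot> \<theta> ?a"
      using arg_cong[OF nat_isoD(7)[OF \<theta>, of e], of "FArr (ladj G)"] by simp
    show ?thesis
      by (simp add: lift_nat_def precomp[OF 1] precomp[OF 2] u)
  qed
  then show ?thesis
    by (intro adj_isoI[OF lift_mor_hom[OF \<Upsilon>] lift_mor_hom[OF \<Upsilon>']
        lift_nat_iso[OF \<theta>, folded lift_mor_simps lift_adj_simps] lift_nat_iso[OF \<phi>, folded lift_mor_simps lift_adj_simps]])
      simp
qed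

lemma endofunctor_L: "endofunctor L_endo"
  unfolding endofunctor_def
proof (intro conjI allI impI)
  fix F :: "'a univ adj" assume F [simp]: "adjunction F"
  show "on_mor L_endo (id_adj F) \<cong> id_adj (on_adj L_endo F)"
    by (rule agree_adj_hom(2)[OF lift_mor_hom[OF id_adj_hom[OF F], folded L_endo_simps]])
      (auto simp: agree_def lift_nat_def lift_ftor_id[of "catA F"] lift_ftor_id[of "catB F"])
next
  fix F G L :: "'a univ adj" and \<Upsilon> \<Psi> assume \<Upsilon>: "\<Upsilon> \<in> adj_hom F G" and \<Psi>: "\<Psi> \<in> adj_hom G L"
  interpret Y: adj_morph F G "mH \<Upsilon>" "mK \<Upsilon>" "ups \<Upsilon>" "dns \<Upsilon>"
    by (rule adj_homD(5)[OF \<Upsilon>])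
  interpret P: adj_morph G L "mH \<Psi>" "mK \<Psi>" "ups \<Psi>" "dns \<Psi>"
    by (rule adj_homD(5)[OF \<Psi>])
  note [simp] = adj_homD(1,2)[OF \<Upsilon>] adj_homD(1,2)[OF \<Psi>]
  have 1: "ups \<Psi> (mH \<Upsilon> \<bullet> Dom (catA F) e) \<circ>\<^bsub>catB L\<^esub> mK \<Psi> \<cdot> ladj G \<cdot> mH \<Upsilon> \<cdot> e =
      ladj L \<cdot> mH \<Psi> \<cdot> mH \<Upsilon> \<cdot> e \<circ>\<^bsub>catB L\<^esub> ups \<Psi> (mH \<Upsilon> \<bullet> Dom (catA F) e)" if "e \<in> idem (catA F)" for e
    using P.u_nat[of "mH \<Upsilon> \<cdot> e"] that by simp
  have 2: "dns \<Psi> (mK \<Upsilon> \<bullet> Dom (catB F) e) \<circ>\<^bsub>catA L\<^esub> mH \<Psi> \<cdot> radj G \<cdot> mK \<Upsilon> \<cdot> e =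
      radj L \<cdot> mK \<Psi> \<cdot> mK \<Upsilon> \<cdot> e \<circ>\<^bsub>catA L\<^esub> dns \<Psi> (mK \<Upsilon> \<bullet> Dom (catB F) e)" if "e \<in> idem (catB F)" for e
    using P.d_nat[of "mK \<Upsilon> \<cdot> e"] that by simp
  show "on_mor L_endo (\<Psi> \<odot> \<Upsilon>) \<cong> on_mor L_endo \<Psi> \<odot> on_mor L_endo \<Upsilon>"
    by (rule agree_adj_hom(2)[OF lift_mor_hom[OF comp_adj_hom[OF \<Upsilon> \<Psi>], folded L_endo_simps]])
      (auto simp: agree_def lift_nat_def precomp[OF 1] precomp[OF 2] elim!: karoubi_cases[rotated])
qed (auto intro: lift_adj lift_mor_hom lift_mor_cong)

lemma embed_ftor_simps [simp]:
  "embed_ftor C \<bullet> a = One C a" "embed_ftor C \<cdot> f = Arrow (One C (Dom C f)) f (One C (Cod C f))"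
  by (simp_all add: embed_ftor_def)

lemma embed_ftor: "category C \<Longrightarrow> is_functor C (karoubi C) (embed_ftor C)"
  by (auto simp: is_functor_iff)

lemma embed_adj_hom:
  assumes F [simp]: "adjunction F"
  shows "embed_adj F \<in> adj_hom F (lift_adj F)"
  unfolding embed_adj_def by (rule strict_mor_hom) (auto intro: lift_adj embed_ftor)

lemma embed_adj_natural: "adj_natural id_endo L_endo embed_adj"
  unfolding adj_natural_def
proof (intro conjI allI impI)
  fix F G :: "'a univ adj" and \<Upsilon> assume \<Upsilon>: "\<Upsilon> \<in> adj_hom F G"
  interpret Y: adj_morph F G "mH \<Upsilon>" "mK \<Upsilon>" "ups \<Upsilon>" "dns \<Upsilon>"
    by (rule adj_homD(5)[OF \<Upsilon>])
  note [simp] = adj_homD(1,2)[OF \<Upsilon>]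
  show "embed_adj G \<odot> on_mor id_endo \<Upsilon> \<cong> on_mor L_endo \<Upsilon> \<odot> embed_adj F"
    unfolding endo_simps L_endo_simps
    by (rule agree_adj_hom(2)[OF comp_adj_hom[OF \<Upsilon> embed_adj_hom]])
      (auto simp: agree_def embed_adj_def lift_nat_def)
qed (simp add: embed_adj_hom)

subsection \<open>Idempotent complete categories\<close>

definition splitting :: "'u cat \<Rightarrow> 'u \<Rightarrow> 'u \<Rightarrow> 'u \<Rightarrow> bool" where
  "splitting C e r s \<longleftrightarrow> r \<in> Arr C \<and> s \<in> Arr C \<and> Dom C r = Dom C e \<and> Cod C s = Dom C e \<and>
     Cod C r = Dom C s \<and> s \<circ>\<^bsub>C\<^esub> r = e \<and> r \<circ>\<^bsub>C\<^esub> s = One C (Dom C s)"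

definition idem_complete :: "'u cat \<Rightarrow> bool" where
  "idem_complete C \<longleftrightarrow> (\<forall>e \<in> idem C. \<exists>r s. splitting C e r s)"

text \<open>An idempotent of the completion on \<open>e\<close> is an idempotent \<open>g\<close>
  absorbed by \<open>e\<close>; it splits through the object \<open>g\<close>, with \<open>g\<close>
  itself as both halves.\<close>

lemma idem_complete_karoubi:
  assumes C [simp]: "category C"
  shows "idem_complete (karoubi C)"
  unfolding idem_complete_def
proof
  fix E assume "E \<in> idem (karoubi C)"
  then have E: "E \<in> Arr (karoubi C)" "src E = tgt E" "Arrow (src E) (und E \<circ>\<^bsub>C\<^esub> und E) (tgt E) = E"
    unfolding idem_iff karoubi_simps by auto
  obtain e g e' where "E = Arrow e g e'" "e \<in> idem C" "g \<in> Arr C" "Dom C g = Dom C e" "Cod C g = Dom C e'"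
    "g \<circ>\<^bsub>C\<^esub> e = g" "e' \<circ>\<^bsub>C\<^esub> g = g"
    using E(1) by (rule karoubi_cases[OF C])
  with E have "g \<in> idem C" "E = Arrow e g e" "e \<in> idem C" "g \<in> Arr C" "Dom C g = Dom C e" "Cod C g = Dom C e"
    "g \<circ>\<^bsub>C\<^esub> e = g" "e \<circ>\<^bsub>C\<^esub> g = g" "g \<circ>\<^bsub>C\<^esub> g = g"
    by (auto intro: idemI)
  then have "splitting (karoubi C) E (Arrow e g g) (Arrow g g e)"
    by (simp add: splitting_def)
  then show "\<exists>r s. splitting (karoubi C) E r s"
    by blast
qed

lemma embed_equivalence:
  assumes C [simp]: "category C" and ic: "idem_complete C"
  shows "equivalence_functor C (karoubi C) (embed_ftor C)"
  unfolding equivalence_functor_iff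
proof
  show "is_functor C (karoubi C) (embed_ftor C)"
    by (rule embed_ftor[OF C])
  show "\<exists>f. f \<in> hom C a a' \<and> embed_ftor C \<cdot> f = g"
    if "a \<in> Obj C" "a' \<in> Obj C" "g \<in> Arr (karoubi C)" "Dom (karoubi C) g = embed_ftor C \<bullet> a"
      "Cod (karoubi C) g = embed_ftor C \<bullet> a'" for a a' g
    using that(3) that by (elim karoubi_cases[OF C]) (intro exI[of _ "und g"], simp add: hom_iff)
  fix e assume "e \<in> Obj (karoubi C)"
  then have e [simp]: "e \<in> idem C"
    by simp
  then obtain r s where "splitting C e r s"
    using ic unfolding idem_complete_def by blast
  then have [simp]: "r \<in> Arr C" "s \<in> Arr C" "Dom C r = Dom C e" "Cod C s = Dom C e" "Cod C r = Dom C s"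
    and sr: "s \<circ>\<^bsub>C\<^esub> r = e" and rs1: "r \<circ>\<^bsub>C\<^esub> s = One C (Dom C s)"
    by (auto simp: splitting_def)
  have "(s \<circ>\<^bsub>C\<^esub> r) \<circ>\<^bsub>C\<^esub> s = s" "r \<circ>\<^bsub>C\<^esub> (s \<circ>\<^bsub>C\<^esub> r) = r"
    by (simp_all add: rs1 precomp[OF rs1])
  then have "e \<circ>\<^bsub>C\<^esub> s = s" "r \<circ>\<^bsub>C\<^esub> e = r"
    unfolding sr by simp_all
  \<comment> \<open>In the completion the section \<open>s\<close> is an isomorphism from the
    embedded object onto the idempotent \<open>e\<close>, with the retraction \<open>r\<close> as
    inverse.\<close>
  then have "iso_arrow (karoubi C) (Arrow (One C (Dom C s)) s e)"
    by (intro karoubi_isoI[of _ _ _ _ r]) (simp_all add: sr rs1)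
  then show "\<exists>a\<in>Obj C. \<exists>i. iso_arrow (karoubi C) i \<and> Dom (karoubi C) i = embed_ftor C \<bullet> a \<and> Cod (karoubi C) i = e"
    by (intro bexI[of _ "Dom C s"] exI[of _ "Arrow (One C (Dom C s)) s e"]) auto
qed simp

lemma embed_adj_equivalence:
  assumes F: "adjunction F" and "idem_complete (catA F)" "idem_complete (catB F)"
  shows "adj_equivalence (embed_adj F)"
  using embed_adj_hom[OF F] assms
  by (simp add: adj_equivalence_def adj_morphism_iff embed_adj_def embed_equivalence)

text \<open>Holds for every category, complete or not. Essential surjectivity is the only point: an
  idempotent \<open>g\<close> on an object \<open>e\<close> of the completion is isomorphic to the
  lift of the object \<open>g\<close>, by an arrow with underlying \<open>g\<close>.\<close>

lemma lift_embed_equivalence: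
  assumes C [simp]: "category C"
  shows "equivalence_functor (karoubi C) (karoubi (karoubi C)) (lift_ftor (embed_ftor C))"
  unfolding equivalence_functor_iff
proof
  let ?E = "\<lambda>e. Arrow (One C (Dom C e)) e (One C (Cod C e))"
  show "is_functor (karoubi C) (karoubi (karoubi C)) (lift_ftor (embed_ftor C))"
    by (rule lift_ftor[OF embed_ftor[OF C]])
  show "f = g" if "f \<in> Arr (karoubi C)" "g \<in> Arr (karoubi C)" "Dom (karoubi C) f = Dom (karoubi C) g"
    "Cod (karoubi C) f = Cod (karoubi C) g" "lift_ftor (embed_ftor C) \<cdot> f = lift_ftor (embed_ftor C) \<cdot> g" for f g
    using that by (elim karoubi_cases[OF C]) simp
  show "\<exists>f. f \<in> hom (karoubi C) e e' \<and> lift_ftor (embed_ftor C) \<cdot> f = x"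
    if "e \<in> Obj (karoubi C)" "e' \<in> Obj (karoubi C)" "x \<in> Arr (karoubi (karoubi C))"
      "Dom (karoubi (karoubi C)) x = lift_ftor (embed_ftor C) \<bullet> e"
      "Cod (karoubi (karoubi C)) x = lift_ftor (embed_ftor C) \<bullet> e'" for e e' x
  proof -
    have [simp]: "e \<in> idem C" "e' \<in> idem C"
      using that by auto
    note h = that(3)
    obtain X y Y where x': "x = Arrow X y Y" and y: "y \<in> Arr (karoubi C)"
      "Dom (karoubi C) y = Dom (karoubi C) X" "Cod (karoubi C) y = Dom (karoubi C) Y"
      "y \<circ>\<^bsub>karoubi C\<^esub> X = y" "Y \<circ>\<^bsub>karoubi C\<^esub> y = y"
      using h by (rule karoubi_cases[OF category_karoubi[OF C]])
    have [simp]: "X = ?E e" "Y = ?E e'"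
      using that(4,5) by (simp_all add: x')
    have x: "x = Arrow (?E e) y (?E e')"
      by (simp add: x')
    obtain b g b' where g': "y = Arrow b g b'" "g \<in> Arr C" "Dom C g = Dom C b" "Cod C g = Dom C b'"
      using y(1) by (rule karoubi_cases[OF C])
    with y(2,3) have g: "y = Arrow (One C (Dom C e)) g (One C (Dom C e'))" "g \<in> Arr C" "Dom C g = Dom C e" "Cod C g = Dom C e'"
      by auto
    with y(4,5) have "g \<circ>\<^bsub>C\<^esub> e = g" "e' \<circ>\<^bsub>C\<^esub> g = g"
      by simp_all
    then show ?thesis
      by (intro exI[of _ "Arrow e g e'"]) (simp add: hom_iff x g)
  qed
  fix E assume "E \<in> Obj (karoubi (karoubi C))"
  then have E: "E \<in> idem (karoubi C)"
    by simp
  then have E': "E \<in> Arr (karoubi C)" "src E = tgt E" "Arrow (src E) (und E \<circ>\<^bsub>C\<^esub> und E) (tgt E) = E"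
    unfolding idem_iff karoubi_simps by auto
  obtain e g e' where "E = Arrow e g e'" "e \<in> idem C" "g \<in> Arr C" "Dom C g = Dom C e" "Cod C g = Dom C e'"
    "g \<circ>\<^bsub>C\<^esub> e = g" "e' \<circ>\<^bsub>C\<^esub> g = g"
    using E'(1) by (rule karoubi_cases[OF C])
  with E' have g [simp]: "g \<in> idem C" and [simp]: "E = Arrow e g e" "e \<in> idem C" "Dom C g = Dom C e"
    "g \<circ>\<^bsub>C\<^esub> e = g" "e \<circ>\<^bsub>C\<^esub> g = g"
    by (auto intro: idemI)
  have [simp]: "Arrow e g e \<in> idem (karoubi C)" "Arrow (One C (Dom C e)) g (One C (Dom C e)) \<in> idem (karoubi C)"
    by (rule idemI; simp)+
  have "iso_arrow (karoubi (karoubi C)) (Arrow (?E g) (Arrow (One C (Dom C e)) g e) (Arrow e g e))"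
    by (rule karoubi_isoI[of _ _ _ _ "Arrow e g (One C (Dom C e))"]) simp_all
  then show "\<exists>e \<in> Obj (karoubi C). \<exists>i. iso_arrow (karoubi (karoubi C)) i \<and>
      Dom (karoubi (karoubi C)) i = lift_ftor (embed_ftor C) \<bullet> e \<and> Cod (karoubi (karoubi C)) i = E"
    by (intro bexI[of _ g] exI[of _ "Arrow (?E g) (Arrow (One C (Dom C e)) g e) (Arrow e g e)"]) simp_all
qed

lemma idem_pointed_L: "idem_pointed_endo L_endo embed_adj"
proof -
  have "adj_equivalence (embed_adj (lift_adj F))" if F: "adjunction F" for F :: "'a univ adj"
    by (rule embed_adj_equivalence[OF lift_adj[OF F]]) (use F in \<open>simp_all add: idem_complete_karoubi\<close>)
  moreover have "adj_equivalence (lift_mor (embed_adj F))" if F: "adjunction F" for F :: "'a univ adj"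
    using lift_mor_hom[OF embed_adj_hom[OF F]] F
    by (simp add: adj_equivalence_def adj_morphism_iff embed_adj_def lift_embed_equivalence)
  ultimately show ?thesis
    unfolding idem_pointed_endo_def using endofunctor_L embed_adj_natural by simp
qed

section \<open>Duality\<close>

definition op_cat :: "'u cat \<Rightarrow> 'u cat" where
  "op_cat C = \<lparr>Obj = Obj C, Arr = Arr C, Dom = Cod C, Cod = Dom C, One = One C,
     Comp = (\<lambda>g f. f \<circ>\<^bsub>C\<^esub> g)\<rparr>"

lemma op_cat_simps [simp]:
  "Obj (op_cat C) = Obj C" "Arr (op_cat C) = Arr C" "Dom (op_cat C) = Cod C" "Cod (op_cat C) = Dom C"
  "One (op_cat C) = One C" "g \<circ>\<^bsub>op_cat C\<^esub> f = f \<circ>\<^bsub>C\<^esub> g" "op_cat (op_cat C) = C"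
  by (simp_all add: op_cat_def)

lemma category_op [simp]: "category (op_cat C) = category C"
proof -
  have "category (op_cat C)" if "category C" for C :: "'a cat"
    by (rule categoryI) (use that in auto)
  from this[of C] this[of "op_cat C"] show ?thesis
    by auto
qed

lemma inverse_arrows_op [simp]: "inverse_arrows (op_cat C) = inverse_arrows C"
  by (auto simp: fun_eq_iff inverse_arrows_iff)

lemma iso_arrow_op [simp]: "iso_arrow (op_cat C) = iso_arrow C" "inverse_arrow (op_cat C) = inverse_arrow C"
  by (simp_all add: fun_eq_iff iso_arrow_def inverse_arrow_def)

lemma is_functor_op [simp]: "is_functor (op_cat A) (op_cat B) F = is_functor A B F"
  unfolding is_functor_iff by auto

lemma nat_iso_op:
  assumes "nat_iso A B F G \<tau>"
  shows "nat_iso (op_cat A) (op_cat B) F G (\<lambda>a. inverse_arrow B (\<tau> a))"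
proof (rule nat_isoI)
  note \<tau> = nat_isoD[OF assms] and \<tau>' = nat_isoD[OF nat_iso_inverse[OF assms]]
  show "is_functor (op_cat A) (op_cat B) F" "is_functor (op_cat A) (op_cat B) G"
    using \<tau>(1,2) by simp_all
  show "iso_arrow (op_cat B) (inverse_arrow B (\<tau> a)) \<and> Dom (op_cat B) (inverse_arrow B (\<tau> a)) = F \<bullet> a \<and>
      Cod (op_cat B) (inverse_arrow B (\<tau> a)) = G \<bullet> a" if "a \<in> Obj (op_cat A)" for a
    using \<tau>(1) \<tau>(3-6)[of a] that by (simp add: is_functor_iff)
  show "inverse_arrow B (\<tau> (Cod (op_cat A) f)) \<circ>\<^bsub>op_cat B\<^esub> F \<cdot> f =
      G \<cdot> f \<circ>\<^bsub>op_cat B\<^esub> inverse_arrow B (\<tau> (Dom (op_cat A) f))" if "f \<in> Arr (op_cat A)" for f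
    using \<tau>'(7)[of f] that by simp
qed

lemma equivalence_functor_op [simp]: "equivalence_functor (op_cat A) (op_cat B) F = equivalence_functor A B F"
proof -
  have "equivalence_functor (op_cat A) (op_cat B) F" if eq: "equivalence_functor A B F" for A B :: "'a cat" and F
  proof -
    obtain G \<sigma> \<tau> where *: "is_functor A B F" "is_functor B A G" "nat_iso A A id_ftor (comp_ftor G F) \<sigma>"
        "nat_iso B B (comp_ftor F G) id_ftor \<tau>"
      using eq unfolding equivalence_functor_def by blast
    show ?thesis
      unfolding equivalence_functor_def is_functor_op using *(1,2) nat_iso_op[OF *(3)] nat_iso_op[OF *(4)] by blast
  qed
  from this[of A B F] this[of "op_cat A" "op_cat B" F] show ?thesis
    by auto
qed

lemma idem_op [simp]: "idem (op_cat C) = idem C"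
  unfolding set_eq_iff idem_iff op_cat_simps by auto

lemma idem_complete_op [simp]: "idem_complete (op_cat C) = idem_complete C"
proof -
  have "splitting (op_cat C) e r s \<longleftrightarrow> splitting C e s r" if "e \<in> idem C" for e r s
    using idem_simps(1,2)[OF that] by (auto simp: splitting_def)
  then show ?thesis
    unfolding idem_complete_def idem_op by blast
qed

section \<open>Dual adjunctions and dual morphisms\<close>

definition op_adj :: "'u adj \<Rightarrow> 'u adj" where
  "op_adj F = \<lparr>catA = op_cat (catB F), catB = op_cat (catA F), ladj = radj F, radj = ladj F,
     eta = eps F, eps = eta F\<rparr>"

lemma op_adj_simps [simp]:
  "catA (op_adj F) = op_cat (catB F)" "catB (op_adj F) = op_cat (catA F)"
  "ladj (op_adj F) = radj F" "radj (op_adj F) = ladj F" "eta (op_adj F) = eps F" "eps (op_adj F) = eta F"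
  "op_adj (op_adj F) = F"
  by (simp_all add: op_adj_def)

lemma adjunction_op [simp]: "adjunction (op_adj F) = adjunction F"
proof -
  have "adjunction (op_adj F)" if F: "adjunction F" for F :: "'a adj"
  proof (rule adjunctionI)
    show "is_functor (catA (op_adj F)) (catB (op_adj F)) (ladj (op_adj F))"
      "is_functor (catB (op_adj F)) (catA (op_adj F)) (radj (op_adj F))"
      using adjunction_ftors[OF F] by (simp_all add: ftor_def)
  qed (use F eta_nat[OF F] eps_nat[OF F] in auto)
  from this[of F] this[of "op_adj F"] show ?thesis
    by auto
qed

text \<open>Duality reverses 2-cells, hence the inverses.\<close>

definition op_mor :: "'u adj_mor \<Rightarrow> 'u adj_mor" where
  "op_mor \<Upsilon> = \<lparr>src_adj = op_adj (src_adj \<Upsilon>), tgt_adj = op_adj (tgt_adj \<Upsilon>), mH = mK \<Upsilon>, mK = mH \<Upsilon>,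
     ups = (\<lambda>b. inverse_arrow (catA (tgt_adj \<Upsilon>)) (dns \<Upsilon> b)),
     dns = (\<lambda>a. inverse_arrow (catB (tgt_adj \<Upsilon>)) (ups \<Upsilon> a))\<rparr>"

lemma op_mor_simps [simp]:
  "src_adj (op_mor \<Upsilon>) = op_adj (src_adj \<Upsilon>)" "tgt_adj (op_mor \<Upsilon>) = op_adj (tgt_adj \<Upsilon>)"
  "mH (op_mor \<Upsilon>) = mK \<Upsilon>" "mK (op_mor \<Upsilon>) = mH \<Upsilon>"
  "ups (op_mor \<Upsilon>) = (\<lambda>b. inverse_arrow (catA (tgt_adj \<Upsilon>)) (dns \<Upsilon> b))"
  "dns (op_mor \<Upsilon>) = (\<lambda>a. inverse_arrow (catB (tgt_adj \<Upsilon>)) (ups \<Upsilon> a))"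
  by (simp_all add: op_mor_def)

lemma op_mor_hom:
  assumes \<Upsilon>: "\<Upsilon> \<in> adj_hom F G"
  shows "op_mor \<Upsilon> \<in> adj_hom (op_adj F) (op_adj G)"
proof -
  interpret Y: adj_morph F G "mH \<Upsilon>" "mK \<Upsilon>" "ups \<Upsilon>" "dns \<Upsilon>"
    by (rule adj_homD(5)[OF \<Upsilon>])
  note [simp] = adj_homD(1,2)[OF \<Upsilon>]
  have "adj_morph (op_adj F) (op_adj G) (mK \<Upsilon>) (mH \<Upsilon>) (\<lambda>b. inverse_arrow (catA G) (dns \<Upsilon> b))
     (\<lambda>a. inverse_arrow (catB G) (ups \<Upsilon> a))"
  proof
    show "nat_iso (catA (op_adj F)) (catB (op_adj G)) (comp_ftor (mH \<Upsilon>) (ladj (op_adj F)))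
        (comp_ftor (ladj (op_adj G)) (mK \<Upsilon>)) (\<lambda>b. inverse_arrow (catA G) (dns \<Upsilon> b))"
      using nat_iso_op[OF Y.d] by simp
    show "nat_iso (catB (op_adj F)) (catA (op_adj G)) (comp_ftor (mK \<Upsilon>) (radj (op_adj F)))
        (comp_ftor (radj (op_adj G)) (mH \<Upsilon>)) (\<lambda>a. inverse_arrow (catB G) (ups \<Upsilon> a))"
      using nat_iso_op[OF Y.u] by simp
    fix b assume "b \<in> Obj (catA (op_adj F))"
    then have b [simp]: "b \<in> Obj (catB F)"
      by simp
    \<comment> \<open>The unit law of the dual is the counit law of \<open>\<Upsilon>\<close> with
      the invertible 2-cells moved to the other side.\<close>
    have "(mK \<Upsilon> \<cdot> eps F b \<circ>\<^bsub>catB G\<^esub> inverse_arrow (catB G) (ups \<Upsilon> (radj F \<bullet> b))) \<circ>\<^bsub>catB G\<^esub>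
       ladj G \<cdot> inverse_arrow (catA G) (dns \<Upsilon> b) = eps G (mK \<Upsilon> \<bullet> b)"
      unfolding Y.counit[OF b, symmetric] by simp
    then show "radj (op_adj G) \<cdot> inverse_arrow (catA G) (dns \<Upsilon> b) \<circ>\<^bsub>catA (op_adj G)\<^esub>
       (inverse_arrow (catB G) (ups \<Upsilon> (ladj (op_adj F) \<bullet> b)) \<circ>\<^bsub>catA (op_adj G)\<^esub> mK \<Upsilon> \<cdot> eta (op_adj F) b) =
       eta (op_adj G) (mK \<Upsilon> \<bullet> b)"
      by simp
  qed (auto simp: Y.H Y.K)
  then show ?thesis
    by (simp add: adj_hom_iff)
qed

text \<open>Not an equality: \<open>op_mor\<close> inverts the identity 2-cells, and the inverse of
  an identity is known to be that identity only at objects of the category.\<close>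

lemma op_strict_mor:
  assumes \<Upsilon>: "strict_mor F G H K \<in> adj_hom F G"
  shows "op_mor (strict_mor F G H K) \<cong> strict_mor (op_adj F) (op_adj G) K H"
proof -
  interpret Y: adj_morph F G H K "\<lambda>a. One (catB G) (K \<bullet> ladj F \<bullet> a)" "\<lambda>b. One (catA G) (H \<bullet> radj F \<bullet> b)"
    using adj_homD(5)[OF \<Upsilon>] by simp
  show ?thesis
    by (rule agree_adj_hom(2)[OF op_mor_hom[OF \<Upsilon>]]) (auto simp: agree_def)
qed

lemma op_mor_cong:
  assumes "\<Upsilon> \<cong> \<Upsilon>'"
  shows "op_mor \<Upsilon> \<cong> op_mor \<Upsilon>'"
  using assms
proof (rule adj_isoE)
  fix F G \<theta> \<phi>
  assume \<Upsilon>: "\<Upsilon> \<in> adj_hom F G" and \<Upsilon>': "\<Upsilon>' \<in> adj_hom F G"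
    and \<theta>: "nat_iso (catA F) (catA G) (mH \<Upsilon>) (mH \<Upsilon>') \<theta>"
    and \<phi>: "nat_iso (catB F) (catB G) (mK \<Upsilon>) (mK \<Upsilon>') \<phi>"
    and d: "\<And>b. b \<in> Obj (catB F) \<Longrightarrow>
      dns \<Upsilon>' b \<circ>\<^bsub>catA G\<^esub> \<theta> (radj F \<bullet> b) = radj G \<cdot> \<phi> b \<circ>\<^bsub>catA G\<^esub> dns \<Upsilon> b"
  interpret Y: adj_morph F G "mH \<Upsilon>" "mK \<Upsilon>" "ups \<Upsilon>" "dns \<Upsilon>"
    by (rule adj_homD(5)[OF \<Upsilon>])
  interpret Y': adj_morph F G "mH \<Upsilon>'" "mK \<Upsilon>'" "ups \<Upsilon>'" "dns \<Upsilon>'"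
    by (rule adj_homD(5)[OF \<Upsilon>'])
  note [simp] = nat_isoD(3-6)[OF \<theta>] nat_isoD(3-6)[OF \<phi>] adj_homD(1,2)[OF \<Upsilon>] adj_homD(1,2)[OF \<Upsilon>']
  have "inverse_arrow (catA G) (\<theta> (radj F \<bullet> b)) \<circ>\<^bsub>catA G\<^esub> inverse_arrow (catA G) (dns \<Upsilon>' b) =
      inverse_arrow (catA G) (dns \<Upsilon> b) \<circ>\<^bsub>catA G\<^esub> radj G \<cdot> inverse_arrow (catB G) (\<phi> b)" if "b \<in> Obj (catB F)" for b
    using arg_cong[OF d[OF that], of "inverse_arrow (catA G)"] that by (simp add: iso_Comp(2))
  then show ?thesis
    by (intro adj_isoI[OF op_mor_hom[OF \<Upsilon>] op_mor_hom[OF \<Upsilon>'], where \<theta> = "\<lambda>b. inverse_arrow (catB G) (\<phi> b)"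
        and \<phi> = "\<lambda>a. inverse_arrow (catA G) (\<theta> a)"]) (simp_all add: nat_iso_op[OF \<theta>] nat_iso_op[OF \<phi>])
qed

lemma op_op_mor:
  assumes \<Upsilon>: "\<Upsilon> \<in> adj_hom F G"
  shows "\<Upsilon> \<cong> op_mor (op_mor \<Upsilon>)"
proof -
  interpret Y: adj_morph F G "mH \<Upsilon>" "mK \<Upsilon>" "ups \<Upsilon>" "dns \<Upsilon>"
    by (rule adj_homD(5)[OF \<Upsilon>])
  show ?thesis
    by (rule agree_adj_hom(2)[OF \<Upsilon>]) (auto simp: agree_def adj_homD(1,2)[OF \<Upsilon>])
qed

lemma op_mor_equivalence:
  assumes "adj_equivalence \<Upsilon>"
  shows "adj_equivalence (op_mor \<Upsilon>)"
  using assms op_mor_hom[of \<Upsilon> "src_adj \<Upsilon>" "tgt_adj \<Upsilon>"] by (simp add: adj_equivalence_def adj_morphism_iff)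

lemma op_mor_comp:
  assumes \<Upsilon>: "\<Upsilon> \<in> adj_hom F G" and \<Psi>: "\<Psi> \<in> adj_hom G L"
  shows "op_mor (\<Psi> \<odot> \<Upsilon>) \<cong> op_mor \<Psi> \<odot> op_mor \<Upsilon>"
proof -
  interpret Y: adj_morph F G "mH \<Upsilon>" "mK \<Upsilon>" "ups \<Upsilon>" "dns \<Upsilon>"
    by (rule adj_homD(5)[OF \<Upsilon>])
  interpret P: adj_morph G L "mH \<Psi>" "mK \<Psi>" "ups \<Psi>" "dns \<Psi>"
    by (rule adj_homD(5)[OF \<Psi>])
  show ?thesis
    by (rule agree_adj_hom(2)[OF op_mor_hom[OF comp_adj_hom[OF \<Upsilon> \<Psi>]]])
      (auto simp: agree_def adj_homD(1,2)[OF \<Upsilon>] adj_homD(1,2)[OF \<Psi>] iso_Comp(2))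
qed

text \<open>Only 2-cells are reversed, so dualisation is covariant on morphisms and qualifies as an
  endofunctor; conjugating by it exchanges algebras and coalgebras.\<close>

definition O_endo :: "'u adj_endo" where
  "O_endo = \<lparr>on_adj = op_adj, on_mor = op_mor\<rparr>"

lemma O_endo_simps [simp]: "on_adj O_endo = op_adj" "on_mor O_endo = op_mor"
  by (simp_all add: O_endo_def)

lemma op_mor_id:
  assumes F: "adjunction F"
  shows "op_mor (id_adj F) \<cong> id_adj (op_adj F)"
  by (rule agree_adj_hom(2)[OF op_mor_hom[OF id_adj_hom[OF F]]]) (use F in \<open>auto simp: agree_def\<close>)

lemma endofunctor_O: "endofunctor O_endo"
  unfolding endofunctor_def by (auto intro: op_mor_hom op_mor_cong op_mor_comp op_mor_id)

lemma adj_equivalence_cong: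
  assumes "\<Upsilon> \<cong> \<Upsilon>'" "adj_equivalence \<Upsilon>"
  shows "adj_equivalence \<Upsilon>'"
proof -
  obtain F G where \<Upsilon>: "\<Upsilon> \<in> adj_hom F G" "\<Upsilon>' \<in> adj_hom F G"
    using assms(1) adj_iso_homD adj_iso_hom by blast
  show ?thesis
    using adj_class_iso[OF \<Upsilon>(1)] adj_class_iso[OF \<Upsilon>(2)] adj_class_cong[OF assms(1)] assms(2) by simp
qed

text \<open>Lets the uniform constructions below be replaced by the given ones, which coincide with
  them on adjunctions but only up to \<open>\<cong>\<close> on morphisms.\<close>

lemma idem_pointed_endo_cong:
  assumes it: "idem_pointed_endo T t"
    and obj: "\<And>F. adjunction F \<Longrightarrow> on_adj T' F = on_adj T F"
    and mor: "\<And>\<Upsilon> F G. \<Upsilon> \<in> adj_hom F G \<Longrightarrow> on_mor T \<Upsilon> \<cong> on_mor T' \<Upsilon>"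
    and t: "\<And>F. adjunction F \<Longrightarrow> t F \<cong> t' F"
  shows "idem_pointed_endo T' t'"
proof -
  have T: "endofunctor T" and tn: "adj_natural id_endo T t"
    and w: "\<And>F. adjunction F \<Longrightarrow> adj_equivalence (t (on_adj T F))"
      "\<And>F. adjunction F \<Longrightarrow> adj_equivalence (on_mor T (t F))"
    using it unfolding idem_pointed_endo_def by blast+
  note T\<Upsilon> = endofunctorD(2)[OF T] and tF = adj_naturalD(1)[OF tn, simplified]
  have T'\<Upsilon>: "on_mor T' \<Upsilon> \<in> adj_hom (on_adj T F) (on_adj T G)" if "\<Upsilon> \<in> adj_hom F G" for \<Upsilon> F G
    using T\<Upsilon>[OF that] adj_iso_hom[OF mor[OF that]] by blast
  have t'F: "t' F \<in> adj_hom F (on_adj T F)" if "adjunction F" for F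
    using tF[OF that] adj_iso_hom[OF t[OF that]] by blast
  have cong: "on_mor T' \<Upsilon> \<cong> on_mor T' \<Upsilon>'" if \<Upsilon>: "\<Upsilon> \<cong> \<Upsilon>'" for \<Upsilon> \<Upsilon>'
  proof -
    obtain F G where "\<Upsilon> \<in> adj_hom F G" "\<Upsilon>' \<in> adj_hom F G"
      using \<Upsilon> adj_iso_homD adj_iso_hom by blast
    then show ?thesis
      using adj_iso_trans[OF adj_iso_sym[OF mor] adj_iso_trans[OF endofunctorD(3)[OF T \<Upsilon>] mor]] by blast
  qed
  have "endofunctor T'"
    unfolding endofunctor_def
  proof (intro conjI allI impI)
    fix F G and \<Upsilon> :: "'a adj_mor" assume \<Upsilon>: "\<Upsilon> \<in> adj_hom F G"
    then show "on_mor T' \<Upsilon> \<in> adj_hom (on_adj T' F) (on_adj T' G)"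
      using T'\<Upsilon>[OF \<Upsilon>] adj_homD(3,4)[OF \<Upsilon>] by (simp add: obj)
  next
    fix F :: "'a adj" assume F: "adjunction F"
    then show "on_mor T' (id_adj F) \<cong> id_adj (on_adj T' F)"
      using adj_iso_trans[OF adj_iso_sym[OF mor[OF id_adj_hom[OF F]]] endofunctorD(4)[OF T F]] by (simp add: obj)
  next
    fix F G L and \<Upsilon> \<Psi> :: "'a adj_mor" assume \<Upsilon>: "\<Upsilon> \<in> adj_hom F G" and \<Psi>: "\<Psi> \<in> adj_hom G L"
    have "on_mor T' (\<Psi> \<odot> \<Upsilon>) \<cong> on_mor T (\<Psi> \<odot> \<Upsilon>)"
      by (rule adj_iso_sym[OF mor[OF comp_adj_hom[OF \<Upsilon> \<Psi>]]])
    also have "\<dots> \<cong> on_mor T \<Psi> \<odot> on_mor T \<Upsilon>"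
      by (rule endofunctorD(5)[OF T \<Upsilon> \<Psi>])
    also have "\<dots> \<cong> on_mor T \<Psi> \<odot> on_mor T' \<Upsilon>"
      by (rule comp_adj_cong_right[OF T\<Upsilon>[OF \<Psi>] mor[OF \<Upsilon>] T\<Upsilon>[OF \<Upsilon>]])
    also have "\<dots> \<cong> on_mor T' \<Psi> \<odot> on_mor T' \<Upsilon>"
      by (rule comp_adj_cong_left[OF T'\<Upsilon>[OF \<Upsilon>] mor[OF \<Psi>] T\<Upsilon>[OF \<Psi>]])
    finally show "on_mor T' (\<Psi> \<odot> \<Upsilon>) \<cong> on_mor T' \<Psi> \<odot> on_mor T' \<Upsilon>" .
  qed (use obj endofunctorD(1)[OF T] cong in auto)
  moreover have "adj_natural id_endo T' t'"
    unfolding adj_natural_def endo_simps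
  proof (intro conjI allI impI)
    fix F G and \<Upsilon> :: "'a adj_mor" assume \<Upsilon>: "\<Upsilon> \<in> adj_hom F G"
    note FG = adj_homD(3,4)[OF \<Upsilon>]
    have "t' G \<odot> \<Upsilon> \<cong> t G \<odot> \<Upsilon>"
      by (rule adj_iso_sym[OF comp_adj_cong_left[OF \<Upsilon> t tF]]) (fact FG)+
    also have "\<dots> \<cong> on_mor T \<Upsilon> \<odot> t F"
      using adj_naturalD(2)[OF tn \<Upsilon>] by simp
    also have "\<dots> \<cong> on_mor T \<Upsilon> \<odot> t' F"
      by (rule comp_adj_cong_right[OF T\<Upsilon>[OF \<Upsilon>] t tF]) (fact FG)+
    also have "\<dots> \<cong> on_mor T' \<Upsilon> \<odot> t' F"
      by (rule comp_adj_cong_left[OF t'F mor[OF \<Upsilon>] T\<Upsilon>[OF \<Upsilon>]]) (fact FG)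
    finally show "t' G \<odot> \<Upsilon> \<cong> on_mor T' \<Upsilon> \<odot> t' F" .
  qed (use t'F obj in auto)
  moreover have "adj_equivalence (t' (on_adj T' F))" "adj_equivalence (on_mor T' (t' F))" if F: "adjunction F" for F
  proof -
    show "adj_equivalence (t' (on_adj T' F))"
      using adj_equivalence_cong[OF t w(1)[OF F]] endofunctorD(1)[OF T F] F by (simp add: obj)
    show "adj_equivalence (on_mor T' (t' F))"
      by (rule adj_equivalence_cong[OF cong[OF t[OF F]] adj_equivalence_cong[OF mor[OF tF[OF F]] w(2)[OF F]]])
  qed
  ultimately show ?thesis
    unfolding idem_pointed_endo_def by blast
qed

text \<open>Dualisation squares to the identity on adjunctions and, by \<open>op_op_mor\<close>, up
  to \<open>\<cong>\<close> on morphisms; so naturality and both invertibility conditions carry over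
  to the conjugate.\<close>

lemma idem_pointed_endo_op:
  assumes it: "idem_pointed_endo T t"
  shows "idem_pointed_endo (comp_endo O_endo (comp_endo T O_endo)) (\<lambda>F. op_mor (t (op_adj F)))"
proof -
  have T: "endofunctor T" and tn: "adj_natural id_endo T t"
    and w: "\<And>F. adjunction F \<Longrightarrow> adj_equivalence (t (on_adj T F))"
      "\<And>F. adjunction F \<Longrightarrow> adj_equivalence (on_mor T (t F))"
    using it unfolding idem_pointed_endo_def by blast+
  note T\<Upsilon> = endofunctorD(2)[OF T] and tF = adj_naturalD(1)[OF tn, simplified]
  have tO: "op_mor (t (op_adj F)) \<in> adj_hom F (op_adj (on_adj T (op_adj F)))" if "adjunction F" for F
    using op_mor_hom[OF tF[of "op_adj F"]] that by simp
  have "adj_natural id_endo (comp_endo O_endo (comp_endo T O_endo)) (\<lambda>F. op_mor (t (op_adj F)))"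
    unfolding adj_natural_def endo_simps O_endo_simps
  proof (intro conjI allI impI)
    fix F G and \<Upsilon> :: "'a adj_mor" assume \<Upsilon>: "\<Upsilon> \<in> adj_hom F G"
    note FG = adj_homD(3,4)[OF \<Upsilon>] and o\<Upsilon> = op_mor_hom[OF \<Upsilon>]
    note FG' = FG[folded adjunction_op[of F] adjunction_op[of G]]
    have "op_mor (t (op_adj G)) \<odot> \<Upsilon> \<cong> op_mor (t (op_adj G)) \<odot> op_mor (op_mor \<Upsilon>)"
      by (rule comp_adj_cong_right[OF tO[OF FG(2)] op_op_mor[OF \<Upsilon>] \<Upsilon>])
    also have "\<dots> \<cong> op_mor (t (op_adj G) \<odot> op_mor \<Upsilon>)"
      by (rule adj_iso_sym[OF op_mor_comp[OF o\<Upsilon> tF[OF FG'(2)]]])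
    also have "\<dots> \<cong> op_mor (on_mor T (op_mor \<Upsilon>) \<odot> t (op_adj F))"
      by (rule op_mor_cong) (use adj_naturalD(2)[OF tn o\<Upsilon>] in simp)
    also have "\<dots> \<cong> op_mor (on_mor T (op_mor \<Upsilon>)) \<odot> op_mor (t (op_adj F))"
      by (rule op_mor_comp[OF tF[OF FG'(1)] T\<Upsilon>[OF o\<Upsilon>]])
    finally show "op_mor (t (op_adj G)) \<odot> \<Upsilon> \<cong> op_mor (on_mor T (op_mor \<Upsilon>)) \<odot> op_mor (t (op_adj F))" .
  qed (rule tO)
  moreover have "adj_equivalence (op_mor (t (op_adj (op_adj (on_adj T (op_adj F))))))"
    "adj_equivalence (op_mor (on_mor T (op_mor (op_mor (t (op_adj F))))))" if F: "adjunction F" for F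
  proof -
    have F': "adjunction (op_adj F)"
      using F by simp
    show "adj_equivalence (op_mor (t (op_adj (op_adj (on_adj T (op_adj F))))))"
      using op_mor_equivalence[OF w(1)[OF F']] by simp
    show "adj_equivalence (op_mor (on_mor T (op_mor (op_mor (t (op_adj F))))))"
      by (rule op_mor_equivalence[OF adj_equivalence_cong[OF endofunctorD(3)[OF T op_op_mor[OF tF[OF F']]] w(2)[OF F']]])
  qed
  ultimately show ?thesis
    unfolding idem_pointed_endo_def using endofunctor_comp[OF endofunctor_O endofunctor_comp[OF T endofunctor_O]]
    by simp
qed

section \<open>Algebras\<close>

text \<open>Up to reversal of all arrows, coalgebras of \<open>F\<close> are algebras of \<open>op_adj F\<close>; the only difference is
  that an arrow from \<open>x\<close> to \<open>y\<close> is encoded as \<open>Arrow y f x\<close>.  The flag \<open>p\<close> selects the encoding, so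
  that both cases are treated at once.\<close>

definition ar :: "bool \<Rightarrow> 'a univ \<Rightarrow> 'a univ \<Rightarrow> 'a univ \<Rightarrow> 'a univ" where
  "ar p x f y = (if p then Arrow x f y else Arrow y f x)"

definition ar_dom :: "bool \<Rightarrow> 'a univ \<Rightarrow> 'a univ" where
  "ar_dom p = (if p then src else tgt)"

definition ar_cod :: "bool \<Rightarrow> 'a univ \<Rightarrow> 'a univ" where
  "ar_cod p = (if p then tgt else src)"

lemma ar_simps [simp]:
  "und (ar p x f y) = f" "ar_dom p (ar p x f y) = x" "ar_cod p (ar p x f y) = y"
  "ar p x f y = ar p x' f' y' \<longleftrightarrow> x = x' \<and> f = f' \<and> y = y'"
  by (auto simp: ar_def ar_dom_def ar_cod_def)

definition algs :: "'a univ adj \<Rightarrow> 'a univ set" where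
  "algs F = algebras (catA F) (comp_ftor (radj F) (ladj F)) (eta F)
     (\<lambda>a. radj F \<cdot> eps F (ladj F \<bullet> a))"

definition Alg_gen :: "bool \<Rightarrow> 'a univ adj \<Rightarrow> 'a univ cat" where
  "Alg_gen p F = \<lparr>Obj = algs F,
     Arr = {ar p x f y | x f y. x \<in> algs F \<and> y \<in> algs F \<and> f \<in> hom (catA F) (carrier x) (carrier y) \<and>
       f \<circ>\<^bsub>catA F\<^esub> action x = action y \<circ>\<^bsub>catA F\<^esub> radj F \<cdot> ladj F \<cdot> f},
     Dom = ar_dom p, Cod = ar_cod p, One = (\<lambda>x. ar p x (One (catA F) (carrier x)) x),
     Comp = (\<lambda>g f. ar p (ar_dom p f) (und g \<circ>\<^bsub>catA F\<^esub> und f) (ar_cod p g))\<rparr>"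

lemma Alg_gen_simps [simp]:
  "Obj (Alg_gen p F) = algs F" "Dom (Alg_gen p F) = ar_dom p" "Cod (Alg_gen p F) = ar_cod p"
  "One (Alg_gen p F) x = ar p x (One (catA F) (carrier x)) x"
  "g \<circ>\<^bsub>Alg_gen p F\<^esub> f = ar p (ar_dom p f) (und g \<circ>\<^bsub>catA F\<^esub> und f) (ar_cod p g)"
  by (simp_all add: Alg_gen_def)

lemma ar_Arr:
  "ar p x f y \<in> Arr (Alg_gen p F) \<longleftrightarrow> x \<in> algs F \<and> y \<in> algs F \<and> f \<in> Arr (catA F) \<and>
    Dom (catA F) f = carrier x \<and> Cod (catA F) f = carrier y \<and>
    f \<circ>\<^bsub>catA F\<^esub> action x = action y \<circ>\<^bsub>catA F\<^esub> radj F \<cdot> ladj F \<cdot> f"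
  by (auto simp: Alg_gen_def hom_iff)

lemma Alg_gen_cases:
  assumes "X \<in> Arr (Alg_gen p F)"
  obtains x f y where "X = ar p x f y" "x \<in> algs F" "y \<in> algs F" "f \<in> Arr (catA F)"
    "Dom (catA F) f = carrier x" "Cod (catA F) f = carrier y"
    "f \<circ>\<^bsub>catA F\<^esub> action x = action y \<circ>\<^bsub>catA F\<^esub> radj F \<cdot> ladj F \<cdot> f"
  using assms by (auto simp: Alg_gen_def hom_iff)

lemma algsI:
  assumes "a \<in> Obj (catA F)" "\<alpha> \<in> Arr (catA F)" "Dom (catA F) \<alpha> = radj F \<bullet> ladj F \<bullet> a" "Cod (catA F) \<alpha> = a"
    "\<alpha> \<circ>\<^bsub>catA F\<^esub> eta F a = One (catA F) a"
    "\<alpha> \<circ>\<^bsub>catA F\<^esub> radj F \<cdot> eps F (ladj F \<bullet> a) = \<alpha> \<circ>\<^bsub>catA F\<^esub> radj F \<cdot> ladj F \<cdot> \<alpha>"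
  shows "Struct a \<alpha> \<in> algs F"
  using assms by (auto simp: algs_def algebras_def hom_iff)

lemma algs_simps [simp]:
  assumes "x \<in> algs F"
  shows "carrier x \<in> Obj (catA F)" "action x \<in> Arr (catA F)"
    "Dom (catA F) (action x) = radj F \<bullet> ladj F \<bullet> carrier x" "Cod (catA F) (action x) = carrier x"
    "action x \<circ>\<^bsub>catA F\<^esub> eta F (carrier x) = One (catA F) (carrier x)"
    "action x \<circ>\<^bsub>catA F\<^esub> radj F \<cdot> ladj F \<cdot> action x = action x \<circ>\<^bsub>catA F\<^esub> radj F \<cdot> eps F (ladj F \<bullet> carrier x)"
    "Struct (carrier x) (action x) = x"
  using assms by (auto simp: algs_def algebras_def hom_iff)

lemma algs_precomp [simp]:
  assumes "adjunction F" "x \<in> algs F" "k \<in> Arr (catA F)"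
  shows "Cod (catA F) k = carrier x \<Longrightarrow> action x \<circ>\<^bsub>catA F\<^esub> (eta F (carrier x) \<circ>\<^bsub>catA F\<^esub> k) = k"
    "Cod (catA F) k = radj F \<bullet> ladj F \<bullet> radj F \<bullet> ladj F \<bullet> carrier x \<Longrightarrow>
      action x \<circ>\<^bsub>catA F\<^esub> (radj F \<cdot> ladj F \<cdot> action x \<circ>\<^bsub>catA F\<^esub> k) =
      action x \<circ>\<^bsub>catA F\<^esub> (radj F \<cdot> eps F (ladj F \<bullet> carrier x) \<circ>\<^bsub>catA F\<^esub> k)"
  using assms by (simp_all add: precomp[OF algs_simps(5)] precomp[OF algs_simps(6)])

lemma ar_comp:
  assumes F [simp]: "adjunction F" and f: "ar p x f y \<in> Arr (Alg_gen p F)" and g: "ar p y g z \<in> Arr (Alg_gen p F)"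
  shows "ar p x (g \<circ>\<^bsub>catA F\<^esub> f) z \<in> Arr (Alg_gen p F)"
proof -
  have [simp]: "x \<in> algs F" "y \<in> algs F" "z \<in> algs F" "f \<in> Arr (catA F)" "g \<in> Arr (catA F)"
    "Dom (catA F) f = carrier x" "Cod (catA F) f = carrier y" "Dom (catA F) g = carrier y" "Cod (catA F) g = carrier z"
    and fh: "f \<circ>\<^bsub>catA F\<^esub> action x = action y \<circ>\<^bsub>catA F\<^esub> radj F \<cdot> ladj F \<cdot> f"
    and gh: "g \<circ>\<^bsub>catA F\<^esub> action y = action z \<circ>\<^bsub>catA F\<^esub> radj F \<cdot> ladj F \<cdot> g"
    using f g by (auto simp: ar_Arr)
  show ?thesis
    by (simp add: ar_Arr fh precomp[OF gh])
qed

lemma category_Alg_gen [simp]: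
  assumes F [simp]: "adjunction F"
  shows "category (Alg_gen p F)"
proof (rule categoryI)
  fix f assume f: "f \<in> Arr (Alg_gen p F)"
  then show "Dom (Alg_gen p F) f \<in> Obj (Alg_gen p F) \<and> Cod (Alg_gen p F) f \<in> Obj (Alg_gen p F)"
    "f \<circ>\<^bsub>Alg_gen p F\<^esub> One (Alg_gen p F) (Dom (Alg_gen p F) f) = f \<and>
     One (Alg_gen p F) (Cod (Alg_gen p F) f) \<circ>\<^bsub>Alg_gen p F\<^esub> f = f"
    by (auto elim!: Alg_gen_cases)
  fix g assume g: "g \<in> Arr (Alg_gen p F)" "Dom (Alg_gen p F) g = Cod (Alg_gen p F) f"
  show "g \<circ>\<^bsub>Alg_gen p F\<^esub> f \<in> Arr (Alg_gen p F) \<and> Dom (Alg_gen p F) (g \<circ>\<^bsub>Alg_gen p F\<^esub> f) = Dom (Alg_gen p F) f \<and>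
     Cod (Alg_gen p F) (g \<circ>\<^bsub>Alg_gen p F\<^esub> f) = Cod (Alg_gen p F) g"
  proof -
    obtain x f' y where f': "f = ar p x f' y"
      using f by (rule Alg_gen_cases)
    obtain y' g' z where g': "g = ar p y' g' z"
      using g(1) by (rule Alg_gen_cases)
    show ?thesis
      using f g ar_comp[OF F, of p x f' y g' z] by (simp add: f' g')
  qed
  fix h assume "h \<in> Arr (Alg_gen p F)" "Dom (Alg_gen p F) h = Cod (Alg_gen p F) g"
  then show "(h \<circ>\<^bsub>Alg_gen p F\<^esub> g) \<circ>\<^bsub>Alg_gen p F\<^esub> f = h \<circ>\<^bsub>Alg_gen p F\<^esub> (g \<circ>\<^bsub>Alg_gen p F\<^esub> f)"
    using f g by (elim Alg_gen_cases) simp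
qed (auto simp: ar_Arr)

text \<open>Forgetting the algebra structure reflects isomorphisms: conjugating the homomorphism
  equation shows that the inverse of the underlying arrow is a homomorphism too.\<close>

lemma Alg_gen_iso:
  assumes F [simp]: "adjunction F" and f: "ar p x f y \<in> Arr (Alg_gen p F)" and iso [simp]: "iso_arrow (catA F) f"
  shows "iso_arrow (Alg_gen p F) (ar p x f y)"
    "inverse_arrow (Alg_gen p F) (ar p x f y) = ar p y (inverse_arrow (catA F) f) x"
proof -
  let ?i = "inverse_arrow (catA F) f"
  note [simp] = f[unfolded ar_Arr, THEN conjunct1] f[unfolded ar_Arr, THEN conjunct2, THEN conjunct1]
  have [simp]: "f \<in> Arr (catA F)" "Dom (catA F) f = carrier x" "Cod (catA F) f = carrier y"
    and h: "f \<circ>\<^bsub>catA F\<^esub> action x = action y \<circ>\<^bsub>catA F\<^esub> radj F \<cdot> ladj F \<cdot> f"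
    using f by (auto simp: ar_Arr)
  have "?i \<circ>\<^bsub>catA F\<^esub> action y = ?i \<circ>\<^bsub>catA F\<^esub> ((action y \<circ>\<^bsub>catA F\<^esub> radj F \<cdot> ladj F \<cdot> f) \<circ>\<^bsub>catA F\<^esub> radj F \<cdot> ladj F \<cdot> ?i)"
    by simp
  also have "\<dots> = action x \<circ>\<^bsub>catA F\<^esub> radj F \<cdot> ladj F \<cdot> ?i"
    unfolding h[symmetric] by simp
  finally have "ar p y ?i x \<in> Arr (Alg_gen p F)"
    by (simp add: ar_Arr)
  then have "inverse_arrows (Alg_gen p F) (ar p x f y) (ar p y ?i x)"
    using f by (simp add: inverse_arrows_iff)
  then show "iso_arrow (Alg_gen p F) (ar p x f y)"
    "inverse_arrow (Alg_gen p F) (ar p x f y) = ar p y ?i x"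
    by (auto simp: iso_arrow_def intro: inverse_arrow_eqI)
qed

text \<open>Split the underlying idempotent and transport the structure map to the
  splitting.\<close>

lemma idem_complete_Alg_gen:
  assumes F [simp]: "adjunction F" and ic: "idem_complete (catA F)"
  shows "idem_complete (Alg_gen p F)"
  unfolding idem_complete_def
proof
  fix E assume "E \<in> idem (Alg_gen p F)"
  then have E: "E \<in> Arr (Alg_gen p F)" "ar_dom p E = ar_cod p E"
    "ar p (ar_dom p E) (und E \<circ>\<^bsub>catA F\<^esub> und E) (ar_cod p E) = E"
    unfolding idem_iff Alg_gen_simps by auto
  obtain x e y where "E = ar p x e y" "x \<in> algs F" "e \<in> Arr (catA F)"
    "Dom (catA F) e = carrier x" "Cod (catA F) e = carrier y"
    "e \<circ>\<^bsub>catA F\<^esub> action x = action y \<circ>\<^bsub>catA F\<^esub> radj F \<cdot> ladj F \<cdot> e"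
    using E(1) by (rule Alg_gen_cases)
  with E have Ex: "E = ar p x e x" and x [simp]: "x \<in> algs F" and e: "e \<in> idem (catA F)" and
    e' [simp]: "e \<in> Arr (catA F)" "Dom (catA F) e = carrier x" "Cod (catA F) e = carrier x"
    and eh: "e \<circ>\<^bsub>catA F\<^esub> action x = action x \<circ>\<^bsub>catA F\<^esub> radj F \<cdot> ladj F \<cdot> e"
    by (auto intro: idemI)
  obtain r s where rs: "splitting (catA F) e r s"
    using ic e unfolding idem_complete_def by blast
  let ?T = "\<lambda>f. radj F \<cdot> ladj F \<cdot> f" and ?a = "carrier x" and ?\<alpha> = "action x" and ?b = "Dom (catA F) s"
  have [simp]: "r \<in> Arr (catA F)" "s \<in> Arr (catA F)" "Dom (catA F) r = ?a" "Cod (catA F) s = ?a"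
    "Cod (catA F) r = ?b" and sr: "s \<circ>\<^bsub>catA F\<^esub> r = e" and rs1: "r \<circ>\<^bsub>catA F\<^esub> s = One (catA F) ?b"
    using rs by (auto simp: splitting_def)
  have sr': "?T s \<circ>\<^bsub>catA F\<^esub> ?T r = ?T e"
    by (simp flip: sr)
  have "(s \<circ>\<^bsub>catA F\<^esub> r) \<circ>\<^bsub>catA F\<^esub> s = s" "r \<circ>\<^bsub>catA F\<^esub> (s \<circ>\<^bsub>catA F\<^esub> r) = r"
    by (simp_all add: rs1 precomp[OF rs1])
  then have es: "e \<circ>\<^bsub>catA F\<^esub> s = s" and re: "r \<circ>\<^bsub>catA F\<^esub> e = r"
    unfolding sr by simp_all
  have es': "?T e \<circ>\<^bsub>catA F\<^esub> ?T s = ?T s"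
    by (simp add: es flip: adjunction_simps(8,14))
  \<comment> \<open>The structure transported along the splitting: include by \<open>s\<close>, act,
    project by \<open>r\<close>.\<close>
  let ?\<beta> = "r \<circ>\<^bsub>catA F\<^esub> (?\<alpha> \<circ>\<^bsub>catA F\<^esub> ?T s)"
  have n: "eta F ?a \<circ>\<^bsub>catA F\<^esub> s = ?T s \<circ>\<^bsub>catA F\<^esub> eta F ?b"
    using eta_nat[OF F, of s] by simp
  have m: "radj F \<cdot> eps F (ladj F \<bullet> ?a) \<circ>\<^bsub>catA F\<^esub> ?T (?T s) = ?T s \<circ>\<^bsub>catA F\<^esub> radj F \<cdot> eps F (ladj F \<bullet> ?b)"
    using arg_cong[OF eps_nat[OF F, of "ladj F \<cdot> s"], of "FArr (radj F)"] by simp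
  have y: "Struct ?b ?\<beta> \<in> algs F"
  proof (rule algsI)
    show "?\<beta> \<circ>\<^bsub>catA F\<^esub> eta F ?b = One (catA F) ?b"
      by (simp add: rs1 flip: n)
    \<comment> \<open>The composite \<open>s r = e\<close> appears under the monad between the two
      actions; as \<open>e\<close> is a homomorphism it moves out to the left, where
      \<open>r\<close> absorbs it.\<close>
    have "?\<beta> \<circ>\<^bsub>catA F\<^esub> ?T ?\<beta> = r \<circ>\<^bsub>catA F\<^esub> (?\<alpha> \<circ>\<^bsub>catA F\<^esub> (?T e \<circ>\<^bsub>catA F\<^esub> (?T ?\<alpha> \<circ>\<^bsub>catA F\<^esub> ?T (?T s))))"
      by (simp add: precomp[OF sr'])
    also have "\<dots> = (r \<circ>\<^bsub>catA F\<^esub> e) \<circ>\<^bsub>catA F\<^esub> (?\<alpha> \<circ>\<^bsub>catA F\<^esub> (?T ?\<alpha> \<circ>\<^bsub>catA F\<^esub> ?T (?T s)))"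
      by (simp add: precomp[OF eh[symmetric]])
    also have "\<dots> = ?\<beta> \<circ>\<^bsub>catA F\<^esub> radj F \<cdot> eps F (ladj F \<bullet> ?b)"
      unfolding re by (simp add: m)
    finally show "?\<beta> \<circ>\<^bsub>catA F\<^esub> radj F \<cdot> eps F (ladj F \<bullet> ?b) = ?\<beta> \<circ>\<^bsub>catA F\<^esub> ?T ?\<beta>" ..
  qed simp_all
  have "?\<beta> \<circ>\<^bsub>catA F\<^esub> ?T r = (r \<circ>\<^bsub>catA F\<^esub> e) \<circ>\<^bsub>catA F\<^esub> ?\<alpha>"
    by (simp add: sr' eh)
  then have "ar p x r (Struct ?b ?\<beta>) \<in> Arr (Alg_gen p F)"
    unfolding re using y by (simp add: ar_Arr)
  moreover have "s \<circ>\<^bsub>catA F\<^esub> ?\<beta> = ?\<alpha> \<circ>\<^bsub>catA F\<^esub> ?T s"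
    by (simp add: precomp[OF sr] precomp[OF eh] es')
  then have "ar p (Struct ?b ?\<beta>) s x \<in> Arr (Alg_gen p F)"
    using y by (simp add: ar_Arr)
  ultimately have "splitting (Alg_gen p F) E (ar p x r (Struct ?b ?\<beta>)) (ar p (Struct ?b ?\<beta>) s x)"
    by (simp add: splitting_def Ex sr rs1)
  then show "\<exists>r s. splitting (Alg_gen p F) E r s"
    by blast
qed

section \<open>Free algebras, the comparison functor and the Eilenberg--Moore adjunction\<close>

definition structured_gen ::
  "bool \<Rightarrow> 'a univ cat \<Rightarrow> ('a univ \<Rightarrow> 'a univ) \<Rightarrow> ('a univ \<Rightarrow> 'a univ) \<Rightarrow> 'a univ ftor" where
  "structured_gen p C X u = \<lparr>FObj = X, FArr = (\<lambda>f. ar p (X (Dom C f)) (u f) (X (Cod C f)))\<rparr>"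

lemma structured_gen_simps [simp]:
  "structured_gen p C X u \<bullet> a = X a" "structured_gen p C X u \<cdot> f = ar p (X (Dom C f)) (u f) (X (Cod C f))"
  by (simp_all add: structured_gen_def)

lemma forget_simps [simp]: "forget \<bullet> x = carrier x" "forget \<cdot> f = und f"
  by (simp_all add: forget_def)

definition free :: "'a univ adj \<Rightarrow> 'a univ \<Rightarrow> 'a univ" where
  "free F a = Struct (radj F \<bullet> ladj F \<bullet> a) (radj F \<cdot> eps F (ladj F \<bullet> a))"

definition kalg :: "'a univ adj \<Rightarrow> 'a univ \<Rightarrow> 'a univ" where
  "kalg F b = Struct (radj F \<bullet> b) (radj F \<cdot> eps F b)"

lemma kalg_simps [simp]: "carrier (kalg F b) = radj F \<bullet> b" "action (kalg F b) = radj F \<cdot> eps F b"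
  by (simp_all add: kalg_def)

lemma free_kalg: "free F a = kalg F (ladj F \<bullet> a)"
  by (simp add: free_def kalg_def)

lemma free_simps [simp]: "carrier (free F a) = radj F \<bullet> ladj F \<bullet> a" "action (free F a) = radj F \<cdot> eps F (ladj F \<bullet> a)"
  by (simp_all add: free_def)

lemma kalg_algs [simp]:
  assumes F [simp]: "adjunction F" and b [simp]: "b \<in> Obj (catB F)"
  shows "kalg F b \<in> algs F"
  unfolding kalg_def
proof (rule algsI)
  show "radj F \<cdot> eps F b \<circ>\<^bsub>catA F\<^esub> radj F \<cdot> eps F (ladj F \<bullet> radj F \<bullet> b) =
      radj F \<cdot> eps F b \<circ>\<^bsub>catA F\<^esub> radj F \<cdot> ladj F \<cdot> radj F \<cdot> eps F b"
    using arg_cong[OF eps_nat[OF F, of "eps F b"], of "FArr (radj F)"] by simp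
qed simp_all

lemma free_algs [simp]: "adjunction F \<Longrightarrow> a \<in> Obj (catA F) \<Longrightarrow> free F a \<in> algs F"
  by (simp add: free_kalg)

definition free_gen :: "bool \<Rightarrow> 'a univ adj \<Rightarrow> 'a univ ftor" where
  "free_gen p F = structured_gen p (catA F) (free F) (\<lambda>f. radj F \<cdot> ladj F \<cdot> f)"

definition kappa_gen :: "bool \<Rightarrow> 'a univ adj \<Rightarrow> 'a univ ftor" where
  "kappa_gen p F = structured_gen p (catB F) (kalg F) (FArr (radj F))"

definition EM_gen :: "bool \<Rightarrow> 'a univ adj \<Rightarrow> 'a univ adj" where
  "EM_gen p F = \<lparr>catA = catA F, catB = Alg_gen p F, ladj = free_gen p F, radj = forget,
     eta = eta F, eps = (\<lambda>x. ar p (free F (carrier x)) (action x) x)\<rparr>"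

lemma EM_gen_simps [simp]:
  "catA (EM_gen p F) = catA F" "catB (EM_gen p F) = Alg_gen p F" "radj (EM_gen p F) = forget"
  "ladj (EM_gen p F) \<bullet> a = free F a"
  "ladj (EM_gen p F) \<cdot> f = ar p (free F (Dom (catA F) f)) (radj F \<cdot> ladj F \<cdot> f) (free F (Cod (catA F) f))"
  "eta (EM_gen p F) = eta F" "eps (EM_gen p F) x = ar p (free F (carrier x)) (action x) x"
  by (simp_all add: EM_gen_def free_gen_def)

lemma kappa_gen_simps [simp]:
  "kappa_gen p F \<bullet> b = kalg F b"
  "kappa_gen p F \<cdot> g = ar p (kalg F (Dom (catB F) g)) (radj F \<cdot> g) (kalg F (Cod (catB F) g))"
  by (simp_all add: kappa_gen_def)

lemma kappa_gen_Arr: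
  assumes F [simp]: "adjunction F" and g [simp]: "g \<in> Arr (catB F)"
  shows "ar p (kalg F (Dom (catB F) g)) (radj F \<cdot> g) (kalg F (Cod (catB F) g)) \<in> Arr (Alg_gen p F)"
  using arg_cong[OF eps_nat[OF F g], of "FArr (radj F)"] by (simp add: ar_Arr)

lemma kappa_gen_functor:
  assumes F [simp]: "adjunction F"
  shows "is_functor (catB F) (Alg_gen p F) (kappa_gen p F)"
  unfolding is_functor_iff by (simp add: kappa_gen_Arr)

lemma free_functor:
  assumes F [simp]: "adjunction F"
  shows "is_functor (catA F) (Alg_gen p F) (ladj (EM_gen p F))"
  using is_functor_comp[OF adjunction_ftors(1)[OF F, unfolded ftor_def] kappa_gen_functor[OF F, of p]]
  by (rule is_functor_cong) (simp_all add: free_kalg)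

lemma forget_functor:
  assumes F [simp]: "adjunction F"
  shows "is_functor (Alg_gen p F) (catA F) forget"
  unfolding is_functor_iff by (auto elim!: Alg_gen_cases)

lemma EM_gen:
  assumes F [simp]: "adjunction F"
  shows "adjunction (EM_gen p F)"
proof (rule adjunctionI)
  show "is_functor (catA (EM_gen p F)) (catB (EM_gen p F)) (ladj (EM_gen p F))"
    using free_functor[OF F] by simp
  show "is_functor (catB (EM_gen p F)) (catA (EM_gen p F)) (radj (EM_gen p F))"
    using forget_functor[OF F] by simp
  show "eps (EM_gen p F) (ladj (EM_gen p F) \<bullet> a) \<circ>\<^bsub>catB (EM_gen p F)\<^esub> ladj (EM_gen p F) \<cdot> eta (EM_gen p F) a =
      One (catB (EM_gen p F)) (ladj (EM_gen p F) \<bullet> a)" if "a \<in> Obj (catA (EM_gen p F))" for a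
    using arg_cong[OF adjunction_unit_counit(9)[OF F, of a], of "FArr (radj F)"] that
    by (simp del: adjunction_unit_counit(9))
qed (use eta_nat[OF F] in \<open>auto simp: ar_Arr elim!: Alg_gen_cases\<close>)

subsection \<open>The action of morphisms of adjunctions on algebras\<close>

context adj_morph
begin

text \<open>The isomorphism between \<open>H\<close> after the monad of \<open>F\<close> and the
  monad of \<open>G\<close> after \<open>H\<close>. Together with compatibility with units and
  multiplications, proved below, it makes \<open>H\<close> a morphism of monads.\<close>

definition rho :: "'u \<Rightarrow> 'u" where
  "rho a = radj G \<cdot> u a \<circ>\<^bsub>catA G\<^esub> d (ladj F \<bullet> a)"

lemma rho_simps [simp]:
  assumes "a \<in> Obj (catA F)"
  shows "rho a \<in> Arr (catA G)" "Dom (catA G) (rho a) = H \<bullet> radj F \<bullet> ladj F \<bullet> a"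
    "Cod (catA G) (rho a) = radj G \<bullet> ladj G \<bullet> H \<bullet> a" "iso_arrow (catA G) (rho a)"
    "rho a \<circ>\<^bsub>catA G\<^esub> H \<cdot> eta F a = eta G (H \<bullet> a)"
  using assms unit[OF assms] by (simp_all add: rho_def iso_Comp(1))

lemma rho_nat:
  assumes [simp]: "f \<in> Arr (catA F)"
  shows "rho (Cod (catA F) f) \<circ>\<^bsub>catA G\<^esub> H \<cdot> radj F \<cdot> ladj F \<cdot> f =
    radj G \<cdot> ladj G \<cdot> H \<cdot> f \<circ>\<^bsub>catA G\<^esub> rho (Dom (catA F) f)"
proof -
  have 1: "d (ladj F \<bullet> Cod (catA F) f) \<circ>\<^bsub>catA G\<^esub> H \<cdot> radj F \<cdot> ladj F \<cdot> f =
      radj G \<cdot> K \<cdot> ladj F \<cdot> f \<circ>\<^bsub>catA G\<^esub> d (ladj F \<bullet> Dom (catA F) f)"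
    using d_nat[of "ladj F \<cdot> f"] by simp
  have 2: "radj G \<cdot> u (Cod (catA F) f) \<circ>\<^bsub>catA G\<^esub> radj G \<cdot> K \<cdot> ladj F \<cdot> f =
      radj G \<cdot> ladj G \<cdot> H \<cdot> f \<circ>\<^bsub>catA G\<^esub> radj G \<cdot> u (Dom (catA F) f)"
    using arg_cong[OF u_nat[of f], of "FArr (radj G)"] by simp
  show ?thesis
    by (simp add: rho_def 1 precomp[OF 2])
qed

text \<open>Naturality of \<open>d\<close> at the counit, combined with the counit law. It says that
  \<open>d b\<close> respects structure maps, which is how \<open>d_kalg\<close> uses it.\<close>

lemma d_mult:
  assumes [simp]: "b \<in> Obj (catB F)"
  shows "d b \<circ>\<^bsub>catA G\<^esub> H \<cdot> radj F \<cdot> eps F b =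
    radj G \<cdot> eps G (K \<bullet> b) \<circ>\<^bsub>catA G\<^esub> (radj G \<cdot> ladj G \<cdot> d b \<circ>\<^bsub>catA G\<^esub> rho (radj F \<bullet> b))"
proof -
  have "d b \<circ>\<^bsub>catA G\<^esub> H \<cdot> radj F \<cdot> eps F b = radj G \<cdot> K \<cdot> eps F b \<circ>\<^bsub>catA G\<^esub> d (ladj F \<bullet> radj F \<bullet> b)"
    using d_nat[of "eps F b"] by simp
  then show ?thesis
    by (simp add: rho_def flip: counit)
qed

lemma rho_mult:
  assumes [simp]: "a \<in> Obj (catA F)"
  shows "rho a \<circ>\<^bsub>catA G\<^esub> H \<cdot> radj F \<cdot> eps F (ladj F \<bullet> a) =
    radj G \<cdot> eps G (ladj G \<bullet> H \<bullet> a) \<circ>\<^bsub>catA G\<^esub> (radj G \<cdot> ladj G \<cdot> rho a \<circ>\<^bsub>catA G\<^esub> rho (radj F \<bullet> ladj F \<bullet> a))"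
proof -
  have 1: "radj G \<cdot> u a \<circ>\<^bsub>catA G\<^esub> radj G \<cdot> eps G (K \<bullet> ladj F \<bullet> a) =
      radj G \<cdot> eps G (ladj G \<bullet> H \<bullet> a) \<circ>\<^bsub>catA G\<^esub> radj G \<cdot> ladj G \<cdot> radj G \<cdot> u a"
    using arg_cong[OF eps_nat[OF G, of "u a"], of "FArr (radj G)"] by simp
  have "rho a \<circ>\<^bsub>catA G\<^esub> H \<cdot> radj F \<cdot> eps F (ladj F \<bullet> a) =
      radj G \<cdot> u a \<circ>\<^bsub>catA G\<^esub> (d (ladj F \<bullet> a) \<circ>\<^bsub>catA G\<^esub> H \<cdot> radj F \<cdot> eps F (ladj F \<bullet> a))"
    by (simp add: rho_def)
  also have "\<dots> = radj G \<cdot> eps G (ladj G \<bullet> H \<bullet> a) \<circ>\<^bsub>catA G\<^esub>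
      (radj G \<cdot> ladj G \<cdot> (radj G \<cdot> u a \<circ>\<^bsub>catA G\<^esub> d (ladj F \<bullet> a)) \<circ>\<^bsub>catA G\<^esub> rho (radj F \<bullet> ladj F \<bullet> a))"
    by (subst d_mult) (simp_all add: precomp[OF 1])
  finally show ?thesis
    by (simp only: rho_def[of a])
qed

end

locale alg_morph = adj_morph F G H K u d for F G :: "'a univ adj" and H K u d
begin

definition act :: "'a univ \<Rightarrow> 'a univ" where
  "act x = Struct (H \<bullet> carrier x) (H \<cdot> action x \<circ>\<^bsub>catA G\<^esub> inverse_arrow (catA G) (rho (carrier x)))"

lemma act_simps [simp]:
  "carrier (act x) = H \<bullet> carrier x"
  "action (act x) = H \<cdot> action x \<circ>\<^bsub>catA G\<^esub> inverse_arrow (catA G) (rho (carrier x))"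
  by (simp_all add: act_def)

lemma act_algs [simp]:
  assumes x [simp]: "x \<in> algs F"
  shows "act x \<in> algs G"
  unfolding act_def
proof (rule algsI)
  let ?a = "carrier x" and ?\<alpha> = "H \<cdot> action x \<circ>\<^bsub>catA G\<^esub> inverse_arrow (catA G) (rho (carrier x))"
  have "?\<alpha> \<circ>\<^bsub>catA G\<^esub> eta G (H \<bullet> ?a) = H \<cdot> (action x \<circ>\<^bsub>catA F\<^esub> eta F ?a)"
    by (simp flip: rho_simps(5) del: algs_simps(5))
  then show "?\<alpha> \<circ>\<^bsub>catA G\<^esub> eta G (H \<bullet> ?a) = One (catA G) (H \<bullet> ?a)"
    by simp
  \<comment> \<open>Associativity is compared after precomposing with this isomorphism from
    \<open>H\<close> of the twice iterated monad, which reduces it to associativity of the original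
    algebra through \<open>rho_mult\<close> and naturality of \<open>rho\<close>.\<close>
  let ?i = "radj G \<cdot> ladj G \<cdot> rho ?a \<circ>\<^bsub>catA G\<^esub> rho (radj F \<bullet> ladj F \<bullet> ?a)"
  have 1: "rho ?a \<circ>\<^bsub>catA G\<^esub> H \<cdot> radj F \<cdot> ladj F \<cdot> action x = radj G \<cdot> ladj G \<cdot> H \<cdot> action x \<circ>\<^bsub>catA G\<^esub> rho (radj F \<bullet> ladj F \<bullet> ?a)"
    using rho_nat[of "action x"] by simp
  have "(?\<alpha> \<circ>\<^bsub>catA G\<^esub> radj G \<cdot> eps G (ladj G \<bullet> H \<bullet> ?a)) \<circ>\<^bsub>catA G\<^esub> ?i =
      H \<cdot> (action x \<circ>\<^bsub>catA F\<^esub> radj F \<cdot> eps F (ladj F \<bullet> ?a))"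
    by (simp flip: rho_mult)
  also have "\<dots> = H \<cdot> (action x \<circ>\<^bsub>catA F\<^esub> radj F \<cdot> ladj F \<cdot> action x)"
    by (simp only: algs_simps(6)[OF x])
  also have "\<dots> = (?\<alpha> \<circ>\<^bsub>catA G\<^esub> radj G \<cdot> ladj G \<cdot> ?\<alpha>) \<circ>\<^bsub>catA G\<^esub> ?i"
    by (simp del: algs_simps(6) flip: 1)
  finally have eq: "(?\<alpha> \<circ>\<^bsub>catA G\<^esub> radj G \<cdot> eps G (ladj G \<bullet> H \<bullet> ?a)) \<circ>\<^bsub>catA G\<^esub> ?i =
      (?\<alpha> \<circ>\<^bsub>catA G\<^esub> radj G \<cdot> ladj G \<cdot> ?\<alpha>) \<circ>\<^bsub>catA G\<^esub> ?i" .
  show "?\<alpha> \<circ>\<^bsub>catA G\<^esub> radj G \<cdot> eps G (ladj G \<bullet> H \<bullet> ?a) = ?\<alpha> \<circ>\<^bsub>catA G\<^esub> radj G \<cdot> ladj G \<cdot> ?\<alpha>"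
    by (rule iso_cancel(2)[OF _ _ _ _ eq]) (simp_all add: iso_Comp(1))
qed simp_all

lemma act_Arr:
  assumes "ar p x f y \<in> Arr (Alg_gen p F)"
  shows "ar p (act x) (H \<cdot> f) (act y) \<in> Arr (Alg_gen p G)"
proof -
  have [simp]: "x \<in> algs F" "y \<in> algs F" "f \<in> Arr (catA F)"
    "Dom (catA F) f = carrier x" "Cod (catA F) f = carrier y"
    and fh: "f \<circ>\<^bsub>catA F\<^esub> action x = action y \<circ>\<^bsub>catA F\<^esub> radj F \<cdot> ladj F \<cdot> f"
    using assms by (auto simp: ar_Arr)
  let ?r = "\<lambda>x. inverse_arrow (catA G) (rho (carrier x))"
  have "H \<cdot> f \<circ>\<^bsub>catA G\<^esub> (H \<cdot> action x \<circ>\<^bsub>catA G\<^esub> ?r x) = H \<cdot> (f \<circ>\<^bsub>catA F\<^esub> action x) \<circ>\<^bsub>catA G\<^esub> ?r x"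
    by simp
  also have "\<dots> = H \<cdot> action y \<circ>\<^bsub>catA G\<^esub> (?r y \<circ>\<^bsub>catA G\<^esub> ((rho (carrier y) \<circ>\<^bsub>catA G\<^esub> H \<cdot> radj F \<cdot> ladj F \<cdot> f) \<circ>\<^bsub>catA G\<^esub> ?r x))"
    unfolding fh by simp
  also have "rho (carrier y) \<circ>\<^bsub>catA G\<^esub> H \<cdot> radj F \<cdot> ladj F \<cdot> f = radj G \<cdot> ladj G \<cdot> H \<cdot> f \<circ>\<^bsub>catA G\<^esub> rho (carrier x)"
    using rho_nat[of f] by simp
  finally have "H \<cdot> f \<circ>\<^bsub>catA G\<^esub> (H \<cdot> action x \<circ>\<^bsub>catA G\<^esub> ?r x) =
      H \<cdot> action y \<circ>\<^bsub>catA G\<^esub> (?r y \<circ>\<^bsub>catA G\<^esub> radj G \<cdot> ladj G \<cdot> H \<cdot> f)"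
    by simp
  then show ?thesis
    by (simp add: ar_Arr)
qed

lemma d_kalg:
  assumes b [simp]: "b \<in> Obj (catB F)"
  shows "ar p (act (kalg F b)) (d b) (kalg G (K \<bullet> b)) \<in> Arr (Alg_gen p G)"
proof -
  have "d b \<circ>\<^bsub>catA G\<^esub> (H \<cdot> radj F \<cdot> eps F b \<circ>\<^bsub>catA G\<^esub> inverse_arrow (catA G) (rho (radj F \<bullet> b))) =
      (d b \<circ>\<^bsub>catA G\<^esub> H \<cdot> radj F \<cdot> eps F b) \<circ>\<^bsub>catA G\<^esub> inverse_arrow (catA G) (rho (radj F \<bullet> b))"
    by simp
  also have "\<dots> = radj G \<cdot> eps G (K \<bullet> b) \<circ>\<^bsub>catA G\<^esub> radj G \<cdot> ladj G \<cdot> d b"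
    unfolding d_mult[OF b] by simp
  finally show ?thesis
    by (simp add: ar_Arr)
qed

text \<open>\<open>rho a\<close> is the homomorphism \<open>d\<close> at
  \<open>ladj F \<bullet> a\<close> followed by the image of \<open>u a\<close> under the comparison
  functor, so it is a homomorphism.\<close>

lemma rho_free:
  assumes a [simp]: "a \<in> Obj (catA F)"
  shows "ar p (act (free F a)) (rho a) (free G (H \<bullet> a)) \<in> Arr (Alg_gen p G)"
proof -
  have "ar p (kalg G (K \<bullet> ladj F \<bullet> a)) (radj G \<cdot> u a) (kalg G (ladj G \<bullet> H \<bullet> a)) \<in> Arr (Alg_gen p G)"
    using kappa_gen_Arr[OF G, of "u a" p] by simp
  from ar_comp[OF G d_kalg this] show ?thesis
    by (simp add: free_kalg rho_def)
qed

end

definition alg_ftor_gen :: "bool \<Rightarrow> 'a univ adj_mor \<Rightarrow> 'a univ ftor" where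
  "alg_ftor_gen p \<Upsilon> = structured_gen p (Alg_gen p (src_adj \<Upsilon>))
     (alg_morph.act (src_adj \<Upsilon>) (tgt_adj \<Upsilon>) (mH \<Upsilon>) (ups \<Upsilon>) (dns \<Upsilon>)) (\<lambda>h. mH \<Upsilon> \<cdot> und h)"

definition EM_mor_gen :: "bool \<Rightarrow> 'a univ adj_mor \<Rightarrow> 'a univ adj_mor" where
  "EM_mor_gen p \<Upsilon> =
     (let F = src_adj \<Upsilon>; G = tgt_adj \<Upsilon>; H = mH \<Upsilon>; K = alg_ftor_gen p \<Upsilon> in
      \<lparr>src_adj = EM_gen p F, tgt_adj = EM_gen p G, mH = H, mK = K,
       ups = (\<lambda>a. ar p (K \<bullet> free F a) (radj G \<cdot> ups \<Upsilon> a \<circ>\<^bsub>catA G\<^esub> dns \<Upsilon> (ladj F \<bullet> a)) (free G (H \<bullet> a))),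
       dns = (\<lambda>x. One (catA G) (H \<bullet> carrier x))\<rparr>)"

lemma adj_hom_alg_morph:
  "\<Upsilon> \<in> adj_hom F G \<Longrightarrow> alg_morph F G (mH \<Upsilon>) (mK \<Upsilon>) (ups \<Upsilon>) (dns \<Upsilon>)"
  by (simp add: alg_morph_def adj_homD(5))

lemma und_Alg_gen:
  assumes "X \<in> Arr (Alg_gen p F)"
  shows "und X \<in> Arr (catA F)" "Dom (catA F) (und X) = carrier (ar_dom p X)"
    "Cod (catA F) (und X) = carrier (ar_cod p X)"
  using assms by (auto elim!: Alg_gen_cases)

lemma alg_ftor_gen_functor:
  assumes \<Upsilon>: "\<Upsilon> \<in> adj_hom F G"
  shows "is_functor (Alg_gen p F) (Alg_gen p G) (alg_ftor_gen p \<Upsilon>)"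
proof -
  interpret Y: alg_morph F G "mH \<Upsilon>" "mK \<Upsilon>" "ups \<Upsilon>" "dns \<Upsilon>"
    by (rule adj_hom_alg_morph[OF \<Upsilon>])
  have "ar p (Y.act (ar_dom p f)) (mH \<Upsilon> \<cdot> und f) (Y.act (ar_cod p f)) \<in> Arr (Alg_gen p G)"
    if f: "f \<in> Arr (Alg_gen p F)" for f
  proof -
    obtain x g y where "f = ar p x g y"
      using f by (rule Alg_gen_cases)
    with f show ?thesis
      using Y.act_Arr by simp
  qed
  then show ?thesis
    unfolding is_functor_iff alg_ftor_gen_def adj_homD(1,2)[OF \<Upsilon>] by (simp add: und_Alg_gen)
qed

lemma EM_mor_gen_simps:
  assumes \<Upsilon>: "\<Upsilon> \<in> adj_hom F G"
  shows "src_adj (EM_mor_gen p \<Upsilon>) = EM_gen p F" "tgt_adj (EM_mor_gen p \<Upsilon>) = EM_gen p G"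
    "mH (EM_mor_gen p \<Upsilon>) = mH \<Upsilon>" "mK (EM_mor_gen p \<Upsilon>) = alg_ftor_gen p \<Upsilon>"
    "alg_ftor_gen p \<Upsilon> \<bullet> x = alg_morph.act F G (mH \<Upsilon>) (ups \<Upsilon>) (dns \<Upsilon>) x"
    "alg_ftor_gen p \<Upsilon> \<cdot> h = ar p (alg_morph.act F G (mH \<Upsilon>) (ups \<Upsilon>) (dns \<Upsilon>) (ar_dom p h)) (mH \<Upsilon> \<cdot> und h)
       (alg_morph.act F G (mH \<Upsilon>) (ups \<Upsilon>) (dns \<Upsilon>) (ar_cod p h))"
    "ups (EM_mor_gen p \<Upsilon>) a = ar p (alg_morph.act F G (mH \<Upsilon>) (ups \<Upsilon>) (dns \<Upsilon>) (free F a))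
       (adj_morph.rho F G (ups \<Upsilon>) (dns \<Upsilon>) a) (free G (mH \<Upsilon> \<bullet> a))"
    "dns (EM_mor_gen p \<Upsilon>) x = One (catA G) (mH \<Upsilon> \<bullet> carrier x)"
  using adj_morph.rho_def[OF adj_homD(5)[OF \<Upsilon>]]
  by (simp_all add: EM_mor_gen_def alg_ftor_gen_def adj_homD(1,2)[OF \<Upsilon>] Let_def)

text \<open>The only nontrivial 2-cell is \<open>rho\<close>, an isomorphism of free algebras by
  \<open>rho_free\<close>; the unit law is its compatibility with the units.\<close>

lemma EM_mor_gen_hom:
  assumes \<Upsilon>: "\<Upsilon> \<in> adj_hom F G"
  shows "EM_mor_gen p \<Upsilon> \<in> adj_hom (EM_gen p F) (EM_gen p G)"
proof -
  interpret Y: alg_morph F G "mH \<Upsilon>" "mK \<Upsilon>" "ups \<Upsilon>" "dns \<Upsilon>"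
    by (rule adj_hom_alg_morph[OF \<Upsilon>])
  note [simp] = EM_mor_gen_simps[OF \<Upsilon>]
  have K: "is_functor (Alg_gen p F) (Alg_gen p G) (alg_ftor_gen p \<Upsilon>)"
    by (rule alg_ftor_gen_functor[OF \<Upsilon>])
  have "adj_morph (EM_gen p F) (EM_gen p G) (mH \<Upsilon>) (alg_ftor_gen p \<Upsilon>) (ups (EM_mor_gen p \<Upsilon>)) (dns (EM_mor_gen p \<Upsilon>))"
  proof
    show "is_functor (catA (EM_gen p F)) (catA (EM_gen p G)) (mH \<Upsilon>)"
      "is_functor (catB (EM_gen p F)) (catB (EM_gen p G)) (alg_ftor_gen p \<Upsilon>)"
      using Y.H K by simp_all
    show "nat_iso (catA (EM_gen p F)) (catB (EM_gen p G)) (comp_ftor (alg_ftor_gen p \<Upsilon>) (ladj (EM_gen p F)))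
        (comp_ftor (ladj (EM_gen p G)) (mH \<Upsilon>)) (ups (EM_mor_gen p \<Upsilon>))"
    proof (rule nat_isoI)
      show "is_functor (catA (EM_gen p F)) (catB (EM_gen p G)) (comp_ftor (alg_ftor_gen p \<Upsilon>) (ladj (EM_gen p F)))"
        "is_functor (catA (EM_gen p F)) (catB (EM_gen p G)) (comp_ftor (ladj (EM_gen p G)) (mH \<Upsilon>))"
        using is_functor_comp[OF free_functor[OF Y.F] K] is_functor_comp[OF Y.H free_functor[OF Y.G]] by simp_all
      show "iso_arrow (catB (EM_gen p G)) (ups (EM_mor_gen p \<Upsilon>) a) \<and>
          Dom (catB (EM_gen p G)) (ups (EM_mor_gen p \<Upsilon>) a) = comp_ftor (alg_ftor_gen p \<Upsilon>) (ladj (EM_gen p F)) \<bullet> a \<and>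
          Cod (catB (EM_gen p G)) (ups (EM_mor_gen p \<Upsilon>) a) = comp_ftor (ladj (EM_gen p G)) (mH \<Upsilon>) \<bullet> a"
        if "a \<in> Obj (catA (EM_gen p F))" for a
        using that Alg_gen_iso(1)[OF Y.G Y.rho_free] by simp
      show "ups (EM_mor_gen p \<Upsilon>) (Cod (catA (EM_gen p F)) f) \<circ>\<^bsub>catB (EM_gen p G)\<^esub>
            comp_ftor (alg_ftor_gen p \<Upsilon>) (ladj (EM_gen p F)) \<cdot> f =
          comp_ftor (ladj (EM_gen p G)) (mH \<Upsilon>) \<cdot> f \<circ>\<^bsub>catB (EM_gen p G)\<^esub>
            ups (EM_mor_gen p \<Upsilon>) (Dom (catA (EM_gen p F)) f)"
        if "f \<in> Arr (catA (EM_gen p F))" for f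
        using that Y.rho_nat[of f] by simp
    qed
    show "nat_iso (catB (EM_gen p F)) (catA (EM_gen p G)) (comp_ftor (mH \<Upsilon>) (radj (EM_gen p F)))
        (comp_ftor (radj (EM_gen p G)) (alg_ftor_gen p \<Upsilon>)) (dns (EM_mor_gen p \<Upsilon>))"
    proof (rule nat_isoI)
      show "is_functor (catB (EM_gen p F)) (catA (EM_gen p G)) (comp_ftor (mH \<Upsilon>) (radj (EM_gen p F)))"
        "is_functor (catB (EM_gen p F)) (catA (EM_gen p G)) (comp_ftor (radj (EM_gen p G)) (alg_ftor_gen p \<Upsilon>))"
        using is_functor_comp[OF forget_functor[OF Y.F] Y.H] is_functor_comp[OF K forget_functor[OF Y.G]] by simp_all
    qed (auto elim!: Alg_gen_cases)
    show "radj (EM_gen p G) \<cdot> ups (EM_mor_gen p \<Upsilon>) a \<circ>\<^bsub>catA (EM_gen p G)\<^esub>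
        (dns (EM_mor_gen p \<Upsilon>) (ladj (EM_gen p F) \<bullet> a) \<circ>\<^bsub>catA (EM_gen p G)\<^esub> mH \<Upsilon> \<cdot> eta (EM_gen p F) a) =
        eta (EM_gen p G) (mH \<Upsilon> \<bullet> a)" if "a \<in> Obj (catA (EM_gen p F))" for a
      using that by simp
  qed (simp_all add: EM_gen)
  then show ?thesis
    by (simp add: adj_hom_iff)
qed

text \<open>As algebras are determined by their carrier and action, an isomorphism between morphisms into
  \<open>EM_gen p G\<close> is determined by its part on the left-hand categories.\<close>

lemma iso_into_EM_gen:
  assumes \<Phi>: "\<Phi> \<in> adj_hom F (EM_gen p G)" and \<Psi>: "\<Psi> \<in> adj_hom F (EM_gen p G)"
    and G [simp]: "adjunction G"
    and \<theta>: "nat_iso (catA F) (catA G) (mH \<Phi>) (mH \<Psi>) \<theta>"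
    and \<theta>_rho: "\<And>a. a \<in> Obj (catA F) \<Longrightarrow>
      und (ups \<Psi> a) \<circ>\<^bsub>catA G\<^esub> (dns \<Psi> (ladj F \<bullet> a) \<circ>\<^bsub>catA G\<^esub> \<theta> (radj F \<bullet> ladj F \<bullet> a)) =
      radj G \<cdot> ladj G \<cdot> \<theta> a \<circ>\<^bsub>catA G\<^esub> (und (ups \<Phi> a) \<circ>\<^bsub>catA G\<^esub> dns \<Phi> (ladj F \<bullet> a))"
  shows "\<Phi> \<cong> \<Psi>"
proof -
  interpret P: adj_morph F "EM_gen p G" "mH \<Phi>" "mK \<Phi>" "ups \<Phi>" "dns \<Phi>"
    by (rule adj_homD(5)[OF \<Phi>])
  interpret Q: adj_morph F "EM_gen p G" "mH \<Psi>" "mK \<Psi>" "ups \<Psi>" "dns \<Psi>"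
    by (rule adj_homD(5)[OF \<Psi>])
  let ?C = "catA G" and ?T = "\<lambda>f. radj G \<cdot> ladj G \<cdot> f" and ?R = "\<lambda>b. radj F \<bullet> b"
  note [simp] = P.d_simps[simplified] P.H.ftor_simps[simplified] P.K.ftor_simps(3)[simplified] P.rho_simps(1-4)[simplified]
    Q.d_simps[simplified] Q.H.ftor_simps[simplified] Q.K.ftor_simps(3)[simplified] Q.rho_simps(1-4)[simplified]
    nat_isoD(3-6)[OF \<theta>]
  note [simp] = P.u_simps(1-3)[simplified] Q.u_simps(1-3)[simplified]
    und_Alg_gen[OF P.u_simps(1)[simplified]] und_Alg_gen[OF Q.u_simps(1)[simplified]]
  \<comment> \<open>The compatibility with \<open>dns\<close> forces this underlying arrow. What
    must be shown is that it is an algebra homomorphism, and here \<open>\<theta>_rho\<close>, the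
    compatibility of \<open>\<theta>\<close> with the two monad morphisms, enters.\<close>
  define \<delta> where "\<delta> b = dns \<Psi> b \<circ>\<^bsub>?C\<^esub> (\<theta> (?R b) \<circ>\<^bsub>?C\<^esub> inverse_arrow ?C (dns \<Phi> b))" for b
  define \<phi> where "\<phi> b = ar p (mK \<Phi> \<bullet> b) (\<delta> b) (mK \<Psi> \<bullet> b)" for b
  have \<delta> [simp]: "\<delta> b \<in> Arr ?C" "Dom ?C (\<delta> b) = carrier (mK \<Phi> \<bullet> b)" "Cod ?C (\<delta> b) = carrier (mK \<Psi> \<bullet> b)" "iso_arrow ?C (\<delta> b)"
    if "b \<in> Obj (catB F)" for b
    using that by (simp_all add: \<delta>_def iso_Comp(1))
  have \<delta>_dns: "\<delta> b \<circ>\<^bsub>?C\<^esub> dns \<Phi> b = dns \<Psi> b \<circ>\<^bsub>?C\<^esub> \<theta> (?R b)" if "b \<in> Obj (catB F)" for b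
    using that by (simp add: \<delta>_def)
  have \<phi>_Arr: "\<phi> b \<in> Arr (Alg_gen p G)" if b [simp]: "b \<in> Obj (catB F)" for b
  proof -
    let ?x = "mK \<Phi> \<bullet> b" and ?y = "mK \<Psi> \<bullet> b"
    \<comment> \<open>Both sides of the homomorphism equation are compared after precomposition with
      this isomorphism, where the actions are expressed by \<open>d_mult\<close>.\<close>
    let ?i = "?T (dns \<Phi> b) \<circ>\<^bsub>?C\<^esub> P.rho (?R b)"
    have r: "Q.rho (?R b) \<circ>\<^bsub>?C\<^esub> \<theta> (?R (ladj F \<bullet> ?R b)) = ?T (\<theta> (?R b)) \<circ>\<^bsub>?C\<^esub> P.rho (?R b)"
      using \<theta>_rho[of "?R b"] by (simp add: P.rho_def Q.rho_def)
    have t: "\<theta> (?R b) \<circ>\<^bsub>?C\<^esub> mH \<Phi> \<cdot> radj F \<cdot> eps F b = mH \<Psi> \<cdot> radj F \<cdot> eps F b \<circ>\<^bsub>?C\<^esub> \<theta> (?R (ladj F \<bullet> ?R b))"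
      using nat_isoD(7)[OF \<theta>, of "radj F \<cdot> eps F b"] by simp
    have 1: "dns \<Phi> b \<circ>\<^bsub>?C\<^esub> mH \<Phi> \<cdot> radj F \<cdot> eps F b = action ?x \<circ>\<^bsub>?C\<^esub> ?i"
      using P.d_mult[OF b] by simp
    have 2: "dns \<Psi> b \<circ>\<^bsub>?C\<^esub> mH \<Psi> \<cdot> radj F \<cdot> eps F b = action ?y \<circ>\<^bsub>?C\<^esub> (?T (dns \<Psi> b) \<circ>\<^bsub>?C\<^esub> Q.rho (?R b))"
      using Q.d_mult[OF b] by simp
    have 3: "?T (\<delta> b) \<circ>\<^bsub>?C\<^esub> ?T (dns \<Phi> b) = ?T (dns \<Psi> b) \<circ>\<^bsub>?C\<^esub> ?T (\<theta> (?R b))"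
      using arg_cong[OF \<delta>_dns[OF b], of ?T] by simp
    have "(\<delta> b \<circ>\<^bsub>?C\<^esub> action ?x) \<circ>\<^bsub>?C\<^esub> ?i = (\<delta> b \<circ>\<^bsub>?C\<^esub> dns \<Phi> b) \<circ>\<^bsub>?C\<^esub> mH \<Phi> \<cdot> radj F \<cdot> eps F b"
      by (simp add: 1)
    also have "\<dots> = (dns \<Psi> b \<circ>\<^bsub>?C\<^esub> mH \<Psi> \<cdot> radj F \<cdot> eps F b) \<circ>\<^bsub>?C\<^esub> \<theta> (?R (ladj F \<bullet> ?R b))"
      unfolding \<delta>_dns[OF b] by (simp add: t)
    also have "\<dots> = action ?y \<circ>\<^bsub>?C\<^esub> ((?T (dns \<Psi> b) \<circ>\<^bsub>?C\<^esub> ?T (\<theta> (?R b))) \<circ>\<^bsub>?C\<^esub> P.rho (?R b))"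
      unfolding 2 by (simp add: r)
    also have "\<dots> = (action ?y \<circ>\<^bsub>?C\<^esub> ?T (\<delta> b)) \<circ>\<^bsub>?C\<^esub> ?i"
      unfolding 3[symmetric] by simp
    finally have eq: "(\<delta> b \<circ>\<^bsub>?C\<^esub> action ?x) \<circ>\<^bsub>?C\<^esub> ?i = (action ?y \<circ>\<^bsub>?C\<^esub> ?T (\<delta> b)) \<circ>\<^bsub>?C\<^esub> ?i" .
    have "\<delta> b \<circ>\<^bsub>?C\<^esub> action ?x = action ?y \<circ>\<^bsub>?C\<^esub> ?T (\<delta> b)"
      by (rule iso_cancel(2)[OF _ _ _ _ eq]) (simp_all add: iso_Comp(1))
    then show ?thesis
      by (simp add: \<phi>_def ar_Arr)
  qed
  have "nat_iso (catB F) (Alg_gen p G) (mK \<Phi>) (mK \<Psi>) \<phi>"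
  proof (rule nat_isoI)
    show "is_functor (catB F) (Alg_gen p G) (mK \<Phi>)" "is_functor (catB F) (Alg_gen p G) (mK \<Psi>)"
      using P.K Q.K by simp_all
    show "iso_arrow (Alg_gen p G) (\<phi> b) \<and> Dom (Alg_gen p G) (\<phi> b) = mK \<Phi> \<bullet> b \<and> Cod (Alg_gen p G) (\<phi> b) = mK \<Psi> \<bullet> b"
      if b: "b \<in> Obj (catB F)" for b
      using Alg_gen_iso(1)[OF G \<phi>_Arr[OF b, unfolded \<phi>_def] \<delta>(4)[OF b]] by (simp add: \<phi>_def)
    fix g assume g [simp]: "g \<in> Arr (catB F)"
    let ?b = "Dom (catB F) g" and ?b' = "Cod (catB F) g"
    have K: "und (mK \<Xi> \<cdot> g) \<in> Arr ?C \<and> Dom ?C (und (mK \<Xi> \<cdot> g)) = carrier (mK \<Xi> \<bullet> ?b) \<and>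
        Cod ?C (und (mK \<Xi> \<cdot> g)) = carrier (mK \<Xi> \<bullet> ?b') \<and> ar_dom p (mK \<Xi> \<cdot> g) = mK \<Xi> \<bullet> ?b \<and> ar_cod p (mK \<Xi> \<cdot> g) = mK \<Xi> \<bullet> ?b'"
      if "is_functor (catB F) (Alg_gen p G) (mK \<Xi>)" for \<Xi> :: "'a univ adj_mor"
      using that und_Alg_gen[of "mK \<Xi> \<cdot> g" p G] unfolding is_functor_iff by auto
    note [simp] = K[of \<Phi>, OF P.K[simplified]] K[of \<Psi>, OF Q.K[simplified]]
    have 1: "dns \<Phi> ?b' \<circ>\<^bsub>?C\<^esub> mH \<Phi> \<cdot> radj F \<cdot> g = und (mK \<Phi> \<cdot> g) \<circ>\<^bsub>?C\<^esub> dns \<Phi> ?b"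
      using P.d_nat[of g] by simp
    have 2: "dns \<Psi> ?b' \<circ>\<^bsub>?C\<^esub> mH \<Psi> \<cdot> radj F \<cdot> g = und (mK \<Psi> \<cdot> g) \<circ>\<^bsub>?C\<^esub> dns \<Psi> ?b"
      using Q.d_nat[of g] by simp
    have "(\<delta> ?b' \<circ>\<^bsub>?C\<^esub> und (mK \<Phi> \<cdot> g)) \<circ>\<^bsub>?C\<^esub> dns \<Phi> ?b = (\<delta> ?b' \<circ>\<^bsub>?C\<^esub> dns \<Phi> ?b') \<circ>\<^bsub>?C\<^esub> mH \<Phi> \<cdot> radj F \<cdot> g"
      by (simp add: 1)
    also have "\<dots> = (dns \<Psi> ?b' \<circ>\<^bsub>?C\<^esub> mH \<Psi> \<cdot> radj F \<cdot> g) \<circ>\<^bsub>?C\<^esub> \<theta> (?R ?b)"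
      using nat_isoD(7)[OF \<theta>, of "radj F \<cdot> g"] by (simp add: \<delta>_dns)
    also have "\<dots> = (und (mK \<Psi> \<cdot> g) \<circ>\<^bsub>?C\<^esub> \<delta> ?b) \<circ>\<^bsub>?C\<^esub> dns \<Phi> ?b"
      unfolding 2 by (simp add: \<delta>_dns)
    finally have eq: "(\<delta> ?b' \<circ>\<^bsub>?C\<^esub> und (mK \<Phi> \<cdot> g)) \<circ>\<^bsub>?C\<^esub> dns \<Phi> ?b = (und (mK \<Psi> \<cdot> g) \<circ>\<^bsub>?C\<^esub> \<delta> ?b) \<circ>\<^bsub>?C\<^esub> dns \<Phi> ?b" .
    have "\<delta> ?b' \<circ>\<^bsub>?C\<^esub> und (mK \<Phi> \<cdot> g) = und (mK \<Psi> \<cdot> g) \<circ>\<^bsub>?C\<^esub> \<delta> ?b"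
      by (rule iso_cancel(2)[OF _ _ _ _ eq]) simp_all
    then show "\<phi> (Cod (catB F) g) \<circ>\<^bsub>Alg_gen p G\<^esub> mK \<Phi> \<cdot> g = mK \<Psi> \<cdot> g \<circ>\<^bsub>Alg_gen p G\<^esub> \<phi> (Dom (catB F) g)"
      by (simp add: \<phi>_def)
  qed
  then show ?thesis
    using \<theta> \<delta>_dns by (intro adj_isoI[OF \<Phi> \<Psi>, of \<theta> \<phi>]) (simp_all add: \<phi>_def)
qed

subsection \<open>Eilenberg--Moore adjunctions as an idempotent pointed endofunctor\<close>

definition EM_endo :: "bool \<Rightarrow> 'a univ adj_endo" where
  "EM_endo p = \<lparr>on_adj = EM_gen p, on_mor = EM_mor_gen p\<rparr>"

lemma EM_endo_simps [simp]: "on_adj (EM_endo p) = EM_gen p" "on_mor (EM_endo p) = EM_mor_gen p"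
  by (simp_all add: EM_endo_def)

definition kappa_mor :: "bool \<Rightarrow> 'a univ adj \<Rightarrow> 'a univ adj_mor" where
  "kappa_mor p F = strict_mor F (EM_gen p F) id_ftor (kappa_gen p F)"

lemma kappa_mor_hom:
  assumes F [simp]: "adjunction F"
  shows "kappa_mor p F \<in> adj_hom F (EM_gen p F)"
  unfolding kappa_mor_def
  by (rule strict_mor_hom) (auto simp: EM_gen is_functor_id kappa_gen_functor free_kalg)

text \<open>The left-hand functors of the two composites coincide, and both induce the same
  isomorphism of monads; so \<open>iso_into_EM_gen\<close> applies with identities as
  \<open>\<theta>\<close>.\<close>

lemma kappa_mor_natural: "adj_natural id_endo (EM_endo p) (kappa_mor p)"
  unfolding adj_natural_def endo_simps EM_endo_simps
proof (intro conjI allI impI)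
  fix F G :: "'a univ adj" and \<Upsilon> assume \<Upsilon>: "\<Upsilon> \<in> adj_hom F G"
  interpret Y: alg_morph F G "mH \<Upsilon>" "mK \<Upsilon>" "ups \<Upsilon>" "dns \<Upsilon>"
    by (rule adj_hom_alg_morph[OF \<Upsilon>])
  show "kappa_mor p G \<odot> \<Upsilon> \<cong> EM_mor_gen p \<Upsilon> \<odot> kappa_mor p F"
  proof (rule iso_into_EM_gen[OF comp_adj_hom[OF \<Upsilon> kappa_mor_hom[OF Y.G]]
        comp_adj_hom[OF kappa_mor_hom[OF Y.F] EM_mor_gen_hom[OF \<Upsilon>]] Y.G])
    show "nat_iso (catA F) (catA G) (mH (kappa_mor p G \<odot> \<Upsilon>)) (mH (EM_mor_gen p \<Upsilon> \<odot> kappa_mor p F))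
        (\<lambda>a. One (catA G) (mH \<Upsilon> \<bullet> a))"
      using nat_iso_id[OF Y.H] by (simp add: kappa_mor_def EM_mor_gen_simps[OF \<Upsilon>])
  qed (auto simp: kappa_mor_def EM_mor_gen_simps[OF \<Upsilon>] Y.rho_def adj_homD(1,2)[OF \<Upsilon>] free_kalg)
qed (rule kappa_mor_hom)

lemma EM_mor_gen_cong:
  assumes "\<Upsilon> \<cong> \<Upsilon>'"
  shows "EM_mor_gen p \<Upsilon> \<cong> EM_mor_gen p \<Upsilon>'"
  using assms
proof (rule adj_isoE)
  fix F G \<theta> \<phi>
  assume \<Upsilon>: "\<Upsilon> \<in> adj_hom F G" and \<Upsilon>': "\<Upsilon>' \<in> adj_hom F G"
    and \<theta>: "nat_iso (catA F) (catA G) (mH \<Upsilon>) (mH \<Upsilon>') \<theta>"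
    and \<phi>: "nat_iso (catB F) (catB G) (mK \<Upsilon>) (mK \<Upsilon>') \<phi>"
    and u: "\<And>a. a \<in> Obj (catA F) \<Longrightarrow>
      ups \<Upsilon>' a \<circ>\<^bsub>catB G\<^esub> \<phi> (ladj F \<bullet> a) = ladj G \<cdot> \<theta> a \<circ>\<^bsub>catB G\<^esub> ups \<Upsilon> a"
    and d: "\<And>b. b \<in> Obj (catB F) \<Longrightarrow>
      dns \<Upsilon>' b \<circ>\<^bsub>catA G\<^esub> \<theta> (radj F \<bullet> b) = radj G \<cdot> \<phi> b \<circ>\<^bsub>catA G\<^esub> dns \<Upsilon> b"
  interpret Y: alg_morph F G "mH \<Upsilon>" "mK \<Upsilon>" "ups \<Upsilon>" "dns \<Upsilon>"
    by (rule adj_hom_alg_morph[OF \<Upsilon>])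
  interpret Y': alg_morph F G "mH \<Upsilon>'" "mK \<Upsilon>'" "ups \<Upsilon>'" "dns \<Upsilon>'"
    by (rule adj_hom_alg_morph[OF \<Upsilon>'])
  note [simp] = nat_isoD(3-6)[OF \<theta>] nat_isoD(3-6)[OF \<phi>]
  have rho: "Y'.rho a \<circ>\<^bsub>catA G\<^esub> \<theta> (radj F \<bullet> ladj F \<bullet> a) = radj G \<cdot> ladj G \<cdot> \<theta> a \<circ>\<^bsub>catA G\<^esub> Y.rho a"
    if a [simp]: "a \<in> Obj (catA F)" for a
  proof -
    have 1: "radj G \<cdot> ups \<Upsilon>' a \<circ>\<^bsub>catA G\<^esub> radj G \<cdot> \<phi> (ladj F \<bullet> a) = radj G \<cdot> ladj G \<cdot> \<theta> a \<circ>\<^bsub>catA G\<^esub> radj G \<cdot> ups \<Upsilon> a"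
      using arg_cong[OF u[OF a], of "FArr (radj G)"] by simp
    show ?thesis
      by (simp add: Y.rho_def Y'.rho_def d precomp[OF 1])
  qed
  show ?thesis
  proof (rule iso_into_EM_gen[OF EM_mor_gen_hom[OF \<Upsilon>] EM_mor_gen_hom[OF \<Upsilon>'] Y.G])
    show "nat_iso (catA (EM_gen p F)) (catA G) (mH (EM_mor_gen p \<Upsilon>)) (mH (EM_mor_gen p \<Upsilon>')) \<theta>"
      using \<theta> by (simp add: EM_mor_gen_simps[OF \<Upsilon>] EM_mor_gen_simps[OF \<Upsilon>'])
  qed (simp add: EM_mor_gen_simps[OF \<Upsilon>] EM_mor_gen_simps[OF \<Upsilon>'] rho)
qed

lemma endofunctor_EM: "endofunctor (EM_endo p)"
  unfolding endofunctor_def EM_endo_simps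
proof (intro conjI allI impI)
  fix F :: "'a univ adj" assume F [simp]: "adjunction F"
  note \<Upsilon> = id_adj_hom[OF F]
  interpret Y: alg_morph F F "mH (id_adj F)" "mK (id_adj F)" "ups (id_adj F)" "dns (id_adj F)"
    by (rule adj_hom_alg_morph[OF \<Upsilon>])
  show "EM_mor_gen p (id_adj F) \<cong> id_adj (EM_gen p F)"
  proof (rule iso_into_EM_gen[OF EM_mor_gen_hom[OF \<Upsilon>] id_adj_hom[OF EM_gen[OF F]] F])
    show "nat_iso (catA (EM_gen p F)) (catA F) (mH (EM_mor_gen p (id_adj F))) (mH (id_adj (EM_gen p F))) (One (catA F))"
      using nat_iso_id[OF is_functor_id, of "catA F"] by (simp add: EM_mor_gen_simps[OF \<Upsilon>])
  qed (use Y.rho_def in \<open>simp add: EM_mor_gen_simps[OF \<Upsilon>] Y.rho_def\<close>)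
next
  fix F G L :: "'a univ adj" and \<Upsilon> \<Psi> assume \<Upsilon>: "\<Upsilon> \<in> adj_hom F G" and \<Psi>: "\<Psi> \<in> adj_hom G L"
  note \<Psi>\<Upsilon> = comp_adj_hom[OF \<Upsilon> \<Psi>]
  interpret Y: alg_morph F G "mH \<Upsilon>" "mK \<Upsilon>" "ups \<Upsilon>" "dns \<Upsilon>"
    by (rule adj_hom_alg_morph[OF \<Upsilon>])
  interpret P: alg_morph G L "mH \<Psi>" "mK \<Psi>" "ups \<Psi>" "dns \<Psi>"
    by (rule adj_hom_alg_morph[OF \<Psi>])
  interpret PY: alg_morph F L "mH (\<Psi> \<odot> \<Upsilon>)" "mK (\<Psi> \<odot> \<Upsilon>)" "ups (\<Psi> \<odot> \<Upsilon>)" "dns (\<Psi> \<odot> \<Upsilon>)"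
    by (rule adj_hom_alg_morph[OF \<Psi>\<Upsilon>])
  \<comment> \<open>Pasting of morphisms of adjunctions induces composition of the monad
    morphisms.\<close>
  have rho: "PY.rho a = P.rho (mH \<Upsilon> \<bullet> a) \<circ>\<^bsub>catA L\<^esub> mH \<Psi> \<cdot> Y.rho a" if [simp]: "a \<in> Obj (catA F)" for a
  proof -
    have 1: "dns \<Psi> (ladj G \<bullet> mH \<Upsilon> \<bullet> a) \<circ>\<^bsub>catA L\<^esub> mH \<Psi> \<cdot> radj G \<cdot> ups \<Upsilon> a =
        radj L \<cdot> mK \<Psi> \<cdot> ups \<Upsilon> a \<circ>\<^bsub>catA L\<^esub> dns \<Psi> (mK \<Upsilon> \<bullet> ladj F \<bullet> a)"
      using P.d_nat[of "ups \<Upsilon> a"] by simp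
    show ?thesis
      unfolding PY.rho_def P.rho_def Y.rho_def by (simp add: adj_homD(1,2)[OF \<Psi>] precomp[OF 1])
  qed
  show "EM_mor_gen p (\<Psi> \<odot> \<Upsilon>) \<cong> EM_mor_gen p \<Psi> \<odot> EM_mor_gen p \<Upsilon>"
  proof (rule iso_into_EM_gen[OF EM_mor_gen_hom[OF \<Psi>\<Upsilon>]
        comp_adj_hom[OF EM_mor_gen_hom[OF \<Upsilon>] EM_mor_gen_hom[OF \<Psi>]] P.G])
    show "nat_iso (catA (EM_gen p F)) (catA L) (mH (EM_mor_gen p (\<Psi> \<odot> \<Upsilon>))) (mH (EM_mor_gen p \<Psi> \<odot> EM_mor_gen p \<Upsilon>))
        (\<lambda>a. One (catA L) (mH \<Psi> \<bullet> mH \<Upsilon> \<bullet> a))"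
      using nat_iso_id[OF PY.H] by (simp add: EM_mor_gen_simps[OF \<Psi>\<Upsilon>] EM_mor_gen_simps[OF \<Upsilon>] EM_mor_gen_simps[OF \<Psi>])
  qed (simp add: EM_mor_gen_simps[OF \<Psi>\<Upsilon>] EM_mor_gen_simps[OF \<Upsilon>] EM_mor_gen_simps[OF \<Psi>] rho[unfolded comp_adj_simps])
qed (auto intro: EM_gen EM_mor_gen_hom EM_mor_gen_cong)

text \<open>\<open>EM_gen p F\<close> induces the same monad as \<open>F\<close>, so the passage to its algebras changes nothing.\<close>

lemma algs_EM_gen: "algs (EM_gen p F) = algs F"
  by (simp add: algs_def algebras_def)

lemma Alg_gen_EM_gen: "Alg_gen q (EM_gen p F) = Alg_gen q F"
  by (simp add: Alg_gen_def algs_EM_gen)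

text \<open>The 2-cells are identities, so \<open>rho\<close> is an identity and the induced functor
  leaves every algebra unchanged. This covers \<open>kappa_mor\<close> as well as the comparison
  from coalgebras to the nucleus.\<close>

lemma EM_strict_equivalence:
  assumes \<Upsilon>: "strict_mor F G id_ftor K \<in> adj_hom F G" and A: "catA G = catA F"
    and algs: "Alg_gen p G = Alg_gen p F"
  shows "adj_equivalence (EM_mor_gen p (strict_mor F G id_ftor K))"
proof -
  let ?\<Upsilon> = "strict_mor F G id_ftor K"
  interpret Y: alg_morph F G id_ftor K "\<lambda>a. One (catB G) (K \<bullet> ladj F \<bullet> a)" "\<lambda>b. One (catA G) (radj F \<bullet> b)"
    using adj_hom_alg_morph[OF \<Upsilon>] by simp
  have rho: "Y.rho a = One (catA F) (radj F \<bullet> ladj F \<bullet> a)" if [simp]: "a \<in> Obj (catA F)" for a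
  proof -
    have "radj G \<bullet> K \<bullet> ladj F \<bullet> a = radj F \<bullet> ladj F \<bullet> a"
      using Y.d_simps(3)[of "ladj F \<bullet> a"] by (simp add: A)
    then show ?thesis
      unfolding Y.rho_def by (simp add: A)
  qed
  have act: "Y.act x = x" if "x \<in> algs F" for x
    unfolding Y.act_def rho[OF algs_simps(1)[OF that]] using that by (simp add: A)
  have "equivalence_functor (Alg_gen p F) (Alg_gen p F) (alg_ftor_gen p ?\<Upsilon>)"
    by (rule equivalence_functor_id) (auto simp: EM_mor_gen_simps(5,6)[OF \<Upsilon>] act elim!: Alg_gen_cases)
  then show ?thesis
    using EM_mor_gen_hom[OF \<Upsilon>, of p]
    by (simp add: adj_equivalence_def adj_morphism_iff EM_mor_gen_simps(1-4)[OF \<Upsilon>] A algs equivalence_functor_id)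
qed

text \<open>The comparison functor of an Eilenberg--Moore adjunction acts as the identity: the
  algebra assigned to \<open>x\<close> consists of the carrier and action of \<open>x\<close>
  itself.\<close>

lemma idem_pointed_EM: "idem_pointed_endo (EM_endo p) (kappa_mor p)"
proof -
  have "adj_equivalence (kappa_mor p (EM_gen p F))" if F [simp]: "adjunction F" for F :: "'a univ adj"
  proof -
    have "kalg (EM_gen p F) x = x" if "x \<in> algs F" for x
      using that by (simp add: kalg_def)
    then have "equivalence_functor (Alg_gen p F) (Alg_gen p F) (kappa_gen p (EM_gen p F))"
      by (intro equivalence_functor_id) (auto elim!: Alg_gen_cases)
    then show ?thesis
      using kappa_mor_hom[OF EM_gen[OF F], of p p]
      by (simp add: adj_equivalence_def adj_morphism_iff kappa_mor_def Alg_gen_EM_gen equivalence_functor_id)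
  qed
  moreover have "adj_equivalence (EM_mor_gen p (kappa_mor p F))" if F: "adjunction F" for F :: "'a univ adj"
    using EM_strict_equivalence[OF kappa_mor_hom[OF F, of p, unfolded kappa_mor_def] EM_gen_simps(1) Alg_gen_EM_gen]
    by (simp add: kappa_mor_def)
  ultimately show ?thesis
    unfolding idem_pointed_endo_def by (simp add: endofunctor_EM kappa_mor_natural)
qed

section \<open>The nucleus\<close>

lemma ar_not [simp]:
  "ar (\<not> p) x f y = ar p y f x" "ar_dom (\<not> p) = ar_cod p" "ar_cod (\<not> p) = ar_dom p"
  by (auto simp: ar_def ar_dom_def ar_cod_def)

text \<open>The opposite category exchanges the ends of an arrow and the negated flag exchanges them
  in the encoding, so an arrow from \<open>x\<close> to \<open>y\<close> is again
  \<open>ar p x f y\<close>, as for algebras.\<close>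

definition Coalg_gen :: "bool \<Rightarrow> 'a univ adj \<Rightarrow> 'a univ cat" where
  "Coalg_gen p F = op_cat (Alg_gen (\<not> p) (op_adj F))"

lemma Coalg_gen_simps [simp]:
  "Obj (Coalg_gen p F) = algs (op_adj F)" "Dom (Coalg_gen p F) = ar_dom p" "Cod (Coalg_gen p F) = ar_cod p"
  "One (Coalg_gen p F) y = ar p y (One (catB F) (carrier y)) y"
  "g \<circ>\<^bsub>Coalg_gen p F\<^esub> f = ar p (ar_dom p f) (und g \<circ>\<^bsub>catB F\<^esub> und f) (ar_cod p g)"
  by (simp_all add: Coalg_gen_def)

lemma category_Coalg_gen [simp]: "adjunction F \<Longrightarrow> category (Coalg_gen p F)"
  by (simp add: Coalg_gen_def)

lemma coalgs_simps [simp]: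
  assumes "y \<in> algs (op_adj F)"
  shows "carrier y \<in> Obj (catB F)" "action y \<in> Arr (catB F)"
    "Dom (catB F) (action y) = carrier y" "Cod (catB F) (action y) = ladj F \<bullet> radj F \<bullet> carrier y"
    "eps F (carrier y) \<circ>\<^bsub>catB F\<^esub> action y = One (catB F) (carrier y)"
    "ladj F \<cdot> radj F \<cdot> action y \<circ>\<^bsub>catB F\<^esub> action y = ladj F \<cdot> eta F (radj F \<bullet> carrier y) \<circ>\<^bsub>catB F\<^esub> action y"
  using algs_simps(1-6)[OF assms] by simp_all

lemma coar_Arr:
  "ar p x f y \<in> Arr (Coalg_gen p F) \<longleftrightarrow> x \<in> algs (op_adj F) \<and> y \<in> algs (op_adj F) \<and> f \<in> Arr (catB F) \<and>
    Dom (catB F) f = carrier x \<and> Cod (catB F) f = carrier y \<and>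
    action y \<circ>\<^bsub>catB F\<^esub> f = ladj F \<cdot> radj F \<cdot> f \<circ>\<^bsub>catB F\<^esub> action x"
  using ar_Arr[of "\<not> p" y f x "op_adj F"] by (auto simp: Coalg_gen_def)

lemma Coalg_gen_cases:
  assumes "Y \<in> Arr (Coalg_gen p F)"
  obtains x f y where "Y = ar p x f y" "x \<in> algs (op_adj F)" "y \<in> algs (op_adj F)" "f \<in> Arr (catB F)"
    "Dom (catB F) f = carrier x" "Cod (catB F) f = carrier y"
    "action y \<circ>\<^bsub>catB F\<^esub> f = ladj F \<cdot> radj F \<cdot> f \<circ>\<^bsub>catB F\<^esub> action x"
proof -
  obtain y f x where Y: "Y = ar (\<not> p) y f x"
    using assms unfolding Coalg_gen_def op_cat_simps by (rule Alg_gen_cases)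
  show thesis
    by (rule that[of x f y]) (use assms in \<open>simp_all add: Y coar_Arr\<close>)
qed

definition cokalg :: "'a univ adj \<Rightarrow> 'a univ \<Rightarrow> 'a univ" where
  "cokalg F = kalg (op_adj F)"

lemma cokalg_simps [simp]:
  "carrier (cokalg F a) = ladj F \<bullet> a" "action (cokalg F a) = ladj F \<cdot> eta F a"
  "adjunction F \<Longrightarrow> a \<in> Obj (catA F) \<Longrightarrow> cokalg F a \<in> algs (op_adj F)"
  by (simp_all add: cokalg_def)

definition nuc_gen :: "bool \<Rightarrow> 'a univ adj \<Rightarrow> 'a univ adj" where
  "nuc_gen p F = \<lparr>catA = Coalg_gen p F, catB = Alg_gen p F, ladj = comp_ftor (kappa_gen p F) forget,
     radj = comp_ftor (kappa_gen (\<not> p) (op_adj F)) forget,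
     eta = (\<lambda>y. ar p y (action y) (cokalg F (radj F \<bullet> carrier y))),
     eps = (\<lambda>x. ar p (kalg F (ladj F \<bullet> carrier x)) (action x) x)\<rparr>"

lemma nuc_gen_simps [simp]:
  "catA (nuc_gen p F) = Coalg_gen p F" "catB (nuc_gen p F) = Alg_gen p F"
  "ladj (nuc_gen p F) \<bullet> y = kalg F (carrier y)" "radj (nuc_gen p F) \<bullet> x = cokalg F (carrier x)"
  "ladj (nuc_gen p F) \<cdot> f = ar p (kalg F (Dom (catB F) (und f))) (radj F \<cdot> und f) (kalg F (Cod (catB F) (und f)))"
  "radj (nuc_gen p F) \<cdot> g = ar p (cokalg F (Dom (catA F) (und g))) (ladj F \<cdot> und g) (cokalg F (Cod (catA F) (und g)))"
  "eta (nuc_gen p F) y = ar p y (action y) (cokalg F (radj F \<bullet> carrier y))"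
  "eps (nuc_gen p F) x = ar p (kalg F (ladj F \<bullet> carrier x)) (action x) x"
  by (simp_all add: nuc_gen_def cokalg_def)

text \<open>The nucleus is self-dual on the nose. Its locality for \<open>C\<close> is thereby the
  locality for \<open>M\<close> of the dual nucleus.\<close>

lemma op_nuc_gen: "op_adj (nuc_gen p F) = nuc_gen (\<not> p) (op_adj F)"
  by (simp add: nuc_gen_def op_adj_def[of "nuc_gen p F"] Coalg_gen_def cokalg_def)

lemma nuc_gen_functors:
  assumes F [simp]: "adjunction F"
  shows "is_functor (Coalg_gen p F) (Alg_gen p F) (ladj (nuc_gen p F))"
    "is_functor (Alg_gen p F) (Coalg_gen p F) (radj (nuc_gen p F))"
proof -
  have F': "adjunction (op_adj F)"
    by simp
  have "is_functor (Coalg_gen p F) (catB F) forget"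
    using forget_functor[OF F', of "\<not> p"] is_functor_op[of "Alg_gen (\<not> p) (op_adj F)" "op_cat (catB F)"]
    by (simp add: Coalg_gen_def)
  from is_functor_comp[OF this kappa_gen_functor[OF F]]
  show "is_functor (Coalg_gen p F) (Alg_gen p F) (ladj (nuc_gen p F))"
    by (simp add: nuc_gen_def)
  have "is_functor (catA F) (Coalg_gen p F) (kappa_gen (\<not> p) (op_adj F))"
    using kappa_gen_functor[OF F', of "\<not> p"] is_functor_op[of "op_cat (catA F)" "Alg_gen (\<not> p) (op_adj F)"]
    by (simp add: Coalg_gen_def)
  from is_functor_comp[OF forget_functor[OF F] this]
  show "is_functor (Alg_gen p F) (Coalg_gen p F) (radj (nuc_gen p F))"
    by (simp add: nuc_gen_def)
qed

text \<open>The triangle identities are the counit law of a coalgebra mapped by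
  \<open>radj F\<close> and the unit law of an algebra mapped by \<open>ladj F\<close>.\<close>

lemma nuc_gen:
  assumes F [simp]: "adjunction F"
  shows "adjunction (nuc_gen p F)"
proof (rule adjunctionI)
  show "is_functor (catA (nuc_gen p F)) (catB (nuc_gen p F)) (ladj (nuc_gen p F))"
    "is_functor (catB (nuc_gen p F)) (catA (nuc_gen p F)) (radj (nuc_gen p F))"
    using nuc_gen_functors[OF F] by simp_all
  show "eps (nuc_gen p F) (ladj (nuc_gen p F) \<bullet> y) \<circ>\<^bsub>catB (nuc_gen p F)\<^esub> ladj (nuc_gen p F) \<cdot> eta (nuc_gen p F) y =
      One (catB (nuc_gen p F)) (ladj (nuc_gen p F) \<bullet> y)" if "y \<in> Obj (catA (nuc_gen p F))" for y
  proof -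
    have "radj F \<cdot> (eps F (carrier y) \<circ>\<^bsub>catB F\<^esub> action y) = One (catA F) (radj F \<bullet> carrier y)"
      using that by simp
    then show ?thesis
      using that by (simp del: coalgs_simps(5))
  qed
  show "radj (nuc_gen p F) \<cdot> eps (nuc_gen p F) x \<circ>\<^bsub>catA (nuc_gen p F)\<^esub> eta (nuc_gen p F) (radj (nuc_gen p F) \<bullet> x) =
      One (catA (nuc_gen p F)) (radj (nuc_gen p F) \<bullet> x)" if "x \<in> Obj (catB (nuc_gen p F))" for x
  proof -
    have "ladj F \<cdot> (action x \<circ>\<^bsub>catA F\<^esub> eta F (carrier x)) = One (catB F) (ladj F \<bullet> carrier x)"
      using that by simp
    then show ?thesis
      using that by (simp del: algs_simps(5))
  qed
qed (auto simp: ar_Arr coar_Arr elim!: Alg_gen_cases Coalg_gen_cases)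

subsection \<open>The nucleus of an idempotent complete adjunction is monadic\<close>

lemma kappa_nuc_functor:
  assumes F: "adjunction F"
  shows "is_functor (Alg_gen p F) (Alg_gen p (nuc_gen p F)) (kappa_gen p (nuc_gen p F))"
  using kappa_gen_functor[OF nuc_gen[OF F], of p p] by simp

text \<open>A homomorphism is recovered from its image under \<open>ladj F\<close>, since the action
  is a retraction of the unit.\<close>

lemma kappa_nuc_faithful:
  assumes F [simp]: "adjunction F" and f: "ar p x f y \<in> Arr (Alg_gen p F)"
  shows "f = action y \<circ>\<^bsub>catA F\<^esub> (radj F \<cdot> ladj F \<cdot> f \<circ>\<^bsub>catA F\<^esub> eta F (carrier x))"
proof -
  have [simp]: "x \<in> algs F" "y \<in> algs F" "f \<in> Arr (catA F)" "Dom (catA F) f = carrier x" "Cod (catA F) f = carrier y"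
    and h: "f \<circ>\<^bsub>catA F\<^esub> action x = action y \<circ>\<^bsub>catA F\<^esub> radj F \<cdot> ladj F \<cdot> f"
    using f by (auto simp: ar_Arr)
  show ?thesis
    by (simp add: precomp[OF h[symmetric]])
qed

text \<open>\<open>h\<close> is a homomorphism both of coalgebras and for the actions. The formula
  of \<open>kappa_nuc_faithful\<close>, with \<open>h\<close> in place of the image, gives the
  preimage; \<open>co\<close> shows that \<open>ladj F\<close> sends it to \<open>h\<close>, and
  \<open>alg\<close> that it is a homomorphism.\<close>

lemma kappa_nuc_full:
  assumes F [simp]: "adjunction F" and [simp]: "x \<in> algs F" "y \<in> algs F" "h \<in> Arr (catB F)"
    "Dom (catB F) h = ladj F \<bullet> carrier x" "Cod (catB F) h = ladj F \<bullet> carrier y"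
    and co: "ladj F \<cdot> eta F (carrier y) \<circ>\<^bsub>catB F\<^esub> h = ladj F \<cdot> radj F \<cdot> h \<circ>\<^bsub>catB F\<^esub> ladj F \<cdot> eta F (carrier x)"
    and alg: "h \<circ>\<^bsub>catB F\<^esub> ladj F \<cdot> action x = ladj F \<cdot> action y \<circ>\<^bsub>catB F\<^esub> ladj F \<cdot> radj F \<cdot> h"
  shows "\<exists>f. ar p x f y \<in> Arr (Alg_gen p F) \<and> ladj F \<cdot> f = h"
proof (intro exI conjI)
  let ?f = "action y \<circ>\<^bsub>catA F\<^esub> (radj F \<cdot> h \<circ>\<^bsub>catA F\<^esub> eta F (carrier x))"
  have 1: "ladj F \<cdot> action y \<circ>\<^bsub>catB F\<^esub> ladj F \<cdot> eta F (carrier y) = One (catB F) (ladj F \<bullet> carrier y)"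
    using arg_cong[OF algs_simps(5)[of y F], of "FArr (ladj F)"] by (simp del: algs_simps(5))
  show Lf: "ladj F \<cdot> ?f = h"
    by (simp add: precomp[OF 1] flip: co)
  have n: "eta F (carrier x) \<circ>\<^bsub>catA F\<^esub> action x = radj F \<cdot> ladj F \<cdot> action x \<circ>\<^bsub>catA F\<^esub> eta F (radj F \<bullet> ladj F \<bullet> carrier x)"
    using eta_nat[OF F, of "action x"] by simp
  have ra: "radj F \<cdot> h \<circ>\<^bsub>catA F\<^esub> radj F \<cdot> ladj F \<cdot> action x =
      radj F \<cdot> ladj F \<cdot> action y \<circ>\<^bsub>catA F\<^esub> radj F \<cdot> ladj F \<cdot> radj F \<cdot> h"
    using arg_cong[OF alg, of "FArr (radj F)"] by simp
  have e: "radj F \<cdot> eps F (ladj F \<bullet> carrier y) \<circ>\<^bsub>catA F\<^esub> radj F \<cdot> ladj F \<cdot> radj F \<cdot> h =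
      radj F \<cdot> h \<circ>\<^bsub>catA F\<^esub> radj F \<cdot> eps F (ladj F \<bullet> carrier x)"
    using arg_cong[OF eps_nat[OF F, of h], of "FArr (radj F)"] by simp
  have "?f \<circ>\<^bsub>catA F\<^esub> action x = action y \<circ>\<^bsub>catA F\<^esub> radj F \<cdot> h"
    by (simp add: n precomp[OF ra] precomp[OF e])
  then show "ar p x ?f y \<in> Arr (Alg_gen p F)"
    using Lf by (simp add: ar_Arr del: adjunction_simps(8))
qed

text \<open>An algebra over the nucleus, unfolded: a coalgebra \<open>y\<close> with a structure map
  \<open>g\<close> that is a coalgebra homomorphism (\<open>co\<close>), unital (\<open>un\<close>)
  and associative (\<open>mu\<close>). It has to come from an algebra of \<open>F\<close>, whose
  carrier is obtained by splitting an idempotent on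
  \<open>radj F \<bullet> carrier y\<close>.\<close>

lemma kappa_nuc_eso:
  assumes F [simp]: "adjunction F" and ic: "idem_complete (catA F)"
    and y [simp]: "y \<in> algs (op_adj F)" "g \<in> Arr (catB F)" "Dom (catB F) g = ladj F \<bullet> radj F \<bullet> carrier y"
      "Cod (catB F) g = carrier y"
    and co: "action y \<circ>\<^bsub>catB F\<^esub> g = ladj F \<cdot> radj F \<cdot> g \<circ>\<^bsub>catB F\<^esub> ladj F \<cdot> eta F (radj F \<bullet> carrier y)"
    and un: "g \<circ>\<^bsub>catB F\<^esub> action y = One (catB F) (carrier y)"
    and mu: "g \<circ>\<^bsub>catB F\<^esub> ladj F \<cdot> radj F \<cdot> g = g \<circ>\<^bsub>catB F\<^esub> ladj F \<cdot> radj F \<cdot> eps F (carrier y)"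
  shows "\<exists>x i. x \<in> algs F \<and> iso_arrow (catB F) i \<and> Dom (catB F) i = ladj F \<bullet> carrier x \<and> Cod (catB F) i = carrier y \<and>
    action y \<circ>\<^bsub>catB F\<^esub> i = ladj F \<cdot> radj F \<cdot> i \<circ>\<^bsub>catB F\<^esub> ladj F \<cdot> eta F (carrier x) \<and>
    i \<circ>\<^bsub>catB F\<^esub> ladj F \<cdot> action x = g \<circ>\<^bsub>catB F\<^esub> ladj F \<cdot> radj F \<cdot> i"
proof -
  let ?A = "catA F" and ?B = "catB F" and ?L = "FArr (ladj F)" and ?R = "FArr (radj F)"
    and ?b = "carrier y" and ?\<beta> = "action y"
  let ?Rb = "radj F \<bullet> ?b"
  \<comment> \<open>The transpose of \<open>g\<close>. By \<open>co\<close> its image under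
    \<open>?L\<close> is \<open>?\<beta>\<close> after \<open>g\<close>, an idempotent that splits
    through \<open>?b\<close> because of \<open>un\<close>.\<close>
  let ?e = "?R g \<circ>\<^bsub>?A\<^esub> eta F ?Rb"
  have n1: "eta F ?Rb \<circ>\<^bsub>?A\<^esub> ?R g = ?R (?L (?R g)) \<circ>\<^bsub>?A\<^esub> eta F (radj F \<bullet> ladj F \<bullet> ?Rb)"
    using eta_nat[OF F, of "?R g"] by simp
  have n2: "eta F ?Rb \<circ>\<^bsub>?A\<^esub> ?R (eps F ?b) = ?R (?L (?R (eps F ?b))) \<circ>\<^bsub>?A\<^esub> eta F (radj F \<bullet> ladj F \<bullet> ?Rb)"
    using eta_nat[OF F, of "?R (eps F ?b)"] by simp
  have mu': "?R g \<circ>\<^bsub>?A\<^esub> ?R (?L (?R g)) = ?R g \<circ>\<^bsub>?A\<^esub> ?R (?L (?R (eps F ?b)))"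
    using arg_cong[OF mu, of ?R] by simp
  \<comment> \<open>Associativity says that after \<open>?e\<close> the arrow \<open>?R g\<close>
    may be exchanged for the counit. Idempotency of \<open>?e\<close> then follows from a triangle
    identity.\<close>
  have eg: "?e \<circ>\<^bsub>?A\<^esub> ?R g = ?e \<circ>\<^bsub>?A\<^esub> ?R (eps F ?b)"
    by (simp add: n1 n2 precomp[OF mu'])
  have ee: "?e \<circ>\<^bsub>?A\<^esub> ?e = ?e"
  proof -
    have "?e \<circ>\<^bsub>?A\<^esub> ?e = (?e \<circ>\<^bsub>?A\<^esub> ?R g) \<circ>\<^bsub>?A\<^esub> eta F ?Rb"
      by simp
    then show ?thesis
      unfolding eg by simp
  qed
  have Le: "?L ?e = ?\<beta> \<circ>\<^bsub>?B\<^esub> g"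
    using co by simp
  have e_idem: "?e \<in> idem ?A"
    by (rule idemI[OF _ _ ee]) simp_all
  define e where "e = ?e"
  have e [simp]: "e \<in> Arr ?A" "Dom ?A e = ?Rb" "Cod ?A e = ?Rb" and Le: "?L e = ?\<beta> \<circ>\<^bsub>?B\<^esub> g"
    and eg: "e \<circ>\<^bsub>?A\<^esub> ?R g = e \<circ>\<^bsub>?A\<^esub> ?R (eps F ?b)" and e': "?R g \<circ>\<^bsub>?A\<^esub> eta F ?Rb = e"
    using Le eg by (simp_all add: e_def)
  obtain r s where rs: "splitting ?A e r s"
    using ic e_idem unfolding e_def idem_complete_def by blast
  let ?a = "Dom ?A s"
  have [simp]: "r \<in> Arr ?A" "s \<in> Arr ?A" "Dom ?A r = ?Rb" "Cod ?A s = ?Rb" "Cod ?A r = ?a"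
    and sr: "s \<circ>\<^bsub>?A\<^esub> r = e" and rs1: "r \<circ>\<^bsub>?A\<^esub> s = One ?A ?a"
    using rs by (auto simp: splitting_def)
  have "(s \<circ>\<^bsub>?A\<^esub> r) \<circ>\<^bsub>?A\<^esub> s = s" "r \<circ>\<^bsub>?A\<^esub> (s \<circ>\<^bsub>?A\<^esub> r) = r"
    by (simp_all add: rs1 precomp[OF rs1])
  then have es: "e \<circ>\<^bsub>?A\<^esub> s = s" and re: "r \<circ>\<^bsub>?A\<^esub> e = r"
    unfolding sr by simp_all
  have Lsr: "?L s \<circ>\<^bsub>?B\<^esub> ?L r = ?\<beta> \<circ>\<^bsub>?B\<^esub> g" and Lrs: "?L r \<circ>\<^bsub>?B\<^esub> ?L s = One ?B (ladj F \<bullet> ?a)"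
    and Les: "?\<beta> \<circ>\<^bsub>?B\<^esub> (g \<circ>\<^bsub>?B\<^esub> ?L s) = ?L s"
    using arg_cong[OF sr, of ?L] arg_cong[OF rs1, of ?L] arg_cong[OF es, of ?L] by (simp_all add: Le)
  \<comment> \<open>\<open>?L\<close> carries the splitting of \<open>e\<close> to a second
    splitting of \<open>?\<beta>\<close> after \<open>g\<close>; these are the canonical comparison
    arrows between the two splittings, hence mutually inverse.\<close>
  let ?i = "g \<circ>\<^bsub>?B\<^esub> ?L s" and ?j = "?L r \<circ>\<^bsub>?B\<^esub> ?\<beta>"
  have i: "?i \<in> Arr ?B" "Dom ?B ?i = ladj F \<bullet> ?a" "Cod ?B ?i = ?b"
    by simp_all
  have iso: "iso_arrow ?B ?i"
    by (rule iso_arrowI[of _ _ ?j]) (simp_all add: Les Lrs precomp[OF Lsr] un precomp[OF un])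
  have rg: "r \<circ>\<^bsub>?A\<^esub> ?R g = r \<circ>\<^bsub>?A\<^esub> ?R (eps F ?b)"
  proof -
    have "(r \<circ>\<^bsub>?A\<^esub> e) \<circ>\<^bsub>?A\<^esub> ?R g = (r \<circ>\<^bsub>?A\<^esub> e) \<circ>\<^bsub>?A\<^esub> ?R (eps F ?b)"
      by (simp add: eg)
    then show ?thesis
      unfolding re .
  qed
  have n3: "eta F ?Rb \<circ>\<^bsub>?A\<^esub> s = ?R (?L s) \<circ>\<^bsub>?A\<^esub> eta F ?a"
    using eta_nat[OF F, of s] by simp
  have Ri: "?R ?i \<circ>\<^bsub>?A\<^esub> eta F ?a = s"
    by (simp add: es precomp[OF e'] flip: n3)
  \<comment> \<open>\<open>?R ?i\<close> leads from the monad applied to \<open>?a\<close> into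
    \<open>radj F \<bullet> ?b\<close>, and \<open>r\<close> retracts the latter onto
    \<open>?a\<close>. The unit law is \<open>Ri\<close> followed by the splitting; associativity
    rests on \<open>rg\<close>.\<close>
  let ?x = "Struct ?a (r \<circ>\<^bsub>?A\<^esub> ?R ?i)"
  have x: "?x \<in> algs F"
  proof (rule algsI)
    show "(r \<circ>\<^bsub>?A\<^esub> ?R ?i) \<circ>\<^bsub>?A\<^esub> eta F ?a = One ?A ?a"
      using Ri rs1 by simp
    have "(r \<circ>\<^bsub>?A\<^esub> ?R ?i) \<circ>\<^bsub>?A\<^esub> ?R (eps F (ladj F \<bullet> ?a)) = r \<circ>\<^bsub>?A\<^esub> ?R (?i \<circ>\<^bsub>?B\<^esub> eps F (ladj F \<bullet> ?a))"
      by simp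
    also have "?i \<circ>\<^bsub>?B\<^esub> eps F (ladj F \<bullet> ?a) = eps F ?b \<circ>\<^bsub>?B\<^esub> ?L (?R ?i)"
      using eps_nat[OF F, of ?i] by simp
    also have "r \<circ>\<^bsub>?A\<^esub> ?R (eps F ?b \<circ>\<^bsub>?B\<^esub> ?L (?R ?i)) = (r \<circ>\<^bsub>?A\<^esub> ?R g) \<circ>\<^bsub>?A\<^esub> ?R (?L (?R ?i))"
      unfolding rg by simp
    also have "\<dots> = r \<circ>\<^bsub>?A\<^esub> ?R (g \<circ>\<^bsub>?B\<^esub> ((?L s \<circ>\<^bsub>?B\<^esub> ?L r) \<circ>\<^bsub>?B\<^esub> ?L (?R ?i)))"
      unfolding Lsr by (simp add: precomp[OF un])
    also have "\<dots> = (r \<circ>\<^bsub>?A\<^esub> ?R ?i) \<circ>\<^bsub>?A\<^esub> ?R (?L (r \<circ>\<^bsub>?A\<^esub> ?R ?i))"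
      by simp
    finally show "(r \<circ>\<^bsub>?A\<^esub> ?R ?i) \<circ>\<^bsub>?A\<^esub> ?R (eps F (ladj F \<bullet> ?a)) = (r \<circ>\<^bsub>?A\<^esub> ?R ?i) \<circ>\<^bsub>?A\<^esub> ?R (?L (r \<circ>\<^bsub>?A\<^esub> ?R ?i))" .
  qed simp_all
  have "?L (?R ?i) \<circ>\<^bsub>?B\<^esub> ?L (eta F ?a) = ?L s"
    using arg_cong[OF Ri, of ?L] by simp
  then have "?\<beta> \<circ>\<^bsub>?B\<^esub> ?i = ?L (?R ?i) \<circ>\<^bsub>?B\<^esub> ?L (eta F (carrier ?x))"
    using Les by simp
  moreover have "?i \<circ>\<^bsub>?B\<^esub> ?L (action ?x) = g \<circ>\<^bsub>?B\<^esub> ?L (?R ?i)"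
    by (simp add: precomp[OF Lsr] precomp[OF un])
  ultimately show ?thesis
    using x iso i by (intro exI[of _ ?x] exI[of _ ?i]) (simp del: adjunction_simps(8,14))
qed

lemma Coalg_gen_iso:
  assumes "adjunction F" "ar p x f y \<in> Arr (Coalg_gen p F)" "iso_arrow (catB F) f"
  shows "iso_arrow (Coalg_gen p F) (ar p x f y)"
    "inverse_arrow (Coalg_gen p F) (ar p x f y) = ar p y (inverse_arrow (catB F) f) x"
  using Alg_gen_iso[of "op_adj F" "\<not> p" y f x] assms by (simp_all add: Coalg_gen_def)

text \<open>Monadicity of the nucleus. Its algebras are coalgebras with an action, so the three
  preceding lemmas apply after unpacking two layers of arrow encodings.\<close>

lemma kappa_nuc_equivalence:
  assumes F [simp]: "adjunction F" and ic: "idem_complete (catA F)"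
  shows "equivalence_functor (Alg_gen p F) (Alg_gen p (nuc_gen p F)) (kappa_gen p (nuc_gen p F))"
  unfolding equivalence_functor_iff
proof
  let ?N = "nuc_gen p F" and ?k = "kappa_gen p (nuc_gen p F)"
  show "is_functor (Alg_gen p F) (Alg_gen p ?N) ?k"
    by (rule kappa_nuc_functor[OF F])
  show "f = g" if "f \<in> Arr (Alg_gen p F)" "g \<in> Arr (Alg_gen p F)" "Dom (Alg_gen p F) f = Dom (Alg_gen p F) g"
    "Cod (Alg_gen p F) f = Cod (Alg_gen p F) g" "?k \<cdot> f = ?k \<cdot> g" for f g
  proof -
    note fg = that(1,2)
    obtain x u y where f: "f = ar p x u y"
      using fg(1) by (rule Alg_gen_cases)
    obtain x' v y' where g: "g = ar p x' v y'"
      using fg(2) by (rule Alg_gen_cases)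
    have [simp]: "x' = x" "y' = y" and uv: "ladj F \<cdot> u = ladj F \<cdot> v"
      using that(3-5) by (simp_all add: f g)
    show ?thesis
      using kappa_nuc_faithful[OF F that(1)[unfolded f]] kappa_nuc_faithful[OF F that(2)[unfolded g]]
      by (simp add: f g uv)
  qed
  show "\<exists>f. f \<in> hom (Alg_gen p F) x y \<and> ?k \<cdot> f = X"
    if "x \<in> Obj (Alg_gen p F)" "y \<in> Obj (Alg_gen p F)" "X \<in> Arr (Alg_gen p ?N)" "Dom (Alg_gen p ?N) X = ?k \<bullet> x"
      "Cod (Alg_gen p ?N) X = ?k \<bullet> y" for x y X
  proof -
    have [simp]: "x \<in> algs F" "y \<in> algs F"
      using that by simp_all
    note Xd = that(4,5)
    obtain x' Y y' where X': "X = ar p x' Y y'" and Y: "Y \<in> Arr (Coalg_gen p F)" and Y': "ar_dom p Y = carrier x'"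
      "ar_cod p Y = carrier y'" "Y \<circ>\<^bsub>Coalg_gen p F\<^esub> action x' = action y' \<circ>\<^bsub>Coalg_gen p F\<^esub> radj ?N \<cdot> ladj ?N \<cdot> Y"
      using \<open>X \<in> Arr (Alg_gen p ?N)\<close> by (rule Alg_gen_cases) (simp del: Coalg_gen_simps(4,5))
    have [simp]: "x' = kalg ?N x" "y' = kalg ?N y"
      using Xd by (simp_all add: X')
    obtain z h z' where Yz: "Y = ar p z h z'"
      using Y by (rule Coalg_gen_cases)
    have [simp]: "z = cokalg F (carrier x)" "z' = cokalg F (carrier y)"
      using Y'(1,2) by (simp_all add: Yz)
    have [simp]: "h \<in> Arr (catB F)" "Dom (catB F) h = ladj F \<bullet> carrier x" "Cod (catB F) h = ladj F \<bullet> carrier y"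
      and co: "ladj F \<cdot> eta F (carrier y) \<circ>\<^bsub>catB F\<^esub> h = ladj F \<cdot> radj F \<cdot> h \<circ>\<^bsub>catB F\<^esub> ladj F \<cdot> eta F (carrier x)"
      using Y by (simp_all add: Yz coar_Arr)
    have "h \<circ>\<^bsub>catB F\<^esub> ladj F \<cdot> action x = ladj F \<cdot> action y \<circ>\<^bsub>catB F\<^esub> ladj F \<cdot> radj F \<cdot> h"
      using Y'(3) by (simp add: Yz)
    from kappa_nuc_full[OF F _ _ _ _ _ co this, of p] obtain f where f: "ar p x f y \<in> Arr (Alg_gen p F)" "ladj F \<cdot> f = h"
      by auto
    then show ?thesis
      by (intro exI[of _ "ar p x f y"]) (simp add: hom_iff X' Yz ar_Arr)
  qed
  fix Y assume "Y \<in> Obj (Alg_gen p ?N)"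
  then have Y: "Y \<in> algs ?N"
    by simp
  let ?y = "carrier Y"
  note a = algs_simps[OF Y]
  have y [simp]: "?y \<in> algs (op_adj F)"
    using a(1) by simp
  obtain z g z' where g': "action Y = ar p z g z'"
    using a(2) unfolding nuc_gen_simps by (rule Coalg_gen_cases)
  then have g: "action Y = ar p (cokalg F (radj F \<bullet> carrier ?y)) g ?y"
    using a(3,4) by simp
  have gs: "g \<in> Arr (catB F)" "Dom (catB F) g = ladj F \<bullet> radj F \<bullet> carrier ?y" "Cod (catB F) g = carrier ?y"
    "action ?y \<circ>\<^bsub>catB F\<^esub> g = ladj F \<cdot> radj F \<cdot> g \<circ>\<^bsub>catB F\<^esub> ladj F \<cdot> eta F (radj F \<bullet> carrier ?y)"
    using a(2) by (simp_all add: g coar_Arr)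
  have un: "g \<circ>\<^bsub>catB F\<^esub> action ?y = One (catB F) (carrier ?y)"
    using a(5) by (simp add: g)
  have mu: "g \<circ>\<^bsub>catB F\<^esub> ladj F \<cdot> radj F \<cdot> g = g \<circ>\<^bsub>catB F\<^esub> ladj F \<cdot> radj F \<cdot> eps F (carrier ?y)"
    using a(6) gs by (simp add: g)
  obtain x i where x [simp]: "x \<in> algs F" and iso: "iso_arrow (catB F) i" and
    i: "Dom (catB F) i = ladj F \<bullet> carrier x" "Cod (catB F) i = carrier ?y"
    "action ?y \<circ>\<^bsub>catB F\<^esub> i = ladj F \<cdot> radj F \<cdot> i \<circ>\<^bsub>catB F\<^esub> ladj F \<cdot> eta F (carrier x)"
    "i \<circ>\<^bsub>catB F\<^esub> ladj F \<cdot> action x = g \<circ>\<^bsub>catB F\<^esub> ladj F \<cdot> radj F \<cdot> i"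
    using kappa_nuc_eso[OF F ic y gs un mu] by blast
  let ?I = "ar p (cokalg F (carrier x)) i ?y"
  have I: "?I \<in> Arr (Coalg_gen p F)"
    using i iso_arrow_Arr[OF iso] by (simp add: coar_Arr)
  have "ar p (kalg ?N x) ?I Y \<in> Arr (Alg_gen p ?N)"
    using Y I i iso_arrow_Arr[OF iso] kalg_algs[OF nuc_gen[OF F], of x p] by (simp add: ar_Arr g)
  from Alg_gen_iso(1)[OF nuc_gen[OF F] this] Coalg_gen_iso(1)[OF F I iso]
  have "iso_arrow (Alg_gen p ?N) (ar p (kalg ?N x) ?I Y)"
    by simp
  then show "\<exists>x\<in>Obj (Alg_gen p F). \<exists>i. iso_arrow (Alg_gen p ?N) i \<and> Dom (Alg_gen p ?N) i = ?k \<bullet> x \<and> Cod (Alg_gen p ?N) i = Y"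
    by (intro bexI[of _ x] exI[of _ "ar p (kalg ?N x) ?I Y"]) simp_all
qed

subsection \<open>Morphisms of nuclei\<close>

lemma adj_hom_alg_morph_op:
  assumes \<Upsilon>: "\<Upsilon> \<in> adj_hom F G"
  shows "alg_morph (op_adj F) (op_adj G) (mK \<Upsilon>) (mH \<Upsilon>) (\<lambda>b. inverse_arrow (catA G) (dns \<Upsilon> b))
    (\<lambda>a. inverse_arrow (catB G) (ups \<Upsilon> a))"
  using adj_hom_alg_morph[OF op_mor_hom[OF \<Upsilon>]] by (simp add: adj_homD(1,2)[OF \<Upsilon>])

definition coalg_ftor_gen :: "bool \<Rightarrow> 'a univ adj_mor \<Rightarrow> 'a univ ftor" where
  "coalg_ftor_gen p \<Upsilon> = alg_ftor_gen (\<not> p) (op_mor \<Upsilon>)"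

definition coact :: "'a univ adj_mor \<Rightarrow> 'a univ \<Rightarrow> 'a univ" where
  "coact \<Upsilon> = alg_morph.act (op_adj (src_adj \<Upsilon>)) (op_adj (tgt_adj \<Upsilon>)) (mK \<Upsilon>)
     (\<lambda>b. inverse_arrow (catA (tgt_adj \<Upsilon>)) (dns \<Upsilon> b)) (\<lambda>a. inverse_arrow (catB (tgt_adj \<Upsilon>)) (ups \<Upsilon> a))"

text \<open>The dual 2-cells are inverses, and \<open>act\<close> inverts their composite once more;
  the two inversions cancel and leave the formula for \<open>K\<close> applied to a
  coalgebra.\<close>

lemma coact_simps:
  assumes \<Upsilon>: "\<Upsilon> \<in> adj_hom F G"
  shows "carrier (coact \<Upsilon> y) = mK \<Upsilon> \<bullet> carrier y"
    "y \<in> algs (op_adj F) \<Longrightarrow> action (coact \<Upsilon> y) = ladj G \<cdot> dns \<Upsilon> (carrier y) \<circ>\<^bsub>catB G\<^esub>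
       (ups \<Upsilon> (radj F \<bullet> carrier y) \<circ>\<^bsub>catB G\<^esub> mK \<Upsilon> \<cdot> action y)"
    "y \<in> algs (op_adj F) \<Longrightarrow> coact \<Upsilon> y \<in> algs (op_adj G)"
    "y \<in> algs (op_adj F) \<Longrightarrow> coact \<Upsilon> y = Struct (mK \<Upsilon> \<bullet> carrier y) (ladj G \<cdot> dns \<Upsilon> (carrier y) \<circ>\<^bsub>catB G\<^esub>
       (ups \<Upsilon> (radj F \<bullet> carrier y) \<circ>\<^bsub>catB G\<^esub> mK \<Upsilon> \<cdot> action y))"
proof -
  interpret Y: adj_morph F G "mH \<Upsilon>" "mK \<Upsilon>" "ups \<Upsilon>" "dns \<Upsilon>"
    by (rule adj_homD(5)[OF \<Upsilon>])
  interpret O: alg_morph "op_adj F" "op_adj G" "mK \<Upsilon>" "mH \<Upsilon>" "\<lambda>b. inverse_arrow (catA G) (dns \<Upsilon> b)"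
      "\<lambda>a. inverse_arrow (catB G) (ups \<Upsilon> a)"
    by (rule adj_hom_alg_morph_op[OF \<Upsilon>])
  have co: "coact \<Upsilon> = O.act"
    by (simp add: coact_def adj_homD(1,2)[OF \<Upsilon>])
  show 1: "carrier (coact \<Upsilon> y) = mK \<Upsilon> \<bullet> carrier y"
    by (simp add: co)
  assume y [simp]: "y \<in> algs (op_adj F)"
  show "coact \<Upsilon> y \<in> algs (op_adj G)"
    by (simp add: co)
  show 2: "action (coact \<Upsilon> y) = ladj G \<cdot> dns \<Upsilon> (carrier y) \<circ>\<^bsub>catB G\<^esub>
      (ups \<Upsilon> (radj F \<bullet> carrier y) \<circ>\<^bsub>catB G\<^esub> mK \<Upsilon> \<cdot> action y)"
    by (simp add: co O.rho_def iso_Comp(2))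
  show "coact \<Upsilon> y = Struct (mK \<Upsilon> \<bullet> carrier y) (ladj G \<cdot> dns \<Upsilon> (carrier y) \<circ>\<^bsub>catB G\<^esub>
      (ups \<Upsilon> (radj F \<bullet> carrier y) \<circ>\<^bsub>catB G\<^esub> mK \<Upsilon> \<cdot> action y))"
    unfolding 2[symmetric] 1[symmetric] using algs_simps(7)[of "coact \<Upsilon> y" "op_adj G"] by (simp add: co)
qed

lemma coalg_ftor_gen_simps:
  assumes \<Upsilon>: "\<Upsilon> \<in> adj_hom F G"
  shows "coalg_ftor_gen p \<Upsilon> \<bullet> y = coact \<Upsilon> y"
    "coalg_ftor_gen p \<Upsilon> \<cdot> h = ar p (coact \<Upsilon> (ar_dom p h)) (mK \<Upsilon> \<cdot> und h) (coact \<Upsilon> (ar_cod p h))"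
  using EM_mor_gen_simps(5,6)[OF op_mor_hom[OF \<Upsilon>], of "\<not> p"]
  by (simp_all add: coalg_ftor_gen_def coact_def adj_homD(1,2)[OF \<Upsilon>])

lemma coalg_ftor_gen_functor:
  assumes \<Upsilon>: "\<Upsilon> \<in> adj_hom F G"
  shows "is_functor (Coalg_gen p F) (Coalg_gen p G) (coalg_ftor_gen p \<Upsilon>)"
  using alg_ftor_gen_functor[OF op_mor_hom[OF \<Upsilon>], of "\<not> p"] by (simp add: Coalg_gen_def coalg_ftor_gen_def)

text \<open>\<open>d_kalg\<close> for the dual morphism concerns the inverse of \<open>ups\<close>;
  isomorphisms of coalgebras being detected on carriers, it can be inverted.\<close>

lemma u_cokalg:
  assumes \<Upsilon>: "\<Upsilon> \<in> adj_hom F G" and a: "a \<in> Obj (catA F)"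
  shows "ar p (coact \<Upsilon> (cokalg F a)) (ups \<Upsilon> a) (cokalg G (mH \<Upsilon> \<bullet> a)) \<in> Arr (Coalg_gen p G)"
    "iso_arrow (Coalg_gen p G) (ar p (coact \<Upsilon> (cokalg F a)) (ups \<Upsilon> a) (cokalg G (mH \<Upsilon> \<bullet> a)))"
proof -
  interpret Y: adj_morph F G "mH \<Upsilon>" "mK \<Upsilon>" "ups \<Upsilon>" "dns \<Upsilon>"
    by (rule adj_homD(5)[OF \<Upsilon>])
  interpret O: alg_morph "op_adj F" "op_adj G" "mK \<Upsilon>" "mH \<Upsilon>" "\<lambda>b. inverse_arrow (catA G) (dns \<Upsilon> b)"
      "\<lambda>a. inverse_arrow (catB G) (ups \<Upsilon> a)"
    by (rule adj_hom_alg_morph_op[OF \<Upsilon>])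
  have co: "coact \<Upsilon> = O.act"
    by (simp add: coact_def adj_homD(1,2)[OF \<Upsilon>])
  have "ar p (cokalg G (mH \<Upsilon> \<bullet> a)) (inverse_arrow (catB G) (ups \<Upsilon> a)) (coact \<Upsilon> (cokalg F a)) \<in> Arr (Coalg_gen p G)"
    using O.d_kalg[of a "\<not> p"] a by (simp add: co cokalg_def Coalg_gen_def)
  note h = Coalg_gen_iso[OF Y.G this]
  have iso: "iso_arrow (catB G) (inverse_arrow (catB G) (ups \<Upsilon> a))"
    "inverse_arrow (catB G) (inverse_arrow (catB G) (ups \<Upsilon> a)) = ups \<Upsilon> a"
    using a by simp_all
  show "iso_arrow (Coalg_gen p G) (ar p (coact \<Upsilon> (cokalg F a)) (ups \<Upsilon> a) (cokalg G (mH \<Upsilon> \<bullet> a)))"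
    using inverse_arrow_simps(8)[OF category_Coalg_gen[OF Y.G] h(1)[OF iso(1)]] unfolding h(2)[OF iso(1)] iso(2) .
  then show "ar p (coact \<Upsilon> (cokalg F a)) (ups \<Upsilon> a) (cokalg G (mH \<Upsilon> \<bullet> a)) \<in> Arr (Coalg_gen p G)"
    by (rule iso_arrow_Arr)
qed

definition nuc_mor_gen :: "bool \<Rightarrow> 'a univ adj_mor \<Rightarrow> 'a univ adj_mor" where
  "nuc_mor_gen p \<Upsilon> =
     (let F = src_adj \<Upsilon>; G = tgt_adj \<Upsilon> in
      \<lparr>src_adj = nuc_gen p F, tgt_adj = nuc_gen p G, mH = coalg_ftor_gen p \<Upsilon>, mK = alg_ftor_gen p \<Upsilon>,
       ups = (\<lambda>y. ar p (alg_ftor_gen p \<Upsilon> \<bullet> kalg F (carrier y)) (dns \<Upsilon> (carrier y)) (kalg G (mK \<Upsilon> \<bullet> carrier y))),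
       dns = (\<lambda>x. ar p (coalg_ftor_gen p \<Upsilon> \<bullet> cokalg F (carrier x)) (ups \<Upsilon> (carrier x)) (cokalg G (mH \<Upsilon> \<bullet> carrier x)))\<rparr>)"

lemma nuc_mor_gen_simps:
  assumes \<Upsilon>: "\<Upsilon> \<in> adj_hom F G"
  shows "src_adj (nuc_mor_gen p \<Upsilon>) = nuc_gen p F" "tgt_adj (nuc_mor_gen p \<Upsilon>) = nuc_gen p G"
    "mH (nuc_mor_gen p \<Upsilon>) = coalg_ftor_gen p \<Upsilon>" "mK (nuc_mor_gen p \<Upsilon>) = alg_ftor_gen p \<Upsilon>"
    "ups (nuc_mor_gen p \<Upsilon>) y = ar p (alg_morph.act F G (mH \<Upsilon>) (ups \<Upsilon>) (dns \<Upsilon>) (kalg F (carrier y)))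
       (dns \<Upsilon> (carrier y)) (kalg G (mK \<Upsilon> \<bullet> carrier y))"
    "dns (nuc_mor_gen p \<Upsilon>) x = ar p (coact \<Upsilon> (cokalg F (carrier x))) (ups \<Upsilon> (carrier x)) (cokalg G (mH \<Upsilon> \<bullet> carrier x))"
  by (simp_all add: nuc_mor_gen_def adj_homD(1,2)[OF \<Upsilon>] EM_mor_gen_simps[OF \<Upsilon>] coalg_ftor_gen_simps[OF \<Upsilon>] Let_def)

text \<open>The 2-cells are isomorphisms by \<open>d_kalg\<close> and \<open>u_cokalg\<close>. On
  underlying arrows the unit law is the very formula for the structure map of
  \<open>coact\<close>.\<close>

lemma nuc_mor_gen_hom:
  assumes \<Upsilon>: "\<Upsilon> \<in> adj_hom F G"
  shows "nuc_mor_gen p \<Upsilon> \<in> adj_hom (nuc_gen p F) (nuc_gen p G)"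
proof -
  interpret Y: alg_morph F G "mH \<Upsilon>" "mK \<Upsilon>" "ups \<Upsilon>" "dns \<Upsilon>"
    by (rule adj_hom_alg_morph[OF \<Upsilon>])
  note simps = nuc_mor_gen_simps[OF \<Upsilon>] EM_mor_gen_simps(5,6)[OF \<Upsilon>] coalg_ftor_gen_simps[OF \<Upsilon>]
  note KH = alg_ftor_gen_functor[OF \<Upsilon>, of p] coalg_ftor_gen_functor[OF \<Upsilon>, of p]
  note nF = nuc_gen_functors[OF Y.F, of p] and nG = nuc_gen_functors[OF Y.G, of p]
  have "adj_morph (nuc_gen p F) (nuc_gen p G) (coalg_ftor_gen p \<Upsilon>) (alg_ftor_gen p \<Upsilon>)
     (ups (nuc_mor_gen p \<Upsilon>)) (dns (nuc_mor_gen p \<Upsilon>))"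
  proof
    show "nat_iso (catA (nuc_gen p F)) (catB (nuc_gen p G)) (comp_ftor (alg_ftor_gen p \<Upsilon>) (ladj (nuc_gen p F)))
        (comp_ftor (ladj (nuc_gen p G)) (coalg_ftor_gen p \<Upsilon>)) (ups (nuc_mor_gen p \<Upsilon>))"
    proof (rule nat_isoI)
      show "is_functor (catA (nuc_gen p F)) (catB (nuc_gen p G)) (comp_ftor (alg_ftor_gen p \<Upsilon>) (ladj (nuc_gen p F)))"
        "is_functor (catA (nuc_gen p F)) (catB (nuc_gen p G)) (comp_ftor (ladj (nuc_gen p G)) (coalg_ftor_gen p \<Upsilon>))"
        using is_functor_comp[OF nF(1) KH(1)] is_functor_comp[OF KH(2) nG(1)] by simp_all
    next
      fix y assume "y \<in> Obj (catA (nuc_gen p F))"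
      then have [simp]: "y \<in> algs (op_adj F)"
        by simp
      show "iso_arrow (catB (nuc_gen p G)) (ups (nuc_mor_gen p \<Upsilon>) y) \<and>
          Dom (catB (nuc_gen p G)) (ups (nuc_mor_gen p \<Upsilon>) y) = comp_ftor (alg_ftor_gen p \<Upsilon>) (ladj (nuc_gen p F)) \<bullet> y \<and>
          Cod (catB (nuc_gen p G)) (ups (nuc_mor_gen p \<Upsilon>) y) = comp_ftor (ladj (nuc_gen p G)) (coalg_ftor_gen p \<Upsilon>) \<bullet> y"
        using Alg_gen_iso(1)[OF Y.G Y.d_kalg] by (simp add: simps coact_simps(1)[OF \<Upsilon>])
    next
      fix f assume "f \<in> Arr (catA (nuc_gen p F))"
      then obtain x g y where f: "f = ar p x g y" and [simp]: "x \<in> algs (op_adj F)" "y \<in> algs (op_adj F)"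
        "g \<in> Arr (catB F)" "Dom (catB F) g = carrier x" "Cod (catB F) g = carrier y"
        unfolding nuc_gen_simps by (rule Coalg_gen_cases)
      show "ups (nuc_mor_gen p \<Upsilon>) (Cod (catA (nuc_gen p F)) f) \<circ>\<^bsub>catB (nuc_gen p G)\<^esub>
            comp_ftor (alg_ftor_gen p \<Upsilon>) (ladj (nuc_gen p F)) \<cdot> f =
          comp_ftor (ladj (nuc_gen p G)) (coalg_ftor_gen p \<Upsilon>) \<cdot> f \<circ>\<^bsub>catB (nuc_gen p G)\<^esub>
            ups (nuc_mor_gen p \<Upsilon>) (Dom (catA (nuc_gen p F)) f)"
        using Y.d_nat[of g] by (simp add: f simps)
    qed
    show "nat_iso (catB (nuc_gen p F)) (catA (nuc_gen p G)) (comp_ftor (coalg_ftor_gen p \<Upsilon>) (radj (nuc_gen p F)))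
        (comp_ftor (radj (nuc_gen p G)) (alg_ftor_gen p \<Upsilon>)) (dns (nuc_mor_gen p \<Upsilon>))"
    proof (rule nat_isoI)
      show "is_functor (catB (nuc_gen p F)) (catA (nuc_gen p G)) (comp_ftor (coalg_ftor_gen p \<Upsilon>) (radj (nuc_gen p F)))"
        "is_functor (catB (nuc_gen p F)) (catA (nuc_gen p G)) (comp_ftor (radj (nuc_gen p G)) (alg_ftor_gen p \<Upsilon>))"
        using is_functor_comp[OF nF(2) KH(2)] is_functor_comp[OF KH(1) nG(2)] by simp_all
    next
      fix x assume "x \<in> Obj (catB (nuc_gen p F))"
      then have [simp]: "x \<in> algs F"
        by simp
      show "iso_arrow (catA (nuc_gen p G)) (dns (nuc_mor_gen p \<Upsilon>) x) \<and>
          Dom (catA (nuc_gen p G)) (dns (nuc_mor_gen p \<Upsilon>) x) = comp_ftor (coalg_ftor_gen p \<Upsilon>) (radj (nuc_gen p F)) \<bullet> x \<and>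
          Cod (catA (nuc_gen p G)) (dns (nuc_mor_gen p \<Upsilon>) x) = comp_ftor (radj (nuc_gen p G)) (alg_ftor_gen p \<Upsilon>) \<bullet> x"
        using u_cokalg(2)[OF \<Upsilon>, of "carrier x" p] by (simp add: simps)
    next
      fix f assume "f \<in> Arr (catB (nuc_gen p F))"
      then obtain x g y where f: "f = ar p x g y" and [simp]: "x \<in> algs F" "y \<in> algs F"
        "g \<in> Arr (catA F)" "Dom (catA F) g = carrier x" "Cod (catA F) g = carrier y"
        unfolding nuc_gen_simps by (rule Alg_gen_cases)
      show "dns (nuc_mor_gen p \<Upsilon>) (Cod (catB (nuc_gen p F)) f) \<circ>\<^bsub>catA (nuc_gen p G)\<^esub>
            comp_ftor (coalg_ftor_gen p \<Upsilon>) (radj (nuc_gen p F)) \<cdot> f =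
          comp_ftor (radj (nuc_gen p G)) (alg_ftor_gen p \<Upsilon>) \<cdot> f \<circ>\<^bsub>catA (nuc_gen p G)\<^esub>
            dns (nuc_mor_gen p \<Upsilon>) (Dom (catB (nuc_gen p F)) f)"
        using Y.u_nat[of g] by (simp add: f simps)
    qed
    fix y assume "y \<in> Obj (catA (nuc_gen p F))"
    then have [simp]: "y \<in> algs (op_adj F)"
      by simp
    show "radj (nuc_gen p G) \<cdot> ups (nuc_mor_gen p \<Upsilon>) y \<circ>\<^bsub>catA (nuc_gen p G)\<^esub>
        (dns (nuc_mor_gen p \<Upsilon>) (ladj (nuc_gen p F) \<bullet> y) \<circ>\<^bsub>catA (nuc_gen p G)\<^esub> coalg_ftor_gen p \<Upsilon> \<cdot> eta (nuc_gen p F) y) =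
        eta (nuc_gen p G) (coalg_ftor_gen p \<Upsilon> \<bullet> y)"
      by (simp add: simps coact_simps[OF \<Upsilon>])
  qed (simp_all add: nuc_gen KH)
  then show ?thesis
    by (simp add: adj_hom_iff nuc_mor_gen_simps[OF \<Upsilon>])
qed

subsection \<open>The comparison of the coalgebra adjunction with the nucleus\<close>

definition coEM_gen :: "bool \<Rightarrow> 'a univ adj \<Rightarrow> 'a univ adj" where
  "coEM_gen p F = op_adj (EM_gen (\<not> p) (op_adj F))"

lemma coEM_gen_simps [simp]:
  "catA (coEM_gen p F) = Coalg_gen p F" "catB (coEM_gen p F) = catB F"
  "ladj (coEM_gen p F) = forget" "radj (coEM_gen p F) \<bullet> b = cokalg F (radj F \<bullet> b)"
  "radj (coEM_gen p F) \<cdot> g = ar p (cokalg F (radj F \<bullet> Dom (catB F) g)) (ladj F \<cdot> radj F \<cdot> g) (cokalg F (radj F \<bullet> Cod (catB F) g))"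
  "eta (coEM_gen p F) y = ar p y (action y) (cokalg F (radj F \<bullet> carrier y))" "eps (coEM_gen p F) = eps F"
  by (simp_all add: coEM_gen_def Coalg_gen_def cokalg_def free_kalg)

lemma coEM_gen: "adjunction F \<Longrightarrow> adjunction (coEM_gen p F)"
  by (simp add: coEM_gen_def EM_gen)

definition coEM_mor_gen :: "bool \<Rightarrow> 'a univ adj_mor \<Rightarrow> 'a univ adj_mor" where
  "coEM_mor_gen p \<Upsilon> = op_mor (EM_mor_gen (\<not> p) (op_mor \<Upsilon>))"

lemma coEM_mor_gen_hom:
  "\<Upsilon> \<in> adj_hom F G \<Longrightarrow> coEM_mor_gen p \<Upsilon> \<in> adj_hom (coEM_gen p F) (coEM_gen p G)"
  unfolding coEM_mor_gen_def coEM_gen_def by (intro op_mor_hom EM_mor_gen_hom)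

definition coEM_to_nuc :: "bool \<Rightarrow> 'a univ adj \<Rightarrow> 'a univ adj_mor" where
  "coEM_to_nuc p F = strict_mor (coEM_gen p F) (nuc_gen p F) id_ftor (kappa_gen p F)"

lemma coEM_to_nuc_simps [simp]:
  "src_adj (coEM_to_nuc p F) = coEM_gen p F" "tgt_adj (coEM_to_nuc p F) = nuc_gen p F"
  "mH (coEM_to_nuc p F) = id_ftor" "mK (coEM_to_nuc p F) = kappa_gen p F"
  "ups (coEM_to_nuc p F) y = One (Alg_gen p F) (kalg F (carrier y))"
  "dns (coEM_to_nuc p F) b = One (Coalg_gen p F) (cokalg F (radj F \<bullet> b))"
  by (simp_all add: coEM_to_nuc_def)

lemma coEM_to_nuc_hom:
  assumes F [simp]: "adjunction F"
  shows "coEM_to_nuc p F \<in> adj_hom (coEM_gen p F) (nuc_gen p F)"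
  unfolding coEM_to_nuc_def
  by (rule strict_mor_hom)
    (auto simp: nuc_gen coEM_gen is_functor_id kappa_gen_functor elim!: Coalg_gen_cases)

text \<open>On coalgebras the two sides have the same functor; on the other category they differ by
  \<open>dns\<close>, which is an isomorphism of algebras by \<open>d_kalg\<close>.\<close>

lemma coEM_to_nuc_natural:
  assumes \<Upsilon>: "\<Upsilon> \<in> adj_hom F G"
  shows "coEM_to_nuc p G \<odot> coEM_mor_gen p \<Upsilon> \<cong> nuc_mor_gen p \<Upsilon> \<odot> coEM_to_nuc p F"
proof (rule adj_iso_sym)
  interpret Y: alg_morph F G "mH \<Upsilon>" "mK \<Upsilon>" "ups \<Upsilon>" "dns \<Upsilon>"
    by (rule adj_hom_alg_morph[OF \<Upsilon>])
  note simps = nuc_mor_gen_simps[OF \<Upsilon>] EM_mor_gen_simps(5,6)[OF \<Upsilon>] coalg_ftor_gen_simps[OF \<Upsilon>]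
    coact_simps(1)[OF \<Upsilon>]
  note KH = alg_ftor_gen_functor[OF \<Upsilon>, of p] coalg_ftor_gen_functor[OF \<Upsilon>, of p]
  have co: "mH (coEM_mor_gen p \<Upsilon>) = coalg_ftor_gen p \<Upsilon>" "mK (coEM_mor_gen p \<Upsilon>) = mK \<Upsilon>"
    "y \<in> algs (op_adj F) \<Longrightarrow> ups (coEM_mor_gen p \<Upsilon>) y = One (catB G) (mK \<Upsilon> \<bullet> carrier y)" for y
    using EM_mor_gen_simps[OF op_mor_hom[OF \<Upsilon>], of "\<not> p"]
    by (simp_all add: coEM_mor_gen_def coalg_ftor_gen_def)
  let ?\<phi> = "\<lambda>b. ar p (Y.act (kalg F b)) (dns \<Upsilon> b) (kalg G (mK \<Upsilon> \<bullet> b))"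
  have "nat_iso (catB F) (Alg_gen p G) (comp_ftor (alg_ftor_gen p \<Upsilon>) (kappa_gen p F)) (comp_ftor (kappa_gen p G) (mK \<Upsilon>)) ?\<phi>"
  proof (rule nat_isoI[OF is_functor_comp[OF kappa_gen_functor[OF Y.F] KH(1)] is_functor_comp[OF Y.K kappa_gen_functor[OF Y.G]]])
    show "?\<phi> (Cod (catB F) g) \<circ>\<^bsub>Alg_gen p G\<^esub> comp_ftor (alg_ftor_gen p \<Upsilon>) (kappa_gen p F) \<cdot> g =
        comp_ftor (kappa_gen p G) (mK \<Upsilon>) \<cdot> g \<circ>\<^bsub>Alg_gen p G\<^esub> ?\<phi> (Dom (catB F) g)" if "g \<in> Arr (catB F)" for g
      using Y.d_nat[OF that] that by (simp add: simps)
    show "iso_arrow (Alg_gen p G) (?\<phi> b) \<and> Dom (Alg_gen p G) (?\<phi> b) = comp_ftor (alg_ftor_gen p \<Upsilon>) (kappa_gen p F) \<bullet> b \<and>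
        Cod (Alg_gen p G) (?\<phi> b) = comp_ftor (kappa_gen p G) (mK \<Upsilon>) \<bullet> b" if "b \<in> Obj (catB F)" for b
      using Alg_gen_iso(1)[OF Y.G Y.d_kalg[OF that]] that by (simp add: simps)
  qed
  then show "nuc_mor_gen p \<Upsilon> \<odot> coEM_to_nuc p F \<cong> coEM_to_nuc p G \<odot> coEM_mor_gen p \<Upsilon>"
    using nat_iso_id[OF KH(2)]
    by (intro adj_isoI[OF comp_adj_hom[OF coEM_to_nuc_hom[OF Y.F] nuc_mor_gen_hom[OF \<Upsilon>]]
          comp_adj_hom[OF coEM_mor_gen_hom[OF \<Upsilon>] coEM_to_nuc_hom[OF Y.G]],
          where \<theta> = "\<lambda>y. One (Coalg_gen p G) (coalg_ftor_gen p \<Upsilon> \<bullet> y)" and \<phi> = ?\<phi>])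
      (simp_all add: simps co)
qed

section \<open>The comparison of the algebra adjunction with the nucleus\<close>

definition cokappa_gen :: "bool \<Rightarrow> 'a univ adj \<Rightarrow> 'a univ ftor" where
  "cokappa_gen p F = kappa_gen (\<not> p) (op_adj F)"

lemma cokappa_gen_simps [simp]:
  "cokappa_gen p F \<bullet> a = cokalg F a"
  "cokappa_gen p F \<cdot> f = ar p (cokalg F (Dom (catA F) f)) (ladj F \<cdot> f) (cokalg F (Cod (catA F) f))"
  by (simp_all add: cokappa_gen_def cokalg_def)

lemma cokappa_gen_functor: "adjunction F \<Longrightarrow> is_functor (catA F) (Coalg_gen p F) (cokappa_gen p F)"
  using kappa_gen_functor[of "op_adj F" "\<not> p"] is_functor_op[of "op_cat (catA F)" "Alg_gen (\<not> p) (op_adj F)"]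
  by (simp add: Coalg_gen_def cokappa_gen_def)

definition EM_to_nuc :: "bool \<Rightarrow> 'a univ adj \<Rightarrow> 'a univ adj_mor" where
  "EM_to_nuc p F = strict_mor (EM_gen p F) (nuc_gen p F) (cokappa_gen p F) id_ftor"

lemma EM_to_nuc_simps [simp]:
  "src_adj (EM_to_nuc p F) = EM_gen p F" "tgt_adj (EM_to_nuc p F) = nuc_gen p F"
  "mH (EM_to_nuc p F) = cokappa_gen p F" "mK (EM_to_nuc p F) = id_ftor"
  "ups (EM_to_nuc p F) a = One (Alg_gen p F) (free F a)"
  "dns (EM_to_nuc p F) x = One (Coalg_gen p F) (cokalg F (carrier x))"
  by (simp_all add: EM_to_nuc_def)

lemma EM_to_nuc_hom:
  assumes F [simp]: "adjunction F"
  shows "EM_to_nuc p F \<in> adj_hom (EM_gen p F) (nuc_gen p F)"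
  unfolding EM_to_nuc_def
  by (rule strict_mor_hom)
    (auto simp: nuc_gen EM_gen is_functor_id cokappa_gen_functor free_kalg elim!: Alg_gen_cases)

text \<open>Mirror image of the previous naturality: identities on algebras, and \<open>ups\<close>
  as an isomorphism of coalgebras.\<close>

lemma EM_to_nuc_natural:
  assumes \<Upsilon>: "\<Upsilon> \<in> adj_hom F G"
  shows "EM_to_nuc p G \<odot> EM_mor_gen p \<Upsilon> \<cong> nuc_mor_gen p \<Upsilon> \<odot> EM_to_nuc p F"
proof (rule adj_iso_sym)
  interpret Y: alg_morph F G "mH \<Upsilon>" "mK \<Upsilon>" "ups \<Upsilon>" "dns \<Upsilon>"
    by (rule adj_hom_alg_morph[OF \<Upsilon>])
  note simps = nuc_mor_gen_simps[OF \<Upsilon>] EM_mor_gen_simps[OF \<Upsilon>] coalg_ftor_gen_simps[OF \<Upsilon>]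
    coact_simps(1)[OF \<Upsilon>]
  note KH = alg_ftor_gen_functor[OF \<Upsilon>, of p] coalg_ftor_gen_functor[OF \<Upsilon>, of p]
  let ?\<theta> = "\<lambda>a. ar p (coact \<Upsilon> (cokalg F a)) (ups \<Upsilon> a) (cokalg G (mH \<Upsilon> \<bullet> a))"
  have "nat_iso (catA F) (Coalg_gen p G) (comp_ftor (coalg_ftor_gen p \<Upsilon>) (cokappa_gen p F)) (comp_ftor (cokappa_gen p G) (mH \<Upsilon>)) ?\<theta>"
  proof (rule nat_isoI[OF is_functor_comp[OF cokappa_gen_functor[OF Y.F] KH(2)] is_functor_comp[OF Y.H cokappa_gen_functor[OF Y.G]]])
    show "?\<theta> (Cod (catA F) f) \<circ>\<^bsub>Coalg_gen p G\<^esub> comp_ftor (coalg_ftor_gen p \<Upsilon>) (cokappa_gen p F) \<cdot> f =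
        comp_ftor (cokappa_gen p G) (mH \<Upsilon>) \<cdot> f \<circ>\<^bsub>Coalg_gen p G\<^esub> ?\<theta> (Dom (catA F) f)" if "f \<in> Arr (catA F)" for f
      using Y.u_nat[OF that] that by (simp add: simps)
    show "iso_arrow (Coalg_gen p G) (?\<theta> a) \<and> Dom (Coalg_gen p G) (?\<theta> a) = comp_ftor (coalg_ftor_gen p \<Upsilon>) (cokappa_gen p F) \<bullet> a \<and>
        Cod (Coalg_gen p G) (?\<theta> a) = comp_ftor (cokappa_gen p G) (mH \<Upsilon>) \<bullet> a" if "a \<in> Obj (catA F)" for a
      using u_cokalg(2)[OF \<Upsilon> that, of p] by (simp add: simps)
  qed
  then show "nuc_mor_gen p \<Upsilon> \<odot> EM_to_nuc p F \<cong> EM_to_nuc p G \<odot> EM_mor_gen p \<Upsilon>"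
    using nat_iso_id[OF KH(1)]
    by (intro adj_isoI[OF comp_adj_hom[OF EM_to_nuc_hom[OF Y.F] nuc_mor_gen_hom[OF \<Upsilon>]]
          comp_adj_hom[OF EM_mor_gen_hom[OF \<Upsilon>] EM_to_nuc_hom[OF Y.G]],
          where \<theta> = ?\<theta> and \<phi> = "\<lambda>x. One (Alg_gen p G) (alg_ftor_gen p \<Upsilon> \<bullet> x)"])
      (simp_all add: simps)
qed

section \<open>Comparison maps inverted by the resolutions\<close>

lemma Alg_gen_cong:
  assumes A: "catA G = catA F"
    and T: "\<And>a. a \<in> Obj (catA F) \<Longrightarrow> radj G \<bullet> ladj G \<bullet> a = radj F \<bullet> ladj F \<bullet> a"
      "\<And>f. f \<in> Arr (catA F) \<Longrightarrow> radj G \<cdot> ladj G \<cdot> f = radj F \<cdot> ladj F \<cdot> f"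
    and \<eta>: "\<And>a. a \<in> Obj (catA F) \<Longrightarrow> eta G a = eta F a"
    and \<mu>: "\<And>a. a \<in> Obj (catA F) \<Longrightarrow> radj G \<cdot> eps G (ladj G \<bullet> a) = radj F \<cdot> eps F (ladj F \<bullet> a)"
  shows "Alg_gen p G = Alg_gen p F"
proof -
  have algs: "algs G = algs F"
    unfolding algs_def algebras_def by (auto simp: A T \<eta> \<mu> hom_iff)
  have "f \<circ>\<^bsub>catA F\<^esub> action x = action y \<circ>\<^bsub>catA F\<^esub> radj G \<cdot> ladj G \<cdot> f \<longleftrightarrow>
      f \<circ>\<^bsub>catA F\<^esub> action x = action y \<circ>\<^bsub>catA F\<^esub> radj F \<cdot> ladj F \<cdot> f"
    if "f \<in> hom (catA F) (carrier x) (carrier y)" for x y f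
    using that T(2)[of f] by (simp add: hom_iff)
  then show ?thesis
    unfolding Alg_gen_def algs A by (simp cong: conj_cong)
qed

text \<open>On a coalgebra with carrier \<open>b\<close> both monads return the coalgebra
  \<open>cokalg F (radj F \<bullet> b)\<close>, with the same unit and multiplication. So the
  comparison from \<open>coEM_gen\<close> to the nucleus induces an equivalence on algebras.\<close>

lemma Alg_gen_nuc_gen:
  assumes F: "adjunction F"
  shows "Alg_gen p (nuc_gen p F) = Alg_gen p (coEM_gen p F)"
  by (rule Alg_gen_cong) (use F in \<open>auto elim!: Coalg_gen_cases\<close>)

lemma EM_coEM_to_nuc_equivalence:
  assumes F: "adjunction F"
  shows "adj_equivalence (EM_mor_gen p (coEM_to_nuc p F))"
  using EM_strict_equivalence[OF coEM_to_nuc_hom[OF F, of p, unfolded coEM_to_nuc_def], of p] Alg_gen_nuc_gen[OF F]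
  by (simp add: coEM_to_nuc_def)

lemma kappa_mor_nuc_equivalence:
  assumes F: "adjunction F" and ic: "idem_complete (catA F)"
  shows "adj_equivalence (kappa_mor p (nuc_gen p F))"
  using kappa_mor_hom[OF nuc_gen[OF F], of p p] kappa_nuc_equivalence[OF F ic] F
  by (simp add: adj_equivalence_def adj_morphism_iff kappa_mor_def equivalence_functor_id)

lemma idem_complete_Coalg_gen: "\<lbrakk>adjunction F; idem_complete (catB F)\<rbrakk> \<Longrightarrow> idem_complete (Coalg_gen p F)"
  unfolding Coalg_gen_def idem_complete_op by (rule idem_complete_Alg_gen) simp_all

text \<open>Locality passes along an equivalence. The units of \<open>M\<close> and \<open>C\<close>
  are taken after completion, so locality known for an adjunction is carried over to its completion
  along \<open>embed_adj\<close>.\<close>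

lemma idem_pointed_endo_transfer:
  assumes T: "idem_pointed_endo T t" and \<Upsilon>: "\<Upsilon> \<in> adj_hom F G" and eq: "adj_equivalence \<Upsilon>" "adj_equivalence (t F)"
  shows "adj_equivalence (t G)"
proof -
  interpret idem_pointed hAdj "endo_ftor T" "\<lambda>x. adj_class (t (projl x))"
    by (rule idem_pointed_hAdj[OF T])
  have "adj_natural id_endo T t"
    using T by (simp add: idem_pointed_endo_def)
  note tF = adj_naturalD(1)[OF this, simplified]
  show ?thesis
    using iso_T_of_local_equiv[of "adj_class \<Upsilon>"] adj_class_hAdj[OF \<Upsilon>] eq adj_class_iso[OF \<Upsilon>]
      adj_class_iso[OF tF[OF adj_homD(3)[OF \<Upsilon>]]] adj_class_iso[OF tF[OF adj_homD(4)[OF \<Upsilon>]]] by simp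
qed

text \<open>Between idempotent complete adjunctions, \<open>q\<close> and its lift are conjugate
  through the embeddings, so \<open>T\<close> inverts one if it inverts the other.\<close>

lemma endofunctor_lift_equivalence:
  assumes T: "endofunctor T" and q: "q \<in> adj_hom F G"
    and eF: "adj_equivalence (embed_adj F)" and eG: "adj_equivalence (embed_adj G)"
    and Tq: "adj_equivalence (on_mor T q)"
  shows "adj_equivalence (on_mor T (lift_mor q))"
proof -
  interpret ftor hAdj hAdj "endo_ftor T"
    by unfold_locales (rule endo_ftor[OF T])
  note FG = adj_homD(3,4)[OF q]
  note h = embed_adj_hom[OF FG(1)] embed_adj_hom[OF FG(2)] lift_mor_hom[OF q]
  note ty = adj_class_hAdj[OF q] adj_class_hAdj[OF h(1)] adj_class_hAdj[OF h(2)] adj_class_hAdj[OF h(3)]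
  let ?T = "\<lambda>f. endo_ftor T \<cdot> adj_class f"
  have iso: "iso_arrow hAdj (adj_class (embed_adj F))" "iso_arrow hAdj (adj_class (embed_adj G))" "iso_arrow hAdj (?T q)"
    using eF eG Tq adj_class_iso[OF h(1)] adj_class_iso[OF h(2)] adj_class_iso[OF endofunctorD(2)[OF T q]]
    by (simp_all add: endo_ftor_class[OF T q])
  have "adj_class (embed_adj G) \<circ>\<^bsub>hAdj\<^esub> adj_class q = adj_class (lift_mor q) \<circ>\<^bsub>hAdj\<^esub> adj_class (embed_adj F)"
    using adj_natural_class[OF embed_adj_natural q] q h(3) by simp
  from arg_cong[OF this, of "FArr (endo_ftor T)"]
  have nat: "?T (embed_adj G) \<circ>\<^bsub>hAdj\<^esub> ?T q = ?T (lift_mor q) \<circ>\<^bsub>hAdj\<^esub> ?T (embed_adj F)"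
    by (simp add: ty)
  have "?T (lift_mor q) = (?T (lift_mor q) \<circ>\<^bsub>hAdj\<^esub> ?T (embed_adj F)) \<circ>\<^bsub>hAdj\<^esub> inverse_arrow hAdj (?T (embed_adj F))"
    using iso FG by (simp add: ty)
  also have "iso_arrow hAdj \<dots>"
    unfolding nat[symmetric] using iso FG by (auto simp: ty intro!: iso_Comp(1))
  finally show ?thesis
    using adj_class_iso[OF endofunctorD(2)[OF T h(3)]] by (simp add: endo_ftor_class[OF T h(3)])
qed

section \<open>The endofunctors \<open>M\<close>, \<open>C\<close> and \<open>N\<close>\<close>

lemma structured_eq: "structured = structured_gen True"
  by (simp add: fun_eq_iff structured_def structured_gen_def ar_def)

lemma Alg_eq: "Alg F = Alg_gen True F"
  by (simp add: Alg_def EM_cat_def Alg_gen_def algs_def ar_def ar_dom_def ar_cod_def)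

lemma Coalg_eq: "Coalg F = Coalg_gen True F"
proof -
  have "coalgebras (catB F) (comp_ftor (ladj F) (radj F)) (eps F) (\<lambda>b. ladj F \<cdot> eta F (radj F \<bullet> b)) = algs (op_adj F)"
    unfolding coalgebras_def algs_def algebras_def by (auto simp: hom_iff)
  then show ?thesis
    unfolding Coalg_def coEM_cat_def Coalg_gen_def Alg_gen_def op_cat_def
    by (auto simp: hom_iff ar_def ar_dom_def ar_cod_def)
qed

lemma free_alg_eq: "free_alg F = free_gen True F"
  by (simp add: free_alg_def free_gen_def structured_eq free_def[abs_def])

lemma kappa1_eq: "kappa1 F = kappa_gen True F"
  by (simp add: kappa1_def kappa_gen_def structured_eq kalg_def[abs_def])

lemma kappa0_eq: "kappa0 F = kappa_gen False (op_adj F)"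
  by (simp add: kappa0_def kappa_gen_def structured_def structured_gen_def kalg_def[abs_def] ar_def)

lemma EM_adj_eq: "EM_adj F = EM_gen True F"
  by (simp add: EM_adj_def EM_gen_def Alg_eq free_alg_eq ar_def free_gen_def)

lemma cofree_coalg_eq: "cofree_coalg F = free_gen False (op_adj F)"
  by (simp add: cofree_coalg_def free_gen_def structured_def structured_gen_def free_def[abs_def] ar_def)

lemma coEM_adj_eq: "coEM_adj F = coEM_gen True F"
  by (simp add: coEM_adj_def coEM_gen_def op_adj_def EM_gen_def Coalg_eq Coalg_gen_def cofree_coalg_eq ar_def
      free_gen_def)

lemma nucleus_adj_eq: "nucleus_adj F = nuc_gen True F"
  by (simp add: nucleus_adj_def nuc_gen_def Let_def Alg_eq Coalg_eq kappa1_eq kappa0_eq ar_def cokalg_def)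

text \<open>\<open>alg_ftor\<close> composes the inverses of the two 2-cells, \<open>act\<close>
  inverts their composite. These agree where the 2-cells are invertible, which is why the equations
  are restricted to algebras.\<close>

lemma alg_ftor_eq:
  assumes \<Upsilon>: "\<Upsilon> \<in> adj_hom F G"
  shows "x \<in> algs F \<Longrightarrow> alg_ftor \<Upsilon> \<bullet> x = alg_ftor_gen True \<Upsilon> \<bullet> x"
    "f \<in> Arr (Alg_gen True F) \<Longrightarrow> alg_ftor \<Upsilon> \<cdot> f = alg_ftor_gen True \<Upsilon> \<cdot> f"
proof -
  interpret Y: alg_morph F G "mH \<Upsilon>" "mK \<Upsilon>" "ups \<Upsilon>" "dns \<Upsilon>"
    by (rule adj_hom_alg_morph[OF \<Upsilon>])
  show 1: "alg_ftor \<Upsilon> \<bullet> x = alg_ftor_gen True \<Upsilon> \<bullet> x" if "x \<in> algs F" for x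
    using that by (simp add: EM_mor_gen_simps(5,6)[OF \<Upsilon>] alg_ftor_def structured_eq adj_homD(1,2)[OF \<Upsilon>]
        Y.act_def Y.rho_def iso_Comp(2) Let_def)
  show "alg_ftor \<Upsilon> \<cdot> f = alg_ftor_gen True \<Upsilon> \<cdot> f" if "f \<in> Arr (Alg_gen True F)" for f
    using that 1 unfolding EM_mor_gen_simps(5,6)[OF \<Upsilon>]
    by (auto simp: alg_ftor_def structured_eq adj_homD(1,2)[OF \<Upsilon>] Alg_eq Let_def elim!: Alg_gen_cases)
qed

lemma coalg_ftor_eq:
  assumes \<Upsilon>: "\<Upsilon> \<in> adj_hom F G"
  shows "y \<in> algs (op_adj F) \<Longrightarrow> coalg_ftor \<Upsilon> \<bullet> y = coalg_ftor_gen True \<Upsilon> \<bullet> y"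
    "f \<in> Arr (Coalg_gen True F) \<Longrightarrow> coalg_ftor \<Upsilon> \<cdot> f = coalg_ftor_gen True \<Upsilon> \<cdot> f"
proof -
  show 1: "coalg_ftor \<Upsilon> \<bullet> y = coalg_ftor_gen True \<Upsilon> \<bullet> y" if "y \<in> algs (op_adj F)" for y
    using coact_simps(4)[OF \<Upsilon> that]
    by (simp add: coalg_ftor_gen_simps[OF \<Upsilon>] coalg_ftor_def structured_eq adj_homD(1,2)[OF \<Upsilon>] Let_def)
  show "coalg_ftor \<Upsilon> \<cdot> f = coalg_ftor_gen True \<Upsilon> \<cdot> f" if "f \<in> Arr (Coalg_gen True F)" for f
    using that 1 unfolding coalg_ftor_gen_simps[OF \<Upsilon>]
    by (auto simp: coalg_ftor_def structured_eq adj_homD(1,2)[OF \<Upsilon>] Coalg_eq Let_def elim!: Coalg_gen_cases)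
qed

lemma EM_mor_eq:
  assumes \<Upsilon>: "\<Upsilon> \<in> adj_hom F G"
  shows "EM_mor_gen True \<Upsilon> \<cong> EM_mor \<Upsilon>"
proof -
  interpret Y: alg_morph F G "mH \<Upsilon>" "mK \<Upsilon>" "ups \<Upsilon>" "dns \<Upsilon>"
    by (rule adj_hom_alg_morph[OF \<Upsilon>])
  show ?thesis
    by (rule agree_adj_hom(2)[OF EM_mor_gen_hom[OF \<Upsilon>]])
      (auto simp: agree_def EM_mor_gen_def EM_mor_def adj_homD(1,2)[OF \<Upsilon>] EM_adj_eq Let_def
        alg_ftor_eq[OF \<Upsilon>] free_alg_eq free_gen_def ar_def)
qed

lemma coEM_mor_eq:
  assumes \<Upsilon>: "\<Upsilon> \<in> adj_hom F G"
  shows "coEM_mor_gen True \<Upsilon> \<cong> coEM_mor \<Upsilon>"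
proof -
  interpret Y: alg_morph F G "mH \<Upsilon>" "mK \<Upsilon>" "ups \<Upsilon>" "dns \<Upsilon>"
    by (rule adj_hom_alg_morph[OF \<Upsilon>])
  interpret O: alg_morph "op_adj F" "op_adj G" "mK \<Upsilon>" "mH \<Upsilon>" "\<lambda>b. inverse_arrow (catA G) (dns \<Upsilon> b)"
      "\<lambda>a. inverse_arrow (catB G) (ups \<Upsilon> a)"
    by (rule adj_hom_alg_morph_op[OF \<Upsilon>])
  have co: "coact \<Upsilon> = O.act"
    by (simp add: coact_def adj_homD(1,2)[OF \<Upsilon>])
  have "dns (coEM_mor_gen True \<Upsilon>) b = dns (coEM_mor \<Upsilon>) b" if b [simp]: "b \<in> Obj (catB F)" for b
  proof -
    have G': "adjunction (op_adj G)"
      by simp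
    \<comment> \<open>\<open>coEM_mor_gen\<close> is a dual, so its \<open>dns\<close> is an inverse
      formed in a category of algebras. It is computed on carriers, where inverting
      \<open>O.rho\<close> cancels the inverses introduced by duality.\<close>
    have "inverse_arrow (Alg_gen False (op_adj G)) (ar False (O.act (free (op_adj F) b)) (O.rho b) (free (op_adj G) (mK \<Upsilon> \<bullet> b))) =
        ar False (free (op_adj G) (mK \<Upsilon> \<bullet> b)) (inverse_arrow (catA (op_adj G)) (O.rho b)) (O.act (free (op_adj F) b))"
      by (rule Alg_gen_iso(2)[OF G']) (use O.rho_free[of b False] O.rho_simps(4)[of b] in simp_all)
    moreover have "inverse_arrow (catB G) (O.rho b) = ladj G \<cdot> dns \<Upsilon> b \<circ>\<^bsub>catB G\<^esub> ups \<Upsilon> (radj F \<bullet> b)"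
      by (simp add: O.rho_def iso_Comp(2))
    ultimately show ?thesis
      using EM_mor_gen_simps(7)[OF op_mor_hom[OF \<Upsilon>], of False b]
        EM_mor_gen_simps(2)[OF op_mor_hom[OF \<Upsilon>], of False]
      by (simp add: coEM_mor_gen_def coEM_mor_def Let_def adj_homD(1,2)[OF \<Upsilon>] coalg_ftor_eq[OF \<Upsilon>]
        coalg_ftor_gen_simps[OF \<Upsilon>] co cofree_coalg_eq free_gen_def ar_def)
  qed
  moreover have "ups (coEM_mor_gen True \<Upsilon>) y = ups (coEM_mor \<Upsilon>) y" if "y \<in> algs (op_adj F)" for y
    using that EM_mor_gen_simps(2)[OF op_mor_hom[OF \<Upsilon>], of False] EM_mor_gen_simps(8)[OF op_mor_hom[OF \<Upsilon>], of False y]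
    by (simp add: coEM_mor_gen_def coEM_mor_def Let_def adj_homD(1,2)[OF \<Upsilon>])
  moreover have "mH (coEM_mor_gen True \<Upsilon>) = coalg_ftor_gen True \<Upsilon>" "mK (coEM_mor_gen True \<Upsilon>) = mK \<Upsilon>"
    using EM_mor_gen_simps(3,4)[OF op_mor_hom[OF \<Upsilon>], of False]
    by (simp_all add: coEM_mor_gen_def coalg_ftor_gen_def)
  ultimately show ?thesis
    by (intro agree_adj_hom(2)[OF coEM_mor_gen_hom[OF \<Upsilon>]])
      (auto simp: agree_def coEM_adj_eq coalg_ftor_eq[OF \<Upsilon>] adj_homD(1,2)[OF coEM_mor_gen_hom[OF \<Upsilon>]],
       auto simp: coEM_mor_def Let_def coalg_ftor_eq[OF \<Upsilon>] coEM_adj_eq adj_homD(1,2)[OF \<Upsilon>])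
qed

lemma nucleus_mor_eq:
  assumes \<Upsilon>: "\<Upsilon> \<in> adj_hom F G"
  shows "nuc_mor_gen True \<Upsilon> \<cong> nucleus_mor \<Upsilon>"
proof -
  interpret Y: alg_morph F G "mH \<Upsilon>" "mK \<Upsilon>" "ups \<Upsilon>" "dns \<Upsilon>"
    by (rule adj_hom_alg_morph[OF \<Upsilon>])
  note simps = nuc_mor_gen_simps[OF \<Upsilon>] EM_mor_gen_simps(5,6)[OF \<Upsilon>] coalg_ftor_gen_simps[OF \<Upsilon>]
    coact_simps(1)[OF \<Upsilon>] alg_ftor_eq[OF \<Upsilon>] coalg_ftor_eq[OF \<Upsilon>]
  show ?thesis
    by (rule agree_adj_hom(2)[OF nuc_mor_gen_hom[OF \<Upsilon>]])
      (auto simp: agree_def simps nucleus_mor_def adj_homD(1,2)[OF \<Upsilon>] nucleus_adj_eq Let_def ar_def)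
qed

section \<open>The concrete endofunctors satisfy the hypotheses of the formal nucleus\<close>

lemma endo_defs [simp]:
  "on_adj M_endo F = EM_gen True (lift_adj F)" "on_mor M_endo \<Upsilon> = EM_mor (lift_mor \<Upsilon>)"
  "on_adj C_endo F = coEM_gen True (lift_adj F)" "on_mor C_endo \<Upsilon> = coEM_mor (lift_mor \<Upsilon>)"
  "on_adj N_endo F = nuc_gen True (lift_adj F)" "on_mor N_endo \<Upsilon> = nucleus_mor (lift_mor \<Upsilon>)"
  by (simp_all add: M_endo_def C_endo_def N_endo_def EM_adj_eq coEM_adj_eq nucleus_adj_eq)

lemma lift_adj_complete:
  assumes F: "adjunction F"
  shows "idem_complete (catA (lift_adj F))" "idem_complete (catB (lift_adj F))"
  using F by (simp_all add: idem_complete_karoubi)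

lemma bar_to_M_eq: "bar_to_M F = kappa_mor True (lift_adj F)"
  by (simp add: bar_to_M_def kappa_mor_def kappa1_eq)

definition cokappa_mor :: "'a univ adj \<Rightarrow> 'a univ adj_mor" where
  "cokappa_mor F = op_mor (kappa_mor False (op_adj F))"

lemma cokappa_mor_hom: "adjunction F \<Longrightarrow> cokappa_mor F \<in> adj_hom F (coEM_gen True F)"
  using op_mor_hom[OF kappa_mor_hom[of "op_adj F" False]] by (simp add: cokappa_mor_def coEM_gen_def)

lemma bar_to_C_iso:
  assumes F: "adjunction F"
  shows "cokappa_mor (lift_adj F) \<cong> bar_to_C F"
  using op_strict_mor[OF kappa_mor_hom[of "op_adj (lift_adj F)" False, unfolded kappa_mor_def]] lift_adj[OF F]
  by (simp add: cokappa_mor_def kappa_mor_def bar_to_C_def kappa0_eq coEM_gen_def)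

lemma idem_pointed_coEM:
  "idem_pointed_endo (comp_endo O_endo (comp_endo (EM_endo False) O_endo)) (cokappa_mor :: 'a univ adj \<Rightarrow> _)"
  using idem_pointed_endo_op[OF idem_pointed_EM[of False]] by (simp add: cokappa_mor_def[abs_def])

text \<open>\<open>M\<close> is completion followed by the passage to algebras. The closure
  condition holds because algebras over an idempotent complete category are idempotent
  complete.\<close>

lemma idem_pointed_M: "idem_pointed_endo (M_endo :: 'a univ adj_endo) M_unit"
proof (rule idem_pointed_endo_cong)
  show "idem_pointed_endo (comp_endo (EM_endo True) L_endo) (\<lambda>F :: 'a univ adj. kappa_mor True (lift_adj F) \<odot> embed_adj F)"
  proof (rule idem_pointed_endo_comp[OF idem_pointed_L idem_pointed_EM, simplified])
    show "adj_equivalence (embed_adj (EM_gen True (lift_adj F)))" if F: "adjunction F" for F :: "'a univ adj"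
      using lift_adj_complete[OF F] lift_adj[OF F]
      by (intro embed_adj_equivalence EM_gen) (simp_all add: idem_complete_Alg_gen)
  qed
  show "on_mor (comp_endo (EM_endo True) L_endo) \<Upsilon> \<cong> on_mor M_endo \<Upsilon>" if "\<Upsilon> \<in> adj_hom F G" for F G and \<Upsilon> :: "'a univ adj_mor"
    using EM_mor_eq[OF lift_mor_hom[OF that]] by simp
  show "kappa_mor True (lift_adj F) \<odot> embed_adj F \<cong> M_unit F" if F: "adjunction F" for F :: "'a univ adj"
    unfolding M_unit_def bar_to_M_eq
    by (rule adj_iso_refl[OF comp_adj_hom[OF embed_adj_hom[OF F] kappa_mor_hom[OF lift_adj[OF F]]]])
qed simp

lemma idem_pointed_C: "idem_pointed_endo (C_endo :: 'a univ adj_endo) C_unit"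
proof (rule idem_pointed_endo_cong)
  show "idem_pointed_endo (comp_endo (comp_endo O_endo (comp_endo (EM_endo False) O_endo)) L_endo)
      (\<lambda>F :: 'a univ adj. cokappa_mor (lift_adj F) \<odot> embed_adj F)"
  proof (rule idem_pointed_endo_comp[OF idem_pointed_L idem_pointed_coEM, simplified])
    show "adj_equivalence (embed_adj (op_adj (EM_gen False (op_adj (lift_adj F)))))" if F: "adjunction F" for F :: "'a univ adj"
      using lift_adj_complete[OF F] embed_adj_equivalence[OF coEM_gen[OF lift_adj[OF F]], of True]
        idem_complete_Coalg_gen[OF lift_adj[OF F], of True]
      by (simp add: coEM_gen_def Coalg_gen_def)
  qed
  show "on_mor (comp_endo (comp_endo O_endo (comp_endo (EM_endo False) O_endo)) L_endo) \<Upsilon> \<cong> on_mor C_endo \<Upsilon>"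
    if "\<Upsilon> \<in> adj_hom F G" for F G and \<Upsilon> :: "'a univ adj_mor"
    using coEM_mor_eq[OF lift_mor_hom[OF that]] by (simp add: coEM_mor_gen_def)
  show "cokappa_mor (lift_adj F) \<odot> embed_adj F \<cong> C_unit F" if F: "adjunction F" for F :: "'a univ adj"
    unfolding C_unit_def
    by (rule comp_adj_cong_left[OF embed_adj_hom[OF F] bar_to_C_iso[OF F] cokappa_mor_hom[OF lift_adj[OF F]]])
qed (simp add: coEM_gen_def)

lemma kappa0_cokappa: "kappa0 F = cokappa_gen True F"
  by (simp add: kappa0_eq cokappa_gen_def)

lemma M_to_N_eq: "M_to_N F = EM_to_nuc True (lift_adj F)"
  by (simp add: M_to_N_def EM_to_nuc_def kappa0_cokappa)

lemma C_to_N_eq: "C_to_N F = coEM_to_nuc True (lift_adj F)"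
  by (simp add: C_to_N_def coEM_to_nuc_def kappa1_eq)

lemma nucleus_mor_hom:
  assumes \<Upsilon>: "\<Upsilon> \<in> adj_hom F G"
  shows "nucleus_mor \<Upsilon> \<in> adj_hom (nuc_gen True F) (nuc_gen True G)"
  using adj_iso_hom[OF nucleus_mor_eq[OF \<Upsilon>]] nuc_mor_gen_hom[OF \<Upsilon>] by blast

lemma C_to_N_natural: "adj_natural (C_endo :: 'a univ adj_endo) N_endo C_to_N"
  unfolding adj_natural_def
proof (intro conjI allI impI)
  fix F G and \<Upsilon> :: "'a univ adj_mor" assume \<Upsilon>: "\<Upsilon> \<in> adj_hom F G"
  note FG = lift_adj[OF adj_homD(3)[OF \<Upsilon>]] lift_adj[OF adj_homD(4)[OF \<Upsilon>]] and l = lift_mor_hom[OF \<Upsilon>]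
  have "C_to_N G \<odot> coEM_mor (lift_mor \<Upsilon>) \<cong> C_to_N G \<odot> coEM_mor_gen True (lift_mor \<Upsilon>)"
    unfolding C_to_N_eq
    by (rule adj_iso_sym[OF comp_adj_cong_right[OF coEM_to_nuc_hom[OF FG(2)] coEM_mor_eq[OF l] coEM_mor_gen_hom[OF l]]])
  also have "\<dots> \<cong> nuc_mor_gen True (lift_mor \<Upsilon>) \<odot> C_to_N F"
    unfolding C_to_N_eq by (rule coEM_to_nuc_natural[OF l])
  also have "\<dots> \<cong> nucleus_mor (lift_mor \<Upsilon>) \<odot> C_to_N F"
    unfolding C_to_N_eq
    by (rule comp_adj_cong_left[OF coEM_to_nuc_hom[OF FG(1)] nucleus_mor_eq[OF l] nuc_mor_gen_hom[OF l]])
  finally show "C_to_N G \<odot> on_mor C_endo \<Upsilon> \<cong> on_mor N_endo \<Upsilon> \<odot> C_to_N F"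
    by simp
qed (simp add: C_to_N_eq coEM_to_nuc_hom lift_adj)

lemma M_to_N_natural: "adj_natural (M_endo :: 'a univ adj_endo) N_endo M_to_N"
  unfolding adj_natural_def
proof (intro conjI allI impI)
  fix F G and \<Upsilon> :: "'a univ adj_mor" assume \<Upsilon>: "\<Upsilon> \<in> adj_hom F G"
  note FG = lift_adj[OF adj_homD(3)[OF \<Upsilon>]] lift_adj[OF adj_homD(4)[OF \<Upsilon>]] and l = lift_mor_hom[OF \<Upsilon>]
  have "M_to_N G \<odot> EM_mor (lift_mor \<Upsilon>) \<cong> M_to_N G \<odot> EM_mor_gen True (lift_mor \<Upsilon>)"
    unfolding M_to_N_eq
    by (rule adj_iso_sym[OF comp_adj_cong_right[OF EM_to_nuc_hom[OF FG(2)] EM_mor_eq[OF l] EM_mor_gen_hom[OF l]]])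
  also have "\<dots> \<cong> nuc_mor_gen True (lift_mor \<Upsilon>) \<odot> M_to_N F"
    unfolding M_to_N_eq by (rule EM_to_nuc_natural[OF l])
  also have "\<dots> \<cong> nucleus_mor (lift_mor \<Upsilon>) \<odot> M_to_N F"
    unfolding M_to_N_eq
    by (rule comp_adj_cong_left[OF EM_to_nuc_hom[OF FG(1)] nucleus_mor_eq[OF l] nuc_mor_gen_hom[OF l]])
  finally show "M_to_N G \<odot> on_mor M_endo \<Upsilon> \<cong> on_mor N_endo \<Upsilon> \<odot> M_to_N F"
    by simp
qed (simp add: M_to_N_eq EM_to_nuc_hom lift_adj)

lemma bar_to_M_hom: "adjunction F \<Longrightarrow> bar_to_M F \<in> adj_hom (lift_adj F) (EM_gen True (lift_adj F))"
  by (simp add: bar_to_M_eq kappa_mor_hom lift_adj)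

lemma bar_to_C_hom: "adjunction F \<Longrightarrow> bar_to_C F \<in> adj_hom (lift_adj F) (coEM_gen True (lift_adj F))"
  using adj_iso_hom[OF bar_to_C_iso] cokappa_mor_hom[OF lift_adj] by blast

text \<open>All 2-cells involved are identities, and a pasting of identities is an identity; so the
  square commutes strictly and not merely up to \<open>\<cong>\<close>.\<close>

lemma M_to_N_bar:
  assumes F: "adjunction F"
  shows "M_to_N F \<odot> bar_to_M F \<doteq> bar_to_N F"
  by (rule adj_eqI[OF comp_adj_hom[OF bar_to_M_hom[OF F]]])
    (use F lift_adj[OF F] EM_to_nuc_hom[OF lift_adj[OF F], of True] in
      \<open>auto simp: M_to_N_eq agree_def bar_to_N_def bar_to_M_eq kappa_mor_def kappa1_eq kappa0_cokappa
        free_kalg\<close>)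

lemma C_to_N_bar:
  assumes F: "adjunction F"
  shows "C_to_N F \<odot> bar_to_C F \<doteq> bar_to_N F"
  by (rule adj_eqI[OF comp_adj_hom[OF bar_to_C_hom[OF F]]])
    (use F lift_adj[OF F] coEM_to_nuc_hom[OF lift_adj[OF F], of True] in
      \<open>auto simp: C_to_N_eq agree_def bar_to_N_def bar_to_C_def kappa1_eq kappa0_cokappa\<close>)

lemma embed_nuc_equivalence:
  assumes F: "adjunction F"
  shows "adj_equivalence (embed_adj (nuc_gen p (lift_adj F)))"
  by (rule embed_adj_equivalence[OF nuc_gen[OF lift_adj[OF F]]])
    (use lift_adj[OF F] lift_adj_complete[OF F] in \<open>simp_all add: idem_complete_Alg_gen idem_complete_Coalg_gen\<close>)

lemma embed_EM_equivalence:
  assumes F: "adjunction F"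
  shows "adj_equivalence (embed_adj (EM_gen p (lift_adj F)))" "adj_equivalence (embed_adj (coEM_gen p (lift_adj F)))"
  by (rule embed_adj_equivalence[OF EM_gen[OF lift_adj[OF F]]] embed_adj_equivalence[OF coEM_gen[OF lift_adj[OF F]]];
    use lift_adj[OF F] lift_adj_complete[OF F] in \<open>simp add: idem_complete_Alg_gen idem_complete_Coalg_gen\<close>)+

lemma adj_equivalence_comp:
  assumes \<Upsilon>: "\<Upsilon> \<in> adj_hom F G" "adj_equivalence \<Upsilon>" and \<Psi>: "\<Psi> \<in> adj_hom G L" "adj_equivalence \<Psi>"
  shows "adj_equivalence (\<Psi> \<odot> \<Upsilon>)"
  using iso_Comp(1)[OF hAdj_category, of "adj_class \<Upsilon>" "adj_class \<Psi>"] assms adj_class_iso[OF \<Upsilon>(1)] adj_class_iso[OF \<Psi>(1)]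
    adj_class_iso[OF comp_adj_hom[OF \<Upsilon>(1) \<Psi>(1)]]
  by (simp add: adj_class_hAdj[OF \<Upsilon>(1)] adj_class_hAdj[OF \<Psi>(1)] adj_class_comp[OF \<Upsilon>(1) \<Psi>(1)])

text \<open>Both categories of the nucleus are idempotent complete, so the embedding into its
  completion is an equivalence; along it monadicity of the nucleus is transferred to the
  completion.\<close>

lemma M_unit_nuc_equivalence:
  assumes F: "adjunction F"
  shows "adj_equivalence (M_unit (nuc_gen True (lift_adj F)))"
proof -
  let ?N = "nuc_gen True (lift_adj F)"
  have N: "adjunction ?N"
    by (rule nuc_gen[OF lift_adj[OF F]])
  have "adj_equivalence (kappa_mor True (lift_adj ?N))"
    by (rule idem_pointed_endo_transfer[OF idem_pointed_EM embed_adj_hom[OF N] embed_nuc_equivalence[OF F]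
        kappa_mor_nuc_equivalence[OF lift_adj[OF F] lift_adj_complete(1)[OF F]]])
  then show ?thesis
    unfolding M_unit_def bar_to_M_eq
    by (rule adj_equivalence_comp[OF embed_adj_hom[OF N] embed_nuc_equivalence[OF F] kappa_mor_hom[OF lift_adj[OF N]]])
qed

lemma C_unit_nuc_equivalence:
  assumes F: "adjunction F"
  shows "adj_equivalence (C_unit (nuc_gen True (lift_adj F)))"
proof -
  let ?N = "nuc_gen True (lift_adj F)"
  have N: "adjunction ?N"
    by (rule nuc_gen[OF lift_adj[OF F]])
  \<comment> \<open>By self-duality, monadicity of the nucleus of the opposite adjunction is what is
    needed; it splits idempotents in the other category, now the left-hand one.\<close>
  have "adj_equivalence (kappa_mor False (nuc_gen False (op_adj (lift_adj F))))"
    by (rule kappa_mor_nuc_equivalence) (use lift_adj[OF F] lift_adj_complete(2)[OF F] in simp_all)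
  then have "adj_equivalence (cokappa_mor ?N)"
    using op_mor_equivalence by (simp add: cokappa_mor_def op_nuc_gen)
  then have "adj_equivalence (cokappa_mor (lift_adj ?N))"
    by (rule idem_pointed_endo_transfer[OF idem_pointed_coEM embed_adj_hom[OF N] embed_nuc_equivalence[OF F]])
  then have "adj_equivalence (bar_to_C ?N)"
    by (rule adj_equivalence_cong[OF bar_to_C_iso[OF N]])
  then show ?thesis
    unfolding C_unit_def
    by (rule adj_equivalence_comp[OF embed_adj_hom[OF N] embed_nuc_equivalence[OF F] bar_to_C_hom[OF N]])
qed

text \<open>Without completion this is the coincidence of the two monads on coalgebras. The extra
  completion inside \<open>M\<close> is harmless since both adjunctions are already
  complete.\<close>

lemma M_C_to_N_equivalence:
  assumes F: "adjunction F"
  shows "adj_equivalence (on_mor M_endo (C_to_N F))"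
proof -
  note F' = lift_adj[OF F]
  note q = coEM_to_nuc_hom[OF F', of True]
  have "adj_equivalence (on_mor (EM_endo True) (lift_mor (C_to_N F)))"
    unfolding C_to_N_eq
    by (rule endofunctor_lift_equivalence[OF endofunctor_EM q embed_EM_equivalence(2)[OF F] embed_nuc_equivalence[OF F]])
      (simp add: EM_coEM_to_nuc_equivalence[OF F'])
  then show ?thesis
    using adj_equivalence_cong[OF EM_mor_eq[OF lift_mor_hom[OF q]]] by (simp add: C_to_N_eq)
qed

lemma C_M_to_N_equivalence:
  assumes F: "adjunction F"
  shows "adj_equivalence (on_mor C_endo (M_to_N F))"
proof -
  note F' = lift_adj[OF F]
  note p = EM_to_nuc_hom[OF F', of True]
  let ?C = "comp_endo O_endo (comp_endo (EM_endo False) O_endo) :: 'a univ adj_endo"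
  have C: "endofunctor ?C"
    by (intro endofunctor_comp endofunctor_O endofunctor_EM)
  \<comment> \<open>Duality turns the comparison from algebras into the comparison from coalgebras
    of the opposite adjunction, for which the result is known.\<close>
  have "op_mor (EM_to_nuc True (lift_adj F)) \<cong> coEM_to_nuc False (op_adj (lift_adj F))"
    using op_strict_mor[OF p[unfolded EM_to_nuc_def]]
    by (simp add: EM_to_nuc_def coEM_to_nuc_def coEM_gen_def op_nuc_gen cokappa_gen_def)
  from endofunctorD(3)[OF endofunctor_EM this, of False]
  have "EM_mor_gen False (coEM_to_nuc False (op_adj (lift_adj F))) \<cong> EM_mor_gen False (op_mor (EM_to_nuc True (lift_adj F)))"
    using adj_iso_sym by simp
  then have "adj_equivalence (EM_mor_gen False (op_mor (EM_to_nuc True (lift_adj F))))"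
    by (rule adj_equivalence_cong) (use F' in \<open>simp add: EM_coEM_to_nuc_equivalence\<close>)
  then have "adj_equivalence (on_mor ?C (EM_to_nuc True (lift_adj F)))"
    using op_mor_equivalence by simp
  then have "adj_equivalence (on_mor ?C (lift_mor (M_to_N F)))"
    unfolding M_to_N_eq
    by (rule endofunctor_lift_equivalence[OF C p embed_EM_equivalence(1)[OF F] embed_nuc_equivalence[OF F]])
  then show ?thesis
    using adj_equivalence_cong[OF coEM_mor_eq[OF lift_mor_hom[OF p]]] by (simp add: M_to_N_eq coEM_mor_gen_def)
qed

lemma formal_nucleus_MCN:
  "formal_nucleus (M_endo :: 'a univ adj_endo) C_endo N_endo M_unit C_unit M_to_N C_to_N N_unit"
proof
  show "idem_pointed_endo (M_endo :: 'a univ adj_endo) M_unit" "idem_pointed_endo (C_endo :: 'a univ adj_endo) C_unit"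
    by (rule idem_pointed_M idem_pointed_C)+
  show "adj_natural (M_endo :: 'a univ adj_endo) N_endo M_to_N" "adj_natural (C_endo :: 'a univ adj_endo) N_endo C_to_N"
    by (rule M_to_N_natural C_to_N_natural)+
  show "on_mor N_endo \<Upsilon> \<in> adj_hom (on_adj N_endo F) (on_adj N_endo G)" if "\<Upsilon> \<in> adj_hom F G" for F G and \<Upsilon> :: "'a univ adj_mor"
    using nucleus_mor_hom[OF lift_mor_hom[OF that]] by simp
  fix F :: "'a univ adj" assume F: "adjunction F"
  show "adjunction (on_adj N_endo F)"
    using nuc_gen[OF lift_adj[OF F]] by simp
  show "adj_equivalence (M_unit (on_adj N_endo F))" "adj_equivalence (C_unit (on_adj N_endo F))"
    using M_unit_nuc_equivalence[OF F] C_unit_nuc_equivalence[OF F] by simp_all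
  show "adj_equivalence (on_mor C_endo (M_to_N F))" "adj_equivalence (on_mor M_endo (C_to_N F))"
    by (rule C_M_to_N_equivalence[OF F] M_C_to_N_equivalence[OF F])+
  note F' = lift_adj[OF F] and e = embed_adj_hom[OF F]
  have "M_to_N F \<odot> M_unit F \<cong> (M_to_N F \<odot> bar_to_M F) \<odot> embed_adj F"
    unfolding M_unit_def M_to_N_eq by (rule adj_iso_sym[OF comp_adj_assoc[OF e bar_to_M_hom[OF F] EM_to_nuc_hom[OF F']]])
  also have "\<dots> \<cong> N_unit F"
    unfolding N_unit_def M_to_N_eq
    by (rule comp_adj_cong_left[OF e adj_eq_iso[OF M_to_N_bar[OF F, unfolded M_to_N_eq]]
        comp_adj_hom[OF bar_to_M_hom[OF F] EM_to_nuc_hom[OF F']]])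
  finally show "N_unit F \<cong> M_to_N F \<odot> M_unit F"
    by (rule adj_iso_sym)
  have "C_to_N F \<odot> C_unit F \<cong> (C_to_N F \<odot> bar_to_C F) \<odot> embed_adj F"
    unfolding C_unit_def C_to_N_eq by (rule adj_iso_sym[OF comp_adj_assoc[OF e bar_to_C_hom[OF F] coEM_to_nuc_hom[OF F']]])
  also have "\<dots> \<cong> N_unit F"
    unfolding N_unit_def C_to_N_eq
    by (rule comp_adj_cong_left[OF e adj_eq_iso[OF C_to_N_bar[OF F, unfolded C_to_N_eq]]
        comp_adj_hom[OF bar_to_C_hom[OF F] coEM_to_nuc_hom[OF F']]])
  finally show "N_unit F \<cong> C_to_N F \<odot> C_unit F"
    by (rule adj_iso_sym)
qed

theorem theorem5p1:
  shows "idempotent_monad (M_endo :: 'a univ adj_endo) M_unit \<and>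
    idempotent_monad (C_endo :: 'a univ adj_endo) C_unit \<and>
    idempotent_monad (N_endo :: 'a univ adj_endo) N_unit \<and>
    (\<exists>(E1 :: 'a univ adj \<Rightarrow> 'a univ adj_mor) (E2 :: 'a univ adj \<Rightarrow> 'a univ adj_mor).
       natural_equivalence (comp_endo C_endo M_endo) N_endo E1 \<and>
       natural_equivalence N_endo (comp_endo M_endo C_endo) E2 \<and>
       natural_equivalence (comp_endo C_endo M_endo) (comp_endo M_endo C_endo)
         (\<lambda>F. E2 F \<odot> E1 F) \<and>
       (\<forall>F. adjunction F \<longrightarrow>
          E1 F \<odot> C_unit (on_adj M_endo F) \<cong> M_to_N F \<and>
          E2 F \<odot> C_to_N F \<cong> M_unit (on_adj C_endo F) \<and>
          M_to_N F \<odot> bar_to_M F \<doteq> bar_to_N F \<and>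
          C_to_N F \<odot> bar_to_C F \<doteq> bar_to_N F))"
proof -
  interpret formal_nucleus "M_endo :: 'a univ adj_endo" C_endo N_endo M_unit C_unit M_to_N C_to_N N_unit
    by (rule formal_nucleus_MCN)
  show ?thesis
    using idempotent_monadI[OF idem_pointed_M] idempotent_monadI[OF idem_pointed_C]
      idempotent_monadI[OF idem_pointed_N] nucleus_equivalences M_to_N_bar C_to_N_bar by blast
qed

end
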